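(* Let $k$ be an algebraically closed field, $G$ a group such that $kG$ is finite dimensional and semisimple, $a\in Z(G)$, $\chi:G\to k^{\times}$ a linear character with $q:=\chi(a)\neq1$, and let $H=kG(\chi^{-1},a,0)$. Assume $|q|=|\chi|=s$. Then $$\{V_t(i),\ V_t(j,\beta)\mid i\in I,\ [j]\in I_0,\ \beta\in k^{\times},\ t\in\mathbb N^+\}$$ (one representative $j$ being taken from each class $[j]\in I_0$) is a complete set of representatives of the isomorphism classes of finite dimensional indecomposable $H$-modules.
   Context: $k^{\times}=k\setminus\{0\}$; $\mathbb N^+$ is the set of positive integers; $\hat G$ is the group of linear characters $G\to k^{\times}$; $|\chi|$ is the order of $\chi$ in $\hat G$ and $|q|$ the order of $q$ in $k^{\times}$. $H=kG(\chi^{-1},a,0)$ is the Hopf algebra generated as an algebra by $G$ and $x$ with relations $xg=\chi^{-1}(g)gx$ ($g\in G$) in addition to those of $kG$; it has $k$-basis $\{gx^i\mid g\in G, i\ge 0\}$, and $\Delta(x)=x\otimes a+1\otimes x$, $\varepsilon(x)=0$, $S(x)=-xa^{-1}$, $\Delta(g)=g\otimes g$, $\varepsilon(g)=1$, $S(g)=g^{-1}$. $\{V_i\mid i\in I\}$ is a complete set of representatives of isomorphism classes of simple $kG$-modules. For $\lambda\in\hat G$, $V_\lambda$ is the corresponding one-dimensional module. Let $\sigma$ be the permutation of $I$ with $V_\chi\otimes V_i\cong V_{\sigma(i)}$. Define $i\sim j$ iff $i=\sigma^t(j)$ for some $t\in\mathbb Z$; $[i]$ is the class of $i$ and $I_0$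 is the set of classes. For $i\in I$ put $M(V_i)=H\otimes_{kG}V_i$. For $t\in\mathbb N^+$ put $V_t(i)=M(V_i)/x^tM(V_i)$ (where $x^tM(V_i)$ is the submodule generated by $x^t\otimes V_i$), and for $\beta\in k$ put $V_t(i,\beta)=M(V_i)/(x^s-\beta)^tM(V_i)$ (here $x^s$ is central in $H$). *)

theory Defs
  imports
    "HOL-Algebra.Algebra"
    "HOL-Combinatorics.Permutations"
    "HOL-Computational_Algebra.Polynomial"
begin

section \<open>Left modules over a ring that need not be commutative\<close>

text \<open>
  The record \<open>module\<close> and the locale \<open>submodule\<close> of HOL-Algebra are reused; only the locale
  \<open>module\<close> of HOL-Algebra is restricted to commutative rings. The fields \<open>mult\<close> and \<open>one\<close>
  which the record inherits from \<open>ring\<close> carry no meaning for a module.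
\<close>

locale left_module = R?: ring R + M?: abelian_group M
  for R :: "('r, 'x) ring_scheme" (structure) and M :: "('r, 'a, 'y) module_scheme" (structure) +
  assumes smult_closed:
      "\<lbrakk>a \<in> carrier R; x \<in> carrier M\<rbrakk> \<Longrightarrow> a \<odot>\<^bsub>M\<^esub> x \<in> carrier M"
    and smult_l_distr:
      "\<lbrakk>a \<in> carrier R; b \<in> carrier R; x \<in> carrier M\<rbrakk> \<Longrightarrow>
        (a \<oplus> b) \<odot>\<^bsub>M\<^esub> x = a \<odot>\<^bsub>M\<^esub> x \<oplus>\<^bsub>M\<^esub> b \<odot>\<^bsub>M\<^esub> x"
    and smult_r_distr:
      "\<lbrakk>a \<in> carrier R; x \<in> carrier M; y \<in> carrier M\<rbrakk> \<Longrightarrow>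
        a \<odot>\<^bsub>M\<^esub> (x \<oplus>\<^bsub>M\<^esub> y) = a \<odot>\<^bsub>M\<^esub> x \<oplus>\<^bsub>M\<^esub> a \<odot>\<^bsub>M\<^esub> y"
    and smult_assoc:
      "\<lbrakk>a \<in> carrier R; b \<in> carrier R; x \<in> carrier M\<rbrakk> \<Longrightarrow>
        (a \<otimes> b) \<odot>\<^bsub>M\<^esub> x = a \<odot>\<^bsub>M\<^esub> (b \<odot>\<^bsub>M\<^esub> x)"
    and smult_one:
      "x \<in> carrier M \<Longrightarrow> \<one> \<odot>\<^bsub>M\<^esub> x = x"

definition module_iso ::
  "('r, 'x) ring_scheme \<Rightarrow> ('r, 'a, 'y) module_scheme \<Rightarrow> ('r, 'b, 'z) module_scheme \<Rightarrow> bool"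
  where "module_iso R M N \<longleftrightarrow>
    (\<exists>f. bij_betw f (carrier M) (carrier N) \<and>
         (\<forall>u\<in>carrier M. \<forall>v\<in>carrier M. f (u \<oplus>\<^bsub>M\<^esub> v) = f u \<oplus>\<^bsub>N\<^esub> f v) \<and>
         (\<forall>r\<in>carrier R. \<forall>v\<in>carrier M. f (r \<odot>\<^bsub>M\<^esub> v) = r \<odot>\<^bsub>N\<^esub> f v))"

definition regular_module :: "('r, 'x) ring_scheme \<Rightarrow> ('r, 'r) module"
  where "regular_module R =
    \<lparr>carrier = carrier R, monoid.mult = monoid.mult R, one = one R, ring.zero = ring.zero R, ring.add = ring.add R,
     module.smult = monoid.mult R\<rparr>"

definition simple_module :: "('r, 'x) ring_scheme \<Rightarrow> ('r, 'a, 'y) module_scheme \<Rightarrow> bool"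
  where "simple_module R M \<longleftrightarrow>
    left_module R M \<and> carrier M \<noteq> {\<zero>\<^bsub>M\<^esub>} \<and>
    (\<forall>N. submodule N R M \<longrightarrow> N = {\<zero>\<^bsub>M\<^esub>} \<or> N = carrier M)"

text \<open>\<open>M = N \<oplus> N'\<close>, internally.\<close>

definition internal_direct_sum ::
  "('r, 'x) ring_scheme \<Rightarrow> ('r, 'a, 'y) module_scheme \<Rightarrow> 'a set \<Rightarrow> 'a set \<Rightarrow> bool"
  where "internal_direct_sum R M N N' \<longleftrightarrow>
    submodule N R M \<and> submodule N' R M \<and> N \<inter> N' = {\<zero>\<^bsub>M\<^esub>} \<and> N <+>\<^bsub>M\<^esub> N' = carrier M"

definition semisimple_module :: "('r, 'x) ring_scheme \<Rightarrow> ('r, 'a, 'y) module_scheme \<Rightarrow> bool"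
  where "semisimple_module R M \<longleftrightarrow>
    left_module R M \<and> (\<forall>N. submodule N R M \<longrightarrow> (\<exists>N'. internal_direct_sum R M N N'))"

definition semisimple_ring :: "('r, 'x) ring_scheme \<Rightarrow> bool"
  where "semisimple_ring R \<longleftrightarrow> ring R \<and> semisimple_module R (regular_module R)"

definition indecomposable_module :: "('r, 'x) ring_scheme \<Rightarrow> ('r, 'a, 'y) module_scheme \<Rightarrow> bool"
  where "indecomposable_module R M \<longleftrightarrow>
    left_module R M \<and> carrier M \<noteq> {\<zero>\<^bsub>M\<^esub>} \<and>
    (\<forall>N N'. internal_direct_sum R M N N' \<longrightarrow> N = {\<zero>\<^bsub>M\<^esub>} \<or> N' = {\<zero>\<^bsub>M\<^esub>})"

text \<open>
  Dimension over the field \<open>'k\<close>, which acts on \<open>M\<close> through the structure map \<open>\<iota>\<close>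
  of a \<open>'k\<close>-algebra.
\<close>

definition finite_dimensional :: "('k \<Rightarrow> 'r) \<Rightarrow> ('r, 'a, 'y) module_scheme \<Rightarrow> bool"
  where "finite_dimensional \<iota> M \<longleftrightarrow>
    (\<exists>B. finite B \<and> B \<subseteq> carrier M \<and>
      (\<forall>v\<in>carrier M. \<exists>c. v = (\<Oplus>\<^bsub>M\<^esub>b\<in>B. \<iota> (c b) \<odot>\<^bsub>M\<^esub> b)))"

definition submodule_generated ::
  "('r, 'x) ring_scheme \<Rightarrow> ('r, 'a, 'y) module_scheme \<Rightarrow> 'a set \<Rightarrow> 'a set"
  where "submodule_generated R M S = \<Inter>{N. submodule N R M \<and> S \<subseteq> N}"

definition quotient_module :: "('r, 'a, 'y) module_scheme \<Rightarrow> 'a set \<Rightarrow> ('r, 'a set) module"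
  where "quotient_module M N =
    \<lparr>carrier = a_rcosets\<^bsub>M\<^esub> N, monoid.mult = (\<lambda>_ _. undefined), one = undefined,
     ring.zero = N, ring.add = set_add M,
     module.smult = (\<lambda>r C. \<Union>v\<in>C. N +>\<^bsub>M\<^esub> (r \<odot>\<^bsub>M\<^esub> v))\<rparr>"

text \<open>
  A family of representatives of the isomorphism classes of \<open>R\<close>-modules with a given property,
  without repetitions. HOL cannot quantify over carrier types inside a formula, so the property is
  passed twice: \<open>P\<close> at the carrier type of the family, \<open>Q\<close> at the carrier type of the modules
  that the family has to exhaust.
\<close>

definition complete_representatives ::
  "('r, 'x) ring_scheme \<Rightarrow> (('r, 'a) module \<Rightarrow> bool) \<Rightarrow> (('r, 'b) module \<Rightarrow> bool) \<Rightarrow>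
   'i set \<Rightarrow> ('i \<Rightarrow> ('r, 'a) module) \<Rightarrow> bool"
  where "complete_representatives R P Q A F \<longleftrightarrow>
    (\<forall>\<alpha>\<in>A. P (F \<alpha>)) \<and>
    (\<forall>\<alpha>\<in>A. \<forall>\<beta>\<in>A. module_iso R (F \<alpha>) (F \<beta>) \<longrightarrow> \<alpha> = \<beta>) \<and>
    (\<forall>M. Q M \<longrightarrow> (\<exists>\<alpha>\<in>A. module_iso R M (F \<alpha>)))"


text \<open>
  For simple modules the carrier type of the ring itself is large enough for \<open>Q\<close>: a simple module
  is an image of the ring, so it is isomorphic to one whose carrier is a subset of the ring.
\<close>

lemma simple_module_on_ring_type:
  fixes R :: "('r, 'x) ring_scheme" and W :: "('r, 'w) module"
  assumes simp: "simple_module R W"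
  shows "\<exists>W' :: ('r,'r) module. simple_module R W' \<and> module_iso R W W'"
proof -
  have lm: "left_module R W" and ne: "carrier W \<noteq> {\<zero>\<^bsub>W\<^esub>}"
    and mx: "\<And>N. submodule N R W \<Longrightarrow> N = {\<zero>\<^bsub>W\<^esub>} \<or> N = carrier W"
    using simp by (auto simp: simple_module_def)
  interpret left_module R W by fact
  interpret MG: group "add_monoid W" using M.a_group .
  obtain w where w: "w \<in> carrier W" "w \<noteq> \<zero>\<^bsub>W\<^esub>" using ne M.zero_closed by blast
  let ?N = "(\<lambda>r. r \<odot>\<^bsub>W\<^esub> w) ` carrier R"
  have neg: "\<ominus>\<^bsub>W\<^esub> (r \<odot>\<^bsub>W\<^esub> w) = (\<ominus>\<^bsub>R\<^esub> r) \<odot>\<^bsub>W\<^esub> w" if "r \<in> carrier R" for r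
  proof -
    have z: "\<zero>\<^bsub>R\<^esub> \<odot>\<^bsub>W\<^esub> w = \<zero>\<^bsub>W\<^esub>"
      using smult_l_distr[of "\<zero>\<^bsub>R\<^esub>" "\<zero>\<^bsub>R\<^esub>" w] w smult_closed[of "\<zero>\<^bsub>R\<^esub>" w]
      by (metis M.add.r_cancel_one R.add.one_closed R.r_zero)
    have "(\<ominus>\<^bsub>R\<^esub> r) \<odot>\<^bsub>W\<^esub> w \<oplus>\<^bsub>W\<^esub> r \<odot>\<^bsub>W\<^esub> w = \<zero>\<^bsub>W\<^esub>"
      using smult_l_distr[of "\<ominus>\<^bsub>R\<^esub> r" r w] that w z by (simp add: R.l_neg)
    then show ?thesis using that w by (metis M.minus_equality R.a_inv_closed smult_closed)
  qed
  have sub: "submodule ?N R W"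
  proof (intro submodule.intro subgroup.intro submodule_axioms.intro, goal_cases)
    case 1 then show ?case using w by (auto intro: smult_closed)
  next
    case (2 x y) then show ?case using w by (auto simp: smult_l_distr[symmetric])
  next
    case 3 show ?case using neg[of "\<zero>\<^bsub>R\<^esub>"] smult_l_distr[of "\<zero>\<^bsub>R\<^esub>" "\<zero>\<^bsub>R\<^esub>" w] w smult_closed[of "\<zero>\<^bsub>R\<^esub>" w]
      by (auto simp: image_iff) (metis M.add.r_cancel_one R.add.one_closed R.r_zero)
  next
    case (4 x) then show ?case using neg by (auto simp: a_inv_def[symmetric])
  next
    case (5 r x) then show ?case using w by (auto simp: smult_assoc[symmetric])
  qed
  have "w \<in> ?N" using w smult_one by (metis R.one_closed image_eqI)
  then have N: "?N = carrier W" using mx[OF sub] w by auto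
  define h where "h = inv_into (carrier R) (\<lambda>r. r \<odot>\<^bsub>W\<^esub> w)"
  let ?C = "h ` carrier W"
  have hk: "h u \<odot>\<^bsub>W\<^esub> w = u" if "u \<in> carrier W" for u
    unfolding h_def using f_inv_into_f[of u "\<lambda>r. r \<odot>\<^bsub>W\<^esub> w" "carrier R"] that N by simp
  have inj: "inj_on h (carrier W)" by (metis hk inj_onI)
  define k where "k r = r \<odot>\<^bsub>W\<^esub> w" for r
  have kh[simp]: "k (h u) = u" if "u \<in> carrier W" for u using hk that by (simp add: k_def)
  define W' :: "('r,'r) module" where "W' = \<lparr>carrier = ?C, monoid.mult = (\<lambda>_ _. undefined), one = undefined,
      ring.zero = h \<zero>\<^bsub>W\<^esub>, ring.add = (\<lambda>x y. h (k x \<oplus>\<^bsub>W\<^esub> k y)), module.smult = (\<lambda>r x. h (r \<odot>\<^bsub>W\<^esub> k x))\<rparr>"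
  have ag: "abelian_group W'"
  proof (rule abelian_groupI, goal_cases)
    case (6 x) then obtain u where "u \<in> carrier W" "x = h u" by (auto simp: W'_def)
    then show ?case by (intro bexI[of _ "h (\<ominus>\<^bsub>W\<^esub> u)"]) (auto simp: W'_def M.l_neg)
  qed (auto simp: W'_def M.a_ac)
  have lm': "left_module R W'"
  proof (intro left_module.intro left_module_axioms.intro, goal_cases)
    case 1 show ?case by (rule R.ring_axioms)
  next case 2 show ?case by (rule ag)
  qed (auto simp: W'_def smult_closed smult_l_distr smult_r_distr smult_assoc smult_one)
  have iso: "module_iso R W W'"
    unfolding module_iso_def
    by (rule exI[of _ h]) (auto simp: W'_def bij_betw_def inj smult_closed)
  have "N = {\<zero>\<^bsub>W'\<^esub>} \<or> N = carrier W'" if N: "submodule N R W'" for N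
  proof -
    have sc: "N \<subseteq> ?C" using submodule.axioms(1)[OF N] subgroup.subset by (fastforce simp: W'_def)
    have cl: "\<And>x y. x\<in>N \<Longrightarrow> y\<in>N \<Longrightarrow> h (k x \<oplus>\<^bsub>W\<^esub> k y) \<in> N" and z: "h \<zero>\<^bsub>W\<^esub> \<in> N"
      using subgroup.m_closed[OF submodule.axioms(1)[OF N]] subgroup.one_closed[OF submodule.axioms(1)[OF N]] by (auto simp: W'_def)
    have sm: "\<And>r x. r \<in> carrier R \<Longrightarrow> x\<in>N \<Longrightarrow> h (r \<odot>\<^bsub>W\<^esub> k x) \<in> N"
      using submodule.smult_closed[OF N] by (auto simp: W'_def)
    have mI: "\<ominus>\<^bsub>W\<^esub> u = (\<ominus>\<^bsub>R\<^esub> \<one>\<^bsub>R\<^esub>) \<odot>\<^bsub>W\<^esub> u" if "u \<in> carrier W" for u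
    proof -
      have z: "\<zero>\<^bsub>R\<^esub> \<odot>\<^bsub>W\<^esub> u = \<zero>\<^bsub>W\<^esub>"
        using smult_l_distr[of "\<zero>\<^bsub>R\<^esub>" "\<zero>\<^bsub>R\<^esub>" u] that smult_closed[of "\<zero>\<^bsub>R\<^esub>" u]
        by (metis M.add.r_cancel_one R.add.one_closed R.r_zero)
      have "(\<ominus>\<^bsub>R\<^esub> \<one>\<^bsub>R\<^esub>) \<odot>\<^bsub>W\<^esub> u \<oplus>\<^bsub>W\<^esub> \<one>\<^bsub>R\<^esub> \<odot>\<^bsub>W\<^esub> u = \<zero>\<^bsub>W\<^esub>"
        using smult_l_distr[of "\<ominus>\<^bsub>R\<^esub> \<one>\<^bsub>R\<^esub>" "\<one>\<^bsub>R\<^esub>" u] that z by (simp add: R.l_neg)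
      then show ?thesis using that smult_one by (metis M.minus_equality R.a_inv_closed R.one_closed smult_closed)
    qed
    have "submodule (k ` N) R W"
    proof (intro submodule.intro subgroup.intro submodule_axioms.intro, goal_cases)
      case 1 then show ?case using sc by auto
    next
      case (2 x y) then show ?case using sc cl by (auto simp: image_iff subset_eq) (metis M.a_closed kh)
    next
      case 3 show ?case using z by (auto simp: image_iff) (metis M.zero_closed kh)
    next
      case (4 x) then obtain y where y: "y \<in> N" "x = k y" by auto
      then have xc: "x \<in> carrier W" using sc by auto
      have "h (\<ominus>\<^bsub>W\<^esub> x) \<in> N" using sm[of "\<ominus>\<^bsub>R\<^esub> \<one>\<^bsub>R\<^esub>" y] y mI[OF xc] by auto
      then have "\<ominus>\<^bsub>W\<^esub> x \<in> k ` N" using xc by (metis M.a_inv_closed image_eqI kh)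
      then show ?case by (simp add: a_inv_def)
    next
      case (5 r x) then obtain y where y: "y \<in> N" "x = k y" by auto
      then have xc: "x \<in> carrier W" using sc by auto
      then show ?case using sm[of r y] y 5 by (metis image_eqI kh smult_closed)
    qed
    moreover have "N = h ` k ` N" using sc by (force simp: image_image)
    ultimately show ?thesis using mx[of "k ` N"] by (auto simp: W'_def)
  qed
  moreover have "carrier W' \<noteq> {\<zero>\<^bsub>W'\<^esub>}"
    using w inj by (auto simp: W'_def inj_on_def)
  ultimately show ?thesis using lm' iso unfolding simple_module_def by blast
qed


section \<open>Tensor products\<close>

text \<open>
  \<open>M \<otimes>\<^sub>R N\<close> for a right \<open>R\<close>-module \<open>M\<close> with action \<open>ra\<close> and a left \<open>R\<close>-module \<open>N\<close> with action
  \<open>la\<close>: the free abelian group on \<open>M \<times> N\<close> modulo the usual relations. The result is written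
  multiplicatively because \<open>free_Abelian_group\<close> is.
\<close>

definition tensor_relators ::
  "('r, 'x) ring_scheme \<Rightarrow> ('a, 'y) ring_scheme \<Rightarrow> ('a \<Rightarrow> 'r \<Rightarrow> 'a) \<Rightarrow>
   ('b, 'z) ring_scheme \<Rightarrow> ('r \<Rightarrow> 'b \<Rightarrow> 'b) \<Rightarrow> ('a \<times> 'b \<Rightarrow>\<^sub>0 int) set"
  where "tensor_relators R M ra N la =
    {frag_of (m \<oplus>\<^bsub>M\<^esub> m', n) - frag_of (m, n) - frag_of (m', n) | m m' n.
       m \<in> carrier M \<and> m' \<in> carrier M \<and> n \<in> carrier N} \<union>
    {frag_of (m, n \<oplus>\<^bsub>N\<^esub> n') - frag_of (m, n) - frag_of (m, n') | m n n'.
       m \<in> carrier M \<and> n \<in> carrier N \<and> n' \<in> carrier N} \<union>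
    {frag_of (ra m r, n) - frag_of (m, la r n) | m r n.
       m \<in> carrier M \<and> r \<in> carrier R \<and> n \<in> carrier N}"

definition tensor_null ::
  "('r, 'x) ring_scheme \<Rightarrow> ('a, 'y) ring_scheme \<Rightarrow> ('a \<Rightarrow> 'r \<Rightarrow> 'a) \<Rightarrow>
   ('b, 'z) ring_scheme \<Rightarrow> ('r \<Rightarrow> 'b \<Rightarrow> 'b) \<Rightarrow> ('a \<times> 'b \<Rightarrow>\<^sub>0 int) set"
  where "tensor_null R M ra N la =
    generate (free_Abelian_group (carrier M \<times> carrier N)) (tensor_relators R M ra N la)"

definition tensor_product ::
  "('r, 'x) ring_scheme \<Rightarrow> ('a, 'y) ring_scheme \<Rightarrow> ('a \<Rightarrow> 'r \<Rightarrow> 'a) \<Rightarrow>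
   ('b, 'z) ring_scheme \<Rightarrow> ('r \<Rightarrow> 'b \<Rightarrow> 'b) \<Rightarrow> ('a \<times> 'b \<Rightarrow>\<^sub>0 int) set monoid"
  where "tensor_product R M ra N la =
    free_Abelian_group (carrier M \<times> carrier N) Mod tensor_null R M ra N la"

definition tensor_class ::
  "('r, 'x) ring_scheme \<Rightarrow> ('a, 'y) ring_scheme \<Rightarrow> ('a \<Rightarrow> 'r \<Rightarrow> 'a) \<Rightarrow>
   ('b, 'z) ring_scheme \<Rightarrow> ('r \<Rightarrow> 'b \<Rightarrow> 'b) \<Rightarrow>
   ('a \<times> 'b \<Rightarrow>\<^sub>0 int) \<Rightarrow> ('a \<times> 'b \<Rightarrow>\<^sub>0 int) set"
  where "tensor_class R M ra N la c =
    tensor_null R M ra N la #>\<^bsub>free_Abelian_group (carrier M \<times> carrier N)\<^esub> c"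

text \<open>
  The additive map determined by \<open>m \<otimes> n \<mapsto> m' \<otimes> n'\<close> for \<open>(m', n') = \<phi> (m, n)\<close>. It is only
  used for \<open>\<phi>\<close> that respect the relations, where all members of the union are equal.
\<close>

definition tensor_map ::
  "('r, 'x) ring_scheme \<Rightarrow> ('a, 'y) ring_scheme \<Rightarrow> ('a \<Rightarrow> 'r \<Rightarrow> 'a) \<Rightarrow>
   ('b, 'z) ring_scheme \<Rightarrow> ('r \<Rightarrow> 'b \<Rightarrow> 'b) \<Rightarrow> ('a \<times> 'b \<Rightarrow> 'a \<times> 'b) \<Rightarrow>
   ('a \<times> 'b \<Rightarrow>\<^sub>0 int) set \<Rightarrow> ('a \<times> 'b \<Rightarrow>\<^sub>0 int) set"
  where "tensor_map R M ra N la \<phi> C =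
    (\<Union>c\<in>C. tensor_class R M ra N la (frag_extend (\<lambda>p. frag_of (\<phi> p)) c))"


section \<open>Characters and group algebras\<close>

definition scalar_ring :: "'k::field ring"
  where "scalar_ring = \<lparr>carrier = UNIV, monoid.mult = (*), one = 1, ring.zero = 0, ring.add = (+)\<rparr>"

definition character_group :: "('g, 'x) monoid_scheme \<Rightarrow> ('g \<Rightarrow> 'k::field) monoid"
  where "character_group G =
    \<lparr>carrier = hom G (units_of scalar_ring) \<inter> extensional (carrier G),
     monoid.mult = (\<lambda>\<phi> \<psi>. \<lambda>g\<in>carrier G. \<phi> g * \<psi> g),
     one = (\<lambda>g\<in>carrier G. 1)\<rparr>"

text \<open>\<open>kG\<close> has the elements of \<open>G\<close> as basis; \<open>Poly_Mapping.single g c\<close> is \<open>c g\<close>.\<close>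

definition group_algebra :: "('g, 'x) monoid_scheme \<Rightarrow> ('g \<Rightarrow>\<^sub>0 'k::field) ring"
  where "group_algebra G =
    \<lparr>carrier = {f. Poly_Mapping.keys f \<subseteq> carrier G},
     monoid.mult = (\<lambda>f f'. \<Sum>g\<in>Poly_Mapping.keys f. \<Sum>h\<in>Poly_Mapping.keys f'.
       Poly_Mapping.single (g \<otimes>\<^bsub>G\<^esub> h) (Poly_Mapping.lookup f g * Poly_Mapping.lookup f' h)),
     one = Poly_Mapping.single \<one>\<^bsub>G\<^esub> 1,
     ring.zero = 0,
     ring.add = (+)\<rparr>"

definition group_algebra_scalar :: "('g, 'x) monoid_scheme \<Rightarrow> 'k::field \<Rightarrow> 'g \<Rightarrow>\<^sub>0 'k"
  where "group_algebra_scalar G c = Poly_Mapping.single \<one>\<^bsub>G\<^esub> c"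

text \<open>The one-dimensional module \<open>V\<^sub>\<mu>\<close>.\<close>

definition character_module :: "('g \<Rightarrow> 'k) \<Rightarrow> ('g \<Rightarrow>\<^sub>0 'k, 'k::field) module"
  where "character_module \<mu> =
    \<lparr>carrier = UNIV, monoid.mult = (*), one = 1, ring.zero = 0, ring.add = (+),
     module.smult = (\<lambda>f c. (\<Sum>g\<in>Poly_Mapping.keys f. Poly_Mapping.lookup f g * \<mu> g) * c)\<rparr>"

text \<open>
  \<open>V \<otimes>\<^sub>k W\<close> for \<open>kG\<close>-modules \<open>V\<close> and \<open>W\<close>, with \<open>kG\<close> acting through \<open>\<Delta>(g) = g \<otimes> g\<close>: an
  element \<open>\<Sum> c\<^sub>g g\<close> sends \<open>v \<otimes> w\<close> to \<open>\<Sum> (c\<^sub>g g v) \<otimes> (g w)\<close>.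
\<close>

definition tensor_module ::
  "('g, 'x) monoid_scheme \<Rightarrow> ('g \<Rightarrow>\<^sub>0 'k::field, 'a) module \<Rightarrow> ('g \<Rightarrow>\<^sub>0 'k, 'b) module \<Rightarrow>
   ('g \<Rightarrow>\<^sub>0 'k, ('a \<times> 'b \<Rightarrow>\<^sub>0 int) set) module"
  where "tensor_module G V W =
    (let ra = (\<lambda>v c. group_algebra_scalar G c \<odot>\<^bsub>V\<^esub> v);
         la = (\<lambda>c w. group_algebra_scalar G c \<odot>\<^bsub>W\<^esub> w);
         T = tensor_product scalar_ring V ra W la
     in \<lparr>carrier = carrier T, monoid.mult = (\<lambda>_ _. undefined), one = undefined,
         ring.zero = one T, ring.add = monoid.mult T,
         module.smult = (\<lambda>f C. \<Otimes>\<^bsub>T\<^esub>g\<in>Poly_Mapping.keys f.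
           tensor_map scalar_ring V ra W la
             (\<lambda>(v, w). (Poly_Mapping.single g (Poly_Mapping.lookup f g) \<odot>\<^bsub>V\<^esub> v,
                        Poly_Mapping.single g 1 \<odot>\<^bsub>W\<^esub> w)) C)\<rparr>)"


section \<open>The Hopf algebra \<open>kG(\<psi>, a, 0)\<close> and its modules\<close>

text \<open>The type \<open>'hh\<close> is meant to carry \<open>H \<otimes>\<^sub>k H\<close>.\<close>

record ('h, 'hh, 'k) hopf_algebra = "'h ring" +
  comult :: "'h \<Rightarrow> 'hh"
  counit :: "'h \<Rightarrow> 'k"
  antipode :: "'h \<Rightarrow> 'h"

text \<open>
  The algebra generated by \<open>kG\<close> and \<open>x\<close> with \<open>x g = \<psi>(g) g x\<close>, on its basis
  \<open>{g x\<^sup>i | g \<in> G, i \<ge> 0}\<close>: \<open>(g, i)\<close> stands for \<open>g x\<^sup>i\<close>, and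
  \<open>(g x\<^sup>i) (h x\<^sup>j) = \<psi>(h)\<^sup>i g h x\<^sup>i\<^sup>+\<^sup>j\<close>.
\<close>

definition ore_algebra ::
  "('g, 'x) monoid_scheme \<Rightarrow> ('g \<Rightarrow> 'k::field) \<Rightarrow> ('g \<times> nat \<Rightarrow>\<^sub>0 'k) ring"
  where "ore_algebra G \<psi> =
    \<lparr>carrier = {f. Poly_Mapping.keys f \<subseteq> carrier G \<times> UNIV},
     monoid.mult = (\<lambda>f f'. \<Sum>(g, i)\<in>Poly_Mapping.keys f. \<Sum>(h, j)\<in>Poly_Mapping.keys f'.
       Poly_Mapping.single (g \<otimes>\<^bsub>G\<^esub> h, i + j)
         (Poly_Mapping.lookup f (g, i) * Poly_Mapping.lookup f' (h, j) * \<psi> h ^ i)),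
     one = Poly_Mapping.single (\<one>\<^bsub>G\<^esub>, 0) 1,
     ring.zero = 0,
     ring.add = (+)\<rparr>"

definition ore_scalar :: "('g, 'x) monoid_scheme \<Rightarrow> 'k::field \<Rightarrow> 'g \<times> nat \<Rightarrow>\<^sub>0 'k"
  where "ore_scalar G c = Poly_Mapping.single (\<one>\<^bsub>G\<^esub>, 0) c"

definition ore_x :: "('g, 'x) monoid_scheme \<Rightarrow> 'g \<times> nat \<Rightarrow>\<^sub>0 'k::field"
  where "ore_x G = Poly_Mapping.single (\<one>\<^bsub>G\<^esub>, 1) 1"

definition ore_embed :: "('g \<Rightarrow>\<^sub>0 'k::field) \<Rightarrow> ('g \<times> nat \<Rightarrow>\<^sub>0 'k)"
  where "ore_embed f =
    (\<Sum>g\<in>Poly_Mapping.keys f. Poly_Mapping.single (g, 0) (Poly_Mapping.lookup f g))"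

text \<open>
  \<open>H \<otimes>\<^sub>k H\<close> has the pairs of basis elements of \<open>H\<close> as basis: \<open>((h, m), (l, n))\<close> stands for
  \<open>h x\<^sup>m \<otimes> l x\<^sup>n\<close>. On the basis of \<open>H\<close> the comultiplication is
  \<open>\<Delta>(g x\<^sup>i) = (g \<otimes> g) (x \<otimes> a + 1 \<otimes> x)\<^sup>i\<close>, where
  \<open>(h x\<^sup>m \<otimes> l x\<^sup>n) (x \<otimes> a) = \<psi>(a)\<^sup>n h x\<^sup>m\<^sup>+\<^sup>1 \<otimes> l a x\<^sup>n\<close> and
  \<open>(h x\<^sup>m \<otimes> l x\<^sup>n) (1 \<otimes> x) = h x\<^sup>m \<otimes> l x\<^sup>n\<^sup>+\<^sup>1\<close>.
\<close>

primrec ore_comult_basis ::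
  "('g, 'x) monoid_scheme \<Rightarrow> ('g \<Rightarrow> 'k::field) \<Rightarrow> 'g \<Rightarrow> 'g \<Rightarrow> nat \<Rightarrow>
   (('g \<times> nat) \<times> ('g \<times> nat) \<Rightarrow>\<^sub>0 'k)"
  where
    "ore_comult_basis G \<psi> a g 0 = Poly_Mapping.single ((g, 0), (g, 0)) 1"
  | "ore_comult_basis G \<psi> a g (Suc i) =
      (let D = ore_comult_basis G \<psi> a g i
       in \<Sum>((h, m), (l, n))\<in>Poly_Mapping.keys D.
            Poly_Mapping.single ((h, Suc m), (l \<otimes>\<^bsub>G\<^esub> a, n))
              (Poly_Mapping.lookup D ((h, m), (l, n)) * \<psi> a ^ n) +
            Poly_Mapping.single ((h, m), (l, Suc n))
              (Poly_Mapping.lookup D ((h, m), (l, n))))"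

text \<open>\<open>S(g x\<^sup>i) = S(x)\<^sup>i g\<^sup>-\<^sup>1\<close> with \<open>S(x) = - x a\<^sup>-\<^sup>1\<close>\<close>

definition ore_antipode_basis ::
  "('g, 'x) monoid_scheme \<Rightarrow> ('g \<Rightarrow> 'k::field) \<Rightarrow> 'g \<Rightarrow> 'g \<times> nat \<Rightarrow> ('g \<times> nat \<Rightarrow>\<^sub>0 'k)"
  where "ore_antipode_basis G \<psi> a = (\<lambda>(g, i).
    (let A = ore_algebra G \<psi>
     in (\<ominus>\<^bsub>A\<^esub> (ore_x G \<otimes>\<^bsub>A\<^esub> Poly_Mapping.single (inv\<^bsub>G\<^esub> a, 0) 1)) [^]\<^bsub>A\<^esub> i
          \<otimes>\<^bsub>A\<^esub> Poly_Mapping.single (inv\<^bsub>G\<^esub> g, 0) 1))"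

definition hopf_ore ::
  "('g, 'x) monoid_scheme \<Rightarrow> ('g \<Rightarrow> 'k::field) \<Rightarrow> 'g \<Rightarrow>
   ('g \<times> nat \<Rightarrow>\<^sub>0 'k, ('g \<times> nat) \<times> ('g \<times> nat) \<Rightarrow>\<^sub>0 'k, 'k) hopf_algebra"
  where "hopf_ore G \<psi> a =
    (let A = ore_algebra G \<psi>
     in \<lparr>carrier = carrier A, monoid.mult = monoid.mult A, one = one A,
         ring.zero = ring.zero A, ring.add = ring.add A,
         comult = (\<lambda>f. \<Sum>(g, i)\<in>Poly_Mapping.keys f.
           Poly_Mapping.map ((*) (Poly_Mapping.lookup f (g, i))) (ore_comult_basis G \<psi> a g i)),
         counit = (\<lambda>f. \<Sum>(g, i)\<in>Poly_Mapping.keys f.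
           if i = 0 then Poly_Mapping.lookup f (g, i) else 0),
         antipode = (\<lambda>f. \<Sum>b\<in>Poly_Mapping.keys f.
           Poly_Mapping.map ((*) (Poly_Mapping.lookup f b)) (ore_antipode_basis G \<psi> a b))\<rparr>)"

text \<open>\<open>M(V) = H \<otimes>\<^bsub>kG\<^esub> V\<close>, where \<open>H = kG(\<psi>, a, 0)\<close> here and below\<close>

definition induced_module ::
  "('g, 'x) monoid_scheme \<Rightarrow> ('g \<times> nat \<Rightarrow>\<^sub>0 'k::field, 'y) ring_scheme \<Rightarrow>
   ('g \<Rightarrow>\<^sub>0 'k, 'v) module \<Rightarrow>
   ('g \<times> nat \<Rightarrow>\<^sub>0 'k, (('g \<times> nat \<Rightarrow>\<^sub>0 'k) \<times> 'v \<Rightarrow>\<^sub>0 int) set) module"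
  where "induced_module G H V =
    (let ra = (\<lambda>h f. h \<otimes>\<^bsub>H\<^esub> ore_embed f);
         T = tensor_product (group_algebra G) H ra V (module.smult V)
     in \<lparr>carrier = carrier T, monoid.mult = (\<lambda>_ _. undefined), one = undefined,
         ring.zero = one T, ring.add = monoid.mult T,
         module.smult = (\<lambda>h. tensor_map (group_algebra G) H ra V (module.smult V)
           (\<lambda>(h', v). (h \<otimes>\<^bsub>H\<^esub> h', v)))\<rparr>)"

definition induced_tensor ::
  "('g, 'x) monoid_scheme \<Rightarrow> ('g \<times> nat \<Rightarrow>\<^sub>0 'k::field, 'y) ring_scheme \<Rightarrow>
   ('g \<Rightarrow>\<^sub>0 'k, 'v) module \<Rightarrow> ('g \<times> nat \<Rightarrow>\<^sub>0 'k) \<Rightarrow> 'v \<Rightarrow>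
   (('g \<times> nat \<Rightarrow>\<^sub>0 'k) \<times> 'v \<Rightarrow>\<^sub>0 int) set"
  where "induced_tensor G H V h v =
    tensor_class (group_algebra G) H (\<lambda>h f. h \<otimes>\<^bsub>H\<^esub> ore_embed f) V (module.smult V)
      (frag_of (h, v))"

text \<open>\<open>V\<^sub>t(i)\<close> for \<open>V = V\<^sub>i\<close>\<close>

definition nilpotent_quotient ::
  "('g, 'x) monoid_scheme \<Rightarrow> ('g \<times> nat \<Rightarrow>\<^sub>0 'k::field, 'y) ring_scheme \<Rightarrow>
   nat \<Rightarrow> ('g \<Rightarrow>\<^sub>0 'k, 'v) module \<Rightarrow>
   ('g \<times> nat \<Rightarrow>\<^sub>0 'k, (('g \<times> nat \<Rightarrow>\<^sub>0 'k) \<times> 'v \<Rightarrow>\<^sub>0 int) set set) module"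
  where "nilpotent_quotient G H t V =
    quotient_module (induced_module G H V)
      (submodule_generated H (induced_module G H V)
        {induced_tensor G H V (ore_x G [^]\<^bsub>H\<^esub> t) v | v. v \<in> carrier V})"

text \<open>\<open>V\<^sub>t(i, \<beta>)\<close> for \<open>V = V\<^sub>i\<close>; \<open>s\<close> is such that \<open>x\<^sup>s\<close> is central\<close>

definition unit_quotient ::
  "('g, 'x) monoid_scheme \<Rightarrow> ('g \<times> nat \<Rightarrow>\<^sub>0 'k::field, 'y) ring_scheme \<Rightarrow>
   nat \<Rightarrow> nat \<Rightarrow> ('g \<Rightarrow>\<^sub>0 'k, 'v) module \<Rightarrow> 'k \<Rightarrow>
   ('g \<times> nat \<Rightarrow>\<^sub>0 'k, (('g \<times> nat \<Rightarrow>\<^sub>0 'k) \<times> 'v \<Rightarrow>\<^sub>0 int) set set) module"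
  where "unit_quotient G H s t V \<beta> =
    (let M = induced_module G H V;
         z = (ore_x G [^]\<^bsub>H\<^esub> s) \<ominus>\<^bsub>H\<^esub> ore_scalar G \<beta>
     in quotient_module M ((\<lambda>m. (z [^]\<^bsub>H\<^esub> t) \<odot>\<^bsub>M\<^esub> m) ` carrier M))"

definition fin_dim_indecomposable ::
  "('g, 'x) monoid_scheme \<Rightarrow> ('g \<times> nat \<Rightarrow>\<^sub>0 'k::field, 'y) ring_scheme \<Rightarrow>
   ('g \<times> nat \<Rightarrow>\<^sub>0 'k, 'a) module \<Rightarrow> bool"
  where "fin_dim_indecomposable G H M \<longleftrightarrow>
    indecomposable_module H M \<and> finite_dimensional (ore_scalar G) M"


section \<open>Orbits and labels\<close>

definition perm_power :: "('i \<Rightarrow> 'i) \<Rightarrow> int \<Rightarrow> 'i \<Rightarrow> 'i"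
  where "perm_power \<sigma> t = (if 0 \<le> t then \<sigma> ^^ nat t else inv_into UNIV \<sigma> ^^ nat (- t))"

definition orbit_relation :: "'i set \<Rightarrow> ('i \<Rightarrow> 'i) \<Rightarrow> ('i \<times> 'i) set"
  where "orbit_relation I \<sigma> = {(i, j). i \<in> I \<and> j \<in> I \<and> (\<exists>t. i = perm_power \<sigma> t j)}"

text \<open>\<open>Nilp t i\<close> labels \<open>V\<^sub>t(i)\<close> and \<open>Unip t j \<beta>\<close> labels \<open>V\<^sub>t(j, \<beta>)\<close>.\<close>

datatype ('i, 'k) label = Nilp nat 'i | Unip nat 'i 'k

end

theory Submission
  imports Defs
begin

text \<open>
  Both families are treated as one. Put \<open>y = x\<^sup>m - \<beta>\<close>, where \<open>m = 1\<close> and \<open>\<beta> = 0\<close> for \<open>V\<^sub>t(i)\<close>, and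
  \<open>m = s\<close> and \<open>\<beta> \<noteq> 0\<close> for \<open>V\<^sub>t(i, \<beta>)\<close>. On every \<open>H\<close>-module \<open>y\<close> commutes with \<open>x\<close>, and with \<open>G\<close> up to the
  character \<open>\<chi>\<^sup>m\<close>. Both quotients of \<open>M(V)\<close> are generated by a copy of \<open>V\<close> subject only to
  \<open>y\<^sup>t V = 0\<close> (\<open>quotient_iso_D\<close>); such a module is realized concretely as a module \<open>D\<close> with
  the underlying space \<open>\<Sum> y\<^sup>c x\<^sup>b \<otimes> V\<close> for \<open>c < t\<close> and \<open>b < m\<close>.

  The modules are indecomposable, because every nonzero submodule of \<open>D\<close> contains \<open>y\<^sup>t\<^sup>-\<^sup>1 \<otimes> V\<close>
  (\<open>socle\<close>). The central element \<open>a\<close> acts on \<open>V\<close> by a scalar \<open>\<omega>\<close>, hence on \<open>y\<^sup>t\<^sup>-\<^sup>1 x\<^sup>b \<otimes> V\<close> by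
  \<open>\<omega> q\<^sup>n\<close> with \<open>n = (t - 1) m + b\<close>. As \<open>m\<close> does not exceed the order of \<open>q\<close>, these eigenvalues are
  distinct for \<open>b < m\<close>, and the component in \<open>y\<^sup>t\<^sup>-\<^sup>1 \<otimes> V\<close> of a suitable element can be isolated.

  They are all. Let \<open>M\<close> be finite dimensional and indecomposable. As \<open>\<chi>\<^sup>s = 1\<close>, the element \<open>x\<^sup>s\<close> is central and
  so has only one eigenvalue on \<open>M\<close>, which determines \<open>m\<close> and \<open>\<beta>\<close>; let \<open>t\<close> be the nilpotency index of \<open>y\<close>
  on \<open>M\<close> (\<open>parameters_exist\<close>). Since \<open>kG\<close> is semisimple, \<open>M\<close> has a simple \<open>kG\<close>-submodule \<open>V\<close> that
  meets the kernel of \<open>y\<^sup>t\<^sup>-\<^sup>1\<close> trivially (\<open>generating_simple\<close>). The inclusion of \<open>V\<close> extends to a map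
  \<open>D \<rightarrow> M\<close>, injective by the statement on submodules of \<open>D\<close>, and its image is a direct summand:
  if \<open>K\<close> is a \<open>kG\<close>-complement of \<open>y\<^sup>t\<^sup>-\<^sup>1 V\<close> in \<open>M\<close>, then the largest \<open>H\<close>-submodule of \<open>K\<close> is an
  \<open>H\<close>-complement of the image (\<open>splitting\<close>). Hence \<open>M\<close> is isomorphic to \<open>D\<close>. If \<open>\<beta> \<noteq> 0\<close>, then \<open>x\<close> is bijective on \<open>M\<close> and
  \<open>x V\<close> is a copy of \<open>V\<^sub>\<chi> \<otimes> V\<close>, so that \<open>V\<close> may be replaced by any member of its orbit under \<open>\<sigma>\<close>.

  They are distinct (\<open>model_iso_imp\<close>). The eigenvalue of \<open>x\<^sup>s\<close> is \<open>\<beta>\<close>, the nilpotency index of \<open>y\<close> is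
  \<open>t\<close>, and the kernel of \<open>y\<close> consists of the \<open>y\<^sup>t\<^sup>-\<^sup>1 x\<^sup>b \<otimes> V\<close> with \<open>b < m\<close>, which
  determine \<open>V\<close> up to a twist by \<open>\<chi>\<^sup>b\<close>: up to isomorphism if \<open>m = 1\<close>, and up to the action of \<open>\<sigma>\<close> if \<open>m = s\<close>.
\<close>

section \<open>Modules, homomorphisms and quotients\<close>

context left_module
begin

lemma smult_r_null [simp]: "r \<in> carrier R \<Longrightarrow> r \<odot>\<^bsub>M\<^esub> \<zero>\<^bsub>M\<^esub> = \<zero>\<^bsub>M\<^esub>"
  using smult_r_distr[of r "\<zero>\<^bsub>M\<^esub>" "\<zero>\<^bsub>M\<^esub>"] smult_closed[of r "\<zero>\<^bsub>M\<^esub>"]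
  by (metis M.add.r_cancel_one' M.r_zero M.zero_closed)

lemma smult_l_null [simp]: "v \<in> carrier M \<Longrightarrow> \<zero> \<odot>\<^bsub>M\<^esub> v = \<zero>\<^bsub>M\<^esub>"
  using smult_l_distr[of "\<zero>" "\<zero>" v] smult_closed[of "\<zero>" v]
  by (metis M.add.r_cancel_one' R.r_zero R.zero_closed)

lemma smult_l_minus:
  "\<lbrakk>r \<in> carrier R; v \<in> carrier M\<rbrakk> \<Longrightarrow> (\<ominus> r) \<odot>\<^bsub>M\<^esub> v = \<ominus>\<^bsub>M\<^esub> (r \<odot>\<^bsub>M\<^esub> v)"
  by (metis M.minus_equality R.a_inv_closed R.l_neg smult_closed smult_l_distr smult_l_null)

lemma minus_as_smult: "v \<in> carrier M \<Longrightarrow> \<ominus>\<^bsub>M\<^esub> v = (\<ominus> \<one>) \<odot>\<^bsub>M\<^esub> v"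
  by (simp add: smult_l_minus smult_one)

lemma smult_finsum:
  assumes "finite A" "f \<in> A \<rightarrow> carrier M" "r \<in> carrier R"
  shows "r \<odot>\<^bsub>M\<^esub> (\<Oplus>\<^bsub>M\<^esub>i\<in>A. f i) = (\<Oplus>\<^bsub>M\<^esub>i\<in>A. r \<odot>\<^bsub>M\<^esub> f i)"
  using assms
  by (induction A rule: finite_induct) (auto simp: smult_r_distr smult_closed Pi_iff M.finsum_insert)

lemma submoduleI:
  assumes "N \<subseteq> carrier M" "\<zero>\<^bsub>M\<^esub> \<in> N"
    and "\<And>u v. \<lbrakk>u \<in> N; v \<in> N\<rbrakk> \<Longrightarrow> u \<oplus>\<^bsub>M\<^esub> v \<in> N"
    and "\<And>r v. \<lbrakk>r \<in> carrier R; v \<in> N\<rbrakk> \<Longrightarrow> r \<odot>\<^bsub>M\<^esub> v \<in> N"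
  shows "submodule N R M"
proof (intro submodule.intro subgroup.intro submodule_axioms.intro)
  fix v assume v: "v \<in> N"
  then have "\<ominus>\<^bsub>M\<^esub> v \<in> N" using assms by (subst minus_as_smult) auto
  then show "inv\<^bsub>add_monoid M\<^esub> v \<in> N" by (simp add: a_inv_def)
qed (use assms in auto)

lemma submoduleD:
  assumes "submodule N R M"
  shows "N \<subseteq> carrier M" "\<zero>\<^bsub>M\<^esub> \<in> N"
    and "\<And>u v. \<lbrakk>u \<in> N; v \<in> N\<rbrakk> \<Longrightarrow> u \<oplus>\<^bsub>M\<^esub> v \<in> N"
    and "\<And>r v. \<lbrakk>r \<in> carrier R; v \<in> N\<rbrakk> \<Longrightarrow> r \<odot>\<^bsub>M\<^esub> v \<in> N"
    and "\<And>u. u \<in> N \<Longrightarrow> \<ominus>\<^bsub>M\<^esub> u \<in> N"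
    and "\<And>u v. \<lbrakk>u \<in> N; v \<in> N\<rbrakk> \<Longrightarrow> u \<ominus>\<^bsub>M\<^esub> v \<in> N"
proof -
  interpret submodule N R M by fact
  show "N \<subseteq> carrier M" using subset by simp
  show "\<zero>\<^bsub>M\<^esub> \<in> N" using one_closed by simp
  show *: "\<And>u v. \<lbrakk>u \<in> N; v \<in> N\<rbrakk> \<Longrightarrow> u \<oplus>\<^bsub>M\<^esub> v \<in> N" using m_closed by simp
  show "\<And>r v. \<lbrakk>r \<in> carrier R; v \<in> N\<rbrakk> \<Longrightarrow> r \<odot>\<^bsub>M\<^esub> v \<in> N" by simp
  show **: "\<And>u. u \<in> N \<Longrightarrow> \<ominus>\<^bsub>M\<^esub> u \<in> N" using m_inv_closed by (simp add: a_inv_def)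
  show "\<And>u v. \<lbrakk>u \<in> N; v \<in> N\<rbrakk> \<Longrightarrow> u \<ominus>\<^bsub>M\<^esub> v \<in> N" using * ** by (simp add: a_minus_def)
qed

lemma left_module_submodule: 
  assumes "submodule N R M" shows "left_module R (M\<lparr>carrier := N\<rparr>)"
proof -
  note N = submoduleD[OF assms]
  have ag: "abelian_group (M\<lparr>carrier := N\<rparr>)"
  proof (rule abelian_groupI, goal_cases)
    case (6 x)
    then show ?case using N M.l_neg by (intro bexI[of _ "\<ominus>\<^bsub>M\<^esub> x"]) (auto intro: M.l_neg)
  qed (use N in \<open>auto simp: M.a_ac subset_iff\<close>)
  show ?thesis
    by (intro left_module.intro left_module_axioms.intro R.ring_axioms ag)
       (use N in \<open>auto simp: smult_l_distr smult_r_distr smult_assoc smult_one subset_iff\<close>)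
qed

lemma submodule_carrier: "submodule (carrier M) R M"
  by (rule submoduleI) (auto simp: smult_closed)

lemma submodule_zero: "submodule {\<zero>\<^bsub>M\<^esub>} R M"
  by (rule submoduleI) auto

lemma submodule_Int: "\<lbrakk>submodule N R M; submodule N' R M\<rbrakk> \<Longrightarrow> submodule (N \<inter> N') R M"
  by (rule submoduleI) (auto dest: submoduleD(1) simp: submoduleD(2-4))

lemma set_add_eq: "A <+>\<^bsub>M\<^esub> B = {u \<oplus>\<^bsub>M\<^esub> v | u v. u \<in> A \<and> v \<in> B}"
  by (auto simp: set_add_def set_mult_def)

lemma set_addI: "\<lbrakk>u \<in> A; v \<in> B\<rbrakk> \<Longrightarrow> u \<oplus>\<^bsub>M\<^esub> v \<in> A <+>\<^bsub>M\<^esub> B"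
  by (auto simp: set_add_eq)

lemma set_addE:
  assumes "w \<in> A <+>\<^bsub>M\<^esub> B" obtains u v where "w = u \<oplus>\<^bsub>M\<^esub> v" "u \<in> A" "v \<in> B"
  using assms by (auto simp: set_add_eq)

lemma set_add_left: "\<lbrakk>submodule N R M; submodule N' R M\<rbrakk> \<Longrightarrow> N \<subseteq> N <+>\<^bsub>M\<^esub> N'"
  using set_addI[of _ N "\<zero>\<^bsub>M\<^esub>" N'] submoduleD(1)[of N] submoduleD(2)[of N'] M.r_zero
  by (metis subsetD subsetI)

lemma set_add_right: "\<lbrakk>submodule N R M; submodule N' R M\<rbrakk> \<Longrightarrow> N' \<subseteq> N <+>\<^bsub>M\<^esub> N'"
  using set_addI[of "\<zero>\<^bsub>M\<^esub>" N _ N'] submoduleD(1)[of N'] submoduleD(2)[of N] M.l_zero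
  by (metis subsetD subsetI)

lemma submodule_set_add:
  assumes NN: "submodule N R M" "submodule N' R M" shows "submodule (N <+>\<^bsub>M\<^esub> N') R M"
proof (rule submoduleI)
  note N = submoduleD[OF assms(1)] and N' = submoduleD[OF assms(2)]
  show "N <+>\<^bsub>M\<^esub> N' \<subseteq> carrier M" using N(1) N'(1) by (auto simp: set_add_eq)
  show "\<zero>\<^bsub>M\<^esub> \<in> N <+>\<^bsub>M\<^esub> N'" using set_add_left[OF NN] N(2) by blast
  fix u v assume u: "u \<in> N <+>\<^bsub>M\<^esub> N'" and v: "v \<in> N <+>\<^bsub>M\<^esub> N'"
  obtain u1 u2 where 1: "u = u1 \<oplus>\<^bsub>M\<^esub> u2" "u1 \<in> N" "u2 \<in> N'" using u by (rule set_addE)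
  obtain v1 v2 where 2: "v = v1 \<oplus>\<^bsub>M\<^esub> v2" "v1 \<in> N" "v2 \<in> N'" using v by (rule set_addE)
  have "u1 \<in> carrier M" "u2 \<in> carrier M" "v1 \<in> carrier M" "v2 \<in> carrier M"
    using 1 2 N(1) N'(1) by auto
  then have "u \<oplus>\<^bsub>M\<^esub> v = (u1 \<oplus>\<^bsub>M\<^esub> v1) \<oplus>\<^bsub>M\<^esub> (u2 \<oplus>\<^bsub>M\<^esub> v2)"
    by (simp add: 1 2 M.a_ac)
  then show "u \<oplus>\<^bsub>M\<^esub> v \<in> N <+>\<^bsub>M\<^esub> N'" using set_addI[OF N(3)[OF 1(2) 2(2)] N'(3)[OF 1(3) 2(3)]] by simp
next
  note N = submoduleD[OF assms(1)] and N' = submoduleD[OF assms(2)]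
  fix r u assume r: "r \<in> carrier R" and u: "u \<in> N <+>\<^bsub>M\<^esub> N'"
  obtain u1 u2 where 1: "u = u1 \<oplus>\<^bsub>M\<^esub> u2" "u1 \<in> N" "u2 \<in> N'" using u by (rule set_addE)
  have "u1 \<in> carrier M" "u2 \<in> carrier M" using 1 N(1) N'(1) by auto
  then have "r \<odot>\<^bsub>M\<^esub> u = r \<odot>\<^bsub>M\<^esub> u1 \<oplus>\<^bsub>M\<^esub> r \<odot>\<^bsub>M\<^esub> u2" by (simp add: 1 smult_r_distr r)
  then show "r \<odot>\<^bsub>M\<^esub> u \<in> N <+>\<^bsub>M\<^esub> N'" using set_addI[OF N(4)[OF r 1(2)] N'(4)[OF r 1(3)]] by simp
qed

lemma submodule_generated:
  assumes "S \<subseteq> carrier M"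
  shows "submodule (submodule_generated R M S) R M" "S \<subseteq> submodule_generated R M S"
    and "\<And>N. \<lbrakk>submodule N R M; S \<subseteq> N\<rbrakk> \<Longrightarrow> submodule_generated R M S \<subseteq> N"
proof -
  have c: "carrier M \<in> {N. submodule N R M \<and> S \<subseteq> N}" using submodule_carrier assms by auto
  show "submodule (submodule_generated R M S) R M"
    unfolding submodule_generated_def
    by (rule submoduleI) (use c in \<open>auto dest: submoduleD(1) simp: submoduleD(2-4)\<close>)
qed (auto simp: submodule_generated_def)

end

definition linear_map ::
  "('r, 'x) ring_scheme \<Rightarrow> ('r, 'a, 'y) module_scheme \<Rightarrow> ('r, 'b, 'z) module_scheme \<Rightarrow> ('a \<Rightarrow> 'b) \<Rightarrow> bool"
  where "linear_map R M N f \<longleftrightarrow> f \<in> carrier M \<rightarrow> carrier N \<and>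
    (\<forall>u\<in>carrier M. \<forall>v\<in>carrier M. f (u \<oplus>\<^bsub>M\<^esub> v) = f u \<oplus>\<^bsub>N\<^esub> f v) \<and>
    (\<forall>r\<in>carrier R. \<forall>v\<in>carrier M. f (r \<odot>\<^bsub>M\<^esub> v) = r \<odot>\<^bsub>N\<^esub> f v)"

lemma linear_mapD:
  assumes "linear_map R M N f"
  shows "u \<in> carrier M \<Longrightarrow> f u \<in> carrier N"
    and "\<lbrakk>u \<in> carrier M; v \<in> carrier M\<rbrakk> \<Longrightarrow> f (u \<oplus>\<^bsub>M\<^esub> v) = f u \<oplus>\<^bsub>N\<^esub> f v"
    and "\<lbrakk>r \<in> carrier R; v \<in> carrier M\<rbrakk> \<Longrightarrow> f (r \<odot>\<^bsub>M\<^esub> v) = r \<odot>\<^bsub>N\<^esub> f v"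
  using assms by (auto simp: linear_map_def)

lemma module_iso_iff:
  "module_iso R M N \<longleftrightarrow> (\<exists>f. linear_map R M N f \<and> bij_betw f (carrier M) (carrier N))"
  unfolding module_iso_def linear_map_def by (auto simp: bij_betw_def)

lemma linear_map_comp:
  "\<lbrakk>linear_map R M N f; linear_map R N P h\<rbrakk> \<Longrightarrow> linear_map R M P (h \<circ> f)"
  by (fastforce simp: linear_map_def Pi_iff)

lemma linear_map_zero:
  assumes "left_module R M" "left_module R N" "linear_map R M N f"
  shows "f \<zero>\<^bsub>M\<^esub> = \<zero>\<^bsub>N\<^esub>"
proof -
  interpret M: left_module R M by fact
  interpret N: left_module R N by fact
  show ?thesis using linear_mapD(2)[OF assms(3), of "\<zero>\<^bsub>M\<^esub>" "\<zero>\<^bsub>M\<^esub>"] linear_mapD(1)[OF assms(3), of "\<zero>\<^bsub>M\<^esub>"]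
    by (metis M.M.r_zero M.M.zero_closed N.M.add.r_cancel_one')
qed

lemma linear_map_minus:
  assumes "left_module R M" "left_module R N" "linear_map R M N f" "u \<in> carrier M"
  shows "f (\<ominus>\<^bsub>M\<^esub> u) = \<ominus>\<^bsub>N\<^esub> f u"
proof -
  interpret M: left_module R M by fact
  interpret N: left_module R N by fact
  show ?thesis using linear_mapD[OF assms(3)] assms(4)
    by (simp add: M.minus_as_smult N.minus_as_smult)
qed

lemma linear_map_diff:
  assumes "left_module R M" "left_module R N" "linear_map R M N f" "u \<in> carrier M" "v \<in> carrier M"
  shows "f (u \<ominus>\<^bsub>M\<^esub> v) = f u \<ominus>\<^bsub>N\<^esub> f v"
proof -
  interpret M: left_module R M by fact
  show ?thesis using linear_mapD[OF assms(3)] assms(4,5) linear_map_minus[OF assms(1-3)]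
    by (simp add: a_minus_def)
qed

lemma linear_map_inverse:
  assumes "left_module R M" "linear_map R M N f" "bij_betw f (carrier M) (carrier N)"
  shows "linear_map R N M (inv_into (carrier M) f)"
    and "bij_betw (inv_into (carrier M) f) (carrier N) (carrier M)"
proof -
  interpret M: left_module R M by fact
  let ?h = "inv_into (carrier M) f"
  note f = linear_mapD[OF assms(2)]
  show b: "bij_betw ?h (carrier N) (carrier M)" using assms(3) by (rule bij_betw_inv_into)
  have hf: "?h (f u) = u" if "u \<in> carrier M" for u using that assms(3) by (simp add: bij_betw_inv_into_left)
  have fh: "f (?h u) = u" if "u \<in> carrier N" for u using that assms(3) by (simp add: bij_betw_inv_into_right)
  have hc: "?h u \<in> carrier M" if "u \<in> carrier N" for u using that b by (auto simp: bij_betw_def)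
  have "?h (u \<oplus>\<^bsub>N\<^esub> v) = ?h u \<oplus>\<^bsub>M\<^esub> ?h v" if "u \<in> carrier N" "v \<in> carrier N" for u v
    using that f(2)[of "?h u" "?h v"] hf[of "?h u \<oplus>\<^bsub>M\<^esub> ?h v"] by (simp add: fh hc)
  moreover have "?h (r \<odot>\<^bsub>N\<^esub> v) = r \<odot>\<^bsub>M\<^esub> ?h v" if "r \<in> carrier R" "v \<in> carrier N" for r v
    using that f(3)[of r "?h v"] hf[of "r \<odot>\<^bsub>M\<^esub> ?h v"] by (simp add: fh hc M.smult_closed)
  ultimately show "linear_map R N M ?h" using hc by (auto simp: linear_map_def)
qed

lemma module_iso_sym: "\<lbrakk>left_module R M; module_iso R M N\<rbrakk> \<Longrightarrow> module_iso R N M"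
  unfolding module_iso_iff using linear_map_inverse by blast

lemma module_iso_trans: "\<lbrakk>module_iso R M N; module_iso R N P\<rbrakk> \<Longrightarrow> module_iso R M P"
  unfolding module_iso_iff using linear_map_comp bij_betw_trans by blast

lemma submodule_image:
  assumes "left_module R M" "left_module R N" "linear_map R M N f" "submodule U R M"
  shows "submodule (f ` U) R N"
proof -
  interpret M: left_module R M by fact
  interpret N: left_module R N by fact
  note f = linear_mapD[OF assms(3)] and U = M.submoduleD[OF assms(4)]
  show ?thesis
  proof (rule N.submoduleI)
    show "f ` U \<subseteq> carrier N" using f U by auto
    show "\<zero>\<^bsub>N\<^esub> \<in> f ` U" using linear_map_zero[OF assms(1-3)] U(2) by force
    fix u v assume "u \<in> f ` U" "v \<in> f ` U"
    then show "u \<oplus>\<^bsub>N\<^esub> v \<in> f ` U" using f(2)[symmetric] U(1,3) by (fastforce simp: subset_iff)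
  next
    fix r v assume "r \<in> carrier R" "v \<in> f ` U"
    then show "r \<odot>\<^bsub>N\<^esub> v \<in> f ` U" using f(3)[symmetric] U(1,4) by (fastforce simp: subset_iff)
  qed
qed

lemma submodule_preimage:
  assumes "left_module R M" "left_module R N" "linear_map R M N f" "submodule U R N"
  shows "submodule {v \<in> carrier M. f v \<in> U} R M"
proof -
  interpret M: left_module R M by fact
  interpret N: left_module R N by fact
  note f = linear_mapD[OF assms(3)] and U = N.submoduleD[OF assms(4)]
  show ?thesis
    by (rule M.submoduleI) (use f U linear_map_zero[OF assms(1-3)] in \<open>auto simp: M.smult_closed\<close>)
qed

lemma linear_map_inj_on:
  assumes "left_module R M" "left_module R N" "linear_map R M N f"
    and ker: "\<And>v. \<lbrakk>v \<in> carrier M; f v = \<zero>\<^bsub>N\<^esub>\<rbrakk> \<Longrightarrow> v = \<zero>\<^bsub>M\<^esub>"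
  shows "inj_on f (carrier M)"
proof (rule inj_onI)
  interpret M: left_module R M by fact
  interpret N: left_module R N by fact
  fix u v assume uv: "u \<in> carrier M" "v \<in> carrier M" "f u = f v"
  then have "f (u \<ominus>\<^bsub>M\<^esub> v) = \<zero>\<^bsub>N\<^esub>"
    using linear_map_diff[OF assms(1-3)] linear_mapD(1)[OF assms(3)] by (simp add: N.M.r_neg a_minus_def)
  then have "u \<ominus>\<^bsub>M\<^esub> v = \<zero>\<^bsub>M\<^esub>" using ker uv by simp
  then show "u = v" using uv by (simp add: a_minus_def) (metis M.M.a_inv_closed M.M.minus_equality M.M.minus_minus)
qed

lemma indecomposable_module_transport:
  assumes "left_module R M" "module_iso R M N" "indecomposable_module R N"
  shows "indecomposable_module R M"
proof -
  from assms(2) obtain f where f: "linear_map R M N f" "bij_betw f (carrier M) (carrier N)"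
    by (auto simp: module_iso_iff)
  have N: "left_module R N" using assms(3) by (simp add: indecomposable_module_def)
  interpret M: left_module R M by fact
  interpret N: left_module R N by fact
  have z: "f \<zero>\<^bsub>M\<^esub> = \<zero>\<^bsub>N\<^esub>" by (rule linear_map_zero[OF assms(1) N f(1)])
  have inj: "inj_on f (carrier M)" and im: "f ` carrier M = carrier N" using f(2) by (auto simp: bij_betw_def)
  note fD = linear_mapD[OF f(1)]
  have "A = {\<zero>\<^bsub>M\<^esub>} \<or> B = {\<zero>\<^bsub>M\<^esub>}" if AB: "internal_direct_sum R M A B" for A B
  proof -
    have A: "submodule A R M" and B: "submodule B R M" and i: "A \<inter> B = {\<zero>\<^bsub>M\<^esub>}" and s: "A <+>\<^bsub>M\<^esub> B = carrier M"
      using AB by (auto simp: internal_direct_sum_def)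
    have sub: "A \<subseteq> carrier M" "B \<subseteq> carrier M" using M.submoduleD(1) A B by auto
    have "f ` A \<inter> f ` B = f ` (A \<inter> B)" by (rule inj_on_image_Int[OF inj sub, symmetric])
    then have i': "f ` A \<inter> f ` B = {\<zero>\<^bsub>N\<^esub>}" using i z by simp
    have "f ` A <+>\<^bsub>N\<^esub> f ` B = f ` (A <+>\<^bsub>M\<^esub> B)"
    proof safe
      fix w assume "w \<in> f ` A <+>\<^bsub>N\<^esub> f ` B"
      then obtain u v where "w = f u \<oplus>\<^bsub>N\<^esub> f v" "u \<in> A" "v \<in> B" by (auto simp: N.set_add_eq)
      moreover from this have "u \<in> carrier M" "v \<in> carrier M" using sub by auto
      ultimately have "w = f (u \<oplus>\<^bsub>M\<^esub> v)" "u \<oplus>\<^bsub>M\<^esub> v \<in> A <+>\<^bsub>M\<^esub> B" by (simp_all add: fD(2) M.set_addI)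
      then show "w \<in> f ` (A <+>\<^bsub>M\<^esub> B)" by blast
    next
      fix w assume "w \<in> A <+>\<^bsub>M\<^esub> B"
      then obtain u v where w: "w = u \<oplus>\<^bsub>M\<^esub> v" and uv: "u \<in> A" "v \<in> B" by (auto simp: M.set_add_eq)
      then have "u \<in> carrier M" "v \<in> carrier M" using sub by auto
      then have "f w = f u \<oplus>\<^bsub>N\<^esub> f v" by (simp add: w fD(2))
      then show "f w \<in> f ` A <+>\<^bsub>N\<^esub> f ` B" using N.set_addI uv by auto
    qed
    then have "internal_direct_sum R N (f ` A) (f ` B)"
      unfolding internal_direct_sum_def using i' s im submodule_image[OF assms(1) N f(1)] A B by simp
    then have "f ` A = f ` {\<zero>\<^bsub>M\<^esub>} \<or> f ` B = f ` {\<zero>\<^bsub>M\<^esub>}"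
      using assms(3) z by (auto simp: indecomposable_module_def)
    then show ?thesis using inj_on_image_eq_iff[OF inj] sub by (metis M.M.zero_closed empty_subsetI insert_subset)
  qed
  moreover have "carrier M \<noteq> {\<zero>\<^bsub>M\<^esub>}" using z im assms(3) by (auto simp: indecomposable_module_def)
  ultimately show ?thesis using assms(1) by (simp add: indecomposable_module_def)
qed

text \<open>The kernel and the image of a nonzero map between simple modules leave no other choice.\<close>

lemma schur:
  assumes "simple_module R M" "simple_module R N" "linear_map R M N f"
    and "u \<in> carrier M" "f u \<noteq> \<zero>\<^bsub>N\<^esub>"
  shows "bij_betw f (carrier M) (carrier N)"
proof -
  have M: "left_module R M" and N: "left_module R N" using assms by (auto simp: simple_module_def)
  interpret M: left_module R M by fact
  interpret N: left_module R N by fact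
  have "submodule {v \<in> carrier M. f v \<in> {\<zero>\<^bsub>N\<^esub>}} R M"
    by (rule submodule_preimage[OF M N assms(3) N.submodule_zero])
  then have "{v \<in> carrier M. f v \<in> {\<zero>\<^bsub>N\<^esub>}} = {\<zero>\<^bsub>M\<^esub>}"
    using assms(1,4,5) by (auto simp: simple_module_def)
  then have "inj_on f (carrier M)" by (intro linear_map_inj_on[OF M N assms(3)]) auto
  moreover have "f ` carrier M = carrier N"
    using submodule_image[OF M N assms(3) M.submodule_carrier] assms(2,4,5)
    by (auto simp: simple_module_def)
  ultimately show ?thesis by (simp add: bij_betw_def)
qed

text \<open>
  Spanning is expressed through closed subsets, so that applications can argue by induction
  instead of exhibiting coefficients; the proof takes the set of all linear combinations for \<open>S\<close>.
\<close>

lemma finite_dimensionalI: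
  fixes \<iota> :: "'k::comm_ring_1 \<Rightarrow> 'r"
  assumes "left_module R M" "finite B" "B \<subseteq> carrier M"
    and \<iota>: "\<And>c. \<iota> c \<in> carrier R" "\<And>c d. \<iota> (c + d) = \<iota> c \<oplus>\<^bsub>R\<^esub> \<iota> d"
      "\<And>c d. \<iota> (c * d) = \<iota> c \<otimes>\<^bsub>R\<^esub> \<iota> d" "\<iota> 0 = \<zero>\<^bsub>R\<^esub>" "\<iota> 1 = \<one>\<^bsub>R\<^esub>"
    and closure: "\<And>S. \<lbrakk>S \<subseteq> carrier M; B \<subseteq> S; \<zero>\<^bsub>M\<^esub> \<in> S; \<And>u v. \<lbrakk>u \<in> S; v \<in> S\<rbrakk> \<Longrightarrow> u \<oplus>\<^bsub>M\<^esub> v \<in> S;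
      \<And>c v. v \<in> S \<Longrightarrow> \<iota> c \<odot>\<^bsub>M\<^esub> v \<in> S\<rbrakk> \<Longrightarrow> carrier M \<subseteq> S"
  shows "finite_dimensional \<iota> M"
proof -
  interpret left_module R M by fact
  define comb where "comb c = (\<Oplus>\<^bsub>M\<^esub>b\<in>B. \<iota> (c b) \<odot>\<^bsub>M\<^esub> b)" for c
  define S where "S = range comb"
  have cl: "\<iota> c \<odot>\<^bsub>M\<^esub> b \<in> carrier M" if "b \<in> B" for c b using that assms(3) \<iota>(1) smult_closed by auto
  have "carrier M \<subseteq> S"
  proof (rule closure)
    show "S \<subseteq> carrier M" unfolding S_def comb_def using cl by (auto intro!: M.finsum_closed)
    show "B \<subseteq> S"
    proof
      fix b0 assume b0: "b0 \<in> B"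
      have "comb (\<lambda>b. if b = b0 then 1 else 0) = (\<Oplus>\<^bsub>M\<^esub>b\<in>B. if b0 = b then b else \<zero>\<^bsub>M\<^esub>)"
        unfolding comb_def by (rule M.finsum_cong') (use assms(3) \<iota> in \<open>auto simp: smult_one subset_iff\<close>)
      also have "\<dots> = b0"
        by (rule M.finsum_singleton) (use b0 assms(2,3) in auto)
      finally show "b0 \<in> S" unfolding S_def by (metis rangeI)
    qed
    have "comb (\<lambda>_. 0) = \<zero>\<^bsub>M\<^esub>" unfolding comb_def
      by (rule M.add.finprod_one_eqI) (use assms(3) \<iota> in \<open>auto simp: subset_iff\<close>) 
    then show "\<zero>\<^bsub>M\<^esub> \<in> S" unfolding S_def by (metis rangeI)
  next
    fix u v assume "u \<in> S" "v \<in> S"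
    then obtain c d where uv: "u = comb c" "v = comb d" by (auto simp: S_def)
    have "comb (\<lambda>b. c b + d b) = (\<Oplus>\<^bsub>M\<^esub>b\<in>B. \<iota> (c b) \<odot>\<^bsub>M\<^esub> b \<oplus>\<^bsub>M\<^esub> \<iota> (d b) \<odot>\<^bsub>M\<^esub> b)"
      unfolding comb_def
      by (rule M.finsum_cong') (use assms(3) \<iota> cl in \<open>auto simp: smult_l_distr subset_iff\<close>)
    also have "\<dots> = u \<oplus>\<^bsub>M\<^esub> v" unfolding uv comb_def using cl by (intro M.finsum_addf) auto
    finally show "u \<oplus>\<^bsub>M\<^esub> v \<in> S" unfolding S_def by (metis rangeI)
  next
    fix e v assume "v \<in> S"
    then obtain c where v: "v = comb c" by (auto simp: S_def)
    have "comb (\<lambda>b. e * c b) = (\<Oplus>\<^bsub>M\<^esub>b\<in>B. \<iota> e \<odot>\<^bsub>M\<^esub> (\<iota> (c b) \<odot>\<^bsub>M\<^esub> b))"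
      unfolding comb_def
      by (rule M.finsum_cong') (use assms(3) \<iota> cl in \<open>auto simp: smult_assoc smult_closed subset_iff\<close>)
    also have "\<dots> = \<iota> e \<odot>\<^bsub>M\<^esub> v"
      unfolding v comb_def using cl assms(2) \<iota> by (intro smult_finsum[symmetric]) auto
    finally show "\<iota> e \<odot>\<^bsub>M\<^esub> v \<in> S" unfolding S_def by (metis rangeI)
  qed
  then have "\<exists>c. v = comb c" if "v \<in> carrier M" for v using that by (auto simp: S_def)
  then show ?thesis unfolding finite_dimensional_def comb_def using assms(2,3) by blast
qed

lemma finite_dimensional_transport:
  fixes \<iota> :: "'k::comm_ring_1 \<Rightarrow> 'r"
  assumes "left_module R M" "left_module R N" "linear_map R M N f" "f ` carrier M = carrier N"
    and \<iota>: "\<And>c. \<iota> c \<in> carrier R" "\<And>c d. \<iota> (c + d) = \<iota> c \<oplus>\<^bsub>R\<^esub> \<iota> d"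
      "\<And>c d. \<iota> (c * d) = \<iota> c \<otimes>\<^bsub>R\<^esub> \<iota> d" "\<iota> 0 = \<zero>\<^bsub>R\<^esub>" "\<iota> 1 = \<one>\<^bsub>R\<^esub>"
    and "finite_dimensional \<iota> M"
  shows "finite_dimensional \<iota> N"
proof -
  interpret M: left_module R M by fact
  interpret N: left_module R N by fact
  note f = linear_mapD[OF assms(3)]
  obtain B where B: "finite B" "B \<subseteq> carrier M" "\<And>v. v \<in> carrier M \<Longrightarrow> \<exists>c. v = (\<Oplus>\<^bsub>M\<^esub>b\<in>B. \<iota> (c b) \<odot>\<^bsub>M\<^esub> b)"
    using assms(10) by (auto simp: finite_dimensional_def)
  show ?thesis
  proof (rule finite_dimensionalI[OF assms(2) _ _ \<iota>])
    fix S assume S: "S \<subseteq> carrier N" "f ` B \<subseteq> S" "\<zero>\<^bsub>N\<^esub> \<in> S" "\<And>u v. \<lbrakk>u \<in> S; v \<in> S\<rbrakk> \<Longrightarrow> u \<oplus>\<^bsub>N\<^esub> v \<in> S"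
      "\<And>c v. v \<in> S \<Longrightarrow> \<iota> c \<odot>\<^bsub>N\<^esub> v \<in> S"
    have im: "f (\<Oplus>\<^bsub>M\<^esub>b\<in>A. \<iota> (c b) \<odot>\<^bsub>M\<^esub> b) \<in> S" if "A \<subseteq> B" for c A
      using finite_subset[OF that B(1)] that
    proof (induction A rule: finite_induct)
      case empty then show ?case using linear_map_zero[OF assms(1-3)] S by simp
    next
      case (insert b F)
      have c: "\<iota> (c e) \<odot>\<^bsub>M\<^esub> e \<in> carrier M" if "e \<in> insert b F" for e
        using that insert(4) B(2) \<iota>(1) M.smult_closed by auto
      have "f (\<iota> (c b) \<odot>\<^bsub>M\<^esub> b \<oplus>\<^bsub>M\<^esub> (\<Oplus>\<^bsub>M\<^esub>b\<in>F. \<iota> (c b) \<odot>\<^bsub>M\<^esub> b)) \<in> S"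
        using insert c S(2,4,5) \<iota>(1) B(2) f by (simp add: M.M.finsum_closed Pi_iff subset_iff)
      then show ?case using insert c by (subst M.M.finsum_insert) auto
    qed
    show "carrier N \<subseteq> S"
    proof
      fix w assume "w \<in> carrier N"
      then obtain v where "v \<in> carrier M" "w = f v" using assms(4) by auto
      then show "w \<in> S" using B(3) im[of B] by auto
    qed
  qed (use B f in auto)
qed

context left_module
begin

lemma diff_zeroD: "\<lbrakk>u \<in> carrier M; v \<in> carrier M; u \<ominus>\<^bsub>M\<^esub> v = \<zero>\<^bsub>M\<^esub>\<rbrakk> \<Longrightarrow> u = v"
  by (simp add: a_minus_def) (metis M.a_inv_closed M.minus_equality M.minus_minus)

lemma add_diff_cancel_left: "\<lbrakk>u \<in> carrier M; v \<in> carrier M\<rbrakk> \<Longrightarrow> (u \<oplus>\<^bsub>M\<^esub> v) \<ominus>\<^bsub>M\<^esub> u = v"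
  by (simp add: a_minus_def M.a_comm[of u v] M.a_assoc M.r_neg)

lemma coset_eq: "N +>\<^bsub>M\<^esub> v = {n \<oplus>\<^bsub>M\<^esub> v | n. n \<in> N}"
  by (auto simp: a_r_coset_def r_coset_def)

lemma coset_self: "\<lbrakk>submodule N R M; v \<in> carrier M\<rbrakk> \<Longrightarrow> v \<in> N +>\<^bsub>M\<^esub> v"
  using submoduleD(2)[of N] M.l_zero[of v] unfolding coset_eq by (metis (mono_tags, lifting) mem_Collect_eq)

lemma coset_eq_iff:
  assumes N: "submodule N R M" and uv: "u \<in> carrier M" "v \<in> carrier M"
  shows "N +>\<^bsub>M\<^esub> u = N +>\<^bsub>M\<^esub> v \<longleftrightarrow> u \<ominus>\<^bsub>M\<^esub> v \<in> N"
proof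
  note ND = submoduleD[OF N]
  assume "N +>\<^bsub>M\<^esub> u = N +>\<^bsub>M\<^esub> v"
  moreover have "u \<in> N +>\<^bsub>M\<^esub> u" using coset_self[OF N] uv by simp
  ultimately obtain n where n: "n \<in> N" "u = n \<oplus>\<^bsub>M\<^esub> v" by (auto simp: coset_eq)
  then have "u \<ominus>\<^bsub>M\<^esub> v = n" using ND(1) uv by (auto simp: a_minus_def M.a_assoc M.r_neg subset_iff)
  then show "u \<ominus>\<^bsub>M\<^esub> v \<in> N" using n by simp
next
  note ND = submoduleD[OF N]
  have sub: "N +>\<^bsub>M\<^esub> u \<subseteq> N +>\<^bsub>M\<^esub> v" if "u \<ominus>\<^bsub>M\<^esub> v \<in> N" "u \<in> carrier M" "v \<in> carrier M" for u v
  proof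
    fix w assume "w \<in> N +>\<^bsub>M\<^esub> u"
    then obtain n where n: "n \<in> N" "w = n \<oplus>\<^bsub>M\<^esub> u" by (auto simp: coset_eq)
    then have nc: "n \<in> carrier M" using ND(1) by auto
    have "u = (u \<ominus>\<^bsub>M\<^esub> v) \<oplus>\<^bsub>M\<^esub> v" using that by (simp add: a_minus_def M.a_assoc M.l_neg)
    then have "w = n \<oplus>\<^bsub>M\<^esub> ((u \<ominus>\<^bsub>M\<^esub> v) \<oplus>\<^bsub>M\<^esub> v)" using n by simp
    then have "w = (n \<oplus>\<^bsub>M\<^esub> (u \<ominus>\<^bsub>M\<^esub> v)) \<oplus>\<^bsub>M\<^esub> v" using nc that by (simp add: M.a_assoc)
    then show "w \<in> N +>\<^bsub>M\<^esub> v" using ND(3)[OF n(1) that(1)] by (auto simp: coset_eq)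
  qed
  assume *: "u \<ominus>\<^bsub>M\<^esub> v \<in> N"
  have "v \<ominus>\<^bsub>M\<^esub> u = \<ominus>\<^bsub>M\<^esub> (u \<ominus>\<^bsub>M\<^esub> v)" using uv by (simp add: a_minus_def M.minus_add M.a_comm)
  then have "v \<ominus>\<^bsub>M\<^esub> u \<in> N" using ND(5)[OF *] by simp
  then show "N +>\<^bsub>M\<^esub> u = N +>\<^bsub>M\<^esub> v" using sub * uv by blast
qed

lemma quotient_carrier: "carrier (quotient_module M N) = (\<lambda>v. N +>\<^bsub>M\<^esub> v) ` carrier M"
  by (auto simp: quotient_module_def A_RCOSETS_def RCOSETS_def a_r_coset_def)

lemma quotient_zero: "submodule N R M \<Longrightarrow> \<zero>\<^bsub>quotient_module M N\<^esub> = N +>\<^bsub>M\<^esub> \<zero>\<^bsub>M\<^esub>"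
  using submoduleD(1)[of N] M.r_zero by (force simp: quotient_module_def coset_eq subset_iff)

lemma quotient_add:
  assumes N: "submodule N R M" and uv: "u \<in> carrier M" "v \<in> carrier M"
  shows "(N +>\<^bsub>M\<^esub> u) \<oplus>\<^bsub>quotient_module M N\<^esub> (N +>\<^bsub>M\<^esub> v) = N +>\<^bsub>M\<^esub> (u \<oplus>\<^bsub>M\<^esub> v)"
proof -
  interpret abelian_subgroup N M
    by (rule abelian_subgroupI3)
       (use N in \<open>auto simp: additive_subgroup_def submodule_def M.abelian_group_axioms\<close>)
  show ?thesis using a_rcos_sum[OF uv] by (simp add: quotient_module_def)
qed

lemma quotient_smult:
  assumes N: "submodule N R M" and r: "r \<in> carrier R" "v \<in> carrier M"
  shows "r \<odot>\<^bsub>quotient_module M N\<^esub> (N +>\<^bsub>M\<^esub> v) = N +>\<^bsub>M\<^esub> (r \<odot>\<^bsub>M\<^esub> v)"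
proof -
  note ND = submoduleD[OF N]
  have "N +>\<^bsub>M\<^esub> (r \<odot>\<^bsub>M\<^esub> w) = N +>\<^bsub>M\<^esub> (r \<odot>\<^bsub>M\<^esub> v)" if w: "w \<in> N +>\<^bsub>M\<^esub> v" for w
  proof -
    obtain n where n: "n \<in> N" "w = n \<oplus>\<^bsub>M\<^esub> v" using w by (auto simp: coset_eq)
    then have nc: "n \<in> carrier M" using ND(1) by auto
    have "r \<odot>\<^bsub>M\<^esub> w \<ominus>\<^bsub>M\<^esub> r \<odot>\<^bsub>M\<^esub> v = r \<odot>\<^bsub>M\<^esub> n"
      using n nc r by (simp add: smult_r_distr a_minus_def M.a_assoc M.r_neg smult_closed)
    then show ?thesis using ND(4)[OF r(1) n(1)] n nc r N by (subst coset_eq_iff) (auto intro: smult_closed)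
  qed
  then have "(\<Union>w\<in>N +>\<^bsub>M\<^esub> v. N +>\<^bsub>M\<^esub> (r \<odot>\<^bsub>M\<^esub> w)) = (\<Union>w\<in>N +>\<^bsub>M\<^esub> v. N +>\<^bsub>M\<^esub> (r \<odot>\<^bsub>M\<^esub> v))"
    by (rule SUP_cong[OF refl])
  also have "\<dots> = N +>\<^bsub>M\<^esub> (r \<odot>\<^bsub>M\<^esub> v)" using coset_self[OF N r(2)] by auto
  finally show ?thesis by (simp add: quotient_module_def)
qed

lemma left_module_quotient:
  assumes N: "submodule N R M" shows "left_module R (quotient_module M N)"
proof -
  note q = quotient_carrier quotient_zero[OF N] quotient_add[OF N] quotient_smult[OF N]
  have "abelian_group (quotient_module M N)"
  proof (rule abelian_groupI, goal_cases)
    case (6 x)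
    then obtain v where "v \<in> carrier M" "x = N +>\<^bsub>M\<^esub> v" by (auto simp: q)
    then show ?case by (intro bexI[of _ "N +>\<^bsub>M\<^esub> (\<ominus>\<^bsub>M\<^esub> v)"]) (auto simp: q M.l_neg)
  qed (auto simp: q M.a_ac)
  then show ?thesis
    by (intro left_module.intro left_module_axioms.intro R.ring_axioms)
       (auto simp: q smult_l_distr smult_r_distr smult_assoc smult_one smult_closed)
qed

lemma linear_map_quotient: "submodule N R M \<Longrightarrow> linear_map R M (quotient_module M N) (\<lambda>v. N +>\<^bsub>M\<^esub> v)"
  by (auto simp: linear_map_def quotient_carrier quotient_add quotient_smult)

lemma quotient_eq_zero_iff:
  "\<lbrakk>submodule N R M; v \<in> carrier M\<rbrakk> \<Longrightarrow> N +>\<^bsub>M\<^esub> v = \<zero>\<^bsub>quotient_module M N\<^esub> \<longleftrightarrow> v \<in> N"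
proof -
  assume *: "submodule N R M" "v \<in> carrier M"
  have "\<ominus>\<^bsub>M\<^esub> \<zero>\<^bsub>M\<^esub> = \<zero>\<^bsub>M\<^esub>" by (rule M.minus_equality[OF M.r_zero[OF M.zero_closed] M.zero_closed M.zero_closed])
  then have "v \<ominus>\<^bsub>M\<^esub> \<zero>\<^bsub>M\<^esub> = v" unfolding a_minus_def using *(2) M.r_zero by metis
  then show ?thesis using * by (simp add: quotient_zero coset_eq_iff)
qed

lemma quotient_lift:
  assumes N: "submodule N R M" and P: "left_module R P" and f: "linear_map R M P f"
    and ker: "\<And>v. v \<in> N \<Longrightarrow> f v = \<zero>\<^bsub>P\<^esub>"
  obtains h where "linear_map R (quotient_module M N) P h" "\<And>v. v \<in> carrier M \<Longrightarrow> h (N +>\<^bsub>M\<^esub> v) = f v"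
proof -
  interpret P: left_module R P by fact
  note fD = linear_mapD[OF f]
  define h where "h C = f (SOME v. v \<in> carrier M \<and> C = N +>\<^bsub>M\<^esub> v)" for C
  have h: "h (N +>\<^bsub>M\<^esub> v) = f v" if v: "v \<in> carrier M" for v
  proof -
    define w where "w = (SOME w. w \<in> carrier M \<and> N +>\<^bsub>M\<^esub> v = N +>\<^bsub>M\<^esub> w)"
    have w: "w \<in> carrier M" "N +>\<^bsub>M\<^esub> v = N +>\<^bsub>M\<^esub> w"
      unfolding w_def using someI[of "\<lambda>w. w \<in> carrier M \<and> N +>\<^bsub>M\<^esub> v = N +>\<^bsub>M\<^esub> w" v] v by auto
    then have "f (v \<ominus>\<^bsub>M\<^esub> w) = \<zero>\<^bsub>P\<^esub>" using ker coset_eq_iff[OF N v w(1)] by simp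
    then have "f v \<ominus>\<^bsub>P\<^esub> f w = \<zero>\<^bsub>P\<^esub>" using linear_map_diff[OF left_module_axioms P f v w(1)] by simp
    then have "f v = f w" using P.diff_zeroD fD(1) v w by blast
    then show ?thesis by (simp add: h_def w_def)
  qed
  have "linear_map R (quotient_module M N) P h"
    using fD by (auto simp: linear_map_def quotient_carrier quotient_add[OF N] quotient_smult[OF N] h smult_closed)
  then show ?thesis using h that by blast
qed

lemma submodule_Union_chain:
  assumes "C \<noteq> {}" "\<And>N. N \<in> C \<Longrightarrow> submodule N R M" "\<And>N N'. \<lbrakk>N \<in> C; N' \<in> C\<rbrakk> \<Longrightarrow> N \<subseteq> N' \<or> N' \<subseteq> N"
  shows "submodule (\<Union>C) R M"
proof (rule submoduleI)
  show "\<Union>C \<subseteq> carrier M" using submoduleD(1)[OF assms(2)] by auto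
  show "\<zero>\<^bsub>M\<^esub> \<in> \<Union>C" using assms(1) submoduleD(2)[OF assms(2)] by auto
  fix u v assume "u \<in> \<Union>C" "v \<in> \<Union>C"
  then obtain N N' where "u \<in> N" "v \<in> N'" "N \<in> C" "N' \<in> C" by auto
  then have "\<exists>N\<in>C. u \<in> N \<and> v \<in> N" using assms(3)[of N N'] by auto
  then show "u \<oplus>\<^bsub>M\<^esub> v \<in> \<Union>C" using submoduleD(3)[OF assms(2)] by auto
next
  fix r v assume "r \<in> carrier R" "v \<in> \<Union>C"
  then show "r \<odot>\<^bsub>M\<^esub> v \<in> \<Union>C" using submoduleD(4)[OF assms(2)] by auto
qed

lemma submodule_trans:
  assumes "submodule N R M" "submodule N' R (M\<lparr>carrier := N\<rparr>)"
  shows "submodule N' R M"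
proof -
  interpret N: left_module R "M\<lparr>carrier := N\<rparr>" by (rule left_module_submodule[OF assms(1)])
  show ?thesis
    by (rule submoduleI) (use N.submoduleD[OF assms(2)] submoduleD(1)[OF assms(1)] in auto)
qed

lemma internal_direct_sumD:
  assumes "internal_direct_sum R M N K"
  shows "submodule N R M" "submodule K R M" "N \<inter> K = {\<zero>\<^bsub>M\<^esub>}"
    and "v \<in> carrier M \<Longrightarrow> \<exists>n\<in>N. \<exists>k\<in>K. v = n \<oplus>\<^bsub>M\<^esub> k"
proof -
  show "submodule N R M" "submodule K R M" "N \<inter> K = {\<zero>\<^bsub>M\<^esub>}"
    using assms by (auto simp: internal_direct_sum_def)
  assume "v \<in> carrier M"
  then have "v \<in> N <+>\<^bsub>M\<^esub> K" using assms by (simp add: internal_direct_sum_def)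
  then show "\<exists>n\<in>N. \<exists>k\<in>K. v = n \<oplus>\<^bsub>M\<^esub> k" by (metis set_addE)
qed

end

section \<open>Modules over a semisimple ring\<close>

text \<open>
  Let \<open>K\<close> be maximal among the submodules that meet \<open>U\<close> trivially. An element \<open>v\<close> outside
  \<open>U + K\<close> has an annihilator modulo \<open>U + K\<close>, a left ideal \<open>L\<close> of \<open>R\<close>; if \<open>R = L \<oplus> L'\<close>, then
  \<open>L' v\<close> can be added to \<open>K\<close>, against maximality.
\<close>

lemma semisimple_ring_complement:
  assumes R: "semisimple_ring R" and M: "left_module R M" and U: "submodule U R M"
  obtains K where "internal_direct_sum R M U K"
proof -
  interpret left_module R M by fact
  note UD = submoduleD[OF U]
  define A where "A = {K. submodule K R M \<and> U \<inter> K = {\<zero>\<^bsub>M\<^esub>}}"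
  have "{\<zero>\<^bsub>M\<^esub>} \<in> A" using submodule_zero UD(2) by (auto simp: A_def)
  moreover have "(\<Union>C) \<in> A" if C: "C \<noteq> {}" "subset.chain A C" for C
  proof -
    have sub: "N \<in> C \<Longrightarrow> submodule N R M" and i: "N \<in> C \<Longrightarrow> U \<inter> N = {\<zero>\<^bsub>M\<^esub>}" for N
      using C(2) by (auto simp: subset_chain_def A_def)
    have "submodule (\<Union>C) R M"
      by (rule submodule_Union_chain) (use C sub in \<open>auto simp: subset_chain_def\<close>)
    moreover have "U \<inter> (\<Union>C) = {\<zero>\<^bsub>M\<^esub>}" using i C(1) by blast
    ultimately show ?thesis by (simp add: A_def)
  qed
  ultimately obtain K where "K \<in> A" and maxi: "\<And>Y. \<lbrakk>Y \<in> A; K \<subseteq> Y\<rbrakk> \<Longrightarrow> Y = K"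
    using subset_Zorn_nonempty[of A] by blast
  then have K: "submodule K R M" and UK: "U \<inter> K = {\<zero>\<^bsub>M\<^esub>}" by (auto simp: A_def)
  note KD = submoduleD[OF K]
  let ?S = "U <+>\<^bsub>M\<^esub> K"
  have S: "submodule ?S R M" by (rule submodule_set_add[OF U K])
  note SD = submoduleD[OF S]
  have "?S = carrier M"
  proof (rule ccontr)
    assume "?S \<noteq> carrier M"
    then obtain v where v: "v \<in> carrier M" "v \<notin> ?S" using SD(1) by auto
    have RM: "left_module R (regular_module R)"
      using R by (simp add: semisimple_ring_def semisimple_module_def)
    interpret RM: left_module R "regular_module R" by fact
    have rm: "linear_map R (regular_module R) M (\<lambda>r. r \<odot>\<^bsub>M\<^esub> v)"
      using v by (auto simp: linear_map_def regular_module_def smult_closed smult_l_distr smult_assoc)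
    define L where "L = {r \<in> carrier (regular_module R). r \<odot>\<^bsub>M\<^esub> v \<in> ?S}"
    have "submodule L R (regular_module R)"
      unfolding L_def by (rule submodule_preimage[OF RM M rm S])
    then obtain L' where LL: "internal_direct_sum R (regular_module R) L L'"
      using R by (auto simp: semisimple_ring_def semisimple_module_def)
    note LD = RM.internal_direct_sumD[OF LL]
    define D where "D = (\<lambda>r. r \<odot>\<^bsub>M\<^esub> v) ` L'"
    have D: "submodule D R M" unfolding D_def by (rule submodule_image[OF RM M rm LD(2)])
    note DD = submoduleD[OF D]
    have L'c: "L' \<subseteq> carrier R" using RM.submoduleD(1)[OF LD(2)] by (simp add: regular_module_def)
    have DS: "d = \<zero>\<^bsub>M\<^esub>" if d: "d \<in> D" "d \<in> ?S" for d
    proof -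
      obtain r where r: "r \<in> L'" "d = r \<odot>\<^bsub>M\<^esub> v" using d(1) unfolding D_def by blast
      then have "r \<in> L" using d L'c by (auto simp: L_def regular_module_def)
      then have "r = \<zero>\<^bsub>R\<^esub>" using r LD(3) by (auto simp: regular_module_def)
      then show ?thesis using r v by simp
    qed
    have US: "U \<subseteq> ?S" and KS: "K \<subseteq> ?S" using set_add_left[OF U K] set_add_right[OF U K] by auto
    have "U \<inter> (K <+>\<^bsub>M\<^esub> D) \<subseteq> {\<zero>\<^bsub>M\<^esub>}"
    proof safe
      fix u assume u: "u \<in> U" "u \<in> K <+>\<^bsub>M\<^esub> D"
      then obtain k d where kd: "u = k \<oplus>\<^bsub>M\<^esub> d" "k \<in> K" "d \<in> D" by (elim set_addE)
      then have c: "k \<in> carrier M" "d \<in> carrier M" using KD DD by auto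
      then have "d = u \<ominus>\<^bsub>M\<^esub> k" using kd by (simp add: add_diff_cancel_left)
      moreover have "u \<ominus>\<^bsub>M\<^esub> k \<in> ?S" using SD(6) US KS u kd by blast
      ultimately have "d \<in> ?S" by simp
      then have "d = \<zero>\<^bsub>M\<^esub>" using DS kd by auto
      then have "u = k" using kd c by simp
      then show "u = \<zero>\<^bsub>M\<^esub>" using UK u kd by auto
    qed
    then have "K <+>\<^bsub>M\<^esub> D \<in> A"
      using submoduleD(2)[OF submodule_set_add[OF K D]] UD(2) submodule_set_add[OF K D] by (auto simp: A_def)
    then have "K <+>\<^bsub>M\<^esub> D = K" using maxi set_add_left[OF K D] by auto
    then have DK: "D \<subseteq> ?S" using set_add_right[OF K D] KS by auto
    have "\<one>\<^bsub>R\<^esub> \<in> carrier (regular_module R)" by (simp add: regular_module_def)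
    then obtain l l' where l: "l \<in> L" "l' \<in> L'" "\<one>\<^bsub>R\<^esub> = l \<oplus>\<^bsub>R\<^esub> l'"
      using LD(4)[of "\<one>\<^bsub>R\<^esub>"] unfolding regular_module_def by auto
    then have lc: "l \<in> carrier R" "l' \<in> carrier R" using L'c by (auto simp: L_def regular_module_def)
    have "v = l \<odot>\<^bsub>M\<^esub> v \<oplus>\<^bsub>M\<^esub> l' \<odot>\<^bsub>M\<^esub> v"
      using l lc v smult_l_distr smult_one by metis
    moreover have "l' \<odot>\<^bsub>M\<^esub> v \<in> ?S" using l DK by (auto simp: D_def)
    moreover have "l \<odot>\<^bsub>M\<^esub> v \<in> ?S" using l by (auto simp: L_def)
    ultimately show False using SD(3) v by metis
  qed
  then have "internal_direct_sum R M U K" using U K UK by (simp add: internal_direct_sum_def)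
  then show ?thesis by (rule that)
qed

text \<open>
  If \<open>K \<supseteq> P\<close> is maximal among the submodules without \<open>v\<close>, then every submodule properly containing
  \<open>K\<close> contains \<open>v\<close>; hence a complement \<open>W\<close> of \<open>K\<close> has no two independent nonzero submodules.
\<close>

lemma semisimple_ring_simple_submodule:
  assumes R: "semisimple_ring R" and M: "left_module R M" and P: "submodule P R M"
    and v: "v \<in> carrier M" "v \<notin> P"
  obtains W where "submodule W R M" "simple_module R (M\<lparr>carrier := W\<rparr>)" "W \<inter> P = {\<zero>\<^bsub>M\<^esub>}"
proof -
  interpret left_module R M by fact
  define A where "A = {K. submodule K R M \<and> P \<subseteq> K \<and> v \<notin> K}"
  have "P \<in> A" using P v by (auto simp: A_def)
  moreover have "(\<Union>C) \<in> A" if C: "C \<noteq> {}" "subset.chain A C" for C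
  proof -
    have sub: "N \<in> C \<Longrightarrow> submodule N R M" and i: "N \<in> C \<Longrightarrow> P \<subseteq> N \<and> v \<notin> N" for N
      using C(2) by (auto simp: subset_chain_def A_def)
    have "submodule (\<Union>C) R M"
      by (rule submodule_Union_chain) (use C sub in \<open>auto simp: subset_chain_def\<close>)
    then show ?thesis using i C(1) by (auto simp: A_def)
  qed
  ultimately obtain K where "K \<in> A" and maxi: "\<And>Y. \<lbrakk>Y \<in> A; K \<subseteq> Y\<rbrakk> \<Longrightarrow> Y = K"
    using subset_Zorn_nonempty[of A] by blast
  then have K: "submodule K R M" and PK: "P \<subseteq> K" and vK: "v \<notin> K" by (auto simp: A_def)
  note KD = submoduleD[OF K]
  obtain W where KW: "internal_direct_sum R M K W" by (rule semisimple_ring_complement[OF R M K])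
  note KWD = internal_direct_sumD[OF KW]
  note W = KWD(2) and WD = submoduleD[OF KWD(2)]
  have big: "v \<in> K <+>\<^bsub>M\<^esub> Y" if Y: "submodule Y R M" "Y \<subseteq> W" "Y \<noteq> {\<zero>\<^bsub>M\<^esub>}" for Y
  proof (rule ccontr)
    assume "v \<notin> K <+>\<^bsub>M\<^esub> Y"
    then have "K <+>\<^bsub>M\<^esub> Y \<in> A"
      using submodule_set_add[OF K Y(1)] set_add_left[OF K Y(1)] PK by (auto simp: A_def)
    then have "K <+>\<^bsub>M\<^esub> Y = K" using maxi set_add_left[OF K Y(1)] by auto
    then have "Y \<subseteq> K \<inter> W" using set_add_right[OF K Y(1)] Y by auto
    then show False using Y(3) KWD(3) submoduleD(2)[OF Y(1)] by auto
  qed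
  have "simple_module R (M\<lparr>carrier := W\<rparr>)"
    unfolding simple_module_def
  proof (intro conjI allI impI)
    show "left_module R (M\<lparr>carrier := W\<rparr>)" by (rule left_module_submodule[OF W])
    have "W \<noteq> {\<zero>\<^bsub>M\<^esub>}" using KWD(4)[OF v(1)] vK KD(1) by auto
    then show "carrier (M\<lparr>carrier := W\<rparr>) \<noteq> {\<zero>\<^bsub>M\<lparr>carrier := W\<rparr>\<^esub>}" by simp
    fix N assume N': "submodule N R (M\<lparr>carrier := W\<rparr>)"
    have N: "submodule N R M" by (rule submodule_trans[OF W N'])
    have NW: "N \<subseteq> W" using left_module.submoduleD(1)[OF left_module_submodule[OF W] N'] by simp
    obtain Y where NY: "internal_direct_sum R M N Y" by (rule semisimple_ring_complement[OF R M N])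
    note NYD = internal_direct_sumD[OF NY]
    have "N = W" if ne: "N \<noteq> {\<zero>\<^bsub>M\<^esub>}"
    proof (cases "W \<inter> Y = {\<zero>\<^bsub>M\<^esub>}")
      case True
      have "w \<in> N" if w: "w \<in> W" for w
      proof -
        obtain n x where nx: "n \<in> N" "x \<in> Y" "w = n \<oplus>\<^bsub>M\<^esub> x" using NYD(4)[of w] w WD(1) by auto
        then have c: "n \<in> carrier M" "x \<in> carrier M" using submoduleD(1)[OF N] submoduleD(1)[OF NYD(2)] by auto
        then have "x = w \<ominus>\<^bsub>M\<^esub> n" using nx by (simp add: add_diff_cancel_left)
        moreover have "w \<ominus>\<^bsub>M\<^esub> n \<in> W" using WD(6) w nx NW by blast
        ultimately have "x \<in> W \<inter> Y" using nx by simp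
        then show ?thesis using True nx c by auto
      qed
      then show ?thesis using NW by auto
    next
      case False
      then have "v \<in> K <+>\<^bsub>M\<^esub> (W \<inter> Y)" using big[OF submodule_Int[OF W NYD(2)]] by auto
      then obtain k x where kx: "v = k \<oplus>\<^bsub>M\<^esub> x" "k \<in> K" "x \<in> W" "x \<in> Y" by (elim set_addE) auto
      from big[OF N NW ne] obtain k' n where kn: "v = k' \<oplus>\<^bsub>M\<^esub> n" "k' \<in> K" "n \<in> N" by (elim set_addE) auto
      have c: "k \<in> carrier M" "x \<in> carrier M" "k' \<in> carrier M" "n \<in> carrier M"
        using kx kn KD(1) WD(1) NW by auto
      have "k \<ominus>\<^bsub>M\<^esub> k' = n \<ominus>\<^bsub>M\<^esub> x"
      proof -
        have "k = v \<ominus>\<^bsub>M\<^esub> x" using kx c by (simp add: a_minus_def M.a_assoc M.r_neg)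
        also have "\<dots> = k' \<oplus>\<^bsub>M\<^esub> (n \<ominus>\<^bsub>M\<^esub> x)" using kn c by (simp add: a_minus_def M.a_assoc)
        finally show ?thesis using c by (simp add: add_diff_cancel_left)
      qed
      then have "n \<ominus>\<^bsub>M\<^esub> x \<in> K \<inter> W" using KD(6)[OF kx(2) kn(2)] WD(6)[of n x] kx kn NW by auto
      then have "n = x" using KWD(3) c diff_zeroD by auto
      then have "n = \<zero>\<^bsub>M\<^esub>" using NYD(3) kn kx by auto
      then have "v = k'" using kn c by simp
      then show ?thesis using vK kn by simp
    qed
    then show "N = {\<zero>\<^bsub>M\<lparr>carrier := W\<rparr>\<^esub>} \<or> N = carrier (M\<lparr>carrier := W\<rparr>)" by auto
  qed
  moreover have "W \<inter> P = {\<zero>\<^bsub>M\<^esub>}" using KWD(3) PK submoduleD(2)[OF P] WD(2) by auto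
  ultimately show ?thesis using that W by blast
qed

section \<open>Tensor products\<close>

text \<open>
  The actions are plain functions, because the tensor products to be treated, \<open>H \<otimes> V\<close> over \<open>kG\<close> and
  \<open>V\<^sub>\<chi> \<otimes> V\<close> over \<open>k\<close>, have right actions that are not part of a module structure.
\<close>

locale tensor_data =
  fixes R :: "('r, 'x) ring_scheme" and M :: "('a, 'y) ring_scheme" and ra :: "'a \<Rightarrow> 'r \<Rightarrow> 'a"
    and N :: "('b, 'z) ring_scheme" and la :: "'r \<Rightarrow> 'b \<Rightarrow> 'b"
  assumes group_M: "abelian_group M" and group_N: "abelian_group N"
    and ra_closed: "\<lbrakk>m \<in> carrier M; r \<in> carrier R\<rbrakk> \<Longrightarrow> ra m r \<in> carrier M"
    and la_closed: "\<lbrakk>r \<in> carrier R; n \<in> carrier N\<rbrakk> \<Longrightarrow> la r n \<in> carrier N"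
begin

abbreviation "F \<equiv> free_Abelian_group (carrier M \<times> carrier N)"
abbreviation "Z \<equiv> tensor_null R M ra N la"
abbreviation "T \<equiv> tensor_product R M ra N la"

definition pure :: "'a \<Rightarrow> 'b \<Rightarrow> ('a \<times> 'b \<Rightarrow>\<^sub>0 int) set"
  where "pure m n = tensor_class R M ra N la (frag_of (m, n))"

definition balanced :: "('c, 'u) monoid_scheme \<Rightarrow> ('a \<Rightarrow> 'b \<Rightarrow> 'c) \<Rightarrow> bool"
  where "balanced A \<phi> \<longleftrightarrow>
    (\<forall>m\<in>carrier M. \<forall>n\<in>carrier N. \<phi> m n \<in> carrier A) \<and>
    (\<forall>m\<in>carrier M. \<forall>m'\<in>carrier M. \<forall>n\<in>carrier N. \<phi> (m \<oplus>\<^bsub>M\<^esub> m') n = \<phi> m n \<otimes>\<^bsub>A\<^esub> \<phi> m' n) \<and>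
    (\<forall>m\<in>carrier M. \<forall>n\<in>carrier N. \<forall>n'\<in>carrier N. \<phi> m (n \<oplus>\<^bsub>N\<^esub> n') = \<phi> m n \<otimes>\<^bsub>A\<^esub> \<phi> m n') \<and>
    (\<forall>m\<in>carrier M. \<forall>r\<in>carrier R. \<forall>n\<in>carrier N. \<phi> (ra m r) n = \<phi> m (la r n))"

interpretation M: abelian_group M by (rule group_M)
interpretation N: abelian_group N by (rule group_N)
interpretation F: comm_group F by (rule abelian_free_Abelian_group)

lemma relators_closed: "tensor_relators R M ra N la \<subseteq> carrier F"
proof -
  have 3: "frag_of p - frag_of p' - frag_of p'' \<in> carrier F"
    if "p \<in> carrier M \<times> carrier N" "p' \<in> carrier M \<times> carrier N" "p'' \<in> carrier M \<times> carrier N" for p p' p''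
  proof -
    have "Poly_Mapping.keys (frag_of p - frag_of p' - frag_of p'') \<subseteq> {p, p', p''}"
      using keys_diff[of "frag_of p - frag_of p'" "frag_of p''"] keys_diff[of "frag_of p" "frag_of p'"]
      by (auto simp: keys_frag_of)
    then show ?thesis using that by auto
  qed
  have 2: "frag_of p - frag_of p' \<in> carrier F"
    if "p \<in> carrier M \<times> carrier N" "p' \<in> carrier M \<times> carrier N" for p p'
    using that keys_diff[of "frag_of p" "frag_of p'"] by (auto simp: keys_frag_of)
  show ?thesis unfolding tensor_relators_def
    by (intro Un_least subsetI; elim CollectE exE conjE; hypsubst; intro 3 2)
       (simp_all add: ra_closed la_closed)
qed

lemma null_subgroup: "subgroup Z F"
  unfolding tensor_null_def by (rule F.generate_is_subgroup[OF relators_closed])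

lemma null_normal: "Z \<lhd> F"
  using null_subgroup by (simp add: F.normal_iff_subgroup)

lemma comm_group_tensor: "comm_group T"
  unfolding tensor_product_def by (rule F.abelian_FactGroup[OF null_subgroup])

interpretation T: comm_group T by (rule comm_group_tensor)

lemma tensor_carrier: "carrier T = tensor_class R M ra N la ` carrier F"
  by (simp add: tensor_product_def carrier_FactGroup tensor_class_def[abs_def])

lemma class_closed: "c \<in> carrier F \<Longrightarrow> tensor_class R M ra N la c \<in> carrier T"
  by (simp add: tensor_carrier)

lemma class_add: "\<lbrakk>c \<in> carrier F; d \<in> carrier F\<rbrakk> \<Longrightarrow>
  tensor_class R M ra N la (c + d) = tensor_class R M ra N la c \<otimes>\<^bsub>T\<^esub> tensor_class R M ra N la d"
  using normal.rcos_sum[OF null_normal, of c d] by (simp add: tensor_product_def tensor_class_def)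

lemma class_hom: "tensor_class R M ra N la \<in> hom F T"
  unfolding hom_def using class_closed class_add by simp

interpretation cl: group_hom F T "tensor_class R M ra N la"
  using class_hom by (simp add: group_hom_def group_hom_axioms_def F.is_group T.is_group)

lemma class_one: "c \<in> Z \<Longrightarrow> tensor_class R M ra N la c = \<one>\<^bsub>T\<^esub>"
  using subgroup.rcos_const[OF null_subgroup F.is_group] by (simp add: tensor_class_def tensor_product_def)

lemma class_zero: "tensor_class R M ra N la 0 = \<one>\<^bsub>T\<^esub>"
  using cl.hom_one by simp

lemma class_diff: "\<lbrakk>c \<in> carrier F; d \<in> carrier F\<rbrakk> \<Longrightarrow>
  tensor_class R M ra N la (c - d) = tensor_class R M ra N la c \<otimes>\<^bsub>T\<^esub> inv\<^bsub>T\<^esub> tensor_class R M ra N la d"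
  using cl.hom_mult[of c "inv\<^bsub>F\<^esub> d"] cl.hom_inv[of d] by simp

lemma class_relator: "c \<in> tensor_relators R M ra N la \<Longrightarrow> tensor_class R M ra N la c = \<one>\<^bsub>T\<^esub>"
  unfolding tensor_null_def[symmetric] by (rule class_one) (simp add: tensor_null_def generate.incl)

lemma pure_closed [simp]: "\<lbrakk>m \<in> carrier M; n \<in> carrier N\<rbrakk> \<Longrightarrow> pure m n \<in> carrier T"
  unfolding pure_def by (rule class_closed) simp

lemma class_diff3:
  assumes "p \<in> carrier M \<times> carrier N" "p' \<in> carrier M \<times> carrier N" "p'' \<in> carrier M \<times> carrier N"
    and r: "frag_of p - frag_of p' - frag_of p'' \<in> tensor_relators R M ra N la"
  shows "tensor_class R M ra N la (frag_of p) =
    tensor_class R M ra N la (frag_of p') \<otimes>\<^bsub>T\<^esub> tensor_class R M ra N la (frag_of p'')"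
proof -
  let ?c = "tensor_class R M ra N la"
  have F: "frag_of p \<in> carrier F" "frag_of p' \<in> carrier F" "frag_of p'' \<in> carrier F" using assms by auto
  have "frag_of p = (frag_of p - frag_of p' - frag_of p'') + (frag_of p' + frag_of p'')" by simp
  then have "?c (frag_of p) = ?c (frag_of p - frag_of p' - frag_of p'') \<otimes>\<^bsub>T\<^esub> ?c (frag_of p' + frag_of p'')"
    using class_add[of "frag_of p - frag_of p' - frag_of p''" "frag_of p' + frag_of p''"] F
      relators_closed r F.m_closed[of "frag_of p'" "frag_of p''"] by auto
  also have "\<dots> = ?c (frag_of p') \<otimes>\<^bsub>T\<^esub> ?c (frag_of p'')"
    unfolding class_relator[OF r] class_add[OF F(2,3)] by (intro T.l_one T.m_closed class_closed F)
  finally show ?thesis .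
qed

lemma pure_add_left:
  "\<lbrakk>m \<in> carrier M; m' \<in> carrier M; n \<in> carrier N\<rbrakk> \<Longrightarrow> pure (m \<oplus>\<^bsub>M\<^esub> m') n = pure m n \<otimes>\<^bsub>T\<^esub> pure m' n"
  unfolding pure_def by (rule class_diff3) (auto simp: tensor_relators_def)

lemma pure_add_right:
  "\<lbrakk>m \<in> carrier M; n \<in> carrier N; n' \<in> carrier N\<rbrakk> \<Longrightarrow> pure m (n \<oplus>\<^bsub>N\<^esub> n') = pure m n \<otimes>\<^bsub>T\<^esub> pure m n'"
  unfolding pure_def by (rule class_diff3) (auto simp: tensor_relators_def)

lemma pure_assoc:
  assumes "m \<in> carrier M" "r \<in> carrier R" "n \<in> carrier N"
  shows "pure (ra m r) n = pure m (la r n)"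
proof -
  have "frag_of (ra m r, n) - frag_of (m, la r n) \<in> tensor_relators R M ra N la"
    using assms by (auto simp: tensor_relators_def)
  from class_relator[OF this] have "pure (ra m r) n \<otimes>\<^bsub>T\<^esub> inv\<^bsub>T\<^esub> pure m (la r n) = \<one>\<^bsub>T\<^esub>"
    using assms by (subst (asm) class_diff) (auto simp: pure_def ra_closed la_closed)
  then show ?thesis using assms by (simp add: ra_closed la_closed T.inv_solve_right')
qed

lemma pure_zero_left: "n \<in> carrier N \<Longrightarrow> pure \<zero>\<^bsub>M\<^esub> n = \<one>\<^bsub>T\<^esub>"
  using pure_add_left[of "\<zero>\<^bsub>M\<^esub>" "\<zero>\<^bsub>M\<^esub>" n] by (simp add: T.l_cancel_one')

lemma pure_inv: "\<lbrakk>m \<in> carrier M; n \<in> carrier N\<rbrakk> \<Longrightarrow> inv\<^bsub>T\<^esub> pure m n = pure (\<ominus>\<^bsub>M\<^esub> m) n"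
  using pure_add_left[of "\<ominus>\<^bsub>M\<^esub> m" m n] pure_zero_left[of n]
  by (intro T.inv_equality) (simp_all add: M.l_neg)

text \<open>
  Pure tensors generate additively, negatives included, because \<open>- (m \<otimes> n) = (- m) \<otimes> n\<close>. The
  induction over differences in the free group has to carry the inverse along.
\<close>

lemma tensor_induct [consumes 1, case_names pure mult]:
  assumes C: "C \<in> carrier T"
    and pure: "\<And>m n. \<lbrakk>m \<in> carrier M; n \<in> carrier N\<rbrakk> \<Longrightarrow> P (pure m n)"
    and mult: "\<And>x y. \<lbrakk>x \<in> carrier T; y \<in> carrier T; P x; P y\<rbrakk> \<Longrightarrow> P (x \<otimes>\<^bsub>T\<^esub> y)"
  shows "P C"
proof -
  obtain c where c: "c \<in> carrier F" "C = tensor_class R M ra N la c" using C by (auto simp: tensor_carrier)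
  have one: "P \<one>\<^bsub>T\<^esub>" using pure[of "\<zero>\<^bsub>M\<^esub>" "\<zero>\<^bsub>N\<^esub>"] pure_zero_left by simp
  have "P (tensor_class R M ra N la c) \<and> P (inv\<^bsub>T\<^esub> tensor_class R M ra N la c)"
    using c(1) unfolding carrier_free_Abelian_group_iff
  proof (induction c rule: free_Abelian_group_induct[consumes 1, case_names zero diff of])
    case zero then show ?case using one cl.hom_one by simp
  next
    case (diff x y)
    then have cl: "tensor_class R M ra N la x \<in> carrier T" "tensor_class R M ra N la y \<in> carrier T"
      by (simp_all add: class_closed)
    have "inv\<^bsub>T\<^esub> tensor_class R M ra N la (x - y) = tensor_class R M ra N la y \<otimes>\<^bsub>T\<^esub> inv\<^bsub>T\<^esub> tensor_class R M ra N la x"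
      using diff cl by (simp add: class_diff T.inv_mult T.m_comm)
    then show ?case using diff cl by (simp add: class_diff mult)
  next
    case (of p)
    then obtain m n where "p = (m, n)" "m \<in> carrier M" "n \<in> carrier N" by auto
    then show ?case using pure[of m n] pure[of "\<ominus>\<^bsub>M\<^esub> m" n] by (simp add: pure_inv flip: pure_def)
  qed
  then show ?thesis using c by simp
qed

text \<open>
  The extension of a balanced map to the free abelian group on the pairs kills every relator, hence
  the subgroup that the relators generate.
\<close>

lemma tensor_universal:
  assumes A: "comm_group A" and \<phi>: "balanced A \<phi>"
  obtains h where "h \<in> hom T A" "\<And>m n. \<lbrakk>m \<in> carrier M; n \<in> carrier N\<rbrakk> \<Longrightarrow> h (pure m n) = \<phi> m n"
proof -
  interpret A: comm_group A by fact
  have \<phi>c: "\<lbrakk>m \<in> carrier M; n \<in> carrier N\<rbrakk> \<Longrightarrow> \<phi> m n \<in> carrier A" for m n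
    using \<phi> by (auto simp: balanced_def)
  obtain h0 where h0: "h0 \<in> hom F A" "\<And>p. p \<in> carrier M \<times> carrier N \<Longrightarrow> h0 (frag_of p) = (\<lambda>(m, n). \<phi> m n) p"
    by (rule A.free_Abelian_group_universal[of "\<lambda>(m, n). \<phi> m n" "carrier M \<times> carrier N"]) (use \<phi>c in auto)
  interpret h0: group_hom F A h0
    using h0 by (simp add: group_hom_def group_hom_axioms_def F.is_group A.is_group)
  have diff: "h0 (c - d) = h0 c \<otimes>\<^bsub>A\<^esub> inv\<^bsub>A\<^esub> h0 d" if "c \<in> carrier F" "d \<in> carrier F" for c d
    using that h0.hom_mult[of c "inv\<^bsub>F\<^esub> d"] h0.hom_inv[of d] by simp
  have dF: "c - d \<in> carrier F" if "c \<in> carrier F" "d \<in> carrier F" for c d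
    using that F.m_closed[of c "inv\<^bsub>F\<^esub> d"] F.inv_closed[of d] by simp
  have fF: "frag_of (m, n) \<in> carrier F" if "m \<in> carrier M" "n \<in> carrier N" for m n using that by simp
  have h0f: "h0 (frag_of (m, n)) = \<phi> m n" if "m \<in> carrier M" "n \<in> carrier N" for m n using that h0(2) by simp
  have comm: "x \<otimes>\<^bsub>A\<^esub> y \<otimes>\<^bsub>A\<^esub> inv\<^bsub>A\<^esub> x \<otimes>\<^bsub>A\<^esub> inv\<^bsub>A\<^esub> y = \<one>\<^bsub>A\<^esub>" if "x \<in> carrier A" "y \<in> carrier A" for x y
  proof -
    have "x \<otimes>\<^bsub>A\<^esub> y \<otimes>\<^bsub>A\<^esub> inv\<^bsub>A\<^esub> x = y" using that by (simp add: A.m_comm[of x y] A.m_assoc)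
    then show ?thesis using that by simp
  qed
  have "h0 c = \<one>\<^bsub>A\<^esub>" if "c \<in> tensor_relators R M ra N la" for c
    using that unfolding tensor_relators_def
  proof (elim UnE CollectE exE conjE)
    fix m m' n assume *: "c = frag_of (m \<oplus>\<^bsub>M\<^esub> m', n) - frag_of (m, n) - frag_of (m', n)"
      "m \<in> carrier M" "m' \<in> carrier M" "n \<in> carrier N"
    then have "\<phi> (m \<oplus>\<^bsub>M\<^esub> m') n = \<phi> m n \<otimes>\<^bsub>A\<^esub> \<phi> m' n" using \<phi> by (auto simp: balanced_def)
    then show ?thesis using * \<phi>c
      by (simp add: diff dF h0f comm del: carrier_free_Abelian_group_iff add: fF)
  next
    fix m n n' assume *: "c = frag_of (m, n \<oplus>\<^bsub>N\<^esub> n') - frag_of (m, n) - frag_of (m, n')"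
      "m \<in> carrier M" "n \<in> carrier N" "n' \<in> carrier N"
    then have "\<phi> m (n \<oplus>\<^bsub>N\<^esub> n') = \<phi> m n \<otimes>\<^bsub>A\<^esub> \<phi> m n'" using \<phi> by (auto simp: balanced_def)
    then show ?thesis using * \<phi>c
      by (simp add: diff dF h0f comm del: carrier_free_Abelian_group_iff add: fF)
  next
    fix m r n assume *: "c = frag_of (ra m r, n) - frag_of (m, la r n)"
      "m \<in> carrier M" "r \<in> carrier R" "n \<in> carrier N"
    then have "\<phi> (ra m r) n = \<phi> m (la r n)" using \<phi> by (auto simp: balanced_def)
    then show ?thesis using * \<phi>c
      by (simp add: diff dF h0f ra_closed la_closed del: carrier_free_Abelian_group_iff add: fF)
  qed
  then have "tensor_relators R M ra N la \<subseteq> kernel F A h0" using relators_closed unfolding kernel_def by blast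
  then have Zk: "Z \<subseteq> kernel F A h0"
    unfolding tensor_null_def by (rule F.generate_subgroup_incl) (rule h0.subgroup_kernel)
  have "h0 x = h0 y" if "x \<in> carrier F" "y \<in> carrier F" "Z #>\<^bsub>F\<^esub> x = Z #>\<^bsub>F\<^esub> y" for x y
  proof -
    have "x \<in> Z #>\<^bsub>F\<^esub> y" using F.rcos_self[OF that(1) null_subgroup] that(3) by simp
    then obtain z where "z \<in> Z" "x = z \<otimes>\<^bsub>F\<^esub> y" by (auto simp: r_coset_def)
    then show ?thesis using Zk that(2) h0.hom_mult[of z y] by (auto simp: kernel_def)
  qed
  then obtain h where h: "h \<in> hom (F Mod Z) A" "\<And>x. x \<in> carrier F \<Longrightarrow> h (Z #>\<^bsub>F\<^esub> x) = h0 x"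
    using FactGroup_universal[OF h0(1) null_normal] by blast
  have "h (pure m n) = \<phi> m n" if "m \<in> carrier M" "n \<in> carrier N" for m n
    using h(2)[OF fF[OF that]] h0f[OF that] by (simp add: pure_def tensor_class_def)
  moreover have "h \<in> hom T A" using h(1) by (simp add: tensor_product_def)
  ultimately show ?thesis using that by blast
qed

text \<open>
  \<open>tensor_map\<close> forms the union of the values at all representatives of a class. All of them
  give the same value, as comparison with the map from the universal property shows.
\<close>

lemma tensor_map_hom:
  assumes maps: "\<And>m n. \<lbrakk>m \<in> carrier M; n \<in> carrier N\<rbrakk> \<Longrightarrow> \<phi> (m, n) \<in> carrier M \<times> carrier N"
    and bal: "balanced T (\<lambda>m n. case_prod pure (\<phi> (m, n)))"
  shows "tensor_map R M ra N la \<phi> \<in> hom T T"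
    and "\<And>m n. \<lbrakk>m \<in> carrier M; n \<in> carrier N\<rbrakk> \<Longrightarrow> tensor_map R M ra N la \<phi> (pure m n) = case_prod pure (\<phi> (m, n))"
proof -
  let ?c = "tensor_class R M ra N la"
  obtain h where h: "h \<in> hom T T" "\<And>m n. \<lbrakk>m \<in> carrier M; n \<in> carrier N\<rbrakk> \<Longrightarrow> h (pure m n) = case_prod pure (\<phi> (m, n))"
    by (rule tensor_universal[OF comm_group_tensor bal], rule that) (assumption, simp only:)
  interpret h: group_hom T T h
    using h by (simp add: group_hom_def group_hom_axioms_def T.is_group)
  have ext: "Poly_Mapping.keys (frag_extend (\<lambda>p. frag_of (\<phi> p)) c) \<subseteq> carrier M \<times> carrier N \<and>
      ?c (frag_extend (\<lambda>p. frag_of (\<phi> p)) c) = h (?c c)" if "Poly_Mapping.keys c \<subseteq> carrier M \<times> carrier N" for c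
    using that
  proof (induction c rule: free_Abelian_group_induct[consumes 1, case_names zero diff of])
    case zero show ?case unfolding frag_extend_0 class_zero h.hom_one by simp
  next
    case (diff x y)
    then have "Poly_Mapping.keys (frag_extend (\<lambda>p. frag_of (\<phi> p)) x - frag_extend (\<lambda>p. frag_of (\<phi> p)) y)
      \<subseteq> carrier M \<times> carrier N"
      using keys_diff[of "frag_extend (\<lambda>p. frag_of (\<phi> p)) x" "frag_extend (\<lambda>p. frag_of (\<phi> p)) y"] by auto
    then show ?case using diff
      by (simp add: frag_extend_diff class_diff class_closed)
  next
    case (of p)
    then obtain m n where p: "p = (m, n)" "m \<in> carrier M" "n \<in> carrier N" by auto
    obtain m' n' where p': "\<phi> (m, n) = (m', n')" "m' \<in> carrier M" "n' \<in> carrier N" using maps[OF p(2,3)] by auto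
    show ?case using h(2)[OF p(2,3)] p p' by (simp add: pure_def)
  qed
  have eq: "tensor_map R M ra N la \<phi> C = h C" if C: "C \<in> carrier T" for C
  proof -
    obtain c where c: "c \<in> carrier F" "C = ?c c" using C by (auto simp: tensor_carrier)
    have "?c (frag_extend (\<lambda>p. frag_of (\<phi> p)) d) = h C" if d: "d \<in> C" for d
    proof -
      have "C = Z #>\<^bsub>F\<^esub> c" using c by (simp add: tensor_class_def)
      then have d': "d \<in> Z #>\<^bsub>F\<^esub> c" using d by simp
      then have dF: "d \<in> carrier F"
        using F.r_coset_subset_G[OF subgroup.subset[OF null_subgroup] c(1)] by (rule subsetD[rotated])
      have "?c d = C"
        using F.repr_independence[OF d' c(1) null_subgroup] c(2) by (simp add: tensor_class_def)
      then show ?thesis using ext dF by simp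
    qed
    then have "tensor_map R M ra N la \<phi> C = (\<Union>d\<in>C. h C)"
      unfolding tensor_map_def by (intro SUP_cong refl)
    moreover have "C \<noteq> {}" using F.rcos_self[OF c(1) null_subgroup] c(2) by (auto simp: tensor_class_def)
    ultimately show ?thesis by simp
  qed
  show "tensor_map R M ra N la \<phi> \<in> hom T T"
    using h(1) eq by (auto simp: hom_def)
  show "\<And>m n. \<lbrakk>m \<in> carrier M; n \<in> carrier N\<rbrakk> \<Longrightarrow> tensor_map R M ra N la \<phi> (pure m n) = case_prod pure (\<phi> (m, n))"
    using eq h(2) by simp
qed

end

section \<open>Algebras with a multiplicative basis\<close>

abbreviation mon :: "'b \<Rightarrow> 'k::zero \<Rightarrow> 'b \<Rightarrow>\<^sub>0 'k" where "mon \<equiv> Poly_Mapping.single"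

lemma poly_mapping_sum_mon: "(\<Sum>p\<in>Poly_Mapping.keys f. mon p (Poly_Mapping.lookup f p)) = f"
proof (rule poly_mapping_eqI)
  fix q
  have "(\<Sum>p\<in>Poly_Mapping.keys f. if p = q then Poly_Mapping.lookup f p else 0) = Poly_Mapping.lookup f q"
    by (simp add: sum.delta' not_in_keys_iff_lookup_eq_zero)
  then show "Poly_Mapping.lookup (\<Sum>p\<in>Poly_Mapping.keys f. mon p (Poly_Mapping.lookup f p)) q = Poly_Mapping.lookup f q"
    by (simp add: lookup_sum lookup_single when_def)
qed

text \<open>
  The algebras \<open>kG\<close> and \<open>H\<close> both have a basis that is closed under multiplication up to scalars
  \<open>\<tau>\<close>, so that associativity of the algebra is the cocycle identity for \<open>\<tau>\<close>, and modules,
  submodules and linear maps can be described by multiples of basis elements alone.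
\<close>

locale twisted_algebra =
  fixes B :: "'b set" and opr :: "'b \<Rightarrow> 'b \<Rightarrow> 'b" (infixl \<open>\<cdot>\<close> 70) and e :: 'b
    and \<tau> :: "'b \<Rightarrow> 'b \<Rightarrow> 'k::field" and R :: "('b \<Rightarrow>\<^sub>0 'k, 'z) ring_scheme"
  assumes closed: "\<lbrakk>p \<in> B; q \<in> B\<rbrakk> \<Longrightarrow> p \<cdot> q \<in> B" and unit_closed: "e \<in> B"
    and assoc: "\<lbrakk>p \<in> B; q \<in> B; r \<in> B\<rbrakk> \<Longrightarrow> (p \<cdot> q) \<cdot> r = p \<cdot> (q \<cdot> r)"
    and unit_left: "p \<in> B \<Longrightarrow> e \<cdot> p = p" and unit_right: "p \<in> B \<Longrightarrow> p \<cdot> e = p"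
    and cocycle: "\<lbrakk>p \<in> B; q \<in> B; r \<in> B\<rbrakk> \<Longrightarrow> \<tau> p q * \<tau> (p \<cdot> q) r = \<tau> p (q \<cdot> r) * \<tau> q r"
    and twist_left: "p \<in> B \<Longrightarrow> \<tau> e p = 1" and twist_right: "p \<in> B \<Longrightarrow> \<tau> p e = 1"
    and carrier_eq: "carrier R = {f. Poly_Mapping.keys f \<subseteq> B}"
    and mult_eq: "f \<otimes>\<^bsub>R\<^esub> f' = (\<Sum>p\<in>Poly_Mapping.keys f. \<Sum>q\<in>Poly_Mapping.keys f'.
      mon (p \<cdot> q) (Poly_Mapping.lookup f p * Poly_Mapping.lookup f' q * \<tau> p q))"
    and one_eq: "\<one>\<^bsub>R\<^esub> = mon e 1" and zero_eq: "\<zero>\<^bsub>R\<^esub> = 0" and add_eq: "f \<oplus>\<^bsub>R\<^esub> f' = f + f'"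
begin

lemma mon_closed: "p \<in> B \<Longrightarrow> mon p c \<in> carrier R"
  by (auto simp: carrier_eq)

lemma add_closed: "\<lbrakk>f \<in> carrier R; f' \<in> carrier R\<rbrakk> \<Longrightarrow> f + f' \<in> carrier R"
  using keys_add[of f f'] by (auto simp: carrier_eq)

lemma zero_closed: "0 \<in> carrier R"
  by (auto simp: carrier_eq)

lemma mon_induct [consumes 1, case_names zero mon add]:
  assumes f: "f \<in> carrier R" and "P 0" and "\<And>p c. p \<in> B \<Longrightarrow> P (mon p c)"
    and "\<And>f f'. \<lbrakk>f \<in> carrier R; f' \<in> carrier R; P f; P f'\<rbrakk> \<Longrightarrow> P (f + f')"
  shows "P f"
proof -
  have "(\<Sum>p\<in>A. mon p (Poly_Mapping.lookup f p)) \<in> carrier R \<and> P (\<Sum>p\<in>A. mon p (Poly_Mapping.lookup f p))"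
    if "finite A" "A \<subseteq> B" for A
    using that by (induction A rule: finite_induct) (auto simp: assms zero_closed add_closed mon_closed)
  from this[of "Poly_Mapping.keys f"] show ?thesis using f by (simp add: carrier_eq poly_mapping_sum_mon)
qed

lemma mult_mon: "mon p c \<otimes>\<^bsub>R\<^esub> mon q d = mon (p \<cdot> q) (c * d * \<tau> p q)"
  by (cases "c = 0"; cases "d = 0") (auto simp: mult_eq)

lemma mult_add_left: "(f + f') \<otimes>\<^bsub>R\<^esub> h = f \<otimes>\<^bsub>R\<^esub> h + f' \<otimes>\<^bsub>R\<^esub> h"
  unfolding mult_eq
  by (rule setsum_keys_plus_distrib) (simp_all add: single_add distrib_left distrib_right sum.distrib)

lemma mult_add_right: "h \<otimes>\<^bsub>R\<^esub> (f + f') = h \<otimes>\<^bsub>R\<^esub> f + h \<otimes>\<^bsub>R\<^esub> f'"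
  unfolding mult_eq sum.distrib[symmetric]
  by (rule sum.cong[OF refl], rule setsum_keys_plus_distrib)
     (simp_all add: single_add distrib_left distrib_right)

lemma mult_zero_left: "0 \<otimes>\<^bsub>R\<^esub> f = 0" and mult_zero_right: "f \<otimes>\<^bsub>R\<^esub> 0 = 0"
  by (simp_all add: mult_eq)

lemma mult_closed: "\<lbrakk>f \<in> carrier R; f' \<in> carrier R\<rbrakk> \<Longrightarrow> f \<otimes>\<^bsub>R\<^esub> f' \<in> carrier R"
proof (induction f rule: mon_induct)
  case (mon p c)
  show ?case using mon(2,1)
    by (induction f' rule: mon_induct)
       (auto simp: mult_zero_right zero_closed mult_mon mon_closed closed mult_add_right add_closed)
qed (auto simp: mult_zero_left zero_closed mult_add_left add_closed)

lemma mult_assoc: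
  "\<lbrakk>f \<in> carrier R; f' \<in> carrier R; f'' \<in> carrier R\<rbrakk> \<Longrightarrow> (f \<otimes>\<^bsub>R\<^esub> f') \<otimes>\<^bsub>R\<^esub> f'' = f \<otimes>\<^bsub>R\<^esub> (f' \<otimes>\<^bsub>R\<^esub> f'')"
proof (induction f rule: mon_induct)
  case (mon p c)
  show ?case using mon(2,1,3)
  proof (induction f' rule: mon_induct)
    case (mon q d)
    show ?case using mon(3,1,2)
    proof (induction f'' rule: mon_induct)
      case (mon r b)
      then show ?case using cocycle[of p q r] by (simp add: mult_mon assoc algebra_simps)
    qed (auto simp: mult_zero_right mult_add_right)
  qed (auto simp: mult_zero_left mult_zero_right mult_add_left mult_add_right)
qed (auto simp: mult_zero_left mult_add_left)

lemma one_left: "f \<in> carrier R \<Longrightarrow> mon e 1 \<otimes>\<^bsub>R\<^esub> f = f"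
  by (induction f rule: mon_induct) (auto simp: mult_zero_right mult_mon unit_left twist_left mult_add_right)

lemma one_right: "f \<in> carrier R \<Longrightarrow> f \<otimes>\<^bsub>R\<^esub> mon e 1 = f"
  by (induction f rule: mon_induct) (auto simp: mult_zero_left mult_mon unit_right twist_right mult_add_left)

lemma ring_R: "ring R"
proof (rule ringI)
  show "abelian_group R"
  proof (rule abelian_groupI, goal_cases)
    case (6 x)
    then show ?case by (intro bexI[of _ "- x"]) (auto simp: add_eq zero_eq carrier_eq)
  qed (auto simp: add_eq zero_eq add_closed zero_closed add_ac)
  show "monoid R"
    by (rule monoidI) (auto simp: one_eq mon_closed unit_closed mult_closed mult_assoc one_left one_right)
qed (auto simp: add_eq mult_add_left mult_add_right)

lemma a_inv_eq: "f \<in> carrier R \<Longrightarrow> \<ominus>\<^bsub>R\<^esub> f = - f"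
proof -
  interpret ring R by (rule ring_R)
  assume f: "f \<in> carrier R"
  then have "- f \<in> carrier R" by (simp add: carrier_eq)
  then show ?thesis using f by (intro minus_equality) (simp_all add: add_eq zero_eq)
qed

lemma linear_mapI:
  assumes "left_module R M" "left_module R N" "f \<in> carrier M \<rightarrow> carrier N"
    and add: "\<And>u v. \<lbrakk>u \<in> carrier M; v \<in> carrier M\<rbrakk> \<Longrightarrow> f (u \<oplus>\<^bsub>M\<^esub> v) = f u \<oplus>\<^bsub>N\<^esub> f v"
    and mon: "\<And>p c v. \<lbrakk>p \<in> B; v \<in> carrier M\<rbrakk> \<Longrightarrow> f (mon p c \<odot>\<^bsub>M\<^esub> v) = mon p c \<odot>\<^bsub>N\<^esub> f v"
  shows "linear_map R M N f"
proof -
  interpret M: left_module R M by fact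
  interpret N: left_module R N by fact
  have fc: "v \<in> carrier M \<Longrightarrow> f v \<in> carrier N" for v using assms(3) by auto
  have "f (r \<odot>\<^bsub>M\<^esub> v) = r \<odot>\<^bsub>N\<^esub> f v" if "r \<in> carrier R" "v \<in> carrier M" for r v
    using that
  proof (induction r rule: mon_induct)
    case zero
    have "f \<zero>\<^bsub>M\<^esub> = \<zero>\<^bsub>N\<^esub>"
      using add[of "\<zero>\<^bsub>M\<^esub>" "\<zero>\<^bsub>M\<^esub>"] fc[of "\<zero>\<^bsub>M\<^esub>"] N.M.add.r_cancel_one'[of "f \<zero>\<^bsub>M\<^esub>" "f \<zero>\<^bsub>M\<^esub>"] by simp
    then show ?case using M.smult_l_null N.smult_l_null zero fc by (simp add: zero_eq)
  next
    case (add r r')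
    then show ?case
      using M.smult_l_distr[of r r' v] N.smult_l_distr[of r r' "f v"] fc
      by (simp add: add_eq M.smult_closed assms(4))
  qed (use mon in auto)
  then show ?thesis using assms(3) add by (auto simp: linear_map_def)
qed

lemma submodule_monI:
  assumes "left_module R M" "N \<subseteq> carrier M" "\<zero>\<^bsub>M\<^esub> \<in> N"
    and "\<And>u v. \<lbrakk>u \<in> N; v \<in> N\<rbrakk> \<Longrightarrow> u \<oplus>\<^bsub>M\<^esub> v \<in> N"
    and mon: "\<And>p c v. \<lbrakk>p \<in> B; v \<in> N\<rbrakk> \<Longrightarrow> mon p c \<odot>\<^bsub>M\<^esub> v \<in> N"
  shows "submodule N R M"
proof -
  interpret M: left_module R M by fact
  show ?thesis
  proof (rule M.submoduleI)
    fix r v assume "r \<in> carrier R" "v \<in> N"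
    then show "r \<odot>\<^bsub>M\<^esub> v \<in> N"
    proof (induction r rule: mon_induct)
      case zero then show ?case using M.smult_l_null[of v] assms(2,3) by (auto simp: zero_eq)
    next
      case (add r r')
      then show ?case using M.smult_l_distr[of r r' v] assms(2,4) by (auto simp: add_eq)
    qed (use mon in auto)
  qed (use assms in auto)
qed

text \<open>
  \<open>act p c\<close> is the action of the multiple \<open>c p\<close> of a basis element; keeping the scalar in the action
  makes additive groups without a scalar multiplication possible carriers.
\<close>

definition action_module :: "('c, 'a, 'y) module_scheme \<Rightarrow> ('b \<Rightarrow> 'k \<Rightarrow> 'a \<Rightarrow> 'a) \<Rightarrow> ('b \<Rightarrow>\<^sub>0 'k, 'a) module"
  where "action_module M act =
    \<lparr>carrier = carrier M, monoid.mult = (\<lambda>_ _. undefined), one = undefined,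
     ring.zero = \<zero>\<^bsub>M\<^esub>, ring.add = ring.add M,
     module.smult = (\<lambda>f v. \<Oplus>\<^bsub>M\<^esub>p\<in>Poly_Mapping.keys f. act p (Poly_Mapping.lookup f p) v)\<rparr>"

lemma action_module_simps [simp]:
  "carrier (action_module M act) = carrier M" "\<zero>\<^bsub>action_module M act\<^esub> = \<zero>\<^bsub>M\<^esub>"
  "u \<oplus>\<^bsub>action_module M act\<^esub> v = u \<oplus>\<^bsub>M\<^esub> v"
  by (simp_all add: action_module_def)

context
  fixes M :: "('c, 'a, 'y) module_scheme" and act :: "'b \<Rightarrow> 'k \<Rightarrow> 'a \<Rightarrow> 'a"
  assumes M: "abelian_group M"
    and act_closed: "\<And>p c v. \<lbrakk>p \<in> B; v \<in> carrier M\<rbrakk> \<Longrightarrow> act p c v \<in> carrier M"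
    and act_add: "\<And>p c u v. \<lbrakk>p \<in> B; u \<in> carrier M; v \<in> carrier M\<rbrakk> \<Longrightarrow> act p c (u \<oplus>\<^bsub>M\<^esub> v) = act p c u \<oplus>\<^bsub>M\<^esub> act p c v"
    and act_scalar_add: "\<And>p c d v. \<lbrakk>p \<in> B; v \<in> carrier M\<rbrakk> \<Longrightarrow> act p (c + d) v = act p c v \<oplus>\<^bsub>M\<^esub> act p d v"
    and act_mult: "\<And>p c q d v. \<lbrakk>p \<in> B; q \<in> B; v \<in> carrier M\<rbrakk> \<Longrightarrow> act p c (act q d v) = act (p \<cdot> q) (c * d * \<tau> p q) v"
    and act_one: "\<And>v. v \<in> carrier M \<Longrightarrow> act e 1 v = v"
begin

interpretation M: abelian_group M by (rule M)

abbreviation "AM \<equiv> action_module M act"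

lemma act_scalar_zero: "\<lbrakk>p \<in> B; v \<in> carrier M\<rbrakk> \<Longrightarrow> act p 0 v = \<zero>\<^bsub>M\<^esub>"
  using act_scalar_add[of p v 0 0] act_closed[of p v 0] by simp

lemma smult_superset:
  assumes "finite A" "Poly_Mapping.keys f \<subseteq> A" "A \<subseteq> B" "v \<in> carrier M"
  shows "f \<odot>\<^bsub>AM\<^esub> v = (\<Oplus>\<^bsub>M\<^esub>p\<in>A. act p (Poly_Mapping.lookup f p) v)"
  unfolding action_module_def module.simps
  by (rule M.add.finprod_mono_neutral_cong_left)
     (use assms in \<open>auto simp: act_closed act_scalar_zero not_in_keys_iff_lookup_eq_zero subset_iff\<close>)

lemma smult_mon: "\<lbrakk>p \<in> B; v \<in> carrier M\<rbrakk> \<Longrightarrow> mon p c \<odot>\<^bsub>AM\<^esub> v = act p c v"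
  by (subst smult_superset[of "{p}"]) (auto simp: act_closed)

lemma smult_add:
  assumes "f \<in> carrier R" "f' \<in> carrier R" "v \<in> carrier M"
  shows "(f + f') \<odot>\<^bsub>AM\<^esub> v = f \<odot>\<^bsub>AM\<^esub> v \<oplus>\<^bsub>M\<^esub> f' \<odot>\<^bsub>AM\<^esub> v"
proof -
  let ?A = "Poly_Mapping.keys f \<union> Poly_Mapping.keys f'"
  have A: "finite ?A" "?A \<subseteq> B" using assms by (auto simp: carrier_eq)
  have "(f + f') \<odot>\<^bsub>AM\<^esub> v = (\<Oplus>\<^bsub>M\<^esub>p\<in>?A. act p (Poly_Mapping.lookup f p) v \<oplus>\<^bsub>M\<^esub> act p (Poly_Mapping.lookup f' p) v)"
    by (subst smult_superset[OF A(1) keys_add A(2) assms(3)], rule M.finsum_cong')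
       (use A assms(3) in \<open>auto simp: lookup_add act_scalar_add act_closed subset_iff\<close>)
  also have "\<dots> = (\<Oplus>\<^bsub>M\<^esub>p\<in>?A. act p (Poly_Mapping.lookup f p) v) \<oplus>\<^bsub>M\<^esub> (\<Oplus>\<^bsub>M\<^esub>p\<in>?A. act p (Poly_Mapping.lookup f' p) v)"
    using A assms(3) by (intro M.finsum_addf) (auto simp: act_closed subset_iff)
  also have "\<dots> = f \<odot>\<^bsub>AM\<^esub> v \<oplus>\<^bsub>M\<^esub> f' \<odot>\<^bsub>AM\<^esub> v"
    using A assms(3) by (simp add: smult_superset[of ?A])
  finally show ?thesis .
qed

lemma smult_zero: "v \<in> carrier M \<Longrightarrow> 0 \<odot>\<^bsub>AM\<^esub> v = \<zero>\<^bsub>M\<^esub>"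
  using smult_superset[of "{}" 0 v] by simp

lemma smult_AM_closed: "\<lbrakk>f \<in> carrier R; v \<in> carrier M\<rbrakk> \<Longrightarrow> f \<odot>\<^bsub>AM\<^esub> v \<in> carrier M"
  by (induction f rule: mon_induct) (auto simp: smult_zero smult_mon smult_add act_closed)

lemma smult_AM_distr:
  "\<lbrakk>f \<in> carrier R; u \<in> carrier M; v \<in> carrier M\<rbrakk> \<Longrightarrow> f \<odot>\<^bsub>AM\<^esub> (u \<oplus>\<^bsub>M\<^esub> v) = f \<odot>\<^bsub>AM\<^esub> u \<oplus>\<^bsub>M\<^esub> f \<odot>\<^bsub>AM\<^esub> v"
  by (induction f rule: mon_induct) (auto simp: smult_zero smult_mon smult_add act_add smult_AM_closed M.a_ac)

lemma smult_AM_assoc: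
  "\<lbrakk>f \<in> carrier R; f' \<in> carrier R; v \<in> carrier M\<rbrakk> \<Longrightarrow> (f \<otimes>\<^bsub>R\<^esub> f') \<odot>\<^bsub>AM\<^esub> v = f \<odot>\<^bsub>AM\<^esub> (f' \<odot>\<^bsub>AM\<^esub> v)"
proof (induction f rule: mon_induct)
  case (mon p c)
  show ?case using mon(2,1,3)
  proof (induction f' rule: mon_induct)
    case zero
    then show ?case
      using smult_AM_distr[of "mon p c" "\<zero>\<^bsub>M\<^esub>" "\<zero>\<^bsub>M\<^esub>"] smult_AM_closed[of "mon p c" "\<zero>\<^bsub>M\<^esub>"]
      by (simp add: mult_zero_right smult_zero mon_closed)
  next
    case (mon q d)
    then show ?case by (simp add: mult_mon smult_mon act_mult act_closed closed)
  next
    case (add f f')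
    then show ?case
      by (simp add: mult_add_right smult_add mult_closed mon_closed smult_AM_distr smult_AM_closed)
  qed
qed (auto simp: mult_zero_left mult_add_left smult_zero smult_add mult_closed smult_AM_closed)

text \<open>
  All laws are additive in the algebra, so they hold once they hold for multiples of basis
  elements.
\<close>

lemma left_module_action: "left_module R AM"
proof (intro left_module.intro left_module_axioms.intro ring_R)
  show "abelian_group AM"
  proof (rule abelian_groupI, goal_cases)
    case (6 x) then show ?case by (intro bexI[of _ "\<ominus>\<^bsub>M\<^esub> x"]) (auto simp: M.l_neg)
  qed (auto simp: M.a_ac)
qed (auto simp: add_eq one_eq smult_AM_closed smult_add smult_AM_distr smult_AM_assoc smult_mon unit_closed act_one)

end

end

section \<open>Characters, the group algebra and the Hopf algebra\<close>

lemma scalar_ring_simps [simp]: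
  "carrier scalar_ring = UNIV" "x \<otimes>\<^bsub>scalar_ring\<^esub> y = x * y" "\<one>\<^bsub>scalar_ring\<^esub> = 1"
  by (simp_all add: scalar_ring_def)

lemma Units_scalar_ring: "Units (scalar_ring :: 'k::field ring) = {x. x \<noteq> 0}"
proof -
  have "\<exists>y. y * x = 1 \<and> x * y = 1" if "x \<noteq> 0" for x :: 'k
    using that by (intro exI[of _ "inverse x"]) simp
  then show ?thesis by (auto simp: Units_def)
qed

lemma units_of_scalar_ring_simps [simp]:
  "carrier (units_of (scalar_ring :: 'k::field ring)) = {x. x \<noteq> 0}"
  "x \<otimes>\<^bsub>units_of (scalar_ring :: 'k::field ring)\<^esub> y = x * y"
  "\<one>\<^bsub>units_of (scalar_ring :: 'k::field ring)\<^esub> = 1"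
  by (simp_all add: units_of_def Units_scalar_ring)

lemma group_units_of_scalar_ring: "group (units_of (scalar_ring :: 'k::field ring))"
proof (rule groupI)
  fix x :: 'k assume "x \<in> carrier (units_of scalar_ring)"
  then show "\<exists>y\<in>carrier (units_of scalar_ring). y \<otimes>\<^bsub>units_of scalar_ring\<^esub> x = \<one>\<^bsub>units_of scalar_ring\<^esub>"
    by (intro bexI[of _ "inverse x"]) auto
qed auto

lemma ord_units_of_scalar_ring:
  fixes x :: "'k::field"
  assumes "x \<noteq> 0"
  shows "x ^ n = 1 \<longleftrightarrow> group.ord (units_of scalar_ring) x dvd n"
proof -
  interpret U: group "units_of (scalar_ring :: 'k ring)" by (rule group_units_of_scalar_ring)
  have "x [^]\<^bsub>units_of (scalar_ring :: 'k ring)\<^esub> n = x ^ n" for n :: nat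
    by (induction n) (simp_all add: mult.commute)
  then show ?thesis using U.pow_eq_id[of x n] assms by simp
qed

context
  fixes G :: "('g, 'x) monoid_scheme"
  assumes G: "group G"
begin

interpretation G: group G by (rule G)

lemma character_group_carrier:
  "(\<mu> :: 'g \<Rightarrow> 'k::field) \<in> carrier (character_group G) \<longleftrightarrow>
    (\<forall>g\<in>carrier G. \<mu> g \<noteq> 0) \<and> (\<forall>g\<in>carrier G. \<forall>h\<in>carrier G. \<mu> (g \<otimes>\<^bsub>G\<^esub> h) = \<mu> g * \<mu> h) \<and> \<mu> \<in> extensional (carrier G)"
  by (auto simp: character_group_def hom_def)

lemma character_group_simps [simp]:
  "(\<mu> :: 'g \<Rightarrow> 'k::field) \<otimes>\<^bsub>character_group G\<^esub> \<nu> = (\<lambda>g\<in>carrier G. \<mu> g * \<nu> g)"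
  "\<one>\<^bsub>character_group G\<^esub> = (\<lambda>g\<in>carrier G. (1 :: 'k))"
  by (simp_all add: character_group_def)

lemma group_character_group: "group (character_group G :: ('g \<Rightarrow> 'k::field) monoid)"
proof (rule groupI)
  fix \<mu> :: "'g \<Rightarrow> 'k" assume \<mu>: "\<mu> \<in> carrier (character_group G)"
  then show "\<exists>\<nu>\<in>carrier (character_group G). \<nu> \<otimes>\<^bsub>character_group G\<^esub> \<mu> = \<one>\<^bsub>character_group G\<^esub>"
    by (intro bexI[of _ "\<lambda>g\<in>carrier G. inverse (\<mu> g)"])
       (auto simp: character_group_carrier restrict_def extensional_def)
qed (auto simp: character_group_carrier restrict_def fun_eq_iff extensional_def)

lemma character_inv:
  fixes \<mu> :: "'g \<Rightarrow> 'k::field"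
  assumes "\<mu> \<in> carrier (character_group G)" "g \<in> carrier G"
  shows "(inv\<^bsub>character_group G\<^esub> \<mu>) g = inverse (\<mu> g)"
proof -
  interpret X: group "character_group G :: ('g \<Rightarrow> 'k) monoid" by (rule group_character_group)
  have "(\<lambda>g\<in>carrier G. inverse (\<mu> g)) = inv\<^bsub>character_group G\<^esub> \<mu>"
    using assms(1) by (intro X.inv_equality[symmetric])
      (auto simp: character_group_carrier restrict_def extensional_def)
  then show ?thesis using assms(2) by (metis restrict_apply')
qed

lemma character_ord:
  fixes \<mu> :: "'g \<Rightarrow> 'k::field"
  assumes "\<mu> \<in> carrier (character_group G)" "g \<in> carrier G"
  shows "\<mu> g ^ group.ord (character_group G) \<mu> = 1"
proof -
  interpret X: group "character_group G :: ('g \<Rightarrow> 'k) monoid" by (rule group_character_group)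
  have "\<mu> [^]\<^bsub>character_group G\<^esub> n = (\<lambda>g\<in>carrier G. \<mu> g ^ n)" for n :: nat
    by (induction n) (auto simp: mult.commute)
  then show ?thesis using X.pow_ord_eq_1[OF assms(1)] assms(2) by (metis character_group_simps(2) restrict_apply')
qed

lemma character_one:
  fixes \<mu> :: "'g \<Rightarrow> 'k::field"
  assumes "\<mu> \<in> carrier (character_group G)" shows "\<mu> \<one>\<^bsub>G\<^esub> = 1"
proof -
  have "\<mu> \<one>\<^bsub>G\<^esub> * \<mu> \<one>\<^bsub>G\<^esub> = \<mu> \<one>\<^bsub>G\<^esub>" "\<mu> \<one>\<^bsub>G\<^esub> \<noteq> 0"
    using assms character_group_carrier[of \<mu>] by (metis G.one_closed G.r_one, metis G.one_closed)
  then show ?thesis by simp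
qed

lemma twisted_group_algebra:
  "twisted_algebra (carrier G) (\<otimes>\<^bsub>G\<^esub>) \<one>\<^bsub>G\<^esub> (\<lambda>_ _. 1) (group_algebra G :: ('g \<Rightarrow>\<^sub>0 'k::field) ring)"
  by unfold_locales (auto simp: group_algebra_def G.m_assoc)

lemma hopf_ore_mult:
  "f \<otimes>\<^bsub>hopf_ore G \<psi> a\<^esub> f' = (\<Sum>p\<in>Poly_Mapping.keys f. \<Sum>q\<in>Poly_Mapping.keys f'.
      mon (fst p \<otimes>\<^bsub>G\<^esub> fst q, snd p + snd q)
        (Poly_Mapping.lookup f p * Poly_Mapping.lookup f' q * \<psi> (fst q) ^ snd p))"
  by (simp add: hopf_ore_def ore_algebra_def case_prod_unfold)

lemma hopf_ore_simps:
  "carrier (hopf_ore G \<psi> a) = {f. Poly_Mapping.keys f \<subseteq> carrier G \<times> UNIV}"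
  "\<one>\<^bsub>hopf_ore G \<psi> a\<^esub> = mon (\<one>\<^bsub>G\<^esub>, 0) 1" "\<zero>\<^bsub>hopf_ore G \<psi> a\<^esub> = 0"
  "f \<oplus>\<^bsub>hopf_ore G \<psi> a\<^esub> f' = f + f'"
  by (simp_all add: hopf_ore_def ore_algebra_def)

text \<open>
  The factor comes from \<open>x\<^sup>i h = \<psi>(h)\<^sup>i h x\<^sup>i\<close>; it is a cocycle because \<open>\<psi>\<close> is multiplicative.
\<close>

lemma twisted_hopf_ore:
  fixes \<psi> :: "'g \<Rightarrow> 'k::field"
  assumes "\<And>g h. \<lbrakk>g \<in> carrier G; h \<in> carrier G\<rbrakk> \<Longrightarrow> \<psi> (g \<otimes>\<^bsub>G\<^esub> h) = \<psi> g * \<psi> h" "\<psi> \<one>\<^bsub>G\<^esub> = 1"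
  shows "twisted_algebra (carrier G \<times> (UNIV :: nat set)) (\<lambda>p q. (fst p \<otimes>\<^bsub>G\<^esub> fst q, snd p + snd q)) (\<one>\<^bsub>G\<^esub>, 0)
    (\<lambda>p q. \<psi> (fst q) ^ snd p) (hopf_ore G \<psi> a)"
  using assms
  by unfold_locales
     (auto simp: hopf_ore_simps hopf_ore_mult G.m_assoc power_add power_mult_distrib)

end

lemma ore_embed_mon: "ore_embed (mon g c) = mon (g, 0) c"
  by (cases "c = 0") (simp_all add: ore_embed_def)

lemma ore_embed_add: "ore_embed (f + f') = ore_embed f + ore_embed f'"
  unfolding ore_embed_def by (rule setsum_keys_plus_distrib) (simp_all add: single_add)

lemma ore_embed_zero: "ore_embed 0 = 0"
  by (simp add: ore_embed_def)

text \<open>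
  The orders of \<open>\<chi>\<close> and of \<open>q = \<chi>(a)\<close> are recorded through powers, and \<open>\<psi>\<close> through its values on
  \<open>G\<close>, where it is \<open>\<chi>\<^sup>-\<^sup>1\<close>.
\<close>

locale ore_setting =
  fixes G :: "('g, 'x) monoid_scheme" and \<chi> :: "'g \<Rightarrow> 'k::alg_closed_field" and a :: 'g and s :: nat
    and \<psi> :: "'g \<Rightarrow> 'k"
  assumes group_G: "group G" and finite_G: "finite (carrier G)"
    and a_closed: "a \<in> carrier G" and a_central: "g \<in> carrier G \<Longrightarrow> a \<otimes>\<^bsub>G\<^esub> g = g \<otimes>\<^bsub>G\<^esub> a"
    and \<chi>_mult: "\<lbrakk>g \<in> carrier G; h \<in> carrier G\<rbrakk> \<Longrightarrow> \<chi> (g \<otimes>\<^bsub>G\<^esub> h) = \<chi> g * \<chi> h"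
    and \<chi>_nonzero: "g \<in> carrier G \<Longrightarrow> \<chi> g \<noteq> 0"
    and \<psi>_eq: "g \<in> carrier G \<Longrightarrow> \<psi> g = inverse (\<chi> g)"
    and \<chi>_power: "g \<in> carrier G \<Longrightarrow> \<chi> g ^ s = 1"
    and ord_q: "\<chi> a ^ n = 1 \<longleftrightarrow> s dvd n" and s_pos: "0 < s"
begin

sublocale G: group G by (rule group_G)

abbreviation "H \<equiv> hopf_ore G \<psi> a"
abbreviation "kG \<equiv> group_algebra G :: ('g \<Rightarrow>\<^sub>0 'k) ring"

lemma \<chi>_one: "\<chi> \<one>\<^bsub>G\<^esub> = 1"
  using \<chi>_mult[of "\<one>\<^bsub>G\<^esub>" "\<one>\<^bsub>G\<^esub>"] \<chi>_nonzero[of "\<one>\<^bsub>G\<^esub>"] by simp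

sublocale kG: twisted_algebra "carrier G" "(\<otimes>\<^bsub>G\<^esub>)" "\<one>\<^bsub>G\<^esub>" "\<lambda>_ _. 1" kG
  by (rule twisted_group_algebra[OF group_G])

sublocale HH: twisted_algebra "carrier G \<times> (UNIV :: nat set)" "\<lambda>p q. (fst p \<otimes>\<^bsub>G\<^esub> fst q, snd p + snd q)" "(\<one>\<^bsub>G\<^esub>, 0)"
    "\<lambda>p q. \<psi> (fst q) ^ snd p" H
  by (rule twisted_hopf_ore[OF group_G]) (simp_all add: \<psi>_eq \<chi>_mult \<chi>_one)

sublocale kR: ring kG by (rule kG.ring_R)
sublocale HR: ring H by (rule HH.ring_R)

lemma ore_embed_closed: "f \<in> carrier kG \<Longrightarrow> ore_embed f \<in> carrier H"
  by (induction f rule: kG.mon_induct)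
     (auto simp: ore_embed_zero ore_embed_mon ore_embed_add HH.zero_closed HH.mon_closed HH.add_closed)

lemma ore_embed_mult:
  "\<lbrakk>f \<in> carrier kG; f' \<in> carrier kG\<rbrakk> \<Longrightarrow> ore_embed (f \<otimes>\<^bsub>kG\<^esub> f') = ore_embed f \<otimes>\<^bsub>H\<^esub> ore_embed f'"
proof (induction f rule: kG.mon_induct)
  case (mon p c)
  show ?case using mon(2,1)
    by (induction f' rule: kG.mon_induct)
       (auto simp: ore_embed_zero ore_embed_mon ore_embed_add HH.mult_zero_right kG.mult_zero_right
         kG.mult_mon HH.mult_mon kG.mult_add_right HH.mult_add_right)
qed (auto simp: ore_embed_zero ore_embed_add HH.mult_zero_left kG.mult_zero_left kG.mult_add_left HH.mult_add_left)

definition restriction :: "('g \<times> nat \<Rightarrow>\<^sub>0 'k, 'm) module \<Rightarrow> ('g \<Rightarrow>\<^sub>0 'k, 'm) module"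
  where "restriction M = \<lparr>carrier = carrier M, monoid.mult = monoid.mult M, one = one M,
    ring.zero = ring.zero M, ring.add = ring.add M, module.smult = (\<lambda>r v. ore_embed r \<odot>\<^bsub>M\<^esub> v)\<rparr>"

lemma restriction_simps [simp]:
  "carrier (restriction M) = carrier M" "\<zero>\<^bsub>restriction M\<^esub> = \<zero>\<^bsub>M\<^esub>"
  "u \<oplus>\<^bsub>restriction M\<^esub> v = u \<oplus>\<^bsub>M\<^esub> v" "r \<odot>\<^bsub>restriction M\<^esub> v = ore_embed r \<odot>\<^bsub>M\<^esub> v"
  by (simp_all add: restriction_def)

lemma left_module_restriction:
  assumes "left_module H M" shows "left_module kG (restriction M)"
proof -
  interpret M: left_module H M by fact
  have "abelian_group (restriction M)"
  proof (rule abelian_groupI, goal_cases)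
    case (6 x) then show ?case by (intro bexI[of _ "\<ominus>\<^bsub>M\<^esub> x"]) (auto simp: M.M.l_neg)
  qed (auto simp: M.M.a_ac)
  moreover have "ore_embed \<one>\<^bsub>kG\<^esub> = \<one>\<^bsub>H\<^esub>" by (simp add: kG.one_eq HH.one_eq ore_embed_mon)
  ultimately show ?thesis
    by (intro left_module.intro left_module_axioms.intro kG.ring_R)
       (auto simp: ore_embed_closed ore_embed_mult M.smult_closed M.smult_assoc M.smult_one M.smult_r_distr
         kG.add_eq ore_embed_add M.smult_l_distr[unfolded HH.add_eq])
qed

lemma mon_split: "mon (g, i) c = mon (g, 0) c \<otimes>\<^bsub>H\<^esub> mon (\<one>\<^bsub>G\<^esub>, i) 1" if "g \<in> carrier G"
  using that by (simp add: HH.mult_mon \<psi>_eq \<chi>_one)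

lemma mon_power: "mon (\<one>\<^bsub>G\<^esub>, i) 1 \<otimes>\<^bsub>H\<^esub> mon (\<one>\<^bsub>G\<^esub>, j) 1 = mon (\<one>\<^bsub>G\<^esub>, i + j) 1"
  by (simp add: HH.mult_mon \<psi>_eq \<chi>_one)

lemma ore_x_pow: "ore_x G [^]\<^bsub>H\<^esub> (n :: nat) = mon (\<one>\<^bsub>G\<^esub>, n) 1"
  by (induction n) (simp_all add: HH.one_eq ore_x_def mon_power)

end

locale ore_module = ore_setting G \<chi> a s \<psi> + M: left_module "hopf_ore G \<psi> a" M
  for G :: "('g, 'x) monoid_scheme" and \<chi> :: "'g \<Rightarrow> 'k::alg_closed_field" and a s \<psi>
    and M :: "('g \<times> nat \<Rightarrow>\<^sub>0 'k, 'm) module"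
begin

definition op :: "'g \<Rightarrow> 'k \<Rightarrow> 'm \<Rightarrow> 'm" where "op g c v = mon (g, 0) c \<odot>\<^bsub>M\<^esub> v"

definition xop :: "'m \<Rightarrow> 'm" where "xop v = ore_x G \<odot>\<^bsub>M\<^esub> v"

abbreviation sc :: "'k \<Rightarrow> 'm \<Rightarrow> 'm" where "sc \<equiv> op \<one>\<^bsub>G\<^esub>"

lemma op_closed [simp]: "\<lbrakk>g \<in> carrier G; v \<in> carrier M\<rbrakk> \<Longrightarrow> op g c v \<in> carrier M"
  unfolding op_def by (intro M.smult_closed HH.mon_closed) auto

lemma xop_closed [simp]: "v \<in> carrier M \<Longrightarrow> xop v \<in> carrier M"
  unfolding xop_def ore_x_def by (intro M.smult_closed HH.mon_closed) auto

lemma op_add: "\<lbrakk>g \<in> carrier G; u \<in> carrier M; v \<in> carrier M\<rbrakk> \<Longrightarrow> op g c (u \<oplus>\<^bsub>M\<^esub> v) = op g c u \<oplus>\<^bsub>M\<^esub> op g c v"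
  unfolding op_def by (intro M.smult_r_distr HH.mon_closed) auto

lemma xop_add: "\<lbrakk>u \<in> carrier M; v \<in> carrier M\<rbrakk> \<Longrightarrow> xop (u \<oplus>\<^bsub>M\<^esub> v) = xop u \<oplus>\<^bsub>M\<^esub> xop v"
  unfolding xop_def ore_x_def by (intro M.smult_r_distr HH.mon_closed) auto

lemma op_zero [simp]: "g \<in> carrier G \<Longrightarrow> op g c \<zero>\<^bsub>M\<^esub> = \<zero>\<^bsub>M\<^esub>"
  unfolding op_def by (intro M.smult_r_null HH.mon_closed) auto

lemma xop_zero [simp]: "xop \<zero>\<^bsub>M\<^esub> = \<zero>\<^bsub>M\<^esub>"
  unfolding xop_def ore_x_def by (intro M.smult_r_null HH.mon_closed) auto

lemma op_scalar_add: "\<lbrakk>g \<in> carrier G; v \<in> carrier M\<rbrakk> \<Longrightarrow> op g (c + d) v = op g c v \<oplus>\<^bsub>M\<^esub> op g d v"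
  unfolding op_def single_add using M.smult_l_distr[of "mon (g, 0) c" "mon (g, 0) d" v]
  by (simp add: HH.mon_closed HH.add_eq)

lemma op_scalar_zero [simp]: "\<lbrakk>g \<in> carrier G; v \<in> carrier M\<rbrakk> \<Longrightarrow> op g 0 v = \<zero>\<^bsub>M\<^esub>"
  unfolding op_def using M.smult_l_null[of v] by (simp add: HH.zero_eq)

lemma op_op: "\<lbrakk>g \<in> carrier G; h \<in> carrier G; v \<in> carrier M\<rbrakk> \<Longrightarrow> op g c (op h d v) = op (g \<otimes>\<^bsub>G\<^esub> h) (c * d) v"
  unfolding op_def using M.smult_assoc[of "mon (g, 0) c" "mon (h, 0) d" v]
  by (simp add: HH.mon_closed HH.mult_mon)

lemma sc_one [simp]: "v \<in> carrier M \<Longrightarrow> sc 1 v = v"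
  unfolding op_def using M.smult_one[of v] by (simp add: HH.one_eq)

lemma xop_op: "\<lbrakk>g \<in> carrier G; v \<in> carrier M\<rbrakk> \<Longrightarrow> xop (op g c v) = op g (c * inverse (\<chi> g)) (xop v)"
  unfolding op_def xop_def ore_x_def
  using M.smult_assoc[of "mon (\<one>\<^bsub>G\<^esub>, 1) 1" "mon (g, 0) c" v]
    M.smult_assoc[of "mon (g, 0) (c * inverse (\<chi> g))" "mon (\<one>\<^bsub>G\<^esub>, 1) 1" v]
  by (simp add: HH.mon_closed HH.mult_mon \<psi>_eq \<chi>_one)

lemma mon_smult:
  assumes "v \<in> carrier M"
  shows "mon (\<one>\<^bsub>G\<^esub>, i) 1 \<odot>\<^bsub>M\<^esub> v = (xop ^^ i) v"
    and "g \<in> carrier G \<Longrightarrow> mon (g, i) c \<odot>\<^bsub>M\<^esub> v = op g c ((xop ^^ i) v)"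
proof -
  show *: "mon (\<one>\<^bsub>G\<^esub>, i) 1 \<odot>\<^bsub>M\<^esub> v = (xop ^^ i) v"
  proof (induction i)
    case 0 then show ?case using sc_one[OF assms] by (simp add: op_def)
  next
    case (Suc i)
    have "mon (\<one>\<^bsub>G\<^esub>, Suc i) 1 \<odot>\<^bsub>M\<^esub> v = (mon (\<one>\<^bsub>G\<^esub>, 1) 1 \<otimes>\<^bsub>H\<^esub> mon (\<one>\<^bsub>G\<^esub>, i) 1) \<odot>\<^bsub>M\<^esub> v" by (simp add: mon_power)
    also have "\<dots> = xop (mon (\<one>\<^bsub>G\<^esub>, i) 1 \<odot>\<^bsub>M\<^esub> v)"
      unfolding xop_def ore_x_def using assms by (intro M.smult_assoc HH.mon_closed) auto
    finally show ?case using Suc by simp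
  qed
  assume "g \<in> carrier G"
  then show "mon (g, i) c \<odot>\<^bsub>M\<^esub> v = op g c ((xop ^^ i) v)"
    using M.smult_assoc[of "mon (g, 0) c" "mon (\<one>\<^bsub>G\<^esub>, i) 1" v] mon_split[of g i c] * assms
    by (simp add: op_def HH.mon_closed)
qed

lemma ore_submoduleI:
  assumes N: "N \<subseteq> carrier M" "\<zero>\<^bsub>M\<^esub> \<in> N" "\<And>u v. \<lbrakk>u \<in> N; v \<in> N\<rbrakk> \<Longrightarrow> u \<oplus>\<^bsub>M\<^esub> v \<in> N"
    and op: "\<And>g c v. \<lbrakk>g \<in> carrier G; v \<in> N\<rbrakk> \<Longrightarrow> op g c v \<in> N" and x: "\<And>v. v \<in> N \<Longrightarrow> xop v \<in> N"
  shows "submodule N H M"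
proof (rule HH.submodule_monI[OF M.left_module_axioms N])
  fix p c v assume p: "p \<in> carrier G \<times> (UNIV :: nat set)" and v: "v \<in> N"
  obtain g i where gi: "p = (g, i)" "g \<in> carrier G" using p by auto
  have "(xop ^^ i) v \<in> N" using x v by (induction i) auto
  then show "mon p c \<odot>\<^bsub>M\<^esub> v \<in> N" using op gi v N(1) mon_smult(2)[of v g i c] by auto
qed

lemma ore_submoduleD:
  assumes "submodule N H M"
  shows "\<And>g c v. \<lbrakk>g \<in> carrier G; v \<in> N\<rbrakk> \<Longrightarrow> op g c v \<in> N" "\<And>v. v \<in> N \<Longrightarrow> xop v \<in> N"
  using M.submoduleD(4)[OF assms] unfolding op_def xop_def ore_x_def by (simp_all add: HH.mon_closed)

lemma op_restriction: "mon g c \<odot>\<^bsub>restriction M\<^esub> v = op g c v"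
  by (simp add: ore_embed_mon op_def)

lemma funpow_x_closed [simp]: "v \<in> carrier M \<Longrightarrow> (xop ^^ i) v \<in> carrier M"
  by (induction i) auto

lemma funpow_x_add: "\<lbrakk>u \<in> carrier M; v \<in> carrier M\<rbrakk> \<Longrightarrow> (xop ^^ i) (u \<oplus>\<^bsub>M\<^esub> v) = (xop ^^ i) u \<oplus>\<^bsub>M\<^esub> (xop ^^ i) v"
  by (induction i) (auto simp: xop_add)

lemma funpow_x_zero [simp]: "(xop ^^ i) \<zero>\<^bsub>M\<^esub> = \<zero>\<^bsub>M\<^esub>"
  by (induction i) auto

lemma funpow_x_op:
  "\<lbrakk>g \<in> carrier G; v \<in> carrier M\<rbrakk> \<Longrightarrow> (xop ^^ i) (op g c v) = op g (c * inverse (\<chi> g) ^ i) ((xop ^^ i) v)"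
  by (induction i) (auto simp: xop_op mult_ac)

lemma funpow_x_sc: "v \<in> carrier M \<Longrightarrow> (xop ^^ i) (sc c v) = sc c ((xop ^^ i) v)"
  by (simp add: funpow_x_op \<chi>_one)

end

lemma (in ore_setting) ore_linear_mapI:
  fixes M :: "('g \<times> nat \<Rightarrow>\<^sub>0 'k, 'm) module" and N :: "('g \<times> nat \<Rightarrow>\<^sub>0 'k, 'n) module"
  assumes M: "left_module H M" and N: "left_module H N" and f: "f \<in> carrier M \<rightarrow> carrier N"
    and add: "\<And>u v. \<lbrakk>u \<in> carrier M; v \<in> carrier M\<rbrakk> \<Longrightarrow> f (u \<oplus>\<^bsub>M\<^esub> v) = f u \<oplus>\<^bsub>N\<^esub> f v"
    and op: "\<And>g c v. \<lbrakk>g \<in> carrier G; v \<in> carrier M\<rbrakk> \<Longrightarrow> f (mon (g, 0) c \<odot>\<^bsub>M\<^esub> v) = mon (g, 0) c \<odot>\<^bsub>N\<^esub> f v"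
    and x: "\<And>v. v \<in> carrier M \<Longrightarrow> f (ore_x G \<odot>\<^bsub>M\<^esub> v) = ore_x G \<odot>\<^bsub>N\<^esub> f v"
  shows "linear_map H M N f"
proof (rule HH.linear_mapI[OF M N f add])
  interpret M: ore_module G \<chi> a s \<psi> M using M by (simp add: ore_module_def ore_setting_axioms)
  interpret N: ore_module G \<chi> a s \<psi> N using N by (simp add: ore_module_def ore_setting_axioms)
  fix p c v assume p: "p \<in> carrier G \<times> (UNIV :: nat set)" and v: "v \<in> carrier M"
  obtain g i where gi: "p = (g, i)" "g \<in> carrier G" using p by auto
  have fv: "f v \<in> carrier N" if "v \<in> carrier M" for v using f that by auto
  have "f ((M.xop ^^ i) v) = (N.xop ^^ i) (f v)"
    by (induction i) (use x v in \<open>auto simp: M.xop_def[symmetric] N.xop_def[symmetric]\<close>)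
  then show "f (mon p c \<odot>\<^bsub>M\<^esub> v) = mon p c \<odot>\<^bsub>N\<^esub> f v"
    using op[OF gi(2), of "(M.xop ^^ i) v" c] gi v fv M.mon_smult(2)[of v g i c] N.mon_smult(2)[of "f v" g i c]
    by (simp add: M.op_def N.op_def)
qed auto

section \<open>The operator \<open>y = x\<^sup>m - \<beta>\<close>\<close>

text \<open>
  The two families of modules are treated together: \<open>V\<^sub>t(i)\<close> is the case \<open>m = 1\<close>, \<open>\<beta> = 0\<close> and
  \<open>V\<^sub>t(i, \<beta>)\<close> is the case \<open>m = s\<close>, \<open>\<beta> \<noteq> 0\<close>. In both cases \<open>y\<close> commutes with \<open>G\<close> up to the
  character \<open>\<chi>\<^sup>m\<close>, because \<open>\<beta> = 0\<close> or \<open>\<chi>\<^sup>m = 1\<close>.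
\<close>

locale ore_param = ore_setting G \<chi> a s \<psi>
  for G :: "('g, 'x) monoid_scheme" and \<chi> :: "'g \<Rightarrow> 'k::alg_closed_field" and a s \<psi> +
  fixes m :: nat and \<beta> :: 'k
  assumes param: "m = 1 \<and> \<beta> = 0 \<or> m = s \<and> \<beta> \<noteq> 0"
begin

lemma m_pos: "0 < m"
  using param s_pos by auto

lemma \<beta>_\<chi>: "g \<in> carrier G \<Longrightarrow> \<beta> * \<chi> g ^ m = \<beta>"
  using param \<chi>_power by auto

lemma q_power: "\<lbrakk>0 < b; b < m\<rbrakk> \<Longrightarrow> \<chi> a ^ b \<noteq> 1"
  using param ord_q[of b] by (auto dest: dvd_imp_le)

lemma \<beta>_nonzero: "1 < m \<Longrightarrow> \<beta> \<noteq> 0"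
  using param by auto

end

locale param_module = ore_param G \<chi> a s \<psi> m \<beta> + ore_module G \<chi> a s \<psi> M
  for G :: "('g, 'x) monoid_scheme" and \<chi> :: "'g \<Rightarrow> 'k::alg_closed_field" and a s \<psi> m \<beta>
    and M :: "('g \<times> nat \<Rightarrow>\<^sub>0 'k, 'm) module"
begin

definition yop :: "'m \<Rightarrow> 'm" where "yop v = (xop ^^ m) v \<oplus>\<^bsub>M\<^esub> sc (- \<beta>) v"

lemma yop_closed [simp]: "v \<in> carrier M \<Longrightarrow> yop v \<in> carrier M"
  by (simp add: yop_def)

lemma yop_zero [simp]: "yop \<zero>\<^bsub>M\<^esub> = \<zero>\<^bsub>M\<^esub>"
  by (simp add: yop_def)

lemma yop_add: "\<lbrakk>u \<in> carrier M; v \<in> carrier M\<rbrakk> \<Longrightarrow> yop (u \<oplus>\<^bsub>M\<^esub> v) = yop u \<oplus>\<^bsub>M\<^esub> yop v"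
  by (simp add: yop_def funpow_x_add op_add M.M.a_ac)

lemma yop_xop: "v \<in> carrier M \<Longrightarrow> yop (xop v) = xop (yop v)"
  by (simp add: yop_def xop_add xop_op \<chi>_one flip: funpow_swap1)

lemma yop_op:
  assumes "g \<in> carrier G" "v \<in> carrier M"
  shows "yop (op g c v) = op g (c * inverse (\<chi> g) ^ m) (yop v)"
proof -
  have "inverse (\<chi> g) ^ m * (\<beta> * \<chi> g ^ m) = \<beta>"
    using \<chi>_nonzero[OF assms(1)] by (simp add: power_inverse)
  then have "inverse (\<chi> g) ^ m * \<beta> = \<beta>" unfolding \<beta>_\<chi>[OF assms(1)] .
  then have "c * inverse (\<chi> g) ^ m * - \<beta> = - \<beta> * c" by (metis mult.commute mult.left_commute mult_minus_right)
  moreover have "yop (op g c v) = op g (c * inverse (\<chi> g) ^ m) ((xop ^^ m) v) \<oplus>\<^bsub>M\<^esub> op g (- \<beta> * c) v"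
    using assms by (simp add: yop_def funpow_x_op op_op)
  moreover have "op g (c * inverse (\<chi> g) ^ m) (yop v) =
      op g (c * inverse (\<chi> g) ^ m) ((xop ^^ m) v) \<oplus>\<^bsub>M\<^esub> op g (c * inverse (\<chi> g) ^ m * - \<beta>) v"
    using assms by (simp add: yop_def op_add op_op)
  ultimately show ?thesis by metis
qed

lemma xop_power_m: "v \<in> carrier M \<Longrightarrow> (xop ^^ m) v = yop v \<oplus>\<^bsub>M\<^esub> sc \<beta> v"
  by (simp add: yop_def M.M.a_assoc flip: op_scalar_add)

lemma funpow_y_closed [simp]: "v \<in> carrier M \<Longrightarrow> (yop ^^ n) v \<in> carrier M"
  by (induction n) auto

lemma funpow_y_zero [simp]: "(yop ^^ n) \<zero>\<^bsub>M\<^esub> = \<zero>\<^bsub>M\<^esub>"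
  by (induction n) auto

lemma funpow_y_add: "\<lbrakk>u \<in> carrier M; v \<in> carrier M\<rbrakk> \<Longrightarrow> (yop ^^ n) (u \<oplus>\<^bsub>M\<^esub> v) = (yop ^^ n) u \<oplus>\<^bsub>M\<^esub> (yop ^^ n) v"
  by (induction n) (auto simp: yop_add)

lemma funpow_y_x: "v \<in> carrier M \<Longrightarrow> (yop ^^ n) ((xop ^^ i) v) = (xop ^^ i) ((yop ^^ n) v)"
proof (induction n)
  case (Suc n)
  have "yop ((xop ^^ i) w) = (xop ^^ i) (yop w)" if "w \<in> carrier M" for w
    by (induction i) (use that in \<open>auto simp: yop_xop\<close>)
  then show ?case using Suc by simp
qed simp

lemma funpow_y_op:
  "\<lbrakk>g \<in> carrier G; v \<in> carrier M\<rbrakk> \<Longrightarrow> (yop ^^ n) (op g c v) = op g (c * inverse (\<chi> g) ^ (n * m)) ((yop ^^ n) v)"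
  by (induction n) (auto simp: yop_op power_add mult_ac)

lemma funpow_y_sc: "v \<in> carrier M \<Longrightarrow> (yop ^^ n) (sc c v) = sc c ((yop ^^ n) v)"
  by (simp add: funpow_y_op \<chi>_one)

end

section \<open>The model of \<open>V\<^sub>t(i)\<close> and \<open>V\<^sub>t(i, \<beta>)\<close>\<close>

locale kG_module = ore_setting G \<chi> a s \<psi> + V: left_module "group_algebra G" V
  for G :: "('g, 'x) monoid_scheme" and \<chi> :: "'g \<Rightarrow> 'k::alg_closed_field" and a s \<psi>
    and V :: "('g \<Rightarrow>\<^sub>0 'k, 'v) module"
begin

definition gop :: "'g \<Rightarrow> 'k \<Rightarrow> 'v \<Rightarrow> 'v" where "gop g c v = mon g c \<odot>\<^bsub>V\<^esub> v"

lemma gop_closed [simp]: "\<lbrakk>g \<in> carrier G; v \<in> carrier V\<rbrakk> \<Longrightarrow> gop g c v \<in> carrier V"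
  unfolding gop_def by (intro V.smult_closed kG.mon_closed) auto

lemma gop_add: "\<lbrakk>g \<in> carrier G; u \<in> carrier V; v \<in> carrier V\<rbrakk> \<Longrightarrow> gop g c (u \<oplus>\<^bsub>V\<^esub> v) = gop g c u \<oplus>\<^bsub>V\<^esub> gop g c v"
  unfolding gop_def by (intro V.smult_r_distr kG.mon_closed) auto

lemma gop_zero [simp]: "g \<in> carrier G \<Longrightarrow> gop g c \<zero>\<^bsub>V\<^esub> = \<zero>\<^bsub>V\<^esub>"
  unfolding gop_def by (intro V.smult_r_null kG.mon_closed) auto

lemma gop_scalar_add: "\<lbrakk>g \<in> carrier G; v \<in> carrier V\<rbrakk> \<Longrightarrow> gop g (c + d) v = gop g c v \<oplus>\<^bsub>V\<^esub> gop g d v"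
  unfolding gop_def single_add using V.smult_l_distr[of "mon g c" "mon g d" v]
  by (simp add: kG.mon_closed kG.add_eq)

lemma gop_scalar_zero [simp]: "\<lbrakk>g \<in> carrier G; v \<in> carrier V\<rbrakk> \<Longrightarrow> gop g 0 v = \<zero>\<^bsub>V\<^esub>"
  unfolding gop_def using V.smult_l_null[of v] by (simp add: kG.zero_eq)

lemma gop_gop: "\<lbrakk>g \<in> carrier G; h \<in> carrier G; v \<in> carrier V\<rbrakk> \<Longrightarrow> gop g c (gop h d v) = gop (g \<otimes>\<^bsub>G\<^esub> h) (c * d) v"
  unfolding gop_def using V.smult_assoc[of "mon g c" "mon h d" v]
  by (simp add: kG.mon_closed kG.mult_mon)

lemma gop_one [simp]: "v \<in> carrier V \<Longrightarrow> gop \<one>\<^bsub>G\<^esub> 1 v = v"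
  unfolding gop_def using V.smult_one[of v] by (simp add: kG.one_eq)

end

text \<open>
  A function \<open>d\<close> on \<open>{..<t} \<times> {..<m}\<close> with values in \<open>V\<close> stands for
  \<open>\<Sum> y\<^sup>c x\<^sup>b \<otimes> d (c, b)\<close>.
\<close>

locale model = ore_param G \<chi> a s \<psi> m \<beta> + kG_module G \<chi> a s \<psi> V
  for G :: "('g, 'x) monoid_scheme" and \<chi> :: "'g \<Rightarrow> 'k::alg_closed_field" and a s \<psi> m \<beta>
    and V :: "('g \<Rightarrow>\<^sub>0 'k, 'v) module" +
  fixes t :: nat
begin

definition Ix :: "(nat \<times> nat) set" where "Ix = {..<t} \<times> {..<m}"

definition group_D :: "('k, nat \<times> nat \<Rightarrow> 'v) module"
  where "group_D = \<lparr>carrier = {d. (\<forall>p\<in>Ix. d p \<in> carrier V) \<and> (\<forall>p. p \<notin> Ix \<longrightarrow> d p = \<zero>\<^bsub>V\<^esub>)},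
    monoid.mult = (\<lambda>_ _. undefined), one = undefined, ring.zero = (\<lambda>_. \<zero>\<^bsub>V\<^esub>),
    ring.add = (\<lambda>d d' p. d p \<oplus>\<^bsub>V\<^esub> d' p), module.smult = (\<lambda>_ _. undefined)\<rparr>"

text \<open>\<open>g y\<^sup>c x\<^sup>b = \<chi>(g)\<^sup>n y\<^sup>c x\<^sup>b g\<close> with \<open>n = c m + b\<close>\<close>

definition gD :: "'g \<Rightarrow> 'k \<Rightarrow> (nat \<times> nat \<Rightarrow> 'v) \<Rightarrow> nat \<times> nat \<Rightarrow> 'v"
  where "gD g k d = (\<lambda>(c, b). gop g (k * \<chi> g ^ (c * m + b)) (d (c, b)))"

text \<open>
  \<open>x (y\<^sup>c x\<^sup>b) = y\<^sup>c x\<^sup>b\<^sup>+\<^sup>1\<close> and \<open>y\<^sup>c x\<^sup>m = \<beta> y\<^sup>c + y\<^sup>c\<^sup>+\<^sup>1\<close>, so a component with \<open>b = 0\<close> receives two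
  contributions.
\<close>

definition xD :: "(nat \<times> nat \<Rightarrow> 'v) \<Rightarrow> nat \<times> nat \<Rightarrow> 'v"
  where "xD d = (\<lambda>(c, b). if (c, b) \<notin> Ix then \<zero>\<^bsub>V\<^esub>
    else if 0 < b then d (c, b - 1)
    else gop \<one>\<^bsub>G\<^esub> \<beta> (d (c, m - 1)) \<oplus>\<^bsub>V\<^esub> (if 0 < c then d (c - 1, m - 1) else \<zero>\<^bsub>V\<^esub>))"

definition D :: "('g \<times> nat \<Rightarrow>\<^sub>0 'k, nat \<times> nat \<Rightarrow> 'v) module"
  where "D = HH.action_module group_D (\<lambda>p k d. gD (fst p) k ((xD ^^ snd p) d))"

lemma finite_Ix [simp]: "finite Ix"
  by (simp add: Ix_def)

lemma carrier_group_D: "d \<in> carrier group_D \<longleftrightarrow> (\<forall>p. d p \<in> carrier V) \<and> (\<forall>p. p \<notin> Ix \<longrightarrow> d p = \<zero>\<^bsub>V\<^esub>)"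
proof -
  have "(\<forall>p\<in>Ix. d p \<in> carrier V) \<and> (\<forall>p. p \<notin> Ix \<longrightarrow> d p = \<zero>\<^bsub>V\<^esub>) \<longleftrightarrow>
    (\<forall>p. d p \<in> carrier V) \<and> (\<forall>p. p \<notin> Ix \<longrightarrow> d p = \<zero>\<^bsub>V\<^esub>)" by (metis V.M.zero_closed)
  then show ?thesis by (simp add: group_D_def)
qed

lemma group_D_simps [simp]: "\<zero>\<^bsub>group_D\<^esub> = (\<lambda>_. \<zero>\<^bsub>V\<^esub>)" "d \<oplus>\<^bsub>group_D\<^esub> d' = (\<lambda>p. d p \<oplus>\<^bsub>V\<^esub> d' p)"
  by (simp_all add: group_D_def)

lemma abelian_group_D: "abelian_group group_D"
proof (rule abelian_groupI, goal_cases)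
  case (6 d)
  then show ?case
    by (intro bexI[of _ "\<lambda>p. if p \<in> Ix then \<ominus>\<^bsub>V\<^esub> d p else \<zero>\<^bsub>V\<^esub>"]) (auto simp: carrier_group_D V.M.l_neg fun_eq_iff)
qed (auto simp: carrier_group_D V.M.a_ac)

lemma gD_closed: "\<lbrakk>g \<in> carrier G; d \<in> carrier group_D\<rbrakk> \<Longrightarrow> gD g k d \<in> carrier group_D"
  by (auto simp: carrier_group_D gD_def)

lemma xD_closed: "d \<in> carrier group_D \<Longrightarrow> xD d \<in> carrier group_D"
  by (auto simp: carrier_group_D xD_def)

lemma xD_add:
  "\<lbrakk>d \<in> carrier group_D; d' \<in> carrier group_D\<rbrakk> \<Longrightarrow> xD (\<lambda>p. d p \<oplus>\<^bsub>V\<^esub> d' p) = (\<lambda>p. xD d p \<oplus>\<^bsub>V\<^esub> xD d' p)"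
  by (auto simp: carrier_group_D xD_def fun_eq_iff gop_add V.M.a_ac)

lemma xD_gD:
  assumes g: "g \<in> carrier G" and d: "d \<in> carrier group_D"
  shows "xD (gD g k d) = gD g (k * inverse (\<chi> g)) (xD d)"
proof (rule ext, clarify)
  fix c b
  have dc: "d p \<in> carrier V" for p using d unfolding carrier_group_D by blast
  have \<chi>0: "\<chi> g \<noteq> 0" by (rule \<chi>_nonzero[OF g])
  show "xD (gD g k d) (c, b) = gD g (k * inverse (\<chi> g)) (xD d) (c, b)"
  proof (cases "(c, b) \<in> Ix")
    case False then show ?thesis using g by (simp add: xD_def gD_def)
  next
    case Ix: True
    show ?thesis
    proof (cases b)
      case (Suc b')
      then show ?thesis using Ix \<chi>0 by (simp add: xD_def gD_def field_simps)
    next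
      case 0
      let ?K = "k * inverse (\<chi> g) * \<chi> g ^ (c * m)"
      have m: "m = Suc (m - 1)" using m_pos by simp
      have "\<chi> g ^ m = \<chi> g * \<chi> g ^ (m - 1)" by (subst m) simp
      then have "\<beta> * (k * \<chi> g ^ (c * m + (m - 1))) = k * inverse (\<chi> g) * \<chi> g ^ (c * m) * (\<beta> * \<chi> g ^ m)"
        using \<chi>0 by (simp add: power_add)
      then have 1: "\<beta> * (k * \<chi> g ^ (c * m + (m - 1))) = ?K * \<beta>"
        using \<beta>_\<chi>[OF g] by simp
      have 2: "k * \<chi> g ^ ((c - 1) * m + (m - 1)) = ?K" if "0 < c"
      proof -
        have "c * m = Suc ((c - 1) * m + (m - 1))" using that m by (cases c) simp_all
        then show ?thesis using \<chi>0 by simp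
      qed
      have "xD (gD g k d) (c, b) = gop \<one>\<^bsub>G\<^esub> \<beta> (gop g (k * \<chi> g ^ (c * m + (m - 1))) (d (c, m - 1)))
          \<oplus>\<^bsub>V\<^esub> (if 0 < c then gop g (k * \<chi> g ^ ((c - 1) * m + (m - 1))) (d (c - 1, m - 1)) else \<zero>\<^bsub>V\<^esub>)"
        using Ix 0 by (simp add: xD_def gD_def)
      also have "\<dots> = gop g (?K * \<beta>) (d (c, m - 1)) \<oplus>\<^bsub>V\<^esub> (if 0 < c then gop g ?K (d (c - 1, m - 1)) else \<zero>\<^bsub>V\<^esub>)"
        unfolding gop_gop[OF G.one_closed g dc] 1 G.l_one[OF g] by (cases "0 < c") (simp_all only: 2 if_True if_False)
      also have "\<dots> = gop g ?K (gop \<one>\<^bsub>G\<^esub> \<beta> (d (c, m - 1)) \<oplus>\<^bsub>V\<^esub> (if 0 < c then d (c - 1, m - 1) else \<zero>\<^bsub>V\<^esub>))"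
        using g dc by (simp add: gop_add gop_gop)
      also have "\<dots> = gD g (k * inverse (\<chi> g)) (xD d) (c, b)"
        using Ix 0 by (simp add: xD_def gD_def)
      finally show ?thesis .
    qed
  qed
qed

lemma funpow_xD_closed: "d \<in> carrier group_D \<Longrightarrow> (xD ^^ i) d \<in> carrier group_D"
  by (induction i) (auto simp: xD_closed)

lemma funpow_xD_add:
  "\<lbrakk>d \<in> carrier group_D; d' \<in> carrier group_D\<rbrakk> \<Longrightarrow> (xD ^^ i) (\<lambda>p. d p \<oplus>\<^bsub>V\<^esub> d' p) = (\<lambda>p. (xD ^^ i) d p \<oplus>\<^bsub>V\<^esub> (xD ^^ i) d' p)"
  by (induction i) (auto simp: xD_add funpow_xD_closed)

lemma funpow_xD_gD:
  "\<lbrakk>g \<in> carrier G; d \<in> carrier group_D\<rbrakk> \<Longrightarrow> (xD ^^ i) (gD g k d) = gD g (k * inverse (\<chi> g) ^ i) ((xD ^^ i) d)"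
  by (induction i) (auto simp: xD_gD funpow_xD_closed mult_ac)

lemma gD_gD:
  "\<lbrakk>g \<in> carrier G; h \<in> carrier G; d \<in> carrier group_D\<rbrakk> \<Longrightarrow> gD g k (gD h l d) = gD (g \<otimes>\<^bsub>G\<^esub> h) (k * l) d"
  by (auto simp: gD_def carrier_group_D gop_gop \<chi>_mult power_mult_distrib mult_ac)

lemma action_D:
  "left_module H D" "\<And>g i k d. \<lbrakk>g \<in> carrier G; d \<in> carrier group_D\<rbrakk> \<Longrightarrow> mon (g, i) k \<odot>\<^bsub>D\<^esub> d = gD g k ((xD ^^ i) d)"
proof -
  let ?act = "\<lambda>p k d. gD (fst p) k ((xD ^^ snd p) d)"
  have 1: "?act p k d \<in> carrier group_D" if "p \<in> carrier G \<times> (UNIV :: nat set)" "d \<in> carrier group_D" for p k d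
    using that by (intro gD_closed funpow_xD_closed) auto
  have 2: "?act p k (d \<oplus>\<^bsub>group_D\<^esub> d') = ?act p k d \<oplus>\<^bsub>group_D\<^esub> ?act p k d'"
    if "p \<in> carrier G \<times> (UNIV :: nat set)" "d \<in> carrier group_D" "d' \<in> carrier group_D" for p k d d'
    using that funpow_xD_closed[of d] funpow_xD_closed[of d']
    by (auto simp: funpow_xD_add gD_def gop_add carrier_group_D fun_eq_iff)
  have 3: "?act p (k + l) d = ?act p k d \<oplus>\<^bsub>group_D\<^esub> ?act p l d"
    if "p \<in> carrier G \<times> (UNIV :: nat set)" "d \<in> carrier group_D" for p k l d
    using that funpow_xD_closed[of d] by (auto simp: gD_def gop_scalar_add carrier_group_D fun_eq_iff distrib_right)
  have 4: "?act p k (?act q l d) = ?act (fst p \<otimes>\<^bsub>G\<^esub> fst q, snd p + snd q) (k * l * \<psi> (fst q) ^ snd p) d"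
    if "p \<in> carrier G \<times> (UNIV :: nat set)" "q \<in> carrier G \<times> (UNIV :: nat set)" "d \<in> carrier group_D" for p k q l d
    using that by (auto simp: funpow_xD_gD gD_gD funpow_xD_closed \<psi>_eq funpow_add mult_ac)
  have 5: "?act (\<one>\<^bsub>G\<^esub>, 0) 1 d = d" if "d \<in> carrier group_D" for d
    using that by (auto simp: gD_def \<chi>_one carrier_group_D)
  show "left_module H D" unfolding D_def
    by (rule HH.left_module_action[OF abelian_group_D 1 2 3 4 5])
  show "mon (g, i) k \<odot>\<^bsub>D\<^esub> d = gD g k ((xD ^^ i) d)" if "g \<in> carrier G" "d \<in> carrier group_D" for g i k d
    unfolding D_def
    by (subst HH.smult_mon[OF abelian_group_D 1 2 3 4 5]) (use that in auto)
qed

end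

sublocale model \<subseteq> D: param_module G \<chi> a s \<psi> m \<beta> D
  by (intro param_module.intro ore_param_axioms ore_module.intro ore_setting_axioms action_D(1))

context model
begin

lemma D_simps [simp]: "carrier D = carrier group_D" "\<zero>\<^bsub>D\<^esub> = (\<lambda>_. \<zero>\<^bsub>V\<^esub>)" "d \<oplus>\<^bsub>D\<^esub> d' = (\<lambda>p. d p \<oplus>\<^bsub>V\<^esub> d' p)"
  by (simp_all add: D_def)

lemma D_op: "\<lbrakk>g \<in> carrier G; d \<in> carrier group_D\<rbrakk> \<Longrightarrow> D.op g k d = gD g k d"
  using action_D(2)[of g d 0 k] by (simp add: D.op_def)

lemma D_xop: "d \<in> carrier group_D \<Longrightarrow> D.xop d = xD d"
  using action_D(2)[of "\<one>\<^bsub>G\<^esub>" d 1 1] xD_closed[of d]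
  by (auto simp: D.xop_def ore_x_def gD_def \<chi>_one carrier_group_D)

definition E :: "nat \<times> nat \<Rightarrow> 'v \<Rightarrow> nat \<times> nat \<Rightarrow> 'v"
  where "E p v = (\<lambda>p'. if p' = p \<and> p \<in> Ix then v else \<zero>\<^bsub>V\<^esub>)"

lemma E_closed [simp]: "v \<in> carrier V \<Longrightarrow> E p v \<in> carrier group_D"
  by (auto simp: E_def carrier_group_D)

lemma D_induct [consumes 1, case_names zero E add]:
  assumes d: "d \<in> carrier group_D" and zero: "P (\<lambda>_. \<zero>\<^bsub>V\<^esub>)"
    and E: "\<And>p v. \<lbrakk>p \<in> Ix; v \<in> carrier V\<rbrakk> \<Longrightarrow> P (E p v)"
    and add: "\<And>d d'. \<lbrakk>d \<in> carrier group_D; d' \<in> carrier group_D; P d; P d'\<rbrakk> \<Longrightarrow> P (\<lambda>p. d p \<oplus>\<^bsub>V\<^esub> d' p)"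
  shows "P d"
proof -
  have dc: "d p \<in> carrier V" for p using d unfolding carrier_group_D by blast
  have "P (\<lambda>p. if p \<in> A then d p else \<zero>\<^bsub>V\<^esub>)" if "finite A" "A \<subseteq> Ix" for A
    using that
  proof (induction A rule: finite_induct)
    case (insert p A)
    have "(\<lambda>p'. E p (d p) p' \<oplus>\<^bsub>V\<^esub> (if p' \<in> A then d p' else \<zero>\<^bsub>V\<^esub>)) = (\<lambda>p'. if p' \<in> insert p A then d p' else \<zero>\<^bsub>V\<^esub>)"
      using insert dc by (auto simp: E_def fun_eq_iff)
    moreover have "(\<lambda>p'. if p' \<in> A then d p' else \<zero>\<^bsub>V\<^esub>) \<in> carrier group_D"
      using insert dc by (auto simp: carrier_group_D)
    moreover have "P (E p (d p))" using E insert dc by simp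
    moreover have "P (\<lambda>p'. if p' \<in> A then d p' else \<zero>\<^bsub>V\<^esub>)" using insert by simp
    ultimately show ?case using add[of "E p (d p)" "\<lambda>p'. if p' \<in> A then d p' else \<zero>\<^bsub>V\<^esub>"] E_closed[OF dc] by simp
  qed (use zero in simp)
  from this[of Ix] moreover have "(\<lambda>p. if p \<in> Ix then d p else \<zero>\<^bsub>V\<^esub>) = d" using d by (auto simp: carrier_group_D)
  ultimately show ?thesis by simp
qed


lemma E_outside: "p \<notin> Ix \<Longrightarrow> E p v = (\<lambda>_. \<zero>\<^bsub>V\<^esub>)"
  by (simp add: E_def)

lemma Ix_iff: "(c, b) \<in> Ix \<longleftrightarrow> c < t \<and> b < m"
  by (simp add: Ix_def)

lemma op_E:
  assumes g: "g \<in> carrier G" and v: "v \<in> carrier V"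
  shows "D.op g k (E (c, b) v) = E (c, b) (gop g (k * \<chi> g ^ (c * m + b)) v)"
  unfolding D_op[OF g E_closed[OF v]] using g v by (auto simp: gD_def E_def fun_eq_iff)

lemma xop_E:
  assumes v: "v \<in> carrier V" and b: "Suc b < m"
  shows "D.xop (E (c, b) v) = E (c, Suc b) v"
  unfolding D_xop[OF E_closed[OF v]] using v b by (auto simp: xD_def E_def fun_eq_iff Ix_iff)

lemma xop_E_last:
  assumes v: "v \<in> carrier V"
  shows "D.xop (E (c, m - 1) v) = (\<lambda>p. E (c, 0) (gop \<one>\<^bsub>G\<^esub> \<beta> v) p \<oplus>\<^bsub>V\<^esub> E (Suc c, 0) v p)"
  unfolding D_xop[OF E_closed[OF v]] using v m_pos by (auto simp: xD_def E_def fun_eq_iff Ix_iff)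

lemma E_add: "\<lbrakk>u \<in> carrier V; v \<in> carrier V\<rbrakk> \<Longrightarrow> E p (u \<oplus>\<^bsub>V\<^esub> v) = (\<lambda>p'. E p u p' \<oplus>\<^bsub>V\<^esub> E p v p')"
  by (auto simp: E_def fun_eq_iff)

lemma funpow_x_E: "\<lbrakk>v \<in> carrier V; b + j < m\<rbrakk> \<Longrightarrow> (D.xop ^^ j) (E (c, b) v) = E (c, b + j) v"
  by (induction j) (auto simp: xop_E)

lemma yop_E: assumes v: "v \<in> carrier V" and b: "b < m" shows "D.yop (E (c, b) v) = E (Suc c, b) v"
proof -
  have "(D.xop ^^ m) (E (c, b) v) = (D.xop ^^ b) (D.xop ((D.xop ^^ (m - 1 - b)) (E (c, b) v)))"
  proof -
    have "m = b + Suc (m - 1 - b)" using b by simp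
    then have "(D.xop ^^ m) (E (c, b) v) = (D.xop ^^ (b + Suc (m - 1 - b))) (E (c, b) v)" by simp
    then show ?thesis by (simp only: funpow_add comp_apply funpow.simps(2))
  qed
  also have "\<dots> = (D.xop ^^ b) (D.xop (E (c, m - 1) v))" using b v by (simp add: funpow_x_E)
  also have "\<dots> = (D.xop ^^ b) (\<lambda>p. E (c, 0) (gop \<one>\<^bsub>G\<^esub> \<beta> v) p \<oplus>\<^bsub>V\<^esub> E (Suc c, 0) v p)"
    using v by (simp only: xop_E_last)
  also have "\<dots> = (\<lambda>p. E (c, b) (gop \<one>\<^bsub>G\<^esub> \<beta> v) p \<oplus>\<^bsub>V\<^esub> E (Suc c, b) v p)"
    using D.funpow_x_add[of "E (c, 0) (gop \<one>\<^bsub>G\<^esub> \<beta> v)" "E (Suc c, 0) v" b] v b by (simp add: funpow_x_E)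
  finally have *: "(D.xop ^^ m) (E (c, b) v) = (\<lambda>p. E (c, b) (gop \<one>\<^bsub>G\<^esub> \<beta> v) p \<oplus>\<^bsub>V\<^esub> E (Suc c, b) v p)" .
  have "gop \<one>\<^bsub>G\<^esub> \<beta> v \<oplus>\<^bsub>V\<^esub> gop \<one>\<^bsub>G\<^esub> (- \<beta>) v = \<zero>\<^bsub>V\<^esub>" using v by (simp flip: gop_scalar_add)
  then show ?thesis
    unfolding D.yop_def * op_E[OF G.one_closed v] using v by (auto simp: E_def fun_eq_iff \<chi>_one)
qed

lemma funpow_y_E: "\<lbrakk>v \<in> carrier V; b < m\<rbrakk> \<Longrightarrow> (D.yop ^^ n) (E (c, b) v) = E (c + n, b) v"
  by (induction n) (auto simp: yop_E)

lemma funpow_y_D: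
  "d \<in> carrier group_D \<Longrightarrow> (D.yop ^^ n) d = (\<lambda>(c, b). if (c, b) \<in> Ix \<and> n \<le> c then d (c - n, b) else \<zero>\<^bsub>V\<^esub>)"
proof (induction d rule: D_induct)
  case zero then show ?case using D.funpow_y_zero[of n] by auto
next
  case (E p v)
  obtain c b where p: "p = (c, b)" by force
  then have "b < m" "c < t" using E by (auto simp: Ix_iff)
  then show ?case using E(2) p by (auto simp: funpow_y_E) (auto simp: E_def Ix_iff fun_eq_iff)
next
  case (add d d')
  then have "d p \<in> carrier V" "d' p \<in> carrier V" for p unfolding carrier_group_D by blast+
  then show ?case using add D.funpow_y_add[of d d' n] by (auto simp: fun_eq_iff)
qed

lemma yop_nilpotent: "d \<in> carrier D \<Longrightarrow> (D.yop ^^ t) d = \<zero>\<^bsub>D\<^esub>"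
  by (auto simp: funpow_y_D Ix_iff fun_eq_iff)

lemma y_x_E: "\<lbrakk>v \<in> carrier V; b < m\<rbrakk> \<Longrightarrow> (D.yop ^^ c) ((D.xop ^^ b) (E (0, 0) v)) = E (c, b) v"
  by (simp add: funpow_x_E funpow_y_E)

text \<open>
  \<open>F\<close> is \<open>y\<^sup>c x\<^sup>b f\<close> on the component at \<open>(c, b)\<close>. It commutes with \<open>x\<close> also where the exponent
  \<open>b\<close> leaves the range below \<open>m\<close>, because \<open>x\<^sup>m = y + \<beta>\<close> on both sides, and where then \<open>c\<close> reaches
  \<open>t\<close>, because \<open>y\<^sup>t f = 0\<close>.
\<close>

lemma D_universal:
  fixes N :: "('g \<times> nat \<Rightarrow>\<^sub>0 'k, 'n) module"
  assumes N: "left_module H N" and f: "linear_map kG V (restriction N) f"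
    and y: "\<And>v. v \<in> carrier V \<Longrightarrow> (param_module.yop G m \<beta> N ^^ t) (f v) = \<zero>\<^bsub>N\<^esub>"
  obtains F where "linear_map H D N F" "\<And>v. v \<in> carrier V \<Longrightarrow> 0 < t \<Longrightarrow> F (E (0, 0) v) = f v"
proof -
  interpret N: param_module G \<chi> a s \<psi> m \<beta> N
    by (intro param_module.intro ore_param_axioms ore_module.intro ore_setting_axioms N)
  note fD = linear_mapD[OF f, simplified]
  have fop: "f (gop g k v) = N.op g k (f v)" if "g \<in> carrier G" "v \<in> carrier V" for g k v
    using that fD(3)[of "mon g k" v] by (simp add: gop_def N.op_def kG.mon_closed ore_embed_mon)
  define h where "h p v = (N.yop ^^ fst p) ((N.xop ^^ snd p) (f v))" for p v
  define F where "F d = (\<Oplus>\<^bsub>N\<^esub>p\<in>Ix. h p (d p))" for d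
  have hc [simp]: "h p v \<in> carrier N" if "v \<in> carrier V" for p v using that fD(1) by (simp add: h_def)
  have hadd: "h p (u \<oplus>\<^bsub>V\<^esub> v) = h p u \<oplus>\<^bsub>N\<^esub> h p v" if "u \<in> carrier V" "v \<in> carrier V" for p u v
    using that fD(1,2) by (simp add: h_def N.funpow_x_add N.funpow_y_add)
  have h0: "h p \<zero>\<^bsub>V\<^esub> = \<zero>\<^bsub>N\<^esub>" for p
    using hadd[of "\<zero>\<^bsub>V\<^esub>" "\<zero>\<^bsub>V\<^esub>" p] hc[of "\<zero>\<^bsub>V\<^esub>" p] by simp
  have dc: "d p \<in> carrier V" if "d \<in> carrier group_D" for d p using that unfolding carrier_group_D by blast
  have Fc: "F d \<in> carrier N" if "d \<in> carrier group_D" for d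
    unfolding F_def using that dc by (intro N.M.finsum_closed) auto
  have Fadd: "F (\<lambda>p. d p \<oplus>\<^bsub>V\<^esub> d' p) = F d \<oplus>\<^bsub>N\<^esub> F d'" if "d \<in> carrier group_D" "d' \<in> carrier group_D" for d d'
    unfolding F_def using that dc by (subst N.M.finsum_addf[symmetric]) (auto simp: hadd intro!: N.M.finsum_cong')
  have FE: "F (E p v) = h p v" if "v \<in> carrier V" "p \<in> Ix" for p v
  proof -
    have "F (E p v) = (\<Oplus>\<^bsub>N\<^esub>p'\<in>Ix. if p = p' then h p' v else \<zero>\<^bsub>N\<^esub>)"
      unfolding F_def by (rule N.M.finsum_cong') (use that h0 in \<open>auto simp: E_def\<close>)
    also have "\<dots> = h p v" by (rule N.M.finsum_singleton) (use that in auto)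
    finally show ?thesis .
  qed
  have F0: "F (\<lambda>_. \<zero>\<^bsub>V\<^esub>) = \<zero>\<^bsub>N\<^esub>"
    unfolding F_def by (rule N.M.add.finprod_one_eqI) (simp add: h0)
  \<comment> \<open>\<open>y\<^sup>t f = 0\<close> is what makes this hold without the restriction \<open>c < t\<close>\<close>
  have FE': "F (E (c, b) v) = h (c, b) v" if "v \<in> carrier V" "c \<le> t" "b < m" for c b v
  proof (cases "c = t")
    case True
    then have "(N.yop ^^ c) ((N.xop ^^ b) (f v)) = (N.xop ^^ b) \<zero>\<^bsub>N\<^esub>"
      using y[OF that(1)] fD(1) that by (subst N.funpow_y_x) auto
    then show ?thesis using True F0 by (simp add: E_outside Ix_iff h_def)
  next
    case False
    then show ?thesis using FE[of v "(c, b)"] that by (simp add: Ix_iff)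
  qed
  have "linear_map H D N F"
  proof (rule ore_linear_mapI[OF D.M.left_module_axioms N])
    fix g k d assume g: "g \<in> carrier G" and d: "d \<in> carrier D"
    have "F (D.op g k d) = N.op g k (F d)" using d unfolding D_simps
    proof (induction d rule: D_induct)
      case zero then show ?case using D.op_zero[OF g, of k] F0 g by simp
    next
      case (E p v)
      obtain c b where p: "p = (c, b)" by force
      then have bc: "b < m" "c < t" using E by (auto simp: Ix_iff)
      have "h p (gop g (k * \<chi> g ^ (c * m + b)) v) = N.op g k (h p v)"
        using E(2) g \<chi>_nonzero[OF g] fD(1)
        by (simp add: h_def p fop N.funpow_x_op N.funpow_y_op power_add field_simps)
      then show ?case using E g by (simp add: p op_E FE)
    next
      case (add d d')
      then show ?case using g D.op_add[of g d d' k] D.op_closed[of g d k] D.op_closed[of g d' k]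
        by (simp add: Fadd N.op_add Fc)
    qed
    then show "F (mon (g, 0) k \<odot>\<^bsub>D\<^esub> d) = mon (g, 0) k \<odot>\<^bsub>N\<^esub> F d" by (simp add: D.op_def N.op_def)
  next
    fix d assume d: "d \<in> carrier D"
    have "F (D.xop d) = N.xop (F d)" using d unfolding D_simps
    proof (induction d rule: D_induct)
      case zero then show ?case using D.xop_zero F0 by simp
    next
      case (E p v)
      obtain c b where p: "p = (c, b)" by force
      then have bc: "b < m" "c < t" using E by (auto simp: Ix_iff)
      have fv: "f v \<in> carrier N" using fD(1) E by simp
      show ?case
      proof (cases "Suc b = m")
        case False
        have "h (c, Suc b) v = N.xop (h (c, b) v)"
          using N.funpow_y_x[of "(N.xop ^^ b) (f v)" c 1] fv by (simp add: h_def)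
        then show ?thesis using False bc E p by (simp add: xop_E FE')
      next
        case True
        have "N.xop (h (c, b) v) = (N.yop ^^ c) ((N.xop ^^ m) (f v))"
          using N.funpow_y_x[of "(N.xop ^^ b) (f v)" c 1] fv True by (auto simp: h_def)
        also have "\<dots> = (N.yop ^^ c) (N.yop (f v)) \<oplus>\<^bsub>N\<^esub> (N.yop ^^ c) (N.sc \<beta> (f v))"
          using fv by (simp add: N.xop_power_m N.funpow_y_add)
        also have "\<dots> = h (Suc c, 0) v \<oplus>\<^bsub>N\<^esub> h (c, 0) (gop \<one>\<^bsub>G\<^esub> \<beta> v)"
          using E(2) by (simp add: h_def fop funpow_swap1)
        finally have *: "N.xop (h (c, b) v) = h (Suc c, 0) v \<oplus>\<^bsub>N\<^esub> h (c, 0) (gop \<one>\<^bsub>G\<^esub> \<beta> v)" .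
        have "b = m - 1" using True by simp
        then show ?thesis using * bc E p m_pos fv
          by (simp only: xop_E_last) (simp add: Fadd FE' N.M.a_comm)
      qed
    next
      case (add d d')
      then show ?case using D.xop_add[of d d'] D.xop_closed[of d] D.xop_closed[of d']
        by (simp add: Fadd N.xop_add Fc)
    qed
    then show "F (ore_x G \<odot>\<^bsub>D\<^esub> d) = ore_x G \<odot>\<^bsub>N\<^esub> F d" by (simp add: D.xop_def N.xop_def)
  qed (use Fc Fadd in auto)
  moreover have "F (E (0, 0) v) = f v" if "v \<in> carrier V" "0 < t" for v
    using FE[of v "(0, 0)"] that m_pos by (simp add: Ix_iff h_def)
  ultimately show ?thesis using that by blast
qed

end

section \<open>Twists by powers of \<open>\<chi>\<close>\<close>

context ore_setting
begin

text \<open>\<open>V\<^sub>\<chi>\<^sup>n \<otimes> V\<close>, on the carrier of \<open>V\<close>\<close>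

definition twist :: "nat \<Rightarrow> ('g \<Rightarrow>\<^sub>0 'k, 'v) module \<Rightarrow> ('g \<Rightarrow>\<^sub>0 'k, 'v) module"
  where "twist n V = kG.action_module V (\<lambda>g k v. mon g (k * \<chi> g ^ n) \<odot>\<^bsub>V\<^esub> v)"

end

context kG_module
begin

lemma twist_simps [simp]: "carrier (twist n V) = carrier V" "\<zero>\<^bsub>twist n V\<^esub> = \<zero>\<^bsub>V\<^esub>" "u \<oplus>\<^bsub>twist n V\<^esub> v = u \<oplus>\<^bsub>V\<^esub> v"
  by (simp_all add: twist_def)

lemma left_module_twist: "left_module kG (twist n V)"
  and twist_mon: "\<lbrakk>g \<in> carrier G; v \<in> carrier V\<rbrakk> \<Longrightarrow> mon g k \<odot>\<^bsub>twist n V\<^esub> v = gop g (k * \<chi> g ^ n) v"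
proof -
  let ?act = "\<lambda>g k v. mon g (k * \<chi> g ^ n) \<odot>\<^bsub>V\<^esub> v"
  have 1: "?act g k v \<in> carrier V" if "g \<in> carrier G" "v \<in> carrier V" for g k v
    unfolding gop_def[symmetric] using that by simp
  have 2: "?act g k (u \<oplus>\<^bsub>V\<^esub> v) = ?act g k u \<oplus>\<^bsub>V\<^esub> ?act g k v" if "g \<in> carrier G" "u \<in> carrier V" "v \<in> carrier V" for g k u v
    unfolding gop_def[symmetric] using that by (simp add: gop_add)
  have 3: "?act g (k + l) v = ?act g k v \<oplus>\<^bsub>V\<^esub> ?act g l v" if "g \<in> carrier G" "v \<in> carrier V" for g k l v
    unfolding gop_def[symmetric] using that by (simp add: gop_scalar_add distrib_right)
  have 4: "?act g k (?act h l v) = ?act (g \<otimes>\<^bsub>G\<^esub> h) (k * l * 1) v" if "g \<in> carrier G" "h \<in> carrier G" "v \<in> carrier V" for g k h l v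
    unfolding gop_def[symmetric] using that by (simp add: gop_gop \<chi>_mult power_mult_distrib mult_ac)
  have 5: "?act \<one>\<^bsub>G\<^esub> 1 v = v" if "v \<in> carrier V" for v
    unfolding gop_def[symmetric] using that by (simp add: \<chi>_one)
  show "left_module kG (twist n V)" unfolding twist_def
    by (rule kG.left_module_action[OF V.M.abelian_group_axioms 1 2 3 4 5])
  show "mon g k \<odot>\<^bsub>twist n V\<^esub> v = gop g (k * \<chi> g ^ n) v" if "g \<in> carrier G" "v \<in> carrier V"
    unfolding twist_def gop_def
    by (rule kG.smult_mon[OF V.M.abelian_group_axioms 1 2 3 4 5 that])
qed

lemma kG_submoduleI:
  assumes "N \<subseteq> carrier V" "\<zero>\<^bsub>V\<^esub> \<in> N" "\<And>u v. \<lbrakk>u \<in> N; v \<in> N\<rbrakk> \<Longrightarrow> u \<oplus>\<^bsub>V\<^esub> v \<in> N"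
    and "\<And>g k v. \<lbrakk>g \<in> carrier G; v \<in> N\<rbrakk> \<Longrightarrow> gop g k v \<in> N"
  shows "submodule N kG V"
  by (rule kG.submodule_monI[OF V.left_module_axioms assms(1-3)]) (use assms(4) in \<open>auto simp: gop_def\<close>)

lemma simple_twist:
  assumes "simple_module kG V" shows "simple_module kG (twist n V)"
proof -
  interpret T: left_module kG "twist n V" by (rule left_module_twist)
  have "N = {\<zero>\<^bsub>V\<^esub>} \<or> N = carrier V" if N: "submodule N kG (twist n V)" for N
  proof -
    note ND = T.submoduleD[OF N, simplified]
    have "submodule N kG V"
    proof (rule kG_submoduleI)
      fix g k v assume g: "g \<in> carrier G" and v: "v \<in> N"
      have "mon g (k * inverse (\<chi> g ^ n)) \<odot>\<^bsub>twist n V\<^esub> v = gop g k v"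
        using g v ND(1) \<chi>_nonzero[OF g] by (subst twist_mon) (auto simp: subset_iff mult.assoc)
      then show "gop g k v \<in> N" using ND(4)[OF kG.mon_closed[OF g] v] by metis
    qed (use ND in auto)
    then show ?thesis using assms by (auto simp: simple_module_def)
  qed
  then show ?thesis using assms left_module_twist by (simp add: simple_module_def)
qed

lemma gop_scalar_eq_zeroD:
  assumes "v \<in> carrier V" "gop \<one>\<^bsub>G\<^esub> k v = \<zero>\<^bsub>V\<^esub>" "k \<noteq> 0" shows "v = \<zero>\<^bsub>V\<^esub>"
proof -
  have "gop \<one>\<^bsub>G\<^esub> (inverse k) (gop \<one>\<^bsub>G\<^esub> k v) = v" using assms(1,3) by (simp add: gop_gop)
  then show ?thesis using assms(2) by simp
qed

end

lemma (in ore_module) op_scalar_eq_zeroD: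
  assumes "v \<in> carrier M" "sc k v = \<zero>\<^bsub>M\<^esub>" "k \<noteq> 0" shows "v = \<zero>\<^bsub>M\<^esub>"
proof -
  have "sc (inverse k) (sc k v) = v" using assms(1,3) by (simp add: op_op)
  then show ?thesis using assms(2) by simp
qed

section \<open>The socle of the model\<close>

lemma (in param_module) submodule_yop: "\<lbrakk>submodule N H M; v \<in> N\<rbrakk> \<Longrightarrow> (yop ^^ n) v \<in> N"
proof (induction n)
  case (Suc n)
  note ND = M.submoduleD[OF Suc(2)] ore_submoduleD[OF Suc(2)]
  have "(xop ^^ i) w \<in> N" if "w \<in> N" for i w using that by (induction i) (auto intro: ND)
  then show ?case using Suc by (auto simp: yop_def intro!: ND)
qed simp

text \<open>
  \<open>\<omega>\<close> is the scalar by which the central element \<open>a\<close> acts on \<open>V\<close>; on \<open>y\<^sup>c x\<^sup>b \<otimes> V\<close> it then acts by \<open>\<omega> q\<^sup>n\<close>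
  with \<open>n = c m + b\<close>.
\<close>

locale simple_model = model G \<chi> a s \<psi> m \<beta> V t
  for G :: "('g, 'x) monoid_scheme" and \<chi> :: "'g \<Rightarrow> 'k::alg_closed_field" and a s \<psi> m \<beta>
    and V :: "('g \<Rightarrow>\<^sub>0 'k, 'v) module" and t +
  fixes \<omega> :: 'k
  assumes simple: "simple_module kG V" and eigen: "v \<in> carrier V \<Longrightarrow> gop a 1 v = gop \<one>\<^bsub>G\<^esub> \<omega> v"
    and t_pos: "0 < t"
begin

lemma V_nonzero: obtains v where "v \<in> carrier V" "v \<noteq> \<zero>\<^bsub>V\<^esub>"
  using simple V.M.zero_closed by (auto simp: simple_module_def)

lemma gop_a: "v \<in> carrier V \<Longrightarrow> gop a k v = gop \<one>\<^bsub>G\<^esub> (k * \<omega>) v"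
  using gop_gop[of "\<one>\<^bsub>G\<^esub>" a v k 1] gop_gop[of "\<one>\<^bsub>G\<^esub>" "\<one>\<^bsub>G\<^esub>" v k \<omega>] a_closed by (simp add: eigen)

lemma \<omega>_nonzero: "\<omega> \<noteq> 0"
proof
  assume "\<omega> = 0"
  obtain v where v: "v \<in> carrier V" "v \<noteq> \<zero>\<^bsub>V\<^esub>" by (rule V_nonzero)
  have "gop (inv\<^bsub>G\<^esub> a) 1 (gop a 1 v) = v" using v a_closed by (simp add: gop_gop del: eigen)
  then show False using v a_closed \<open>\<omega> = 0\<close> by (simp add: eigen)
qed

text \<open>
  Multiplying a nonzero element by powers of \<open>y\<close> and \<open>x\<close> makes its components outside
  \<open>y\<^sup>t\<^sup>-\<^sup>1 D\<close> vanish and the one at \<open>y\<^sup>t\<^sup>-\<^sup>1 \<otimes> V\<close> nonzero. The summands \<open>y\<^sup>t\<^sup>-\<^sup>1 x\<^sup>b \<otimes> V\<close> for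
  \<open>0 < b < m\<close> belong to other eigenvalues of \<open>a\<close> than \<open>y\<^sup>t\<^sup>-\<^sup>1 \<otimes> V\<close>, because \<open>q\<^sup>b \<noteq> 1\<close>, and so can be
  removed one at a time.
\<close>

lemma socle:
  assumes N: "submodule N H D" and d: "d \<in> N" "d \<noteq> \<zero>\<^bsub>D\<^esub>" and v: "v \<in> carrier V"
  shows "E (t - 1, 0) v \<in> N"
proof -
  note ND = D.M.submoduleD[OF N] D.ore_submoduleD[OF N]
  have NC: "N \<subseteq> carrier group_D" using ND(1) by simp
  have NE: "(\<forall>p. d p \<in> carrier V) \<and> (\<forall>p. p \<notin> Ix \<longrightarrow> d p = \<zero>\<^bsub>V\<^esub>)" if "d \<in> N" for d
    using subsetD[OF NC that] unfolding carrier_group_D .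
  have cV: "d p \<in> carrier V" if "d \<in> N" for d p using NE[OF that] by blast
  have out: "d p = \<zero>\<^bsub>V\<^esub>" if "d \<in> N" "p \<notin> Ix" for d p using NE[OF that(1)] that(2) by blast
  define row where "row d \<longleftrightarrow> (\<forall>c b. c < t - 1 \<longrightarrow> d (c, b) = \<zero>\<^bsub>V\<^esub>)" for d :: "nat \<times> nat \<Rightarrow> 'v"
  define c0 where "c0 = (LEAST c. \<exists>b. d (c, b) \<noteq> \<zero>\<^bsub>V\<^esub>)"
  have "\<exists>c b. d (c, b) \<noteq> \<zero>\<^bsub>V\<^esub>" using d(2) by (auto simp: fun_eq_iff)
  then have "\<exists>b. d (c0, b) \<noteq> \<zero>\<^bsub>V\<^esub>" unfolding c0_def by (rule LeastI_ex)
  then obtain b0 where b0: "d (c0, b0) \<noteq> \<zero>\<^bsub>V\<^esub>" by auto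
  have c0_least: "d (c, b) = \<zero>\<^bsub>V\<^esub>" if "c < c0" for c b
    using not_less_Least[of c "\<lambda>c. \<exists>b. d (c, b) \<noteq> \<zero>\<^bsub>V\<^esub>"] that by (auto simp: c0_def)
  have Ix0: "c0 < t" "b0 < m" using out[OF d(1), of "(c0, b0)"] b0 by (auto simp: Ix_iff)
  \<comment> \<open>this power of \<open>y\<close> moves the lowest nonzero row \<open>c0\<close> to the last row and the rows above it out\<close>
  have "\<exists>d\<in>N. row d \<and> (\<exists>b<m. d (t - 1, b) \<noteq> \<zero>\<^bsub>V\<^esub>)"
  proof (intro bexI conjI)
    let ?d = "(D.yop ^^ (t - 1 - c0)) d"
    show "?d \<in> N" by (rule D.submodule_yop[OF N d(1)])
    have dE: "?d = (\<lambda>(c, b). if (c, b) \<in> Ix \<and> t - 1 - c0 \<le> c then d (c - (t - 1 - c0), b) else \<zero>\<^bsub>V\<^esub>)"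
      using d NC by (intro funpow_y_D) auto
    show "row ?d" unfolding row_def dE using c0_least Ix0 by auto
    show "\<exists>b<m. ?d (t - 1, b) \<noteq> \<zero>\<^bsub>V\<^esub>"
    proof (intro exI[of _ b0] conjI Ix0)
      have "t - 1 - (t - 1 - c0) = c0" using Ix0 by simp
      then show "?d (t - 1, b0) \<noteq> \<zero>\<^bsub>V\<^esub>" unfolding dE using b0 Ix0 by (simp add: Ix_iff)
    qed
  qed
  then obtain d1 b1 where d1: "d1 \<in> N" "row d1" "b1 < m" "d1 (t - 1, b1) \<noteq> \<zero>\<^bsub>V\<^esub>" by auto
  \<comment> \<open>\<open>x\<close> moves the position \<open>b1\<close> up to \<open>m - 1\<close> and from there to \<open>0\<close>, multiplied by \<open>\<beta> \<noteq> 0\<close>\<close>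
  have "\<exists>d\<in>N. row d \<and> d (t - 1, 0) \<noteq> \<zero>\<^bsub>V\<^esub>" using d1
  proof (induction "m - b1" arbitrary: d1 b1 rule: less_induct)
    case less
    show ?case
    proof (cases "b1 = 0")
      case False
      let ?d = "D.xop d1"
      have N': "?d \<in> N" using ND(8) less by blast
      have dE: "?d = xD d1" using NC less by (intro D_xop) auto
      have row': "row ?d" unfolding row_def dE xD_def using less(3) by (auto simp: row_def)
      show ?thesis
      proof (cases "Suc b1 < m")
        case True
        have "?d (t - 1, Suc b1) = d1 (t - 1, b1)" unfolding dE xD_def using True t_pos by (simp add: Ix_iff)
        then show ?thesis using less(1)[of "Suc b1" ?d] True N' row' less(5) by simp
      next
        case False
        then have b1: "b1 = m - 1" using less(4) by simp
        then have "\<beta> \<noteq> 0" using \<open>b1 \<noteq> 0\<close> by (intro \<beta>_nonzero) simp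
        have "?d (t - 1, 0) = gop \<one>\<^bsub>G\<^esub> \<beta> (d1 (t - 1, m - 1))"
          unfolding dE xD_def using less(2,3) cV t_pos m_pos by (auto simp: Ix_iff row_def)
        then have "?d (t - 1, 0) \<noteq> \<zero>\<^bsub>V\<^esub>"
          using gop_scalar_eq_zeroD[OF cV[OF less(2)] _ \<open>\<beta> \<noteq> 0\<close>] less(5) b1 by auto
        then show ?thesis using N' row' by auto
      qed
    qed (use less in auto)
  qed
  then obtain d2 where d2: "d2 \<in> N" "row d2" "d2 (t - 1, 0) \<noteq> \<zero>\<^bsub>V\<^esub>" by auto
  have "\<exists>d\<in>N. row d \<and> d (t - 1, 0) \<noteq> \<zero>\<^bsub>V\<^esub> \<and> (\<forall>b\<in>S. d (t - 1, b) = \<zero>\<^bsub>V\<^esub>)"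
    if "finite S" "S \<subseteq> {0<..<m}" for S
    using that
  proof (induction S rule: finite_induct)
    case empty then show ?case using d2 by auto
  next
    case (insert b1 S)
    then obtain d3 where d3: "d3 \<in> N" "row d3" "d3 (t - 1, 0) \<noteq> \<zero>\<^bsub>V\<^esub>" "\<forall>b\<in>S. d3 (t - 1, b) = \<zero>\<^bsub>V\<^esub>" by auto
    \<comment> \<open>\<open>a - \<omega> q\<^sup>n\<close> with \<open>n = n0 + b1\<close> kills the position \<open>b1\<close> and multiplies the position \<open>0\<close> by a nonzero scalar\<close>
    define n0 where "n0 = (t - 1) * m"
    let ?e = "- (\<omega> * \<chi> a ^ (n0 + b1))"
    let ?d = "D.op a 1 d3 \<oplus>\<^bsub>D\<^esub> D.sc ?e d3"
    have d3D: "d3 \<in> carrier group_D" using NC d3 by auto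
    have N': "?d \<in> N" using ND(3,7) d3 a_closed by simp
    have dE: "?d (c, b) = gop \<one>\<^bsub>G\<^esub> (\<chi> a ^ (c * m + b) * \<omega> + ?e) (d3 (c, b))" for c b
      using d3D a_closed cV[OF d3(1)] by (simp add: D_op gD_def gop_a \<chi>_one gop_scalar_add del: add_uminus_conv_diff)
    have "row ?d" unfolding row_def using dE d3(2) by (simp add: row_def)
    moreover have "?d (t - 1, 0) \<noteq> \<zero>\<^bsub>V\<^esub>"
    proof
      assume "?d (t - 1, 0) = \<zero>\<^bsub>V\<^esub>"
      then have "gop \<one>\<^bsub>G\<^esub> (\<chi> a ^ n0 * \<omega> + ?e) (d3 (t - 1, 0)) = \<zero>\<^bsub>V\<^esub>" using dE[of "t - 1" 0] by (simp add: n0_def)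
      moreover have "\<chi> a ^ n0 * \<omega> + ?e = \<chi> a ^ n0 * \<omega> * (1 - \<chi> a ^ b1)" by (simp add: power_add algebra_simps)
      moreover have "\<dots> \<noteq> 0" using \<chi>_nonzero[OF a_closed] \<omega>_nonzero q_power[of b1] insert(4) by simp
      ultimately show False using gop_scalar_eq_zeroD[OF cV[OF d3(1)]] d3(3) by metis
    qed
    moreover have "\<forall>b\<in>insert b1 S. ?d (t - 1, b) = \<zero>\<^bsub>V\<^esub>"
      using d3(4) dE[of "t - 1"] cV[OF d3(1)] by (auto simp: n0_def mult.commute)
    ultimately show ?case using N' by blast
  qed
  from this[of "{0<..<m}"] obtain d4 where d4: "d4 \<in> N" "row d4" "d4 (t - 1, 0) \<noteq> \<zero>\<^bsub>V\<^esub>"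
    "\<forall>b\<in>{0<..<m}. d4 (t - 1, b) = \<zero>\<^bsub>V\<^esub>" by auto
  have "d4 = E (t - 1, 0) (d4 (t - 1, 0))"
  proof (rule ext, clarify)
    fix c b
    have "c = t - 1" if "(c, b) \<in> Ix" "\<not> c < t - 1" using that by (auto simp: Ix_iff)
    then consider "(c, b) \<notin> Ix" | "(c, b) \<in> Ix" "c < t - 1" | "(c, b) \<in> Ix" "c = t - 1" "0 < b" | "c = t - 1" "b = 0"
      by blast
    then show "d4 (c, b) = E (t - 1, 0) (d4 (t - 1, 0)) (c, b)"
      by cases (use out[OF d4(1)] d4 t_pos m_pos in \<open>auto simp: E_def Ix_iff row_def\<close>)
  qed
  then have E4: "E (t - 1, 0) (d4 (t - 1, 0)) \<in> N" using d4 by simp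
  define U where "U = {v \<in> carrier V. E (t - 1, 0) v \<in> N}"
  have "submodule U kG V"
  proof (rule kG_submoduleI)
    show "\<zero>\<^bsub>V\<^esub> \<in> U" using ND(2) by (simp add: U_def E_def)
    show "u \<oplus>\<^bsub>V\<^esub> v \<in> U" if "u \<in> U" "v \<in> U" for u v
      using that ND(3)[of "E (t - 1, 0) u" "E (t - 1, 0) v"] by (simp add: U_def E_add)
    fix g k v assume g: "g \<in> carrier G" and v: "v \<in> U"
    have "E (t - 1, 0) (gop g k v) = D.op g (k * inverse (\<chi> g ^ ((t - 1) * m))) (E (t - 1, 0) v)"
      using g v \<chi>_nonzero[OF g] by (subst op_E) (auto simp: U_def mult.assoc)
    then show "gop g k v \<in> U" using ND(7)[OF g] v g by (simp add: U_def)
  qed (auto simp: U_def)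
  moreover have "d4 (t - 1, 0) \<in> U" using E4 cV d4 by (simp add: U_def)
  ultimately have "U = carrier V" using simple d4(3) by (auto simp: simple_module_def)
  then show ?thesis using v by (auto simp: U_def)
qed

lemma E_top_nonzero: "\<lbrakk>v \<in> carrier V; v \<noteq> \<zero>\<^bsub>V\<^esub>\<rbrakk> \<Longrightarrow> E (t - 1, 0) v \<noteq> \<zero>\<^bsub>D\<^esub>"
  using t_pos m_pos by (auto simp: E_def Ix_iff fun_eq_iff)

text \<open>Two nonzero submodules have \<open>y\<^sup>t\<^sup>-\<^sup>1 \<otimes> V\<close> in common.\<close>

lemma D_indecomposable: "indecomposable_module H D"
  unfolding indecomposable_module_def
proof (intro conjI allI impI D.M.left_module_axioms)
  obtain v where v: "v \<in> carrier V" "v \<noteq> \<zero>\<^bsub>V\<^esub>" by (rule V_nonzero)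
  show "carrier D \<noteq> {\<zero>\<^bsub>D\<^esub>}" using E_top_nonzero[OF v] E_closed[OF v(1), of "(t - 1, 0)"] by auto
  fix N N' assume "internal_direct_sum H D N N'"
  note NN = D.M.internal_direct_sumD[OF this]
  show "N = {\<zero>\<^bsub>D\<^esub>} \<or> N' = {\<zero>\<^bsub>D\<^esub>}"
  proof (rule ccontr)
    assume "\<not> ?thesis"
    then obtain d d' where "d \<in> N" "d \<noteq> \<zero>\<^bsub>D\<^esub>" "d' \<in> N'" "d' \<noteq> \<zero>\<^bsub>D\<^esub>"
      using D.M.submoduleD(2)[OF NN(1)] D.M.submoduleD(2)[OF NN(2)] by blast
    then have "E (t - 1, 0) v \<in> N \<inter> N'" using socle[OF NN(1) _ _ v(1)] socle[OF NN(2) _ _ v(1)] by blast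
    then show False using NN(3) E_top_nonzero[OF v] by auto
  qed
qed

text \<open>\<open>V\<close> is spanned by the elements \<open>g v\<close>, for any \<open>v \<noteq> 0\<close>, because it is simple.\<close>

lemma D_finite_dimensional: "finite_dimensional (ore_scalar G) D"
proof -
  obtain v where v: "v \<in> carrier V" "v \<noteq> \<zero>\<^bsub>V\<^esub>" by (rule V_nonzero)
  define B where "B = (\<lambda>(p, g). E p (gop g 1 v)) ` (Ix \<times> carrier G)"
  have gen: "(\<lambda>r. r \<odot>\<^bsub>V\<^esub> v) ` carrier kG = carrier V"
  proof -
    have RM: "left_module kG (regular_module kG)"
    proof (intro left_module.intro left_module_axioms.intro kG.ring_R)
      show "abelian_group (regular_module kG)"
      proof (rule abelian_groupI, goal_cases)
        case (6 x) then show ?case by (intro bexI[of _ "\<ominus>\<^bsub>kG\<^esub> x"]) (auto simp: regular_module_def kR.l_neg)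
      qed (auto simp: regular_module_def kR.a_ac)
    qed (auto simp: regular_module_def kR.l_distr kR.r_distr kR.m_assoc)
    have "linear_map kG (regular_module kG) V (\<lambda>r. r \<odot>\<^bsub>V\<^esub> v)"
      using v by (auto simp: linear_map_def regular_module_def V.smult_closed V.smult_l_distr V.smult_assoc)
    from submodule_image[OF RM V.left_module_axioms this left_module.submodule_carrier[OF RM]]
    have "submodule ((\<lambda>r. r \<odot>\<^bsub>V\<^esub> v) ` carrier kG) kG V" by (simp add: regular_module_def)
    moreover have "v \<in> (\<lambda>r. r \<odot>\<^bsub>V\<^esub> v) ` carrier kG" using V.smult_one[OF v(1)] by (metis image_eqI kR.one_closed)
    ultimately show ?thesis using simple v(2) by (auto simp: simple_module_def)
  qed
  show ?thesis
  proof (rule finite_dimensionalI[OF D.M.left_module_axioms, of B])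
    show "finite B" unfolding B_def using finite_G by auto
    show "B \<subseteq> carrier D" unfolding B_def using v by auto
    fix S assume S: "S \<subseteq> carrier D" "B \<subseteq> S" "\<zero>\<^bsub>D\<^esub> \<in> S" "\<And>d d'. \<lbrakk>d \<in> S; d' \<in> S\<rbrakk> \<Longrightarrow> d \<oplus>\<^bsub>D\<^esub> d' \<in> S"
      "\<And>c d. d \<in> S \<Longrightarrow> ore_scalar G c \<odot>\<^bsub>D\<^esub> d \<in> S"
    have ES: "E p (r \<odot>\<^bsub>V\<^esub> v) \<in> S" if "r \<in> carrier kG" "p \<in> Ix" for p r
      using that
    proof (induction r rule: kG.mon_induct)
      case zero
      then show ?case using S(3) V.smult_l_null[OF v(1)] by (simp add: E_def kG.zero_eq)
    next
      case (mon g k)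
      obtain c b where p: "p = (c, b)" by force
      have "E p (mon g k \<odot>\<^bsub>V\<^esub> v) = D.sc k (E p (gop g 1 v))"
        using mon v unfolding gop_def[symmetric] p by (subst op_E) (auto simp: \<chi>_one gop_gop)
      moreover have "E p (gop g 1 v) \<in> S" using S(2) mon by (auto simp: B_def)
      ultimately show ?case using S(5)[of "E p (gop g 1 v)" k] by (simp add: D.op_def ore_scalar_def)
    next
      case (add r r')
      then have "(r + r') \<odot>\<^bsub>V\<^esub> v = r \<odot>\<^bsub>V\<^esub> v \<oplus>\<^bsub>V\<^esub> r' \<odot>\<^bsub>V\<^esub> v" using V.smult_l_distr v by (simp add: kG.add_eq)
      then show ?case using add S(4)[of "E p (r \<odot>\<^bsub>V\<^esub> v)" "E p (r' \<odot>\<^bsub>V\<^esub> v)"] v by (simp add: E_add V.smult_closed)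
    qed
    show "carrier D \<subseteq> S"
    proof
      fix d assume "d \<in> carrier D"
      then have "d \<in> carrier group_D" by simp
      then show "d \<in> S"
      proof (induction d rule: D_induct)
        case zero then show ?case using S(3) by simp
      next
        case (E p u)
        then have "u \<in> (\<lambda>r. r \<odot>\<^bsub>V\<^esub> v) ` carrier kG" by (simp only: gen)
        then show ?case using ES E(1) by blast
      next
        case (add d d') then show ?case using S(4) by simp
      qed
    qed
  qed (auto simp: ore_scalar_def HH.mon_closed HH.add_eq HH.zero_eq HH.one_eq HH.mult_mon single_add \<psi>_eq \<chi>_one)
qed

end

section \<open>Polynomials in a linear operator\<close>

locale poly_action = abelian_group M for M :: "('m, 'z) ring_scheme" (structure) +
  fixes sc :: "'k::alg_closed_field \<Rightarrow> 'm \<Rightarrow> 'm" and T :: "'m \<Rightarrow> 'm"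
  assumes sc_closed [simp]: "v \<in> carrier M \<Longrightarrow> sc c v \<in> carrier M"
    and T_closed [simp]: "v \<in> carrier M \<Longrightarrow> T v \<in> carrier M"
    and sc_add: "\<lbrakk>u \<in> carrier M; v \<in> carrier M\<rbrakk> \<Longrightarrow> sc c (u \<oplus> v) = sc c u \<oplus> sc c v"
    and T_add: "\<lbrakk>u \<in> carrier M; v \<in> carrier M\<rbrakk> \<Longrightarrow> T (u \<oplus> v) = T u \<oplus> T v"
    and sc_scalar_add: "v \<in> carrier M \<Longrightarrow> sc (c + d) v = sc c v \<oplus> sc d v"
    and sc_sc: "v \<in> carrier M \<Longrightarrow> sc c (sc d v) = sc (c * d) v"
    and sc_one [simp]: "v \<in> carrier M \<Longrightarrow> sc 1 v = v"
    and T_sc: "v \<in> carrier M \<Longrightarrow> T (sc c v) = sc c (T v)"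
begin

definition pact :: "'k poly \<Rightarrow> 'm \<Rightarrow> 'm"
  where "pact p v = foldr (\<lambda>c w. sc c v \<oplus> T w) (coeffs p) \<zero>"

lemma sc_zero [simp]: "sc c \<zero> = \<zero>"
  using sc_add[of \<zero> \<zero> c] sc_closed[of \<zero> c] by simp

lemma T_zero [simp]: "T \<zero> = \<zero>"
  using T_add[of \<zero> \<zero>] T_closed[of \<zero>] by simp

lemma sc_scalar_zero [simp]: "v \<in> carrier M \<Longrightarrow> sc 0 v = \<zero>"
  using sc_scalar_add[of v 0 0] sc_closed[of v 0] by simp

lemma sc_eq_zeroD: "\<lbrakk>v \<in> carrier M; sc c v = \<zero>; c \<noteq> 0\<rbrakk> \<Longrightarrow> v = \<zero>"
  using sc_sc[of v "inverse c" c] by simp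

lemma pact_0 [simp]: "pact 0 v = \<zero>"
  by (simp add: pact_def)

lemma pact_pCons: "v \<in> carrier M \<Longrightarrow> pact (pCons c p) v = sc c v \<oplus> T (pact p v)"
  by (auto simp: pact_def cCons_def)

lemma pact_closed [simp]: "v \<in> carrier M \<Longrightarrow> pact p v \<in> carrier M"
  by (induction p) (auto simp: pact_pCons)

lemma pact_add: "v \<in> carrier M \<Longrightarrow> pact (p + q) v = pact p v \<oplus> pact q v"
  by (induction p q rule: poly_induct2) (auto simp: pact_pCons T_add sc_scalar_add a_ac)

lemma pact_smult: "v \<in> carrier M \<Longrightarrow> pact (smult c p) v = sc c (pact p v)"
  by (induction p) (auto simp: pact_pCons T_sc sc_add sc_sc)

lemma pact_mult: "v \<in> carrier M \<Longrightarrow> pact (p * q) v = pact p (pact q v)"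
  by (induction p) (auto simp: pact_pCons pact_add pact_smult)

lemma pact_one [simp]: "v \<in> carrier M \<Longrightarrow> pact 1 v = v"
  by (simp add: one_pCons pact_pCons)

lemma pact_vadd: "\<lbrakk>u \<in> carrier M; v \<in> carrier M\<rbrakk> \<Longrightarrow> pact p (u \<oplus> v) = pact p u \<oplus> pact p v"
  by (induction p) (auto simp: pact_pCons T_add sc_add a_ac)

lemma pact_zero [simp]: "pact p \<zero> = \<zero>"
  by (induction p) (auto simp: pact_pCons)

lemma pact_sc: "v \<in> carrier M \<Longrightarrow> pact p (sc c v) = sc c (pact p v)"
  by (induction p) (auto simp: pact_pCons T_sc sc_add sc_sc mult.commute)

lemma pact_commute: "v \<in> carrier M \<Longrightarrow> pact p (pact q v) = pact q (pact p v)"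
  by (metis mult.commute pact_mult)

lemma pact_linear: "v \<in> carrier M \<Longrightarrow> pact [:c, 1:] v = T v \<oplus> sc c v"
  by (simp add: pact_pCons a_comm)

lemma pact_power: "v \<in> carrier M \<Longrightarrow> pact (p ^ n) v = (pact p ^^ n) v"
proof (induction n)
  case (Suc n)
  then show ?case using pact_mult[of v p "p ^ n"] by simp
qed simp

lemma pact_monom: "v \<in> carrier M \<Longrightarrow> pact (monom c n) v = sc c ((T ^^ n) v)"
proof (induction n)
  case 0 then show ?case by (simp add: monom_0 pact_pCons)
next
  case (Suc n)
  have "(T ^^ n) v \<in> carrier M" using Suc(2) by (induction n) auto
  then show ?case using Suc by (simp add: monom_Suc pact_pCons T_sc)
qed

text \<open>
  Take \<open>p\<close> of least degree among the nonzero polynomials that annihilate \<open>M\<close>, a root \<open>b\<close> of \<open>p\<close> and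
  \<open>p = (X - b)\<^sup>n r\<close> with \<open>r(b) \<noteq> 0\<close>.
\<close>

lemma annihilator_root:
  assumes p: "p \<noteq> 0" "\<And>v. v \<in> carrier M \<Longrightarrow> pact p v = \<zero>" and M: "carrier M \<noteq> {\<zero>}"
  obtains b n r where "0 < n" "poly r b \<noteq> 0" "\<forall>v\<in>carrier M. pact ([:- b, 1:] ^ n * r) v = \<zero>"
    "\<exists>v\<in>carrier M. pact r v \<noteq> \<zero>" "\<exists>v\<in>carrier M. v \<noteq> \<zero> \<and> T v = sc b v"
proof -
  define Q where "Q p \<longleftrightarrow> p \<noteq> 0 \<and> (\<forall>v\<in>carrier M. pact p v = \<zero>)" for p
  define p0 where "p0 = arg_min degree Q"
  have "Q p" using p by (simp add: Q_def)
  then have p0: "Q p0" and least: "\<And>q. Q q \<Longrightarrow> degree p0 \<le> degree q"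
    unfolding p0_def by (auto intro: arg_min_natI arg_min_nat_le)
  obtain u where u: "u \<in> carrier M" "u \<noteq> \<zero>" using M zero_closed by blast
  have "degree p0 \<noteq> 0"
  proof
    assume "degree p0 = 0"
    then obtain c where c: "p0 = [:c:]" by (rule degree_eq_zeroE)
    then have "sc c u = \<zero>" "c \<noteq> 0" using p0 u by (auto simp: Q_def pact_pCons)
    then show False using sc_eq_zeroD u by blast
  qed
  then obtain b where b: "poly p0 b = 0" using alg_closed_imp_poly_has_root[of p0] by auto
  define n where "n = order b p0"
  have p0n: "p0 \<noteq> 0" using p0 by (simp add: Q_def)
  have n: "0 < n" using b p0n by (simp add: n_def order_root)
  obtain r where r: "p0 = [:- b, 1:] ^ n * r" "\<not> [:- b, 1:] dvd r"
    unfolding n_def using order_decomp[OF p0n] by blast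
  have small: "\<exists>v\<in>carrier M. pact q v \<noteq> \<zero>" if "q \<noteq> 0" "degree q < degree p0" for q
    using least[of q] that by (auto simp: Q_def)
  have r0: "r \<noteq> 0" using p0n r by auto
  have "degree p0 = n + degree r" unfolding r(1) using r0 by (subst degree_mult_eq) (auto simp: degree_linear_power)
  then have 1: "\<exists>v\<in>carrier M. pact r v \<noteq> \<zero>" using n r0 by (intro small) auto
  define r' where "r' = [:- b, 1:] ^ (n - 1) * r"
  have r'0: "r' \<noteq> 0" using r0 by (simp add: r'_def)
  have p0r': "p0 = [:- b, 1:] * r'" unfolding r'_def r(1) using n by (simp add: power_eq_if del: mult_pCons_left flip: mult.assoc)
  have "degree p0 = 1 + degree r'" unfolding p0r' using r'0 by (subst degree_mult_eq) auto
  then obtain v where v: "v \<in> carrier M" "pact r' v \<noteq> \<zero>" using small[OF r'0] by auto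
  have "pact [:- b, 1:] (pact r' v) = pact p0 v" unfolding p0r' by (rule pact_mult[OF v(1), symmetric])
  then have "pact [:- b, 1:] (pact r' v) = \<zero>" using p0 v by (simp add: Q_def)
  then have "T (pact r' v) \<oplus> sc (- b) (pact r' v) = \<zero>" using v by (simp add: pact_linear)
  moreover have "sc b (pact r' v) \<oplus> sc (- b) (pact r' v) = \<zero>" using v by (simp flip: sc_scalar_add)
  ultimately have "T (pact r' v) = sc b (pact r' v)"
    using v by (metis T_closed add.r_cancel pact_closed sc_closed)
  then have 2: "\<exists>v\<in>carrier M. v \<noteq> \<zero> \<and> T v = sc b v" using v by (intro bexI[of _ "pact r' v"]) auto
  show ?thesis
  proof (rule that[OF n])
    show "poly r b \<noteq> 0" using r(2) by (simp add: poly_eq_0_iff_dvd)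
    show "\<forall>v\<in>carrier M. pact ([:- b, 1:] ^ n * r) v = \<zero>" using p0 r(1) by (simp add: Q_def)
  qed (use 1 2 in auto)
qed

end

text \<open>
  \<open>1 = c (r - (X - b) w)\<close> with \<open>c = 1 / r(b)\<close>; now raise to the power \<open>n\<close> modulo \<open>r\<close>.
\<close>

lemma bezout_power:
  fixes r :: "'k::field poly"
  assumes "poly r b \<noteq> 0"
  obtains A B where "A * [:- b, 1:] ^ n + B * r = 1"
proof -
  have dvd_power: "r dvd (u + r * w) ^ n - u ^ n" for u w
  proof (induction n)
    case (Suc n)
    have "(u + r * w) ^ Suc n - u ^ Suc n = (u + r * w) * ((u + r * w) ^ n - u ^ n) + r * (w * u ^ n)"
      by (simp add: algebra_simps)
    then show ?case using Suc by simp
  qed simp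
  define l where "l = [:- b, 1:]"
  define P where "P = [:poly r b:]"
  define K where "K = [:inverse (poly r b):]"
  have "poly (r - P) b = 0" by (simp add: P_def)
  then obtain w where "r - P = l * w" unfolding poly_eq_0_iff_dvd l_def by (elim dvdE)
  then have r: "r = P + l * w" by (simp add: algebra_simps)
  have KP: "K * P = 1" using assms by (simp add: K_def P_def one_pCons)
  let ?u = "(K * - w) * l"
  have "?u + r * K = K * P" by (simp add: r algebra_simps)
  then have "r dvd 1 - ?u ^ n" using dvd_power[of ?u K] by (simp add: KP)
  then obtain B where "1 - ?u ^ n = r * B" by (elim dvdE)
  then have "(K * - w) ^ n * l ^ n + B * r = 1"
    unfolding power_mult_distrib by (metis add.commute diff_add_cancel mult.commute)
  then show ?thesis unfolding l_def by (rule that)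
qed

text \<open>
  Gaussian elimination: if \<open>j\<close> is an unknown with a nonzero coefficient in the equation \<open>b\<close>, then
  \<open>C'\<close> are the coefficients of the other equations after \<open>j\<close> has been eliminated.
\<close>

lemma homogeneous_system:
  fixes C :: "'i \<Rightarrow> 'b \<Rightarrow> 'k::field"
  assumes "finite B" "finite I" "card B < card I"
  obtains \<alpha> where "\<exists>i\<in>I. \<alpha> i \<noteq> 0" "\<And>b. b \<in> B \<Longrightarrow> (\<Sum>i\<in>I. \<alpha> i * C i b) = 0"
proof -
  have "\<exists>\<alpha>. (\<exists>i\<in>I. \<alpha> i \<noteq> 0) \<and> (\<forall>b\<in>B. (\<Sum>i\<in>I. \<alpha> i * C i b) = 0)"
    using assms
  proof (induction B arbitrary: I C rule: finite_induct)
    case empty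
    then have "I \<noteq> {}" by auto
    then show ?case by (intro exI[of _ "\<lambda>_. 1"]) auto
  next
    case (insert b B)
    show ?case
    proof (cases "\<forall>i\<in>I. C i b = 0")
      case True
      have "card B < card I" using insert by simp
      from insert(3)[OF insert(4) this, of C]
      obtain \<alpha> where "\<exists>i\<in>I. \<alpha> i \<noteq> 0" "\<forall>b\<in>B. (\<Sum>i\<in>I. \<alpha> i * C i b) = 0" by auto
      then show ?thesis using True by (intro exI[of _ \<alpha>]) auto
    next
      case False
      then obtain j where j: "j \<in> I" "C j b \<noteq> 0" by auto
      define C' where "C' i b' = C i b' - C i b / C j b * C j b'" for i b'
      have "card B < card (I - {j})" using insert j by (simp add: card_Diff_singleton)
      then obtain \<alpha> where \<alpha>: "\<exists>i\<in>I - {j}. \<alpha> i \<noteq> 0" "\<And>b'. b' \<in> B \<Longrightarrow> (\<Sum>i\<in>I - {j}. \<alpha> i * C' i b') = 0"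
        using insert(3)[of "I - {j}" C'] insert(4) by auto
      define \<alpha>' where "\<alpha>' i = (if i = j then - (\<Sum>i\<in>I - {j}. \<alpha> i * (C i b / C j b)) else \<alpha> i)" for i
      have sum: "(\<Sum>i\<in>I. \<alpha>' i * C i b') = (\<Sum>i\<in>I - {j}. \<alpha> i * C' i b')" for b'
      proof -
        have "(\<Sum>i\<in>I. \<alpha>' i * C i b') = \<alpha>' j * C j b' + (\<Sum>i\<in>I - {j}. \<alpha>' i * C i b')"
          using j insert(4) by (simp add: sum.remove)
        also have "(\<Sum>i\<in>I - {j}. \<alpha>' i * C i b') = (\<Sum>i\<in>I - {j}. \<alpha> i * C i b')"
          by (rule sum.cong) (auto simp: \<alpha>'_def)
        finally show ?thesis
          by (simp add: \<alpha>'_def C'_def right_diff_distrib sum_subtractf sum_distrib_right mult.assoc)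
      qed
      have "(\<Sum>i\<in>I. \<alpha>' i * C i b') = 0" if "b' \<in> insert b B" for b'
      proof (cases "b' = b")
        case True
        then show ?thesis unfolding sum using j by (simp add: C'_def)
      next
        case False
        then show ?thesis unfolding sum using \<alpha>(2) that by auto
      qed
      moreover have "\<exists>i\<in>I. \<alpha>' i \<noteq> 0" using \<alpha>(1) by (auto simp: \<alpha>'_def)
      ultimately show ?thesis by blast
    qed
  qed
  then show ?thesis using that by blast
qed

context poly_action
begin

text \<open>
  For \<open>b \<in> B\<close> the \<open>card B + 1\<close> vectors \<open>T\<^sup>i b\<close> are linearly dependent, which gives a polynomial that
  annihilates \<open>b\<close>; the product of these polynomials annihilates the span of \<open>B\<close>.
\<close>

lemma finite_span_annihilator:
  assumes B: "finite B" "B \<subseteq> carrier M" and span: "\<And>v. v \<in> carrier M \<Longrightarrow> \<exists>c. v = (\<Oplus>b\<in>B. sc (c b) b)"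
  obtains p where "p \<noteq> 0" "\<forall>v\<in>carrier M. pact p v = \<zero>"
proof -
  define \<phi> where "\<phi> c = (\<Oplus>b\<in>B. sc (c b) b)" for c
  have scB: "sc c b \<in> carrier M" if "b \<in> B" for c b using that B by auto
  have \<phi>c: "\<phi> c \<in> carrier M" for c unfolding \<phi>_def using scB by (intro finsum_closed) auto
  have \<phi>_add: "\<phi> (\<lambda>b. c b + d b) = \<phi> c \<oplus> \<phi> d" for c d
  proof -
    have "\<phi> (\<lambda>b. c b + d b) = (\<Oplus>b\<in>B. sc (c b) b \<oplus> sc (d b) b)"
      unfolding \<phi>_def by (rule finsum_cong') (use B in \<open>auto simp: sc_scalar_add subset_iff\<close>)
    also have "\<dots> = \<phi> c \<oplus> \<phi> d" unfolding \<phi>_def using scB by (intro finsum_addf) auto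
    finally show ?thesis .
  qed
  have sc_sum: "sc k (\<Oplus>b\<in>A. sc (c b) b) = (\<Oplus>b\<in>A. sc (k * c b) b)" if "A \<subseteq> B" for k c A
    using finite_subset[OF that B(1)] that
  proof (induction A rule: finite_induct)
    case (insert b A)
    have A: "(\<lambda>b. sc (c b) b) \<in> A \<rightarrow> carrier M" "(\<lambda>b. sc (k * c b) b) \<in> A \<rightarrow> carrier M" "b \<in> carrier M"
      using insert B by auto
    then show ?case using insert by (simp add: finsum_insert sc_add sc_sc)
  qed simp
  have \<phi>_sc: "sc k (\<phi> c) = \<phi> (\<lambda>b. k * c b)" for k c
    unfolding \<phi>_def by (rule sc_sum) simp
  have \<phi>_0: "\<phi> (\<lambda>_. 0) = \<zero>"
    unfolding \<phi>_def by (rule add.finprod_one_eqI) (use B in auto)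
  have ex: "\<exists>p. p \<noteq> 0 \<and> pact p b = \<zero>" if b: "b \<in> B" for b
  proof -
    have bM: "b \<in> carrier M" using b B by auto
    have Tc: "(T ^^ i) b \<in> carrier M" for i using bM by (induction i) auto
    then have "\<exists>c. (T ^^ i) b = \<phi> c" for i using span unfolding \<phi>_def by blast
    then obtain C where C: "\<And>i. (T ^^ i) b = \<phi> (C i)" by metis
    obtain \<alpha> where \<alpha>: "\<exists>i\<in>{..card B}. \<alpha> i \<noteq> 0" "\<And>b. b \<in> B \<Longrightarrow> (\<Sum>i\<in>{..card B}. \<alpha> i * C i b) = 0"
      using homogeneous_system[of B "{..card B}" C] B(1) by auto
    define p where "p = (\<Sum>i\<in>{..card B}. monom (\<alpha> i) i)"
    have "pact (\<Sum>i\<in>A. monom (\<alpha> i) i) b = \<phi> (\<lambda>b'. \<Sum>i\<in>A. \<alpha> i * C i b')" if "finite A" for A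
      using that
      by (induction A rule: finite_induct) (simp_all add: \<phi>_0 pact_add bM pact_monom C \<phi>_sc flip: \<phi>_add)
    then have "pact p b = \<phi> (\<lambda>b'. \<Sum>i\<in>{..card B}. \<alpha> i * C i b')" by (simp add: p_def)
    also have "\<dots> = \<phi> (\<lambda>_. 0)" unfolding \<phi>_def
      by (rule finsum_cong') (use \<alpha>(2) B in auto)
    finally have "pact p b = \<zero>" using \<phi>_0 by simp
    moreover obtain i where i: "i \<le> card B" "\<alpha> i \<noteq> 0" using \<alpha>(1) by auto
    have "coeff p i = \<alpha> i" using i by (simp add: p_def coeff_sum)
    then have "p \<noteq> 0" using i by auto
    ultimately show ?thesis by blast
  qed
  then obtain P where P: "\<And>b. b \<in> B \<Longrightarrow> P b \<noteq> 0 \<and> pact (P b) b = \<zero>" by metis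
  define p where "p = (\<Prod>b\<in>B. P b)"
  have pb: "pact p b = \<zero>" if "b \<in> B" for b
  proof -
    have "p = (\<Prod>b\<in>B - {b}. P b) * P b" unfolding p_def using that B(1) by (simp add: prod.remove mult.commute)
    then show ?thesis using that P B pact_mult[of b "\<Prod>b\<in>B - {b}. P b" "P b"] by auto
  qed
  have "pact p (\<Oplus>b\<in>A. sc (c b) b) = \<zero>" if "A \<subseteq> B" for c A
    using finite_subset[OF that B(1)] that
  proof (induction A rule: finite_induct)
    case (insert b A)
    have A: "(\<lambda>b. sc (c b) b) \<in> A \<rightarrow> carrier M" "b \<in> carrier M"
      using insert B by auto
    then show ?case using insert pb by (simp add: finsum_insert pact_vadd pact_sc)
  qed simp
  from this[OF order_refl] have "pact p v = \<zero>" if "v \<in> carrier M" for v using span[OF that] by auto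
  moreover have "p \<noteq> 0" unfolding p_def using B(1) P by (simp add: prod_zero_iff)
  ultimately show ?thesis using that by blast
qed

end

text \<open>
  \<open>a\<close> is annihilated by \<open>X\<^sup>n - 1\<close>, where \<open>n\<close> is the order of \<open>G\<close>, so it has an eigenvector in \<open>V\<close>; as \<open>a\<close>
  is central, its eigenspaces are submodules.
\<close>

lemma (in kG_module) central_eigenvalue:
  assumes "simple_module kG V"
  obtains \<omega> where "\<And>v. v \<in> carrier V \<Longrightarrow> gop a 1 v = gop \<one>\<^bsub>G\<^esub> \<omega> v"
proof -
  interpret P: poly_action V "gop \<one>\<^bsub>G\<^esub>" "gop a 1"
    by unfold_locales (use a_closed in \<open>auto simp: gop_add gop_scalar_add gop_gop\<close>)
  define n where "n = Coset.order G"
  have n: "0 < n" using finite_G unfolding n_def Coset.order_def by (auto simp: card_gt_0_iff)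
  have pow: "(gop a 1 ^^ i) v = gop (a [^]\<^bsub>G\<^esub> i) 1 v" if "v \<in> carrier V" for i v
    using that a_closed by (induction i) (auto simp: gop_gop G.nat_pow_closed simp flip: G.nat_pow_Suc2)
  have 1: "P.pact (monom 1 n + [:- 1:]) v = \<zero>\<^bsub>V\<^esub>" if "v \<in> carrier V" for v
    using that pow[OF that, of n] G.pow_order_eq_1[OF a_closed]
    by (simp add: P.pact_add P.pact_monom P.pact_pCons n_def flip: gop_scalar_add)
      (metis G.one_closed add.right_inverse gop_one gop_scalar_add gop_scalar_zero)
  have 2: "monom (1 :: 'k) n + [:- 1:] \<noteq> 0"
  proof
    assume "monom (1 :: 'k) n + [:- 1:] = 0"
    then have "coeff (monom (1 :: 'k) n + [:- 1:]) n = 0" by simp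
    then show False using n by (cases n) auto
  qed
  have 3: "carrier V \<noteq> {\<zero>\<^bsub>V\<^esub>}" using assms by (simp add: simple_module_def)
  obtain \<omega> where ev: "\<exists>v\<in>carrier V. v \<noteq> \<zero>\<^bsub>V\<^esub> \<and> gop a 1 v = gop \<one>\<^bsub>G\<^esub> \<omega> v"
    by (rule P.annihilator_root[OF 2 1 3], assumption, rule that, assumption)
  define U where "U = {v \<in> carrier V. gop a 1 v = gop \<one>\<^bsub>G\<^esub> \<omega> v}"
  have "submodule U kG V"
  proof (rule kG_submoduleI)
    fix g k v assume g: "g \<in> carrier G" and v: "v \<in> U"
    have vc: "v \<in> carrier V" using v by (simp add: U_def)
    have "gop a 1 (gop g k v) = gop g k (gop a 1 v)"
      using g vc a_closed a_central[OF g] by (simp add: gop_gop)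
    also have "\<dots> = gop g k (gop \<one>\<^bsub>G\<^esub> \<omega> v)" using v by (simp add: U_def)
    also have "\<dots> = gop \<one>\<^bsub>G\<^esub> \<omega> (gop g k v)" using g v by (simp add: U_def gop_gop mult.commute)
    finally show "gop g k v \<in> U" using g v by (simp add: U_def)
  qed (use a_closed in \<open>auto simp: U_def gop_add\<close>)
  then have "U = carrier V" using assms ev by (auto simp: simple_module_def U_def)
  then show ?thesis using that by (auto simp: U_def)
qed

section \<open>The model splits off\<close>

lemma (in ore_param) intertwine:
  fixes M :: "('g \<times> nat \<Rightarrow>\<^sub>0 'k, 'm) module" and N :: "('g \<times> nat \<Rightarrow>\<^sub>0 'k, 'n) module"
  assumes M: "left_module H M" and N: "left_module H N" and F: "linear_map H M N F" and v: "v \<in> carrier M"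
  shows "g \<in> carrier G \<Longrightarrow> F (ore_module.op M g k v) = ore_module.op N g k (F v)"
    and "F ((ore_module.xop G M ^^ i) v) = (ore_module.xop G N ^^ i) (F v)"
    and "F ((param_module.yop G m \<beta> M ^^ i) v) = (param_module.yop G m \<beta> N ^^ i) (F v)"
proof -
  interpret M: param_module G \<chi> a s \<psi> m \<beta> M
    by (intro param_module.intro ore_param_axioms ore_module.intro ore_setting_axioms M)
  interpret N: param_module G \<chi> a s \<psi> m \<beta> N
    by (intro param_module.intro ore_param_axioms ore_module.intro ore_setting_axioms N)
  note FD = linear_mapD[OF F]
  have op: "F (M.op g k v) = N.op g k (F v)" if "g \<in> carrier G" "v \<in> carrier M" for g k v
    using that FD(3)[of "mon (g, 0) k" v] by (simp add: M.op_def N.op_def HH.mon_closed)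
  have x: "F (M.xop v) = N.xop (F v)" if "v \<in> carrier M" for v
    using that FD(3)[of "ore_x G" v] by (simp add: M.xop_def N.xop_def HH.mon_closed ore_x_def)
  have xs: "F ((M.xop ^^ i) v) = (N.xop ^^ i) (F v)" if "v \<in> carrier M" for i v
    using that by (induction i) (simp_all add: x)
  have y: "F (M.yop v) = N.yop (F v)" if "v \<in> carrier M" for v
    using that by (simp add: M.yop_def N.yop_def FD(2) xs op)
  show "g \<in> carrier G \<Longrightarrow> F (M.op g k v) = N.op g k (F v)" using op v by simp
  show "F ((M.xop ^^ i) v) = (N.xop ^^ i) (F v)" using xs v by simp
  show "F ((M.yop ^^ i) v) = (N.yop ^^ i) (F v)" using v by (induction i) (simp_all add: y)
qed

context simple_model
begin

text \<open>
  Let \<open>U = y\<^sup>t\<^sup>-\<^sup>1 f(V)\<close> and let \<open>K\<close> be a \<open>kG\<close>-complement of \<open>U\<close>. The image of \<open>D\<close> is complemented by the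
  largest \<open>H\<close>-submodule \<open>C\<close> of \<open>K\<close>: they meet trivially because every nonzero submodule of \<open>D\<close>
  contains the copy of \<open>U\<close>, and for their sum to be \<open>M\<close> one has to solve
  \<open>y\<^sup>c x\<^sup>b (v - n) \<in> K\<close> with \<open>n\<close> in the image, which succeeds one pair \<open>(c, b)\<close> at a time,
  from \<open>c = t - 1\<close> downwards.
\<close>

lemma splitting:
  fixes M :: "('g \<times> nat \<Rightarrow>\<^sub>0 'k, 'm) module"
  assumes kG: "semisimple_ring kG" and M: "indecomposable_module H M"
    and f: "linear_map kG V (restriction M) f"
    and nil: "\<And>v. v \<in> carrier M \<Longrightarrow> (param_module.yop G m \<beta> M ^^ t) v = \<zero>\<^bsub>M\<^esub>"
    and v0: "v0 \<in> carrier V" "(param_module.yop G m \<beta> M ^^ (t - 1)) (f v0) \<noteq> \<zero>\<^bsub>M\<^esub>"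
  shows "module_iso H D M"
proof -
  have LM: "left_module H M" using M by (simp add: indecomposable_module_def)
  interpret M: param_module G \<chi> a s \<psi> m \<beta> M
    by (intro param_module.intro ore_param_axioms ore_module.intro ore_setting_axioms LM)
  interpret RM: left_module kG "restriction M" by (rule left_module_restriction[OF LM])
  note fD = linear_mapD[OF f, simplified]
  have fc: "f v \<in> carrier M" if "v \<in> carrier V" for v using fD(1) that .
  have fop: "f (gop g k v) = M.op g k (f v)" if "g \<in> carrier G" "v \<in> carrier V" for g k v
    using that fD(3)[of "mon g k" v] by (simp add: gop_def M.op_def kG.mon_closed ore_embed_mon)
  obtain F where F: "linear_map H D M F" "\<And>v. v \<in> carrier V \<Longrightarrow> 0 < t \<Longrightarrow> F (E (0, 0) v) = f v"
    using D_universal[OF LM f] nil fc by blast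
  note FD = linear_mapD[OF F(1), simplified]
  note Fint = intertwine[OF D.M.left_module_axioms LM F(1), simplified]
  have FE: "F (E (c, b) v) = (M.yop ^^ c) ((M.xop ^^ b) (f v))" if "v \<in> carrier V" "b < m" for c b v
  proof -
    have "F (E (c, b) v) = F ((D.yop ^^ c) ((D.xop ^^ b) (E (0, 0) v)))" using y_x_E that by simp
    also have "\<dots> = (M.yop ^^ c) ((M.xop ^^ b) (F (E (0, 0) v)))"
      using that D.funpow_x_closed[of "E (0, 0) v" b] by (simp add: Fint)
    finally show ?thesis using F(2)[OF that(1) t_pos] by simp
  qed
  define ytop where "ytop v = (M.yop ^^ (t - 1)) (f v)" for v
  have FEtop: "F (E (t - 1, 0) v) = ytop v" if "v \<in> carrier V" for v
    using FE[OF that m_pos, of "t - 1"] by (simp add: ytop_def)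
  have ytop_c: "ytop v \<in> carrier M" if "v \<in> carrier V" for v using fc that by (simp add: ytop_def)
  have ytop_op: "ytop (gop g k v) = M.op g (k * inverse (\<chi> g) ^ ((t - 1) * m)) (ytop v)"
    if "g \<in> carrier G" "v \<in> carrier V" for g k v
    using that fc by (simp add: ytop_def fop M.funpow_y_op)
  have ytop_op': "M.op g k (ytop v) = ytop (gop g (k * \<chi> g ^ ((t - 1) * m)) v)"
    if "g \<in> carrier G" "v \<in> carrier V" for g k v
    using that \<chi>_nonzero[OF that(1)] by (simp add: ytop_op mult.assoc flip: power_mult_distrib)
  define U where "U = ytop ` carrier V"
  have U: "submodule U kG (restriction M)"
  proof (rule kG.submodule_monI[OF RM.left_module_axioms])
    show "U \<subseteq> carrier (restriction M)" using ytop_c by (auto simp: U_def)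
    have "ytop \<zero>\<^bsub>V\<^esub> = \<zero>\<^bsub>M\<^esub>"
      using ytop_op[of "\<one>\<^bsub>G\<^esub>" "\<zero>\<^bsub>V\<^esub>" 0] ytop_c[of "\<zero>\<^bsub>V\<^esub>"] by simp
    then show "\<zero>\<^bsub>restriction M\<^esub> \<in> U" by (simp add: U_def) (metis V.M.zero_closed image_eqI)
  next
    fix u v assume "u \<in> U" "v \<in> U"
    then obtain u' v' where uv: "u = ytop u'" "v = ytop v'" "u' \<in> carrier V" "v' \<in> carrier V" by (auto simp: U_def)
    then have "u \<oplus>\<^bsub>M\<^esub> v = ytop (u' \<oplus>\<^bsub>V\<^esub> v')" using fD(2) fc by (simp add: ytop_def M.funpow_y_add)
    then show "u \<oplus>\<^bsub>restriction M\<^esub> v \<in> U" using uv by (simp add: U_def)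
  next
    fix g k u assume g: "g \<in> carrier G" and "u \<in> U"
    then obtain v where "u = ytop v" "v \<in> carrier V" by (auto simp: U_def)
    then show "mon g k \<odot>\<^bsub>restriction M\<^esub> u \<in> U" unfolding M.op_restriction using g by (simp add: ytop_op' U_def)
  qed
  obtain K where UK: "internal_direct_sum kG (restriction M) U K"
    by (rule semisimple_ring_complement[OF kG RM.left_module_axioms U])
  note UKD = RM.internal_direct_sumD[OF UK, simplified]
  note KD = RM.submoduleD[OF UKD(2), simplified]
  have Kop: "M.op g k v \<in> K" if "g \<in> carrier G" "v \<in> K" for g k v
    using RM.submoduleD(4)[OF UKD(2) kG.mon_closed[OF that(1)] that(2), of k] by (simp only: M.op_restriction)
  have Kminus: "\<ominus>\<^bsub>M\<^esub> v \<in> K" if "v \<in> K" for v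
  proof -
    have "\<ominus>\<^bsub>restriction M\<^esub> v = \<ominus>\<^bsub>M\<^esub> v" by (simp add: a_inv_def m_inv_def)
    then show ?thesis using KD(5)[OF that] by simp
  qed
  \<comment> \<open>\<open>a\<close> acts on \<open>U\<close> by the scalar \<open>\<omega> q\<^sup>n\<close> with \<open>n = (t - 1) m\<close>, so its other eigenvectors lie in \<open>K\<close>\<close>
  define \<omega>' where "\<omega>' = \<omega> * \<chi> a ^ ((t - 1) * m)"
  have eigenK: "w \<in> K" if w: "w \<in> carrier M" "M.op a 1 w = M.sc \<theta> w" "\<theta> \<noteq> \<omega>'" for w \<theta>
  proof -
    obtain u k where uk: "u \<in> U" "k \<in> K" "w = u \<oplus>\<^bsub>M\<^esub> k" using UKD(4)[OF w(1)] by auto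
    then obtain v where v: "u = ytop v" "v \<in> carrier V" by (auto simp: U_def)
    have c: "u \<in> carrier M" "k \<in> carrier M" using v ytop_c uk KD(1) by auto
    have "M.op a 1 u = M.sc \<omega>' u"
      using v a_closed by (simp add: ytop_op' gop_a \<chi>_one \<omega>'_def mult.commute)
    then have 1: "M.op a 1 w = M.sc \<omega>' u \<oplus>\<^bsub>M\<^esub> M.op a 1 k" using uk c a_closed by (simp add: M.op_add)
    have 2: "M.op a 1 w = M.sc \<theta> u \<oplus>\<^bsub>M\<^esub> M.sc \<theta> k" using w(2) uk c by (simp add: M.op_add)
    define z where "z = M.op a 1 k \<oplus>\<^bsub>M\<^esub> M.sc (- \<theta>) k"
    have zK: "z \<in> K" unfolding z_def using Kop uk a_closed KD(3) by auto
    have kk: "M.sc \<theta> k \<oplus>\<^bsub>M\<^esub> M.sc (- \<theta>) k = \<zero>\<^bsub>M\<^esub>" using c by (simp flip: M.op_scalar_add)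
    have "M.sc \<omega>' u \<oplus>\<^bsub>M\<^esub> z = M.sc \<theta> u \<oplus>\<^bsub>M\<^esub> (M.sc \<theta> k \<oplus>\<^bsub>M\<^esub> M.sc (- \<theta>) k)"
      unfolding z_def using 1 2 c a_closed by (simp flip: M.M.a_assoc)
    then have 3: "M.sc \<omega>' u \<oplus>\<^bsub>M\<^esub> z = M.sc \<theta> u" using kk c by simp
    have "M.sc (- \<omega>') u \<oplus>\<^bsub>M\<^esub> (M.sc \<omega>' u \<oplus>\<^bsub>M\<^esub> z) = M.sc (- \<omega>' + \<theta>) u"
      unfolding 3 using c by (simp add: M.op_scalar_add del: minus_add_cancel uminus_add_conv_diff)
    moreover have "M.sc (- \<omega>') u \<oplus>\<^bsub>M\<^esub> (M.sc \<omega>' u \<oplus>\<^bsub>M\<^esub> z) = z"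
      using c zK KD(1) by (simp add: subset_iff flip: M.M.a_assoc M.op_scalar_add)
    ultimately have z: "z = M.sc (- \<omega>' + \<theta>) u" by simp
    have "z \<in> U" unfolding z using v by (simp add: ytop_op' U_def)
    then have "z = \<zero>\<^bsub>M\<^esub>" using UKD(3) zK by blast
    then have "M.sc (\<theta> - \<omega>') u = \<zero>\<^bsub>M\<^esub>" using z by simp
    then have "u = \<zero>\<^bsub>M\<^esub>" using M.op_scalar_eq_zeroD c w(3) by simp
    then show ?thesis using uk c by simp
  qed
  define C where "C = {v \<in> carrier M. \<forall>c b. (M.yop ^^ c) ((M.xop ^^ b) v) \<in> K}"
  have C: "submodule C H M"
  proof (rule M.ore_submoduleI)
    fix g k v assume g: "g \<in> carrier G" and v: "v \<in> C"
    then show "M.op g k v \<in> C" using Kop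
      by (auto simp: C_def M.funpow_x_op M.funpow_y_op)
  next
    fix v assume v: "v \<in> C"
    have "(M.yop ^^ c) ((M.xop ^^ b) (M.xop v)) \<in> K" for c b
    proof -
      have "(M.yop ^^ c) ((M.xop ^^ Suc b) v) \<in> K" using v unfolding C_def by blast
      then show ?thesis by (simp add: funpow_swap1)
    qed
    then show "M.xop v \<in> C" using v by (simp add: C_def)
  qed (use KD in \<open>auto simp: C_def M.funpow_x_add M.funpow_y_add\<close>)
  have Ctop: "ytop v0 \<notin> C"
  proof
    assume "ytop v0 \<in> C"
    then have "(M.yop ^^ 0) ((M.xop ^^ 0) (ytop v0)) \<in> K" unfolding C_def by blast
    moreover have "ytop v0 \<in> U" using v0 by (simp add: U_def)
    ultimately have "ytop v0 = \<zero>\<^bsub>M\<^esub>" using UKD(3) by auto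
    then show False using v0 by (simp add: ytop_def)
  qed
  have pre: "d = \<zero>\<^bsub>D\<^esub>" if d: "d \<in> carrier D" "F d \<in> C" for d
  proof (rule ccontr)
    assume "d \<noteq> \<zero>\<^bsub>D\<^esub>"
    moreover have "submodule {d \<in> carrier D. F d \<in> C} H D"
      by (rule submodule_preimage[OF D.M.left_module_axioms LM F(1) C])
    ultimately have "E (t - 1, 0) v0 \<in> {d \<in> carrier D. F d \<in> C}"
      using socle[of "{d \<in> carrier D. F d \<in> C}" d v0] d v0 by simp
    then show False using Ctop FEtop v0 by simp
  qed
  define N where "N = F ` carrier D"
  have N: "submodule N H M"
    unfolding N_def by (rule submodule_image[OF D.M.left_module_axioms LM F(1) D.M.submodule_carrier])
  note ND = M.M.submoduleD[OF N] M.ore_submoduleD[OF N]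
  have yx_E: "(M.yop ^^ c) ((M.xop ^^ b) (f v)) \<in> N" if "v \<in> carrier V" "b < m" for c b v
    using FE[OF that] E_closed[OF that(1), of "(c, b)"] unfolding N_def by (metis D_simps(1) image_eqI)
  have Cint: "N \<inter> C = {\<zero>\<^bsub>M\<^esub>}"
  proof -
    have "\<zero>\<^bsub>M\<^esub> \<in> C" by (rule M.M.submoduleD(2)[OF C])
    moreover have "F \<zero>\<^bsub>D\<^esub> = \<zero>\<^bsub>M\<^esub>" by (rule linear_map_zero[OF D.M.left_module_axioms LM F(1)])
    ultimately show ?thesis using pre ND(2) by (auto simp: N_def)
  qed
  \<comment> \<open>once the pairs \<open>(c, b)\<close> with \<open>c > c0\<close> and those with \<open>c = c0\<close>, \<open>b \<in> B\<close> are settled, one subtracts an \<open>n'\<close>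
     that accounts for the \<open>U\<close>-part at \<open>(c0, b0)\<close> and contributes only elements of \<open>K\<close> at the settled pairs\<close>
  have step: "\<exists>n\<in>N. \<forall>c b. (c0 < c \<and> b < m) \<or> (c = c0 \<and> b \<in> B) \<longrightarrow> (M.yop ^^ c) ((M.xop ^^ b) (v \<ominus>\<^bsub>M\<^esub> n)) \<in> K"
    if c0: "c0 < t" and v: "v \<in> carrier M" and B: "finite B" "B \<subseteq> {..<m}"
      and IH: "\<exists>n\<in>N. \<forall>c b. c0 < c \<and> b < m \<longrightarrow> (M.yop ^^ c) ((M.xop ^^ b) (v \<ominus>\<^bsub>M\<^esub> n)) \<in> K" for c0 v B
    using B
  proof (induction B rule: finite_induct)
    case empty then show ?case using IH by auto
  next
    case (insert b0 B)
    then obtain n where n: "n \<in> N"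
      "\<And>c b. (c0 < c \<and> b < m) \<or> (c = c0 \<and> b \<in> B) \<Longrightarrow> (M.yop ^^ c) ((M.xop ^^ b) (v \<ominus>\<^bsub>M\<^esub> n)) \<in> K" by auto
    define v' where "v' = v \<ominus>\<^bsub>M\<^esub> n"
    have nc: "n \<in> carrier M" and v'c: "v' \<in> carrier M" using n ND(1) v by (auto simp: v'_def)
    obtain u k where uk: "u \<in> U" "k \<in> K" "(M.yop ^^ c0) ((M.xop ^^ b0) v') = u \<oplus>\<^bsub>M\<^esub> k"
      using UKD(4)[of "(M.yop ^^ c0) ((M.xop ^^ b0) v')"] v'c by auto
    then obtain w where w: "u = ytop w" "w \<in> carrier V" by (auto simp: U_def)
    \<comment> \<open>\<open>e + b0\<close> is \<open>0\<close> or \<open>m\<close>, and \<open>y\<^sup>t\<^sup>-\<^sup>1 x\<^sup>m = \<beta> y\<^sup>t\<^sup>-\<^sup>1\<close>\<close>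
    define e where "e = (if b0 = 0 then 0 else m - b0)"
    define \<gamma> where "\<gamma> = (if b0 = 0 then 1 else inverse \<beta>)"
    have b0: "b0 < m" using insert by auto
    then have e: "e < m" using m_pos by (auto simp: e_def)
    define w' where "w' = gop \<one>\<^bsub>G\<^esub> \<gamma> w"
    have w'c: "w' \<in> carrier V" using w by (simp add: w'_def)
    define n' where "n' = (M.yop ^^ (t - 1 - c0)) ((M.xop ^^ e) (f w'))"
    have n'N: "n' \<in> N" unfolding n'_def by (rule yx_E[OF w'c e])
    then have n'c: "n' \<in> carrier M" using ND(1) by auto
    have act: "(M.yop ^^ c) ((M.xop ^^ b) n') = (M.xop ^^ (b + e)) ((M.yop ^^ (c + (t - 1 - c0))) (f w'))" for c b
      using fc[OF w'c] by (simp add: n'_def M.funpow_y_x funpow_add)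
    have top: "c0 + (t - 1 - c0) = t - 1" using c0 by simp
    have act0: "(M.yop ^^ c0) ((M.xop ^^ b) n') = (M.xop ^^ (b + e)) (ytop w')" for b
      unfolding act top ytop_def ..
    have ymy: "(M.xop ^^ m) (ytop w') = M.sc \<beta> (ytop w')"
    proof -
      have "M.yop (ytop w') = (M.yop ^^ t) (f w')" unfolding ytop_def using t_pos by (metis Suc_diff_1 comp_apply funpow.simps(2))
      then show ?thesis using M.xop_power_m[OF ytop_c[OF w'c]] nil[OF fc[OF w'c]] ytop_c[OF w'c] by simp
    qed
    have at0: "(M.yop ^^ c0) ((M.xop ^^ b0) n') = u"
    proof (cases "b0 = 0")
      case True then show ?thesis using w unfolding act0 by (simp add: e_def w'_def \<gamma>_def)
    next
      case False
      then have "1 < m" using b0 by simp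
      have "b0 + e = m" using False b0 by (simp add: e_def)
      then have "(M.yop ^^ c0) ((M.xop ^^ b0) n') = M.sc \<beta> (ytop w')" unfolding act0 by (simp add: ymy)
      also have "\<dots> = u" using w False \<beta>_nonzero[OF \<open>1 < m\<close>] unfolding w'_def by (simp add: ytop_op' gop_gop \<chi>_one \<gamma>_def)
      finally show ?thesis .
    qed
    have others: "(M.yop ^^ c) ((M.xop ^^ b) n') \<in> K" if "(c0 < c \<and> b < m) \<or> (c = c0 \<and> b \<in> B)" for c b
      using that
    proof
      assume "c0 < c \<and> b < m"
      then have "c + (t - 1 - c0) = (c - c0 - 1) + t" using c0 by simp
      then have "(M.yop ^^ (c + (t - 1 - c0))) (f w') = \<zero>\<^bsub>M\<^esub>" using nil[OF fc[OF w'c]] by (simp add: funpow_add)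
      then show ?thesis unfolding act using KD(2) by simp
    next
      assume b: "c = c0 \<and> b \<in> B"
      then have bm: "b < m" "b \<noteq> b0" using insert by auto
      have m1: "1 < m" using bm b0 by linarith
      then have ms: "m = s" using param by auto
      \<comment> \<open>\<open>b + e\<close> is congruent to \<open>b - b0\<close>, hence not to \<open>0\<close>, modulo \<open>m = s\<close>\<close>
      have q: "\<chi> a ^ (b + e) \<noteq> 1"
      proof
        assume "\<chi> a ^ (b + e) = 1"
        then have "m dvd b + e" using ord_q ms by simp
        then obtain j where j: "b + e = m * j" by (elim dvdE)
        show False
        proof (cases "b0 = 0")
          case True
          then have "0 < b" "b = m * j" using bm j by (auto simp: e_def)
          then show False using bm(1) by (cases j) auto
        next
          case False
          then have "b + m = m * j + b0" using j b0 by (simp add: e_def)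
          then have "b mod m = b0 mod m" by (metis mod_add_self2 mod_mult_self4)
          then show False using bm b0 by simp
        qed
      qed
      let ?w = "(M.xop ^^ (b + e)) (ytop w')"
      have wc: "?w \<in> carrier M" using ytop_c[OF w'c] by simp
      have q1: "inverse (\<chi> a) ^ n * \<chi> a ^ n = 1" for n
        using \<chi>_nonzero[OF a_closed] by (simp flip: power_mult_distrib)
      have "M.op a 1 (ytop w') = M.sc \<omega>' (ytop w')"
        using w'c a_closed by (simp add: ytop_op' gop_a \<chi>_one \<omega>'_def mult.commute)
      then have "M.op a (inverse (\<chi> a) ^ (b + e)) ?w = M.sc \<omega>' ?w"
        using M.funpow_x_op[OF a_closed ytop_c[OF w'c], of "b + e" 1] M.funpow_x_sc[OF ytop_c[OF w'c], of "b + e" \<omega>'] by simp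
      then have "M.sc (\<chi> a ^ (b + e)) (M.op a (inverse (\<chi> a) ^ (b + e)) ?w) = M.sc (\<chi> a ^ (b + e)) (M.sc \<omega>' ?w)" by simp
      then have "M.op a 1 ?w = M.sc (\<chi> a ^ (b + e) * \<omega>') ?w"
        using wc a_closed q1[of "b + e"] by (simp add: M.op_op mult.commute)
      moreover have "\<chi> a ^ (b + e) * \<omega>' \<noteq> \<omega>'"
        using q \<omega>_nonzero \<chi>_nonzero[OF a_closed] by (simp add: \<omega>'_def)
      ultimately have "?w \<in> K" by (intro eigenK[OF wc])
      then show ?thesis unfolding b[THEN conjunct1] act0 .
    qed
    have diff: "(M.yop ^^ c) ((M.xop ^^ b) (v \<ominus>\<^bsub>M\<^esub> (n \<oplus>\<^bsub>M\<^esub> n'))) =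
        (M.yop ^^ c) ((M.xop ^^ b) v') \<ominus>\<^bsub>M\<^esub> (M.yop ^^ c) ((M.xop ^^ b) n')" for c b
    proof -
      have "v' = (v \<ominus>\<^bsub>M\<^esub> (n \<oplus>\<^bsub>M\<^esub> n')) \<oplus>\<^bsub>M\<^esub> n'"
        using v nc n'c by (simp add: v'_def a_minus_def M.M.minus_add M.M.a_assoc M.M.l_neg)
      then have "(M.yop ^^ c) ((M.xop ^^ b) v') = (M.yop ^^ c) ((M.xop ^^ b) (v \<ominus>\<^bsub>M\<^esub> (n \<oplus>\<^bsub>M\<^esub> n'))) \<oplus>\<^bsub>M\<^esub> (M.yop ^^ c) ((M.xop ^^ b) n')"
        using v nc n'c by (metis M.funpow_x_add M.funpow_x_closed M.funpow_y_add M.M.a_closed M.M.minus_closed)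
      then show ?thesis using v nc n'c by (simp add: a_minus_def M.M.a_assoc M.M.r_neg)
    qed
    have "(M.yop ^^ c) ((M.xop ^^ b) (v \<ominus>\<^bsub>M\<^esub> (n \<oplus>\<^bsub>M\<^esub> n'))) \<in> K"
      if "(c0 < c \<and> b < m) \<or> (c = c0 \<and> b \<in> insert b0 B)" for c b
    proof (cases "c = c0 \<and> b = b0")
      case True
      have "u \<oplus>\<^bsub>M\<^esub> k \<ominus>\<^bsub>M\<^esub> u = k" using w ytop_c uk KD(1) by (intro M.M.add_diff_cancel_left) auto
      then show ?thesis unfolding diff using True uk at0 by simp
    next
      case False
      then have *: "(c0 < c \<and> b < m) \<or> (c = c0 \<and> b \<in> B)" using that by auto
      have "(M.yop ^^ c) ((M.xop ^^ b) v') \<in> K" unfolding v'_def by (rule n(2)[OF *])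
      then show ?thesis unfolding diff using KD(3) Kminus others[OF *] by (simp add: a_minus_def)
    qed
    moreover have "n \<oplus>\<^bsub>M\<^esub> n' \<in> N" using ND(3) n n'N by blast
    ultimately show ?case by blast
  qed
  have sum: "\<exists>n\<in>N. v \<ominus>\<^bsub>M\<^esub> n \<in> C" if v: "v \<in> carrier M" for v
  proof -
    have "\<exists>n\<in>N. \<forall>c b. t \<le> c + j \<and> b < m \<longrightarrow> (M.yop ^^ c) ((M.xop ^^ b) (v \<ominus>\<^bsub>M\<^esub> n)) \<in> K" if "j \<le> t" for j
      using that
    proof (induction j)
      case 0
      have "(M.yop ^^ c) ((M.xop ^^ b) (v \<ominus>\<^bsub>M\<^esub> \<zero>\<^bsub>M\<^esub>)) \<in> K" if "t \<le> c" for c b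
      proof -
        have "(M.yop ^^ c) w = (M.yop ^^ (c - t)) ((M.yop ^^ t) w)" for w
          using that by (simp flip: funpow_add[unfolded comp_def, THEN fun_cong])
        then show ?thesis using nil v KD(2) by simp
      qed
      then show ?case using ND(2) by auto
    next
      case (Suc j)
      define c0 where "c0 = t - Suc j"
      have c0: "c0 < t" "c0 < c \<longleftrightarrow> t \<le> c + j" for c using Suc(2) by (auto simp: c0_def)
      obtain n where n: "n \<in> N" "\<forall>c b. (c0 < c \<and> b < m) \<or> (c = c0 \<and> b \<in> {..<m}) \<longrightarrow>
          (M.yop ^^ c) ((M.xop ^^ b) (v \<ominus>\<^bsub>M\<^esub> n)) \<in> K"
        using step[OF c0(1) v, of "{..<m}"] Suc by (auto simp: c0)
      have "c0 < c \<or> c = c0" if "t \<le> c + Suc j" for c using that by (auto simp: c0_def)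
      then show ?case using n by (intro bexI[of _ n]) auto
    qed
    from this[OF order_refl] obtain n where n: "n \<in> N"
      "\<And>c b. b < m \<Longrightarrow> (M.yop ^^ c) ((M.xop ^^ b) (v \<ominus>\<^bsub>M\<^esub> n)) \<in> K" by auto
    define w where "w = v \<ominus>\<^bsub>M\<^esub> n"
    have wc: "w \<in> carrier M" using v n ND(1) by (auto simp: w_def)
    \<comment> \<open>larger powers of \<open>x\<close> are reduced with \<open>x\<^sup>m = y + \<beta>\<close>\<close>
    have "(M.yop ^^ c) ((M.xop ^^ b) w) \<in> K" for c b
    proof (induction b arbitrary: c rule: less_induct)
      case (less b)
      show ?case
      proof (cases "b < m")
        case True then show ?thesis using n(2) by (simp add: w_def)
      next
        case False
        define b' where "b' = b - m"
        have "(M.xop ^^ b) w = (M.xop ^^ m) ((M.xop ^^ b') w)"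
          using False by (simp add: b'_def flip: funpow_add[unfolded comp_def, THEN fun_cong])
        also have "\<dots> = M.yop ((M.xop ^^ b') w) \<oplus>\<^bsub>M\<^esub> M.sc \<beta> ((M.xop ^^ b') w)"
          using wc by (simp add: M.xop_power_m)
        finally have "(M.yop ^^ c) ((M.xop ^^ b) w) =
            (M.yop ^^ Suc c) ((M.xop ^^ b') w) \<oplus>\<^bsub>M\<^esub> M.sc \<beta> ((M.yop ^^ c) ((M.xop ^^ b') w))"
          using wc by (simp add: M.funpow_y_add M.funpow_y_sc funpow_swap1)
        moreover have "b' < b" using False m_pos by (simp add: b'_def)
        ultimately show ?thesis using less[of b' "Suc c"] less[of b' c] KD(3) Kop by simp
      qed
    qed
    then show ?thesis using n(1) wc by (auto simp: C_def w_def)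
  qed
  have "N <+>\<^bsub>M\<^esub> C = carrier M"
  proof
    show "N <+>\<^bsub>M\<^esub> C \<subseteq> carrier M" by (rule M.M.submoduleD(1)[OF M.M.submodule_set_add[OF N C]])
    show "carrier M \<subseteq> N <+>\<^bsub>M\<^esub> C"
    proof
      fix v assume v: "v \<in> carrier M"
      then obtain n where n: "n \<in> N" "v \<ominus>\<^bsub>M\<^esub> n \<in> C" using sum by blast
      then have "n \<in> carrier M" using ND(1) by auto
      then have "v = n \<oplus>\<^bsub>M\<^esub> (v \<ominus>\<^bsub>M\<^esub> n)" using v by (simp add: a_minus_def M.M.a_comm[of v] M.M.r_neg flip: M.M.a_assoc)
      then show "v \<in> N <+>\<^bsub>M\<^esub> C" using M.M.set_addI[OF n] by simp
    qed
  qed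
  then have NC: "internal_direct_sum H M N C" using N C Cint by (simp add: internal_direct_sum_def)
  have "ytop v0 \<in> N" using FEtop[OF v0(1)] E_closed[OF v0(1), of "(t - 1, 0)"] unfolding N_def by (metis D_simps(1) image_eqI)
  then have "N \<noteq> {\<zero>\<^bsub>M\<^esub>}" using v0 by (auto simp: ytop_def)
  then have C0: "C = {\<zero>\<^bsub>M\<^esub>}" using M NC by (auto simp: indecomposable_module_def)
  have "F ` carrier D = carrier M"
  proof
    show "F ` carrier D \<subseteq> carrier M" using FD(1) by auto
    show "carrier M \<subseteq> F ` carrier D"
    proof
      fix v assume v: "v \<in> carrier M"
      then obtain n where n: "n \<in> N" "v \<ominus>\<^bsub>M\<^esub> n = \<zero>\<^bsub>M\<^esub>" using sum C0 by blast
      then have "v = n" using M.M.diff_zeroD[OF v] ND(1) by blast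
      then show "v \<in> F ` carrier D" using n by (simp add: N_def)
    qed
  qed
  moreover have "inj_on F (carrier D)"
    by (rule linear_map_inj_on[OF D.M.left_module_axioms LM F(1)]) (use pre C0 in auto)
  ultimately show ?thesis unfolding module_iso_iff using F(1) by (auto simp: bij_betw_def)
qed

end

section \<open>Models that are isomorphic\<close>

lemma (in param_module) yop_of_eigen:
  assumes v: "v \<in> carrier M" and e: "(xop ^^ m) v = sc \<theta> v"
  shows "(yop ^^ n) v = sc ((\<theta> - \<beta>) ^ n) v"
proof (induction n)
  case (Suc n)
  have 1: "yop v = sc (\<theta> - \<beta>) v" unfolding yop_def e using v op_scalar_add[of "\<one>\<^bsub>G\<^esub>" v \<theta> "- \<beta>"] by simp
  have "(yop ^^ Suc n) v = yop (sc ((\<theta> - \<beta>) ^ n) v)" using Suc by simp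
  also have "\<dots> = sc ((\<theta> - \<beta>) ^ n) (yop v)" using v by (simp add: yop_op \<chi>_one)
  finally show ?case using 1 v by (simp add: op_op mult.commute)
qed (use v in simp)

lemma (in param_module) eigen_of_kernel:
  assumes v: "v \<in> carrier M" and y: "yop v = \<zero>\<^bsub>M\<^esub>"
  shows "(xop ^^ s) v = sc \<beta> v"
proof -
  have *: "(xop ^^ m) v = sc \<beta> v" using xop_power_m[OF v] y v by simp
  consider "m = s" | "m = 1" "\<beta> = 0" using param by auto
  then show ?thesis
  proof cases
    case 2
    then have "xop v = \<zero>\<^bsub>M\<^esub>" using * v by simp
    moreover obtain s' where "s = Suc s'" using s_pos by (cases s) auto
    ultimately have "(xop ^^ s) v = (xop ^^ s') \<zero>\<^bsub>M\<^esub>" by (simp only: funpow_Suc_right comp_apply)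
    then show ?thesis using v by (simp add: 2)
  qed (use * in simp)
qed

text \<open>
  If \<open>m = s\<close>, then \<open>y\<^sup>t\<close> multiplies an eigenvector for \<open>\<theta>\<close> by \<open>(\<theta> - \<beta>)\<^sup>t\<close>; if \<open>m = 1\<close>, then \<open>x = y\<close> is
  nilpotent, so that \<open>\<theta> = 0\<close>.
\<close>

lemma (in param_module) unique_eigenvalue:
  assumes v: "v \<in> carrier M" "v \<noteq> \<zero>\<^bsub>M\<^esub>" and e: "(xop ^^ s) v = sc \<theta> v"
    and nil: "\<And>v. v \<in> carrier M \<Longrightarrow> (yop ^^ t) v = \<zero>\<^bsub>M\<^esub>"
  shows "\<theta> = \<beta>"
proof -
  consider "m = s" | "m = 1" "\<beta> = 0" using param by auto
  then show ?thesis
  proof cases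
    case 1
    then have "sc ((\<theta> - \<beta>) ^ t) v = \<zero>\<^bsub>M\<^esub>" using yop_of_eigen[OF v(1), of \<theta> t] e nil[OF v(1)] by simp
    then show ?thesis using op_scalar_eq_zeroD[OF v(1)] v(2) by fastforce
  next
    case 2
    have yx: "yop w = xop w" if "w \<in> carrier M" for w unfolding yop_def using that by (simp add: 2)
    have yxn: "(yop ^^ n) w = (xop ^^ n) w" if "w \<in> carrier M" for n w using that by (induction n) (auto simp: yx)
    have "((xop ^^ s) ^^ n) v = sc (\<theta> ^ n) v" for n
    proof (induction n)
      case (Suc n)
      then have "((xop ^^ s) ^^ Suc n) v = (xop ^^ s) (sc (\<theta> ^ n) v)" by simp
      then show ?case using v by (simp add: funpow_x_sc e op_op mult.commute)
    qed (use v in simp)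
    moreover have "((xop ^^ s) ^^ t) v = (xop ^^ (t * (s - 1))) ((xop ^^ t) v)"
    proof -
      have "s * t = t * (s - 1) + t" using s_pos by (cases s) (auto simp: algebra_simps)
      then show ?thesis by (simp add: funpow_mult flip: funpow_add[unfolded comp_def, THEN fun_cong])
    qed
    moreover have "(xop ^^ t) v = \<zero>\<^bsub>M\<^esub>" using nil[OF v(1)] yxn[OF v(1)] by simp
    ultimately have "sc (\<theta> ^ t) v = \<zero>\<^bsub>M\<^esub>" by simp
    then have "\<theta> ^ t = 0" using op_scalar_eq_zeroD[OF v(1)] v(2) by blast
    then show ?thesis using 2 by simp
  qed
qed

text \<open>
  An isomorphism preserves the eigenvalue of \<open>x\<^sup>s\<close>, hence \<open>\<beta>\<close>, the nilpotency index of \<open>y\<close>, hence \<open>t\<close>,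
  and the kernel of \<open>y\<close>, the sum of the spaces \<open>y\<^sup>t\<^sup>-\<^sup>1 x\<^sup>b \<otimes> V'\<close>; one of the projections of
  \<open>y\<^sup>t\<^sup>-\<^sup>1 \<otimes> V\<close> to these is nonzero and so, up to a twist, an isomorphism.
\<close>

lemma (in ore_setting) model_iso_imp:
  fixes V V' :: "('g \<Rightarrow>\<^sub>0 'k, 'v) module"
  assumes 1: "simple_model G \<chi> a s \<psi> m \<beta> V t \<omega>" and 2: "simple_model G \<chi> a s \<psi> m' \<beta>' V' t' \<omega>'"
    and iso: "module_iso H (model.D G \<chi> m \<beta> V t) (model.D G \<chi> m' \<beta>' V' t')"
  shows "\<beta> = \<beta>'" "m = m'" "t = t'" "\<exists>b<m. module_iso kG V (twist b V')"
proof -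
  interpret A: simple_model G \<chi> a s \<psi> m \<beta> V t \<omega> by (rule 1)
  interpret B: simple_model G \<chi> a s \<psi> m' \<beta>' V' t' \<omega>' by (rule 2)
  obtain f where f: "linear_map H A.D B.D f" "bij_betw f (carrier A.D) (carrier B.D)"
    using iso by (auto simp: module_iso_iff)
  note fD = linear_mapD[OF f(1), simplified]
  note fint = A.intertwine[OF A.D.M.left_module_axioms B.D.M.left_module_axioms f(1), simplified]
  have f0: "f \<zero>\<^bsub>A.D\<^esub> = \<zero>\<^bsub>B.D\<^esub>"
    by (rule linear_map_zero[OF A.D.M.left_module_axioms B.D.M.left_module_axioms f(1)])
  have fne: "f d \<noteq> \<zero>\<^bsub>B.D\<^esub>" if "d \<in> carrier A.D" "d \<noteq> \<zero>\<^bsub>A.D\<^esub>" for d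
    using that f(2) f0 by (metis A.D.M.M.zero_closed bij_betw_imp_inj_on inj_onD)
  obtain v where v: "v \<in> carrier V" "v \<noteq> \<zero>\<^bsub>V\<^esub>" by (rule A.V_nonzero)
  define d where "d v = A.E (t - 1, 0) v" for v
  have dc: "d v \<in> carrier A.group_D" if "v \<in> carrier V" for v using that by (simp add: d_def)
  have dne: "d v \<noteq> \<zero>\<^bsub>A.D\<^esub>" unfolding d_def by (rule A.E_top_nonzero[OF v])
  have yd: "A.D.yop (d v) = \<zero>\<^bsub>A.D\<^esub>" if "v \<in> carrier V" for v
    using A.yop_E[OF that A.m_pos, of "t - 1"] A.t_pos by (simp add: d_def A.E_outside A.Ix_iff)
  have "(A.D.xop ^^ s) (d v) = A.D.sc \<beta> (d v)"
    by (rule A.D.eigen_of_kernel) (use dc[OF v(1)] yd[OF v(1)] in \<open>simp_all only: A.D_simps\<close>)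
  then have "(B.D.xop ^^ s) (f (d v)) = B.D.sc \<beta> (f (d v))"
    using fint(2)[of "d v" s] fint(1)[of "d v" "\<one>\<^bsub>G\<^esub>" \<beta>] dc[OF v(1)] by simp
  then show \<beta>: "\<beta> = \<beta>'"
    using B.D.unique_eigenvalue[of "f (d v)" \<beta> t'] fne[OF _ dne] dc[OF v(1)] fD(1) B.yop_nilpotent by simp
  then show m: "m = m'" using A.param B.param by auto
  have "param_module.yop G m \<beta> B.D = B.D.yop" by (simp only: \<beta> m)
  note fint3 = fint(3)[unfolded this]
  have "t \<le> t'"
  proof (rule ccontr)
    assume "\<not> t \<le> t'"
    then have "A.E (t', 0) v \<noteq> \<zero>\<^bsub>A.D\<^esub>" using v A.m_pos by (auto simp: A.E_def A.Ix_iff fun_eq_iff)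
    moreover have "f (A.E (t', 0) v) = \<zero>\<^bsub>B.D\<^esub>"
    proof -
      have "A.E (t', 0) v = (A.D.yop ^^ t') (A.E (0, 0) v)" using A.funpow_y_E[OF v(1) A.m_pos, of t' 0] by simp
      then have "f (A.E (t', 0) v) = (B.D.yop ^^ t') (f (A.E (0, 0) v))" using fint3[of "A.E (0, 0) v" t'] v by simp
      then show ?thesis using B.yop_nilpotent fD(1) v by simp
    qed
    ultimately show False using fne[of "A.E (t', 0) v"] v by simp
  qed
  moreover have "t' \<le> t"
  proof (rule ccontr)
    assume "\<not> t' \<le> t"
    obtain v' where v': "v' \<in> carrier V'" "v' \<noteq> \<zero>\<^bsub>V'\<^esub>" by (rule B.V_nonzero)
    have "B.E (t, 0) v' \<noteq> \<zero>\<^bsub>B.D\<^esub>" using v' B.m_pos \<open>\<not> t' \<le> t\<close> by (auto simp: B.E_def B.Ix_iff fun_eq_iff)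
    moreover have "B.E (t, 0) v' = \<zero>\<^bsub>B.D\<^esub>"
    proof -
      have "B.E (0, 0) v' \<in> f ` carrier A.D" using f(2) v' by (simp add: bij_betw_def)
      then obtain u where u: "u \<in> carrier A.D" "B.E (0, 0) v' = f u" by blast
      have "B.E (t, 0) v' = (B.D.yop ^^ t) (f u)" using B.funpow_y_E[OF v'(1) B.m_pos, of t 0] u by simp
      also have "\<dots> = f ((A.D.yop ^^ t) u)" using fint3[of u t] u by simp
      finally show ?thesis using A.yop_nilpotent[OF u(1)] f0 by simp
    qed
    ultimately show False by simp
  qed
  ultimately show t: "t = t'" by simp
  have fdc: "f (d v) \<in> carrier B.group_D" if "v \<in> carrier V" for v using fD(1) dc that by simp
  have fdV: "f (d v) p \<in> carrier V'" if "v \<in> carrier V" for v p using fdc[OF that] unfolding B.carrier_group_D by blast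
  have out: "f (d v) (c, b) = \<zero>\<^bsub>V'\<^esub>" if "(c, b) \<noteq> (t - 1, b) \<or> \<not> b < m" for c b
  proof (cases "(c, b) \<in> B.Ix")
    case True
    then have c: "c < t" "b < m" using t m by (auto simp: B.Ix_iff)
    then have "Suc c < t" using that by auto
    have "B.D.yop (f (d v)) = \<zero>\<^bsub>B.D\<^esub>" using fint3[of "d v" 1] yd[OF v(1)] dc[OF v(1)] f0 by simp
    then have "(\<lambda>(c, b). if (c, b) \<in> B.Ix \<and> 1 \<le> c then f (d v) (c - 1, b) else \<zero>\<^bsub>V'\<^esub>) = (\<lambda>_. \<zero>\<^bsub>V'\<^esub>)"
      using B.funpow_y_D[OF fdc[OF v(1)], of 1] by simp
    from fun_cong[OF this, of "(Suc c, b)"] show ?thesis using \<open>Suc c < t\<close> c t m by (simp add: B.Ix_iff)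
  next
    case False
    then show ?thesis using fdc[OF v(1)] unfolding B.carrier_group_D by blast
  qed
  have "\<exists>b<m. f (d v) (t - 1, b) \<noteq> \<zero>\<^bsub>V'\<^esub>"
  proof (rule ccontr)
    assume *: "\<not> ?thesis"
    have "f (d v) (c, b) = \<zero>\<^bsub>V'\<^esub>" for c b using out[of c b] * by (cases "c = t - 1 \<and> b < m") auto
    then have "f (d v) = \<zero>\<^bsub>B.D\<^esub>" by (auto simp: fun_eq_iff)
    then show False using fne[OF _ dne] dc[OF v(1)] by simp
  qed
  then obtain b where b: "b < m" "f (d v) (t - 1, b) \<noteq> \<zero>\<^bsub>V'\<^esub>" by auto
  define h where "h v = f (d v) (t - 1, b)" for v
  have "linear_map kG V (twist b V') h"
  proof (rule kG.linear_mapI[OF A.V.left_module_axioms B.left_module_twist])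
    show "h \<in> carrier V \<rightarrow> carrier (twist b V')" using fdV by (simp add: h_def)
    fix u w assume "u \<in> carrier V" "w \<in> carrier V"
    then show "h (u \<oplus>\<^bsub>V\<^esub> w) = h u \<oplus>\<^bsub>twist b V'\<^esub> h w"
      using fD(2)[of "d u" "d w"] dc by (simp add: h_def d_def A.E_add)
  next
    fix g k w assume g: "g \<in> carrier G" and w: "w \<in> carrier V"
    let ?k = "k * inverse (\<chi> g ^ ((t - 1) * m))"
    have "d (A.gop g k w) = A.D.op g ?k (d w)"
      unfolding d_def using g w \<chi>_nonzero[OF g] by (subst A.op_E) (auto simp: mult.assoc)
    then have "f (d (A.gop g k w)) = B.gD g ?k (f (d w))"
      using fint(1)[of "d w" g ?k] g dc[OF w] B.D_op[OF g fdc[OF w]] by simp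
    then have "h (A.gop g k w) = B.gop g (?k * \<chi> g ^ ((t - 1) * m' + b)) (h w)"
      by (simp add: h_def B.gD_def)
    also have "?k * \<chi> g ^ ((t - 1) * m' + b) = k * \<chi> g ^ b" using m \<chi>_nonzero[OF g] by (simp add: power_add)
    also have "B.gop g (k * \<chi> g ^ b) (h w) = mon g k \<odot>\<^bsub>twist b V'\<^esub> h w"
      using B.twist_mon[OF g, where v = "h w" and k = k and n = b] fdV[OF w] by (simp add: h_def)
    finally show "h (mon g k \<odot>\<^bsub>V\<^esub> w) = mon g k \<odot>\<^bsub>twist b V'\<^esub> h w" by (simp add: A.gop_def)
  qed
  moreover from this have "bij_betw h (carrier V) (carrier (twist b V'))"
    by (rule schur[OF A.simple B.simple_twist[OF B.simple]]) (use v b in \<open>auto simp: h_def\<close>)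
  ultimately show "\<exists>b<m. module_iso kG V (twist b V')" unfolding module_iso_iff using b(1) by blast
qed

section \<open>Finite dimensional indecomposable modules\<close>

text \<open>
  Since \<open>x\<^sup>s\<close> is central, coprime factors of a polynomial that annihilates it decompose \<open>M\<close>;
  so the polynomial may be taken to be a power of \<open>X - b\<close>.
\<close>

lemma (in ore_module) central_power_eigenvalue:
  assumes M: "indecomposable_module H M" and fd: "finite_dimensional (ore_scalar G) M"
  obtains b n where "\<And>v. v \<in> carrier M \<Longrightarrow> ((\<lambda>w. (xop ^^ s) w \<oplus>\<^bsub>M\<^esub> sc (- b) w) ^^ n) v = \<zero>\<^bsub>M\<^esub>"
proof -
  interpret P: poly_action M sc "xop ^^ s"
    by unfold_locales (auto simp: op_add funpow_x_add op_scalar_add op_op funpow_x_sc)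
  obtain B where B: "finite B" "B \<subseteq> carrier M" "\<And>v. v \<in> carrier M \<Longrightarrow> \<exists>c. v = (\<Oplus>\<^bsub>M\<^esub>b\<in>B. sc (c b) b)"
    using fd unfolding finite_dimensional_def op_def ore_scalar_def by blast
  obtain p where p: "p \<noteq> 0" "\<And>v. v \<in> carrier M \<Longrightarrow> P.pact p v = \<zero>\<^bsub>M\<^esub>"
    by (rule P.finite_span_annihilator[OF B], assumption, rule that, assumption, erule bspec, assumption)
  have M0: "carrier M \<noteq> {\<zero>\<^bsub>M\<^esub>}" using M by (simp add: indecomposable_module_def)
  obtain b n r where r: "poly r b \<noteq> 0" "\<forall>v\<in>carrier M. P.pact ([:- b, 1:] ^ n * r) v = \<zero>\<^bsub>M\<^esub>"
    "\<exists>v\<in>carrier M. P.pact r v \<noteq> \<zero>\<^bsub>M\<^esub>"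
    by (rule P.annihilator_root[OF p M0], assumption, rule that; assumption)
  obtain A B where AB: "A * [:- b, 1:] ^ n + B * r = 1" by (rule bezout_power[OF r(1)])
  have op: "P.pact p (op g k v) = op g k (P.pact p v)" if "g \<in> carrier G" "v \<in> carrier M" for p g k v
  proof (induction p)
    case (pCons c p)
    have "inverse (\<chi> g) ^ s = 1" using \<chi>_power[OF that(1)] by (simp add: power_inverse)
    then show ?case using pCons that by (simp add: P.pact_pCons op_add op_op funpow_x_op mult.commute)
  qed (use that in simp)
  have x: "P.pact p (xop v) = xop (P.pact p v)" if "v \<in> carrier M" for p v
  proof (induction p)
    case (pCons c p)
    then show ?case using that by (simp add: P.pact_pCons xop_add xop_op \<chi>_one funpow_swap1)
  qed simp
  have sub: "submodule {v \<in> carrier M. P.pact p v = \<zero>\<^bsub>M\<^esub>} H M" for p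
    by (rule ore_submoduleI) (auto simp: P.pact_vadd op x)
  let ?N1 = "{v \<in> carrier M. P.pact ([:- b, 1:] ^ n) v = \<zero>\<^bsub>M\<^esub>}" and ?N2 = "{v \<in> carrier M. P.pact r v = \<zero>\<^bsub>M\<^esub>}"
  have decomp: "v = P.pact B (P.pact r v) \<oplus>\<^bsub>M\<^esub> P.pact A (P.pact ([:- b, 1:] ^ n) v)" if "v \<in> carrier M" for v
  proof -
    have "v = P.pact (A * [:- b, 1:] ^ n + B * r) v" unfolding AB using that by simp
    then show ?thesis using that by (simp only: P.pact_add P.pact_mult M.M.a_comm P.pact_closed)
  qed
  have kill: "P.pact ([:- b, 1:] ^ n) (P.pact r v) = \<zero>\<^bsub>M\<^esub>" if "v \<in> carrier M" for v
    using bspec[OF r(2) that] P.pact_mult[OF that] by simp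
  have ids: "internal_direct_sum H M ?N1 ?N2"
    unfolding internal_direct_sum_def
  proof (intro conjI sub)
    show "?N1 \<inter> ?N2 = {\<zero>\<^bsub>M\<^esub>}"
    proof -
      have "v = \<zero>\<^bsub>M\<^esub>" if v: "v \<in> ?N1 \<inter> ?N2" for v
      proof -
        have vc: "v \<in> carrier M" and h: "P.pact ([:- b, 1:] ^ n) v = \<zero>\<^bsub>M\<^esub>" "P.pact r v = \<zero>\<^bsub>M\<^esub>" using v by auto
        have "v = P.pact B (P.pact r v) \<oplus>\<^bsub>M\<^esub> P.pact A (P.pact ([:- b, 1:] ^ n) v)" by (rule decomp[OF vc])
        also have "\<dots> = \<zero>\<^bsub>M\<^esub>" by (simp add: h)
        finally show ?thesis .
      qed
      then have "?N1 \<inter> ?N2 \<subseteq> {\<zero>\<^bsub>M\<^esub>}" by (intro subsetI) (rule singleton_iff[THEN iffD2])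
      moreover have "{\<zero>\<^bsub>M\<^esub>} \<subseteq> ?N1 \<inter> ?N2" by simp
      ultimately show ?thesis by (rule equalityI)
    qed
    have "v \<in> ?N1 <+>\<^bsub>M\<^esub> ?N2" if v: "v \<in> carrier M" for v
    proof -
      have 1: "P.pact B (P.pact r v) \<in> ?N1"
        using v kill P.pact_commute[of "P.pact r v" "[:- b, 1:] ^ n" B] by simp
      have 2: "P.pact A (P.pact ([:- b, 1:] ^ n) v) \<in> ?N2"
        using v kill P.pact_commute[of "P.pact ([:- b, 1:] ^ n) v" r A] P.pact_commute[of v r "[:- b, 1:] ^ n"] by simp
      show ?thesis
        by (rule ssubst[OF decomp[OF v], of "\<lambda>w. w \<in> ?N1 <+>\<^bsub>M\<^esub> ?N2"]) (rule M.set_addI[OF 1 2])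
    qed
    then show "?N1 <+>\<^bsub>M\<^esub> ?N2 = carrier M"
      by (intro equalityI subsetI M.submoduleD(1)[OF M.submodule_set_add[OF sub sub], THEN subsetD])
  qed
  have "\<forall>N N'. internal_direct_sum H M N N' \<longrightarrow> N = {\<zero>\<^bsub>M\<^esub>} \<or> N' = {\<zero>\<^bsub>M\<^esub>}"
    using M unfolding indecomposable_module_def by (elim conjE)
  from mp[OF spec[OF spec[OF this]] ids] have "?N1 = {\<zero>\<^bsub>M\<^esub>} \<or> ?N2 = {\<zero>\<^bsub>M\<^esub>}" .
  moreover have "?N1 \<noteq> {\<zero>\<^bsub>M\<^esub>}"
  proof -
    obtain v where v: "v \<in> carrier M" "P.pact r v \<noteq> \<zero>\<^bsub>M\<^esub>" using r(3) by (elim bexE)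
    have "P.pact r v \<in> ?N1" using kill v(1) by simp
    then show ?thesis using v(2) by (metis singletonD)
  qed
  ultimately have N2: "?N2 = {\<zero>\<^bsub>M\<^esub>}" by simp
  have lin: "P.pact [:- b, 1:] w = (xop ^^ s) w \<oplus>\<^bsub>M\<^esub> sc (- b) w" if "w \<in> carrier M" for w
    by (rule P.pact_linear[OF that])
  have pows: "((\<lambda>w. (xop ^^ s) w \<oplus>\<^bsub>M\<^esub> sc (- b) w) ^^ k) v = (P.pact [:- b, 1:] ^^ k) v
      \<and> (P.pact [:- b, 1:] ^^ k) v \<in> carrier M" if "v \<in> carrier M" for k v
  proof (induction k)
    case (Suc k)
    note e = conjunct1[OF Suc] and c = conjunct2[OF Suc]
    show ?case unfolding funpow.simps comp_apply e by (rule conjI[OF lin[OF c, symmetric] P.pact_closed[OF c]])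
  qed (use that in simp)
  have "((\<lambda>w. (xop ^^ s) w \<oplus>\<^bsub>M\<^esub> sc (- b) w) ^^ n) v = \<zero>\<^bsub>M\<^esub>" if v: "v \<in> carrier M" for v
  proof -
    have "P.pact r (P.pact ([:- b, 1:] ^ n) v) = \<zero>\<^bsub>M\<^esub>"
      unfolding P.pact_commute[OF v, of r "[:- b, 1:] ^ n"] by (rule kill[OF v])
    then have "P.pact ([:- b, 1:] ^ n) v \<in> ?N2" using P.pact_closed[OF v] by blast
    then have "P.pact ([:- b, 1:] ^ n) v = \<zero>\<^bsub>M\<^esub>" unfolding N2 by (rule singletonD)
    then show ?thesis using pows[OF v, of n] P.pact_power[OF v, of "[:- b, 1:]" n] by (simp only:)
  qed
  then show ?thesis by (rule that)
qed

text \<open>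
  The eigenvalue \<open>b\<close> of \<open>x\<^sup>s\<close> decides the case: \<open>y = x\<^sup>s - b\<close> if \<open>b \<noteq> 0\<close>, and \<open>y = x\<close>, which is then
  nilpotent, if \<open>b = 0\<close>. The nilpotency index of \<open>y\<close> is \<open>t\<close>.
\<close>

lemma (in ore_module) parameters_exist:
  assumes M: "indecomposable_module H M" and fd: "finite_dimensional (ore_scalar G) M"
  obtains m \<beta> t where "ore_param G \<chi> a s \<psi> m \<beta>" "0 < t"
    "\<And>v. v \<in> carrier M \<Longrightarrow> (param_module.yop G m \<beta> M ^^ t) v = \<zero>\<^bsub>M\<^esub>"
    "\<exists>v\<in>carrier M. (param_module.yop G m \<beta> M ^^ (t - 1)) v \<noteq> \<zero>\<^bsub>M\<^esub>"
proof -
  obtain b n where bn: "\<And>v. v \<in> carrier M \<Longrightarrow> ((\<lambda>w. (xop ^^ s) w \<oplus>\<^bsub>M\<^esub> sc (- b) w) ^^ n) v = \<zero>\<^bsub>M\<^esub>"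
    by (rule central_power_eigenvalue[OF M fd]) (rule that, assumption)
  have "\<exists>m \<beta> k. ore_param G \<chi> a s \<psi> m \<beta> \<and> (\<forall>v\<in>carrier M. (param_module.yop G m \<beta> M ^^ k) v = \<zero>\<^bsub>M\<^esub>)"
  proof (cases "b = 0")
    case False
    then have p: "ore_param G \<chi> a s \<psi> s b" by unfold_locales simp
    interpret Y: param_module G \<chi> a s \<psi> s b M
      by (intro param_module.intro p ore_module_axioms)
    have "Y.yop = (\<lambda>w. (xop ^^ s) w \<oplus>\<^bsub>M\<^esub> sc (- b) w)" by (rule ext) (simp add: Y.yop_def)
    then show ?thesis using p bn by (intro exI[of _ s] exI[of _ b] exI[of _ n]) auto
  next
    case True
    have p: "ore_param G \<chi> a s \<psi> 1 0" by unfold_locales simp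
    interpret Y: param_module G \<chi> a s \<psi> 1 0 M
      by (intro param_module.intro p ore_module_axioms)
    have yx: "Y.yop w = xop w" if "w \<in> carrier M" for w unfolding Y.yop_def using that by simp
    have 1: "(Y.yop ^^ k) v = (xop ^^ k) v" if "v \<in> carrier M" for v k
      using that by (induction k) (simp_all add: yx del: One_nat_def)
    have 2: "((\<lambda>w. (xop ^^ s) w \<oplus>\<^bsub>M\<^esub> sc (- b) w) ^^ k) v = (xop ^^ (s * k)) v" if "v \<in> carrier M" for v k
    proof -
      have "((\<lambda>w. (xop ^^ s) w \<oplus>\<^bsub>M\<^esub> sc (- b) w) ^^ k) v = ((xop ^^ s) ^^ k) v \<and> ((xop ^^ s) ^^ k) v \<in> carrier M"
        using that True by (induction k) auto
      then show ?thesis by (simp add: funpow_mult)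
    qed
    show ?thesis using p bn 1 2 by (intro exI[of _ 1] exI[of _ 0] exI[of _ "s * n"]) auto
  qed
  then obtain m \<beta> k where p: "ore_param G \<chi> a s \<psi> m \<beta>" and k: "\<forall>v\<in>carrier M. (param_module.yop G m \<beta> M ^^ k) v = \<zero>\<^bsub>M\<^esub>"
    by blast
  define Q where "Q j \<longleftrightarrow> (\<forall>v\<in>carrier M. (param_module.yop G m \<beta> M ^^ j) v = \<zero>\<^bsub>M\<^esub>)" for j
  define t where "t = (LEAST j. Q j)"
  have Qt: "Q t" unfolding t_def using k by (intro LeastI[of Q k]) (simp add: Q_def)
  have "carrier M \<noteq> {\<zero>\<^bsub>M\<^esub>}" using M by (simp add: indecomposable_module_def)
  then have "\<not> Q 0" using M.M.zero_closed by (auto simp: Q_def)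
  then have t: "0 < t" using Qt by (cases t) auto
  have "\<not> Q (t - 1)" using not_less_Least[of "t - 1" Q] t unfolding t_def[symmetric] by simp
  then show ?thesis using Qt unfolding Q_def by (intro that[OF p t]) simp_all
qed

text \<open>
  With \<open>n = t - 1\<close> this provides the copy of \<open>V\<close> that generates the model inside \<open>M\<close>. The
  representatives \<open>V i\<close> are complete for modules on the type of elements of \<open>kG\<close>, so the simple submodule
  is first moved to that type.
\<close>

lemma (in param_module) generating_simple:
  fixes V :: "'i \<Rightarrow> ('g \<Rightarrow>\<^sub>0 'k, 'v) module"
  assumes kG: "semisimple_ring kG"
    and top: "\<exists>v\<in>carrier M. (yop ^^ n) v \<noteq> \<zero>\<^bsub>M\<^esub>"
    and V: "\<And>i. i \<in> I \<Longrightarrow> simple_module kG (V i)"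
    and reps: "\<And>W :: ('g \<Rightarrow>\<^sub>0 'k, 'g \<Rightarrow>\<^sub>0 'k) module. simple_module kG W \<Longrightarrow> \<exists>i\<in>I. module_iso kG W (V i)"
  obtains i f where "i \<in> I" "linear_map kG (V i) (restriction M) f"
    "\<And>v. \<lbrakk>v \<in> carrier (V i); v \<noteq> \<zero>\<^bsub>V i\<^esub>\<rbrakk> \<Longrightarrow> (yop ^^ n) (f v) \<noteq> \<zero>\<^bsub>M\<^esub>"
proof -
  interpret RM: left_module kG "restriction M" by (rule left_module_restriction[OF M.left_module_axioms])
  define P where "P = {v \<in> carrier M. (yop ^^ n) v = \<zero>\<^bsub>M\<^esub>}"
  have P: "submodule P kG (restriction M)"
  proof (rule kG.submodule_monI[OF RM.left_module_axioms])
    fix g k v assume "g \<in> carrier G" "v \<in> P"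
    then show "mon g k \<odot>\<^bsub>restriction M\<^esub> v \<in> P" unfolding op_restriction by (simp add: P_def funpow_y_op)
  qed (auto simp: P_def funpow_y_add)
  obtain v0 where v0: "v0 \<in> carrier M" "(yop ^^ n) v0 \<noteq> \<zero>\<^bsub>M\<^esub>" using top by (elim bexE)
  have "v0 \<in> carrier (restriction M)" "v0 \<notin> P" using v0 by (simp_all add: P_def)
  from semisimple_ring_simple_submodule[OF kG RM.left_module_axioms P this]
  obtain W where W: "submodule W kG (restriction M)" "simple_module kG (restriction M\<lparr>carrier := W\<rparr>)"
    "W \<inter> P = {\<zero>\<^bsub>restriction M\<^esub>}"
    by metis
  let ?W = "restriction M\<lparr>carrier := W\<rparr>"
  obtain W' :: "('g \<Rightarrow>\<^sub>0 'k, 'g \<Rightarrow>\<^sub>0 'k) module" where W': "simple_module kG W'" "module_iso kG ?W W'"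
    using simple_module_on_ring_type[OF W(2)] by (elim exE conjE)
  obtain i where i: "i \<in> I" "module_iso kG W' (V i)" using reps[OF W'(1)] by (elim bexE)
  have "module_iso kG (V i) ?W"
    by (rule module_iso_sym[OF _ module_iso_trans[OF W'(2) i(2)]]) (use W(2) in \<open>simp add: simple_module_def\<close>)
  then obtain f where f: "linear_map kG (V i) ?W f" "bij_betw f (carrier (V i)) (carrier ?W)"
    unfolding module_iso_iff by (elim exE conjE)
  have WM: "W \<subseteq> carrier M" using RM.submoduleD(1)[OF W(1)] by simp
  have flin: "linear_map kG (V i) (restriction M) f" using f(1) WM unfolding linear_map_def by (auto simp: Pi_iff)
  have "(yop ^^ n) (f v) \<noteq> \<zero>\<^bsub>M\<^esub>" if v: "v \<in> carrier (V i)" "v \<noteq> \<zero>\<^bsub>V i\<^esub>" for v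
  proof
    have lm: "left_module kG (V i)" "left_module kG ?W" using V[OF i(1)] W(2) by (auto simp: simple_module_def)
    interpret Vi: left_module kG "V i" by (rule lm(1))
    have f0: "f \<zero>\<^bsub>V i\<^esub> = \<zero>\<^bsub>M\<^esub>" using linear_map_zero[OF lm f(1)] by simp
    assume "(yop ^^ n) (f v) = \<zero>\<^bsub>M\<^esub>"
    moreover have "f v \<in> W" using linear_mapD(1)[OF f(1) v(1)] by simp
    ultimately have "f v \<in> W \<inter> P" using WM by (simp add: P_def subset_iff)
    then have fv: "f v = \<zero>\<^bsub>M\<^esub>" unfolding W(3) by simp
    show False using f(2) f0 fv v Vi.M.zero_closed by (metis bij_betw_imp_inj_on inj_onD)
  qed
  then show ?thesis by (rule that[OF i(1) flin])
qed

section \<open>\<open>V\<^sub>\<chi> \<otimes> V\<close> is a twist\<close>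

text \<open>
  \<open>v \<mapsto> 1 \<otimes> v\<close> is bijective onto \<open>k \<otimes> V\<close>, and \<open>g (1 \<otimes> v) = \<chi>(g) \<otimes> g v = 1 \<otimes> \<chi>(g) g v\<close>.
\<close>

lemma (in kG_module) tensor_character_twist:
  "module_iso kG (twist 1 V) (tensor_module G (character_module \<chi>) V)"
proof -
  let ?C = "character_module \<chi>"
  let ?ra = "\<lambda>v c. group_algebra_scalar G c \<odot>\<^bsub>?C\<^esub> v"
  let ?la = "\<lambda>c w. group_algebra_scalar G c \<odot>\<^bsub>V\<^esub> w"
  have smult_C: "mon g c \<odot>\<^bsub>?C\<^esub> v = c * \<chi> g * v" for g c v
    by (cases "c = 0") (simp_all add: character_module_def)
  have C_simps: "carrier ?C = UNIV" "u \<oplus>\<^bsub>?C\<^esub> v = u + v" for u v by (simp_all add: character_module_def)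
  have ra: "?ra v c = c * v" for v c by (simp add: group_algebra_scalar_def smult_C \<chi>_one)
  have la: "?la c w = gop \<one>\<^bsub>G\<^esub> c w" for c w by (simp add: group_algebra_scalar_def gop_def)
  have "abelian_group ?C"
  proof (rule abelian_groupI, goal_cases)
    case (6 x) then show ?case by (intro bexI[of _ "- x"]) (auto simp: character_module_def)
  qed (auto simp: character_module_def)
  then interpret td: tensor_data scalar_ring ?C ?ra V ?la
    by (intro tensor_data.intro V.M.abelian_group_axioms) (simp_all add: C_simps la)
  interpret T: comm_group td.T by (rule td.comm_group_tensor)
  let ?W = "tensor_module G ?C V"
  have W: "carrier ?W = carrier td.T" "x \<oplus>\<^bsub>?W\<^esub> y = x \<otimes>\<^bsub>td.T\<^esub> y" for x y
    by (simp_all add: tensor_module_def Let_def)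
  have W_smult: "r \<odot>\<^bsub>?W\<^esub> C = (\<Otimes>\<^bsub>td.T\<^esub>g\<in>Poly_Mapping.keys r. tensor_map scalar_ring ?C ?ra V ?la
      (\<lambda>(v, w). (mon g (Poly_Mapping.lookup r g) \<odot>\<^bsub>?C\<^esub> v, mon g 1 \<odot>\<^bsub>V\<^esub> w)) C)" for r C
    by (simp add: tensor_module_def Let_def)
  have pure_scalar: "td.pure c w = td.pure 1 (gop \<one>\<^bsub>G\<^esub> c w)" if "w \<in> carrier V" for c w
    using td.pure_assoc[of 1 c w] that by (simp add: C_simps ra la)
  have pc: "td.pure c w \<in> carrier td.T" if "w \<in> carrier V" for c w using that by (intro td.pure_closed) (auto simp: C_simps)
  define f where "f = td.pure 1"
  have f_add: "f (u \<oplus>\<^bsub>V\<^esub> v) = f u \<otimes>\<^bsub>td.T\<^esub> f v" if "u \<in> carrier V" "v \<in> carrier V" for u v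
    unfolding f_def using that by (intro td.pure_add_right) (auto simp: C_simps)
  have f_zero: "f \<zero>\<^bsub>V\<^esub> = \<one>\<^bsub>td.T\<^esub>"
    using f_add[of "\<zero>\<^bsub>V\<^esub>" "\<zero>\<^bsub>V\<^esub>"] pc[of "\<zero>\<^bsub>V\<^esub>" 1] by (simp add: f_def T.l_cancel_one')
  have f_sum: "f (\<Oplus>\<^bsub>V\<^esub>g\<in>A. h g) = (\<Otimes>\<^bsub>td.T\<^esub>g\<in>A. f (h g))" if "finite A" "h \<in> A \<rightarrow> carrier V" for A :: "'g set" and h
    using that
  proof (induction A rule: finite_induct)
    case (insert g A)
    then have h: "h \<in> A \<rightarrow> carrier V" "h g \<in> carrier V" by auto
    have "f (h g \<oplus>\<^bsub>V\<^esub> (\<Oplus>\<^bsub>V\<^esub>g\<in>A. h g)) = f (h g) \<otimes>\<^bsub>td.T\<^esub> (\<Otimes>\<^bsub>td.T\<^esub>g\<in>A. f (h g))"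
      using f_add[OF h(2) V.M.finsum_closed[OF h(1)]] insert(3)[OF h(1)] by simp
    moreover have "f v \<in> carrier td.T" if "v \<in> carrier V" for v using pc that by (simp add: f_def)
    then have "(\<lambda>g. f (h g)) \<in> A \<rightarrow> carrier td.T" "f (h g) \<in> carrier td.T" using h by auto
    ultimately show ?case using insert h by (simp add: V.M.finsum_insert T.finprod_insert)
  qed (simp add: f_zero)
  have act: "tensor_map scalar_ring ?C ?ra V ?la
      (\<lambda>(v, w). (mon g k \<odot>\<^bsub>?C\<^esub> v, mon g 1 \<odot>\<^bsub>V\<^esub> w)) (f v) = f (gop g (k * \<chi> g) v)"
    if g: "g \<in> carrier G" and v: "v \<in> carrier V" for g k v
  proof -
    let ?\<phi> = "\<lambda>(v, w). (mon g k \<odot>\<^bsub>?C\<^esub> v, mon g 1 \<odot>\<^bsub>V\<^esub> w)"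
    have bal: "td.balanced td.T (\<lambda>m n. case_prod td.pure (?\<phi> (m, n)))"
      unfolding td.balanced_def
    proof (intro conjI ballI)
      fix c r w assume "w \<in> carrier V"
      then have "td.pure (k * \<chi> g * (r * c)) (gop g 1 w) = td.pure (k * \<chi> g * c) (gop g 1 (gop \<one>\<^bsub>G\<^esub> r w))"
        using g by (subst (1 2) pure_scalar) (simp_all add: gop_gop mult_ac)
      then show "case_prod td.pure (?\<phi> (?ra c r, w)) = case_prod td.pure (?\<phi> (c, ?la r w))"
        by (simp add: smult_C ra la flip: gop_def)
    next
      fix c c' w assume "w \<in> carrier V"
      then show "case_prod td.pure (?\<phi> (c \<oplus>\<^bsub>?C\<^esub> c', w)) = case_prod td.pure (?\<phi> (c, w)) \<otimes>\<^bsub>td.T\<^esub> case_prod td.pure (?\<phi> (c', w))"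
        using g td.pure_add_left[of "k * \<chi> g * c" "k * \<chi> g * c'" "gop g 1 w"]
        by (simp add: smult_C C_simps distrib_left flip: gop_def)
    next
      fix c w w' assume "w \<in> carrier V" "w' \<in> carrier V"
      then show "case_prod td.pure (?\<phi> (c, w \<oplus>\<^bsub>V\<^esub> w')) = case_prod td.pure (?\<phi> (c, w)) \<otimes>\<^bsub>td.T\<^esub> case_prod td.pure (?\<phi> (c, w'))"
        using g td.pure_add_right[of "k * \<chi> g * c" "gop g 1 w" "gop g 1 w'"]
        by (simp add: smult_C C_simps gop_add flip: gop_def)
    next
      fix c w assume "w \<in> carrier V"
      then show "case_prod td.pure (?\<phi> (c, w)) \<in> carrier td.T" using g by (simp add: pc flip: gop_def)
    qed
    have "tensor_map scalar_ring ?C ?ra V ?la ?\<phi> (td.pure 1 v) = case_prod td.pure (?\<phi> (1, v))"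
      by (rule td.tensor_map_hom(2)[OF _ bal]) (use g v in \<open>auto simp: C_simps simp flip: gop_def\<close>)
    also have "\<dots> = td.pure (k * \<chi> g) (gop g 1 v)" by (simp add: smult_C flip: gop_def)
    also have "\<dots> = td.pure 1 (gop g (k * \<chi> g) v)" using g v by (subst pure_scalar) (simp_all add: gop_gop)
    finally show ?thesis by (simp add: f_def)
  qed
  interpret Tw: left_module kG "twist 1 V" by (rule left_module_twist)
  have "linear_map kG (twist 1 V) ?W f"
    unfolding linear_map_def
  proof (intro conjI ballI)
    show "f \<in> carrier (twist 1 V) \<rightarrow> carrier ?W" using pc by (simp add: W f_def)
    fix r v assume r: "r \<in> carrier kG" and v: "v \<in> carrier (twist 1 V)"
    have v: "v \<in> carrier V" and rG: "Poly_Mapping.keys r \<subseteq> carrier G" using r v by (simp_all add: kG.carrier_eq)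
    have "r \<odot>\<^bsub>twist 1 V\<^esub> v = (\<Oplus>\<^bsub>V\<^esub>g\<in>Poly_Mapping.keys r. gop g (Poly_Mapping.lookup r g * \<chi> g) v)"
      by (simp add: twist_def kG.action_module_def gop_def)
    then have "f (r \<odot>\<^bsub>twist 1 V\<^esub> v) = (\<Otimes>\<^bsub>td.T\<^esub>g\<in>Poly_Mapping.keys r. f (gop g (Poly_Mapping.lookup r g * \<chi> g) v))"
      using rG v by (subst f_sum[symmetric]) (auto simp: subset_iff)
    also have "\<dots> = r \<odot>\<^bsub>?W\<^esub> f v" unfolding W_smult
      by (rule T.finprod_cong') (use rG v act pc in \<open>auto simp: f_def subset_iff\<close>)
    finally show "f (r \<odot>\<^bsub>twist 1 V\<^esub> v) = r \<odot>\<^bsub>?W\<^esub> f v" .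
  qed (simp add: W f_add)
  moreover have "bij_betw f (carrier (twist 1 V)) (carrier ?W)"
  proof -
    have "td.balanced (add_monoid V) (\<lambda>c w. gop \<one>\<^bsub>G\<^esub> c w)"
      unfolding td.balanced_def by (auto simp: C_simps ra la gop_scalar_add gop_add gop_gop mult.commute)
    from td.tensor_universal[OF V.M.a_comm_group this]
    obtain h where h: "h \<in> hom td.T (add_monoid V)"
      "\<And>c w. \<lbrakk>c \<in> carrier ?C; w \<in> carrier V\<rbrakk> \<Longrightarrow> h (td.pure c w) = gop \<one>\<^bsub>G\<^esub> c w"
      by metis
    have 1: "h (f v) = v" if "v \<in> carrier V" for v using h(2)[of 1 v] that by (simp add: f_def C_simps)
    have hc: "h C \<in> carrier V" if "C \<in> carrier td.T" for C using h(1) that by (auto simp: hom_def)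
    have 2: "f (h C) = C" if "C \<in> carrier td.T" for C
      using that
    proof (induction C rule: td.tensor_induct)
      case (pure c w) then show ?case using h(2)[of c w] pure_scalar[of w c] by (simp add: f_def C_simps)
    next
      case (mult x y)
      then have "h (x \<otimes>\<^bsub>td.T\<^esub> y) = h x \<oplus>\<^bsub>V\<^esub> h y" using h(1) by (auto simp: hom_def)
      then show ?case using mult hc by (simp add: f_add)
    qed
    show ?thesis
      by (rule bij_betw_byWitness[of _ h]) (use 1 2 hc pc in \<open>auto simp: W f_def\<close>)
  qed
  ultimately show ?thesis unfolding module_iso_iff by blast
qed

section \<open>The quotients of \<open>M(V)\<close> are isomorphic to the model\<close>

context kG_module
begin

definition rmult :: "('g \<times> nat \<Rightarrow>\<^sub>0 'k) \<Rightarrow> ('g \<Rightarrow>\<^sub>0 'k) \<Rightarrow> ('g \<times> nat \<Rightarrow>\<^sub>0 'k)"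
  where "rmult h f = h \<otimes>\<^bsub>H\<^esub> ore_embed f"

sublocale td: tensor_data kG "hopf_ore G \<psi> a" rmult V "module.smult V"
  by (intro tensor_data.intro HR.abelian_group_axioms V.M.abelian_group_axioms)
     (simp_all add: rmult_def ore_embed_closed V.smult_closed HR.m_closed)

abbreviation "MV \<equiv> induced_module G H V"

lemma MV_simps [simp]:
  "carrier MV = carrier td.T" "\<zero>\<^bsub>MV\<^esub> = \<one>\<^bsub>td.T\<^esub>" "x \<oplus>\<^bsub>MV\<^esub> y = x \<otimes>\<^bsub>td.T\<^esub> y"
  by (simp_all add: induced_module_def rmult_def[abs_def] Let_def)

lemma MV_smult_def:
  "h \<odot>\<^bsub>MV\<^esub> C = tensor_map kG H rmult V (module.smult V) (\<lambda>(h', v). (h \<otimes>\<^bsub>H\<^esub> h', v)) C"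
  by (simp add: induced_module_def rmult_def[abs_def] Let_def)

lemma induced_tensor_pure: "induced_tensor G H V h v = td.pure h v"
  unfolding induced_tensor_def td.pure_def by (simp only: rmult_def[abs_def])

lemma MV_smult:
  assumes h: "h \<in> carrier H"
  shows "(\<lambda>C. h \<odot>\<^bsub>MV\<^esub> C) \<in> hom td.T td.T"
    and "\<And>h' v. \<lbrakk>h' \<in> carrier H; v \<in> carrier V\<rbrakk> \<Longrightarrow> h \<odot>\<^bsub>MV\<^esub> td.pure h' v = td.pure (h \<otimes>\<^bsub>H\<^esub> h') v"
proof -
  let ?\<phi> = "\<lambda>(h', v). (h \<otimes>\<^bsub>H\<^esub> h', v :: 'v)"
  have maps: "?\<phi> (h', v) \<in> carrier H \<times> carrier V" if "h' \<in> carrier H" "v \<in> carrier V" for h' v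
    using h that by simp
  have bal: "td.balanced td.T (\<lambda>h' v. case_prod td.pure (?\<phi> (h', v)))"
    unfolding td.balanced_def
  proof (intro conjI ballI)
    fix h' r v assume *: "h' \<in> carrier H" "r \<in> carrier kG" "v \<in> carrier V"
    then have "h \<otimes>\<^bsub>H\<^esub> rmult h' r = rmult (h \<otimes>\<^bsub>H\<^esub> h') r" using h by (simp add: rmult_def HR.m_assoc ore_embed_closed)
    then show "case_prod td.pure (?\<phi> (rmult h' r, v)) = case_prod td.pure (?\<phi> (h', r \<odot>\<^bsub>V\<^esub> v))"
      using td.pure_assoc[of "h \<otimes>\<^bsub>H\<^esub> h'" r v] * h by simp
  qed (use h in \<open>simp_all add: td.pure_add_left td.pure_add_right HR.r_distr\<close>)
  show "(\<lambda>C. h \<odot>\<^bsub>MV\<^esub> C) \<in> hom td.T td.T"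
    unfolding MV_smult_def by (rule td.tensor_map_hom(1)[OF maps bal])
  show "h \<odot>\<^bsub>MV\<^esub> td.pure h' v = td.pure (h \<otimes>\<^bsub>H\<^esub> h') v" if "h' \<in> carrier H" "v \<in> carrier V" for h' v
    unfolding MV_smult_def using td.tensor_map_hom(2)[OF maps bal that] by simp
qed

lemma left_module_MV: "left_module H MV"
proof -
  interpret T: comm_group td.T by (rule td.comm_group_tensor)
  have ag: "abelian_group MV"
  proof (rule abelian_groupI, goal_cases)
    case (6 x) then show ?case by (intro bexI[of _ "inv\<^bsub>td.T\<^esub> x"]) (auto simp: T.l_inv)
  qed (auto simp: T.m_ac)
  have cl: "h \<odot>\<^bsub>MV\<^esub> C \<in> carrier td.T" if "h \<in> carrier H" "C \<in> carrier td.T" for h C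
    using MV_smult(1)[OF that(1)] that(2) by (auto simp: hom_def)
  have add: "h \<odot>\<^bsub>MV\<^esub> (C \<otimes>\<^bsub>td.T\<^esub> C') = (h \<odot>\<^bsub>MV\<^esub> C) \<otimes>\<^bsub>td.T\<^esub> (h \<odot>\<^bsub>MV\<^esub> C')"
    if "h \<in> carrier H" "C \<in> carrier td.T" "C' \<in> carrier td.T" for h C C'
    using MV_smult(1)[OF that(1)] that(2,3) by (auto simp: hom_def)
  have distr: "(h \<oplus>\<^bsub>H\<^esub> h') \<odot>\<^bsub>MV\<^esub> C = (h \<odot>\<^bsub>MV\<^esub> C) \<otimes>\<^bsub>td.T\<^esub> (h' \<odot>\<^bsub>MV\<^esub> C)"
    if h: "h \<in> carrier H" "h' \<in> carrier H" and "C \<in> carrier td.T" for h h' C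
    using that(3)
  proof (induction C rule: td.tensor_induct)
    case (pure h1 v)
    then show ?case using h by (simp add: MV_smult(2) HR.l_distr td.pure_add_left)
  next
    case (mult x y)
    then show ?case using h cl by (simp add: add T.m_ac)
  qed
  have assoc: "(h \<otimes>\<^bsub>H\<^esub> h') \<odot>\<^bsub>MV\<^esub> C = h \<odot>\<^bsub>MV\<^esub> (h' \<odot>\<^bsub>MV\<^esub> C)"
    if h: "h \<in> carrier H" "h' \<in> carrier H" and "C \<in> carrier td.T" for h h' C
    using that(3)
  proof (induction C rule: td.tensor_induct)
    case (pure h1 v)
    then show ?case using h by (simp add: MV_smult(2) HR.m_assoc)
  next
    case (mult x y)
    then show ?case using h cl by (simp add: add)
  qed
  have one: "\<one>\<^bsub>H\<^esub> \<odot>\<^bsub>MV\<^esub> C = C" if "C \<in> carrier td.T" for C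
    using that
  proof (induction C rule: td.tensor_induct)
    case (pure h1 v)
    then show ?case by (simp add: MV_smult(2))
  next
    case (mult x y)
    then show ?case by (simp add: add)
  qed
  show ?thesis
    by (intro left_module.intro left_module_axioms.intro HR.ring_axioms ag) (simp_all add: cl add distr assoc one)
qed

text \<open>Induction is left adjoint to restriction: \<open>h \<otimes> v\<close> is sent to \<open>h f(v)\<close>.\<close>

lemma MV_universal:
  fixes N :: "('g \<times> nat \<Rightarrow>\<^sub>0 'k, 'n) module"
  assumes N: "left_module H N" and f: "linear_map kG V (restriction N) f"
  obtains F where "linear_map H MV N F" "\<And>v. v \<in> carrier V \<Longrightarrow> F (td.pure \<one>\<^bsub>H\<^esub> v) = f v"
proof -
  interpret N: left_module H N by fact
  note fD = linear_mapD[OF f, simplified]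
  have bal: "td.balanced (add_monoid N) (\<lambda>h v. h \<odot>\<^bsub>N\<^esub> f v)"
    unfolding td.balanced_def
    using fD by (auto simp: N.smult_closed N.smult_l_distr N.smult_r_distr rmult_def N.smult_assoc ore_embed_closed)
  obtain F where F: "F \<in> hom td.T (add_monoid N)"
    "\<And>h v. \<lbrakk>h \<in> carrier H; v \<in> carrier V\<rbrakk> \<Longrightarrow> F (td.pure h v) = h \<odot>\<^bsub>N\<^esub> f v"
    using td.tensor_universal[OF N.M.a_comm_group bal] by metis
  have Fc: "F C \<in> carrier N" if "C \<in> carrier td.T" for C using F(1) that by (auto simp: hom_def)
  have Fadd: "F (x \<otimes>\<^bsub>td.T\<^esub> y) = F x \<oplus>\<^bsub>N\<^esub> F y" if "x \<in> carrier td.T" "y \<in> carrier td.T" for x y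
    using F(1) that by (auto simp: hom_def)
  have Fs: "F (h \<odot>\<^bsub>MV\<^esub> C) = h \<odot>\<^bsub>N\<^esub> F C" if h: "h \<in> carrier H" and "C \<in> carrier td.T" for h C
    using that(2)
  proof (induction C rule: td.tensor_induct)
    case (pure h1 v)
    then show ?case using h fD(1) by (simp add: MV_smult(2) F(2) N.smult_assoc)
  next
    case (mult x y)
    have "h \<odot>\<^bsub>MV\<^esub> x \<in> carrier td.T" "h \<odot>\<^bsub>MV\<^esub> y \<in> carrier td.T" "h \<odot>\<^bsub>MV\<^esub> (x \<otimes>\<^bsub>td.T\<^esub> y) = (h \<odot>\<^bsub>MV\<^esub> x) \<otimes>\<^bsub>td.T\<^esub> (h \<odot>\<^bsub>MV\<^esub> y)"
      using MV_smult(1)[OF h] mult by (auto simp: hom_def)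
    then show ?case using mult h by (simp add: Fadd N.smult_r_distr Fc)
  qed
  have "linear_map H MV N F" using Fc Fadd Fs by (auto simp: linear_map_def)
  moreover have "F (td.pure \<one>\<^bsub>H\<^esub> v) = f v" if "v \<in> carrier V" for v
    using F(2)[of "\<one>\<^bsub>H\<^esub>" v] that fD(1) by (simp add: N.smult_one)
  ultimately show ?thesis using that by blast
qed

lemma MV_generated:
  assumes S: "submodule S H MV" and gen: "\<And>v. v \<in> carrier V \<Longrightarrow> td.pure \<one>\<^bsub>H\<^esub> v \<in> S"
  shows "S = carrier td.T"
proof
  interpret MV: left_module H MV by (rule left_module_MV)
  note SD = MV.submoduleD[OF S]
  show "S \<subseteq> carrier td.T" using SD(1) by simp
  have "C \<in> S" if "C \<in> carrier td.T" for C
    using that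
  proof (induction C rule: td.tensor_induct)
    case (pure h v)
    then show ?case using SD(4)[OF pure(1) gen[OF pure(2)]] by (simp add: MV_smult(2))
  next
    case (mult x y)
    then show ?case using SD(3) by simp
  qed
  then show "carrier td.T \<subseteq> S" by blast
qed

lemma pure_kG_linear: "linear_map kG V (restriction MV) (td.pure \<one>\<^bsub>H\<^esub>)"
proof (rule kG.linear_mapI[OF V.left_module_axioms left_module_restriction[OF left_module_MV]])
  fix g k v assume *: "g \<in> carrier G" "v \<in> carrier V"
  have m: "mon g k \<in> carrier kG" using * by (simp add: kG.mon_closed)
  have "td.pure \<one>\<^bsub>H\<^esub> (mon g k \<odot>\<^bsub>V\<^esub> v) = td.pure (rmult \<one>\<^bsub>H\<^esub> (mon g k)) v"
    using * m by (simp add: td.pure_assoc)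
  also have "rmult \<one>\<^bsub>H\<^esub> (mon g k) = ore_embed (mon g k) \<otimes>\<^bsub>H\<^esub> \<one>\<^bsub>H\<^esub>"
    using m by (simp add: rmult_def ore_embed_closed)
  finally show "td.pure \<one>\<^bsub>H\<^esub> (mon g k \<odot>\<^bsub>V\<^esub> v) = mon g k \<odot>\<^bsub>restriction MV\<^esub> td.pure \<one>\<^bsub>H\<^esub> v"
    using * m by (simp add: MV_smult(2) ore_embed_closed)
qed (simp_all add: td.pure_add_right)

end

context model
begin

text \<open>
  If \<open>S\<close> contains \<open>y\<^sup>t (1 \<otimes> V)\<close> and is killed by all maps to \<open>D\<close>, then the universal properties of
  \<open>D\<close> and of \<open>M(V)/S\<close> give maps in both directions that fix the generators.
\<close>

lemma quotient_iso_D: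
  assumes S: "submodule S H MV" and t: "0 < t"
    and yS: "\<And>v. v \<in> carrier V \<Longrightarrow> (param_module.yop G m \<beta> MV ^^ t) (td.pure \<one>\<^bsub>H\<^esub> v) \<in> S"
    and small: "\<And>F C. \<lbrakk>linear_map H MV D F; C \<in> S\<rbrakk> \<Longrightarrow> F C = \<zero>\<^bsub>D\<^esub>"
  shows "left_module H (quotient_module MV S)" "module_iso H D (quotient_module MV S)"
proof -
  interpret MV: param_module G \<chi> a s \<psi> m \<beta> MV
    by (intro param_module.intro ore_param_axioms ore_module.intro ore_setting_axioms left_module_MV)
  let ?Q = "quotient_module MV S"
  show Q: "left_module H ?Q" by (rule MV.M.left_module_quotient[OF S])
  interpret Q: param_module G \<chi> a s \<psi> m \<beta> ?Q
    by (intro param_module.intro ore_param_axioms ore_module.intro ore_setting_axioms Q)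
  define \<pi> where "\<pi> C = S +>\<^bsub>MV\<^esub> C" for C
  have \<pi>: "linear_map H MV ?Q \<pi>" unfolding \<pi>_def by (rule MV.M.linear_map_quotient[OF S])
  have \<pi>kG: "linear_map kG (restriction MV) (restriction ?Q) \<pi>"
    using \<pi> ore_embed_closed by (auto simp: linear_map_def)
  define j where "j = \<pi> \<circ> td.pure \<one>\<^bsub>H\<^esub>"
  have j: "linear_map kG V (restriction ?Q) j" unfolding j_def by (rule linear_map_comp[OF pure_kG_linear \<pi>kG])
  have jc: "td.pure \<one>\<^bsub>H\<^esub> v \<in> carrier MV" if "v \<in> carrier V" for v using that by simp
  have yj: "(Q.yop ^^ t) (j v) = \<zero>\<^bsub>?Q\<^esub>" if "v \<in> carrier V" for v
  proof -
    have "(Q.yop ^^ t) (j v) = \<pi> ((MV.yop ^^ t) (td.pure \<one>\<^bsub>H\<^esub> v))"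
      using intertwine(3)[OF left_module_MV Q \<pi> jc[OF that]] by (simp add: j_def)
    also have "\<dots> = \<zero>\<^bsub>?Q\<^esub>"
      unfolding \<pi>_def using MV.M.quotient_eq_zero_iff[OF S MV.funpow_y_closed[OF jc[OF that]]] yS[OF that] by blast
    finally show ?thesis .
  qed
  obtain F where F: "linear_map H D ?Q F" "\<And>v. v \<in> carrier V \<Longrightarrow> 0 < t \<Longrightarrow> F (E (0, 0) v) = j v"
    using D_universal[OF Q j yj] by metis
  have e: "linear_map kG V (restriction D) (E (0, 0))"
  proof (rule kG.linear_mapI[OF V.left_module_axioms left_module_restriction[OF D.M.left_module_axioms]])
    fix g k v assume "g \<in> carrier G" "v \<in> carrier V"
    then show "E (0, 0) (mon g k \<odot>\<^bsub>V\<^esub> v) = mon g k \<odot>\<^bsub>restriction D\<^esub> E (0, 0) v"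
      unfolding D.op_restriction by (simp add: op_E gop_def)
  qed (auto simp: E_add)
  obtain \<Phi> where \<Phi>: "linear_map H MV D \<Phi>" "\<And>v. v \<in> carrier V \<Longrightarrow> \<Phi> (td.pure \<one>\<^bsub>H\<^esub> v) = E (0, 0) v"
    using MV_universal[OF D.M.left_module_axioms e] by metis
  obtain \<Phi>' where \<Phi>': "linear_map H ?Q D \<Phi>'" "\<And>C. C \<in> carrier MV \<Longrightarrow> \<Phi>' (\<pi> C) = \<Phi> C"
    unfolding \<pi>_def using MV.M.quotient_lift[OF S D.M.left_module_axioms \<Phi>(1)] small[OF \<Phi>(1)] by metis
  note comp = linear_map_comp[OF F(1) \<Phi>'(1)]
  have id: "\<Phi>' (F d) = d" if "d \<in> carrier group_D" for d
    using that
  proof (induction d rule: D_induct)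
    case zero
    show ?case using linear_map_zero[OF D.M.left_module_axioms D.M.left_module_axioms comp] by simp
  next
    case (E p v)
    obtain c b where p: "p = (c, b)" by force
    have b: "b < m" using E by (simp add: p Ix_iff)
    have base: "\<Phi>' (F (E (0, 0) v)) = E (0, 0) v"
      using F(2)[OF E(2) t] \<Phi>'(2)[OF jc[OF E(2)]] \<Phi>(2)[OF E(2)] by (simp add: j_def)
    have "(\<Phi>' \<circ> F) ((D.yop ^^ c) ((D.xop ^^ b) (E (0, 0) v))) = (D.yop ^^ c) ((D.xop ^^ b) ((\<Phi>' \<circ> F) (E (0, 0) v)))"
      using E(2) intertwine[OF D.M.left_module_axioms D.M.left_module_axioms comp] D.funpow_x_closed[of "E (0, 0) v" b] by simp
    then show ?case using base y_x_E[OF E(2) b] by (simp add: p)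
  next
    case (add d d')
    then show ?case using linear_mapD(2)[OF comp, of d d'] by simp
  qed
  have "inj_on F (carrier D)" using id by (intro inj_on_inverseI[of _ \<Phi>']) simp
  moreover have "F ` carrier D = carrier ?Q"
  proof -
    define S' where "S' = {C \<in> carrier MV. \<pi> C \<in> F ` carrier D}"
    have "submodule S' H MV" unfolding S'_def
      by (rule submodule_preimage[OF left_module_MV Q \<pi> submodule_image[OF D.M.left_module_axioms Q F(1) D.M.submodule_carrier]])
    moreover have "td.pure \<one>\<^bsub>H\<^esub> v \<in> S'" if "v \<in> carrier V" for v
    proof -
      have "\<pi> (td.pure \<one>\<^bsub>H\<^esub> v) = F (E (0, 0) v)" using F(2)[OF that t] by (simp add: j_def)
      then show ?thesis using that by (auto simp: S'_def)
    qed
    ultimately have S': "S' = carrier td.T" by (rule MV_generated)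
    have "carrier ?Q = \<pi> ` carrier MV" unfolding \<pi>_def by (rule MV.M.quotient_carrier)
    also have "\<dots> \<subseteq> F ` carrier D" using S' by (auto simp: S'_def)
    finally show ?thesis using linear_mapD(1)[OF F(1)] by blast
  qed
  ultimately show "module_iso H D ?Q" unfolding module_iso_iff using F(1) by (auto simp: bij_betw_def)
qed

end

text \<open>Here \<open>y = x\<close>, so the generators \<open>x\<^sup>t \<otimes> v\<close> are \<open>y\<^sup>t (1 \<otimes> v)\<close>, and \<open>y\<^sup>t\<close> vanishes on \<open>D\<close>.\<close>

lemma (in kG_module) nilpotent_quotient_iso:
  assumes t: "0 < t"
  shows "left_module H (nilpotent_quotient G H t V)" "module_iso H (model.D G \<chi> 1 0 V t) (nilpotent_quotient G H t V)"
proof -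
  interpret model G \<chi> a s \<psi> 1 0 V t by unfold_locales simp
  interpret MV: param_module G \<chi> a s \<psi> 1 0 MV
    by (intro param_module.intro ore_param_axioms ore_module.intro ore_setting_axioms left_module_MV)
  define S0 where "S0 = {td.pure (ore_x G [^]\<^bsub>H\<^esub> t) v | v. v \<in> carrier V}"
  define S where "S = submodule_generated H MV S0"
  have x: "ore_x G [^]\<^bsub>H\<^esub> t \<in> carrier H" unfolding ore_x_pow by (simp add: HH.mon_closed)
  have S0: "S0 \<subseteq> carrier MV" using x by (auto simp: S0_def)
  have yx: "MV.yop w = MV.xop w" if "w \<in> carrier MV" for w unfolding MV.yop_def using that by (simp del: MV_simps)
  have ypow: "(MV.yop ^^ n) w = (MV.xop ^^ n) w" if "w \<in> carrier MV" for n w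
    using that by (induction n) (simp_all add: yx del: MV_simps One_nat_def)
  have gen: "(MV.yop ^^ t) (td.pure \<one>\<^bsub>H\<^esub> v) = td.pure (ore_x G [^]\<^bsub>H\<^esub> t) v" if "v \<in> carrier V" for v
  proof -
    have "(MV.yop ^^ t) (td.pure \<one>\<^bsub>H\<^esub> v) = (ore_x G [^]\<^bsub>H\<^esub> t) \<odot>\<^bsub>MV\<^esub> td.pure \<one>\<^bsub>H\<^esub> v"
      using ypow[of "td.pure \<one>\<^bsub>H\<^esub> v" t] that MV.mon_smult(1)[of "td.pure \<one>\<^bsub>H\<^esub> v" t] by (simp add: ore_x_pow)
    then show ?thesis using that x by (simp add: MV_smult(2))
  qed
  have S: "submodule S H MV" unfolding S_def by (rule MV.M.submodule_generated(1)[OF S0])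
  have yS: "(MV.yop ^^ t) (td.pure \<one>\<^bsub>H\<^esub> v) \<in> S" if "v \<in> carrier V" for v
    using MV.M.submodule_generated(2)[OF S0] gen[OF that] that by (auto simp: S_def S0_def)
  have small: "F C = \<zero>\<^bsub>D\<^esub>" if F: "linear_map H MV D F" and C: "C \<in> S" for F C
  proof -
    have "submodule {C \<in> carrier MV. F C \<in> {\<zero>\<^bsub>D\<^esub>}} H MV"
      by (rule submodule_preimage[OF left_module_MV D.M.left_module_axioms F D.M.submodule_zero])
    moreover have "S0 \<subseteq> {C \<in> carrier MV. F C \<in> {\<zero>\<^bsub>D\<^esub>}}"
    proof
      fix C assume "C \<in> S0"
      then obtain v where v: "v \<in> carrier V" "C = (MV.yop ^^ t) (td.pure \<one>\<^bsub>H\<^esub> v)" using gen by (auto simp: S0_def)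
      have c: "td.pure \<one>\<^bsub>H\<^esub> v \<in> carrier MV" using v by simp
      have "F C = (D.yop ^^ t) (F (td.pure \<one>\<^bsub>H\<^esub> v))"
        unfolding v by (rule intertwine(3)[OF left_module_MV D.M.left_module_axioms F c])
      also have "\<dots> = \<zero>\<^bsub>D\<^esub>" by (rule yop_nilpotent[OF linear_mapD(1)[OF F c]])
      finally show "C \<in> {C \<in> carrier MV. F C \<in> {\<zero>\<^bsub>D\<^esub>}}" using S0 \<open>C \<in> S0\<close> by auto
    qed
    ultimately have "S \<subseteq> {C \<in> carrier MV. F C \<in> {\<zero>\<^bsub>D\<^esub>}}" unfolding S_def by (rule MV.M.submodule_generated(3)[OF S0])
    then show ?thesis using C by blast
  qed
  have "nilpotent_quotient G H t V = quotient_module MV S"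
    by (simp only: nilpotent_quotient_def S_def S0_def induced_tensor_pure)
  moreover have "left_module H (quotient_module MV S)" "module_iso H D (quotient_module MV S)"
    by (rule quotient_iso_D[OF S t], erule yS, erule small, assumption)+
  ultimately show "left_module H (nilpotent_quotient G H t V)" "module_iso H (model.D G \<chi> 1 0 V t) (nilpotent_quotient G H t V)"
    by (simp_all only:)
qed

text \<open>Here the submodule is the image of \<open>y\<^sup>t\<close>, and \<open>y\<^sup>t\<close> vanishes on \<open>D\<close>.\<close>

lemma (in kG_module) unit_quotient_iso:
  assumes t: "0 < t" and \<beta>: "\<beta> \<noteq> 0"
  shows "left_module H (unit_quotient G H s t V \<beta>)" "module_iso H (model.D G \<chi> s \<beta> V t) (unit_quotient G H s t V \<beta>)"
proof -
  interpret model G \<chi> a s \<psi> s \<beta> V t by unfold_locales (simp add: \<beta>)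
  interpret MV: param_module G \<chi> a s \<psi> s \<beta> MV
    by (intro param_module.intro ore_param_axioms ore_module.intro ore_setting_axioms left_module_MV)
  define z where "z = (ore_x G [^]\<^bsub>H\<^esub> s) \<ominus>\<^bsub>H\<^esub> ore_scalar G \<beta>"
  have "z = mon (\<one>\<^bsub>G\<^esub>, s) 1 \<oplus>\<^bsub>H\<^esub> mon (\<one>\<^bsub>G\<^esub>, 0) (- \<beta>)"
    unfolding z_def ore_x_pow a_minus_def ore_scalar_def by (subst HH.a_inv_eq) (auto simp: HH.mon_closed single_uminus)
  then have zc: "z \<in> carrier H" and zy: "z \<odot>\<^bsub>MV\<^esub> w = MV.yop w" if "w \<in> carrier MV" for w
    using MV.M.smult_l_distr[of "mon (\<one>\<^bsub>G\<^esub>, s) 1" "mon (\<one>\<^bsub>G\<^esub>, 0) (- \<beta>)" w] that MV.mon_smult(1)[of w s]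
    by (auto simp: HH.mon_closed MV.yop_def MV.op_def simp del: MV_simps)
  have zc: "z \<in> carrier H" using zc[OF MV.M.M.zero_closed] .
  have zpow: "(z [^]\<^bsub>H\<^esub> n) \<odot>\<^bsub>MV\<^esub> w = (MV.yop ^^ n) w" if "w \<in> carrier MV" for n :: nat and w
    using that
  proof (induction n arbitrary: w)
    case 0 then show ?case using MV.M.smult_one[of w] by (simp del: MV_simps)
  next
    case (Suc n)
    then show ?case using zc zy by (simp add: MV.M.smult_assoc funpow_swap1 del: MV_simps)
  qed
  define S where "S = (\<lambda>w. (z [^]\<^bsub>H\<^esub> t) \<odot>\<^bsub>MV\<^esub> w) ` carrier MV"
  have S_eq: "S = (MV.yop ^^ t) ` carrier MV" unfolding S_def using zpow by (intro image_cong) auto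
  have S: "submodule S H MV" unfolding S_eq
  proof (rule MV.ore_submoduleI)
    show "\<zero>\<^bsub>MV\<^esub> \<in> (MV.yop ^^ t) ` carrier MV" using MV.funpow_y_zero[of t] by (metis MV.M.M.zero_closed image_eqI)
    fix u v assume "u \<in> (MV.yop ^^ t) ` carrier MV" "v \<in> (MV.yop ^^ t) ` carrier MV"
    then obtain u' v' where "u = (MV.yop ^^ t) u'" "v = (MV.yop ^^ t) v'" "u' \<in> carrier MV" "v' \<in> carrier MV" by blast
    then show "u \<oplus>\<^bsub>MV\<^esub> v \<in> (MV.yop ^^ t) ` carrier MV"
      using MV.funpow_y_add[of u' v' t] MV.M.M.a_closed[of u' v'] by (metis image_eqI)
  next
    fix g k u assume g: "g \<in> carrier G" and "u \<in> (MV.yop ^^ t) ` carrier MV"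
    then obtain u' where u: "u = (MV.yop ^^ t) u'" "u' \<in> carrier MV" by blast
    have "(MV.yop ^^ t) (MV.op g (k * \<chi> g ^ (t * s)) u') = MV.op g k u"
      using MV.funpow_y_op[OF g u(2), of t "k * \<chi> g ^ (t * s)"] \<chi>_nonzero[OF g] u(1)
      by (simp add: mult.assoc flip: power_mult_distrib)
    then show "MV.op g k u \<in> (MV.yop ^^ t) ` carrier MV" using MV.op_closed[OF g u(2)] by (metis image_eqI)
  next
    fix u assume "u \<in> (MV.yop ^^ t) ` carrier MV"
    then obtain u' where u: "u = (MV.yop ^^ t) u'" "u' \<in> carrier MV" by blast
    then have "MV.xop u = (MV.yop ^^ t) (MV.xop u')" using MV.funpow_y_x[OF u(2), of t 1] by simp
    then show "MV.xop u \<in> (MV.yop ^^ t) ` carrier MV" using MV.xop_closed[OF u(2)] by (rule image_eqI)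
  qed (use MV.funpow_y_closed in blast)
  have yS: "(MV.yop ^^ t) (td.pure \<one>\<^bsub>H\<^esub> v) \<in> S" if "v \<in> carrier V" for v
    unfolding S_eq using that by (intro imageI) simp
  have small: "F C = \<zero>\<^bsub>D\<^esub>" if F: "linear_map H MV D F" and C: "C \<in> S" for F C
  proof -
    obtain w where w: "C = (MV.yop ^^ t) w" "w \<in> carrier MV" using C unfolding S_eq by blast
    have "F C = (D.yop ^^ t) (F w)" unfolding w by (rule intertwine(3)[OF left_module_MV D.M.left_module_axioms F w(2)])
    also have "\<dots> = \<zero>\<^bsub>D\<^esub>" by (rule yop_nilpotent[OF linear_mapD(1)[OF F w(2)]])
    finally show ?thesis .
  qed
  have "unit_quotient G H s t V \<beta> = quotient_module MV S"
    by (simp only: unit_quotient_def S_def z_def Let_def)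
  moreover have "left_module H (quotient_module MV S)" "module_iso H D (quotient_module MV S)"
    by (rule quotient_iso_D[OF S t], erule yS, erule small, assumption)+
  ultimately show "left_module H (unit_quotient G H s t V \<beta>)" "module_iso H (model.D G \<chi> s \<beta> V t) (unit_quotient G H s t V \<beta>)"
    by (simp_all only:)
qed

section \<open>Orbits of simple \<open>kG\<close>-modules\<close>

lemma (in kG_module) linear_map_twist:
  fixes W :: "('g \<Rightarrow>\<^sub>0 'k, 'w) module"
  assumes W: "left_module kG W" and f: "linear_map kG V W f"
  shows "linear_map kG (twist n V) (twist n W) f"
proof -
  interpret W: kG_module G \<chi> a s \<psi> W by (intro kG_module.intro ore_setting_axioms W)
  note fD = linear_mapD[OF f]
  show ?thesis
  proof (rule kG.linear_mapI[OF left_module_twist W.left_module_twist])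
    fix g k v assume "g \<in> carrier G" "v \<in> carrier (twist n V)"
    then show "f (mon g k \<odot>\<^bsub>twist n V\<^esub> v) = mon g k \<odot>\<^bsub>twist n W\<^esub> f v"
      using fD(1)[of v] fD(3)[of "mon g (k * \<chi> g ^ n)" v]
      by (simp add: twist_mon W.twist_mon gop_def W.gop_def kG.mon_closed)
  qed (use fD in auto)
qed

lemma (in kG_module) twist_Suc: "module_iso kG (twist (Suc n) V) (twist 1 (twist n V))"
proof -
  interpret T: kG_module G \<chi> a s \<psi> "twist n V" by (intro kG_module.intro ore_setting_axioms left_module_twist)
  have "linear_map kG (twist (Suc n) V) (twist 1 (twist n V)) id"
  proof (rule kG.linear_mapI[OF left_module_twist T.left_module_twist])
    fix g k v assume *: "g \<in> carrier G" "v \<in> carrier (twist (Suc n) V)"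
    then have "mon g k \<odot>\<^bsub>twist 1 (twist n V)\<^esub> v = mon g (k * \<chi> g ^ 1) \<odot>\<^bsub>twist n V\<^esub> v"
      by (subst T.twist_mon) (simp_all add: T.gop_def)
    then show "id (mon g k \<odot>\<^bsub>twist (Suc n) V\<^esub> v) = mon g k \<odot>\<^bsub>twist 1 (twist n V)\<^esub> id v"
      using * by (simp add: twist_mon mult_ac)
  qed auto
  then show ?thesis unfolding module_iso_iff by (intro exI[of _ id]) simp
qed

lemma (in kG_module) twist_trivial:
  assumes "\<And>g. g \<in> carrier G \<Longrightarrow> \<chi> g ^ n = 1" shows "module_iso kG (twist n V) V"
proof -
  have "linear_map kG (twist n V) V id"
    by (rule kG.linear_mapI[OF left_module_twist V.left_module_axioms]) (auto simp: twist_mon assms gop_def)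
  then show ?thesis unfolding module_iso_iff by (intro exI[of _ id]) simp
qed

text \<open>
  \<open>\<sigma>\<close> is described by \<open>twist 1 (V i)\<close> in place of the isomorphic module \<open>V\<^sub>\<chi> \<otimes> V\<^sub>i\<close>, which lives on another
  type and cannot be iterated.
\<close>

locale orbit_setting = ore_setting G \<chi> a s \<psi>
  for G :: "('g, 'x) monoid_scheme" and \<chi> :: "'g \<Rightarrow> 'k::alg_closed_field" and a s \<psi> +
  fixes I J :: "'i set" and V :: "'i \<Rightarrow> ('g \<Rightarrow>\<^sub>0 'k, 'v) module" and \<sigma> :: "'i \<Rightarrow> 'i"
  assumes semisimple: "semisimple_ring kG"
    and simple_V: "i \<in> I \<Longrightarrow> simple_module kG (V i)"
    and distinct_V: "\<lbrakk>i \<in> I; j \<in> I; module_iso kG (V i) (V j)\<rbrakk> \<Longrightarrow> i = j"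
    and exhaust_V: "simple_module kG (W :: ('g \<Rightarrow>\<^sub>0 'k, 'g \<Rightarrow>\<^sub>0 'k) module) \<Longrightarrow> \<exists>i\<in>I. module_iso kG W (V i)"
    and \<sigma>_permutes: "\<sigma> permutes I"
    and \<sigma>_twist: "i \<in> I \<Longrightarrow> module_iso kG (twist 1 (V i)) (V (\<sigma> i))"
    and J_subset: "J \<subseteq> I" and J_transversal: "c \<in> I // orbit_relation I \<sigma> \<Longrightarrow> \<exists>!j. j \<in> J \<inter> c"
begin

lemma V_module: "i \<in> I \<Longrightarrow> left_module kG (V i)"
  using simple_V by (simp add: simple_module_def)

lemma V_kG_module: "i \<in> I \<Longrightarrow> kG_module G \<chi> a s \<psi> (V i)"
  by (intro kG_module.intro ore_setting_axioms V_module)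

lemma \<sigma>_funpow_closed: "i \<in> I \<Longrightarrow> (\<sigma> ^^ n) i \<in> I"
  using \<sigma>_permutes by (induction n) (auto simp: permutes_in_image)

lemma twist_orbit: "i \<in> I \<Longrightarrow> module_iso kG (twist n (V i)) (V ((\<sigma> ^^ n) i))"
proof (induction n)
  case 0
  then show ?case using kG_module.twist_trivial[OF V_kG_module[OF 0], of 0] by simp
next
  case (Suc n)
  interpret Vi: kG_module G \<chi> a s \<psi> "V i" by (rule V_kG_module[OF Suc(2)])
  have n: "(\<sigma> ^^ n) i \<in> I" by (rule \<sigma>_funpow_closed[OF Suc(2)])
  interpret Vn: kG_module G \<chi> a s \<psi> "V ((\<sigma> ^^ n) i)" by (rule V_kG_module[OF n])
  interpret T: kG_module G \<chi> a s \<psi> "twist n (V i)" by (intro kG_module.intro ore_setting_axioms Vi.left_module_twist)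
  obtain f where f: "linear_map kG (twist n (V i)) (V ((\<sigma> ^^ n) i)) f"
    "bij_betw f (carrier (twist n (V i))) (carrier (V ((\<sigma> ^^ n) i)))"
    using Suc unfolding module_iso_iff by blast
  have "module_iso kG (twist 1 (twist n (V i))) (twist 1 (V ((\<sigma> ^^ n) i)))"
    unfolding module_iso_iff
    using T.linear_map_twist[OF V_module[OF n] f(1), of 1] f(2) by (intro exI[of _ f]) simp
  from module_iso_trans[OF module_iso_trans[OF Vi.twist_Suc this] \<sigma>_twist[OF n]]
  show ?case by simp
qed

text \<open>The \<open>s\<close>-fold twist is trivial, because \<open>\<chi>\<^sup>s = 1\<close>.\<close>

lemma \<sigma>_power_s: "i \<in> I \<Longrightarrow> (\<sigma> ^^ s) i = i"
proof -
  assume i: "i \<in> I"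
  interpret Vi: kG_module G \<chi> a s \<psi> "V i" by (rule V_kG_module[OF i])
  have "module_iso kG (V i) (twist s (V i))"
    by (rule module_iso_sym[OF Vi.left_module_twist Vi.twist_trivial[OF \<chi>_power]])
  from distinct_V[OF i \<sigma>_funpow_closed[OF i] module_iso_trans[OF this twist_orbit[OF i]]]
  show ?thesis by simp
qed

lemma inv_\<sigma>_funpow: "(inv_into UNIV \<sigma> ^^ n) ((\<sigma> ^^ n) i) = i" "(\<sigma> ^^ n) ((inv_into UNIV \<sigma> ^^ n) i) = i"
proof -
  note b = permutes_bij[OF \<sigma>_permutes]
  show "(inv_into UNIV \<sigma> ^^ n) ((\<sigma> ^^ n) i) = i"
  proof (induction n)
    case (Suc n)
    have "(inv_into UNIV \<sigma> ^^ Suc n) ((\<sigma> ^^ Suc n) i) = (inv_into UNIV \<sigma> ^^ n) (inv_into UNIV \<sigma> (\<sigma> ((\<sigma> ^^ n) i)))"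
      by (subst funpow_Suc_right) simp
    then show ?case using Suc inv_f_f[OF bij_is_inj[OF b]] by simp
  qed simp
  show "(\<sigma> ^^ n) ((inv_into UNIV \<sigma> ^^ n) i) = i"
  proof (induction n)
    case (Suc n)
    have "(\<sigma> ^^ Suc n) ((inv_into UNIV \<sigma> ^^ Suc n) i) = (\<sigma> ^^ n) (\<sigma> (inv_into UNIV \<sigma> ((inv_into UNIV \<sigma> ^^ n) i)))"
      by (subst funpow_Suc_right) simp
    then show ?case using Suc surj_f_inv_f[OF bij_is_surj[OF b]] by simp
  qed simp
qed

lemma J_unique:
  assumes "j \<in> J" "j' \<in> J" "j = (\<sigma> ^^ n) j'"
  shows "j = j'"
proof -
  have I: "j \<in> I" "j' \<in> I" using assms J_subset by auto
  let ?c = "orbit_relation I \<sigma> `` {j'}"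
  have "j' = perm_power \<sigma> (- int n) j"
    using assms(3) inv_\<sigma>_funpow(1)[of n j'] by (cases "n = 0") (auto simp: perm_power_def)
  then have "j \<in> ?c" using I by (auto simp: orbit_relation_def)
  moreover have "j' = perm_power \<sigma> 0 j'" by (simp add: perm_power_def)
  then have "j' \<in> ?c" using I by (auto simp: orbit_relation_def)
  moreover have "\<exists>!j. j \<in> J \<inter> ?c" using I by (intro J_transversal quotientI)
  ultimately show ?thesis using assms(1,2) by blast
qed

text \<open>
  Nonnegative powers suffice, because \<open>\<sigma>\<^sup>s\<close> is the identity on \<open>I\<close>; they correspond to multiplication by powers of \<open>x\<close>.
\<close>

lemma J_representative:
  assumes i: "i \<in> I" obtains n where "(\<sigma> ^^ n) i \<in> J"
proof -
  have "\<exists>!j. j \<in> J \<inter> orbit_relation I \<sigma> `` {i}" using i by (intro J_transversal quotientI)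
  then obtain j t where j: "j \<in> J" "i = perm_power \<sigma> t j" by (auto simp: orbit_relation_def)
  have jI: "j \<in> I" using j J_subset by auto
  show ?thesis
  proof (cases "0 \<le> t")
    case True
    define k where "k = nat t"
    have i: "i = (\<sigma> ^^ k) j" using j True by (simp add: perm_power_def k_def)
    have "(\<sigma> ^^ (s * l)) j = j" for l
    proof (induction l)
      case (Suc l)
      have "(\<sigma> ^^ (s * Suc l)) j = (\<sigma> ^^ s) ((\<sigma> ^^ (s * l)) j)" by (simp add: funpow_add)
      then show ?case using Suc \<sigma>_power_s[OF jI] by simp
    qed simp
    moreover have "k \<le> s * k" using s_pos by simp
    then have "(\<sigma> ^^ (s * k - k)) i = (\<sigma> ^^ (s * k)) j"
      unfolding i by (simp flip: funpow_add[unfolded comp_def, THEN fun_cong])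
    ultimately show ?thesis using that j by metis
  next
    case False
    then have "i = (inv_into UNIV \<sigma> ^^ nat (- t)) j" using j by (simp add: perm_power_def)
    then have "(\<sigma> ^^ nat (- t)) i = j" using inv_\<sigma>_funpow(2) by simp
    then show ?thesis using that j by metis
  qed
qed

section \<open>The classification\<close>

lemma simple_model_exists:
  assumes i: "i \<in> I" and t: "0 < t" and p: "ore_param G \<chi> a s \<psi> m \<beta>"
  obtains \<omega> where "simple_model G \<chi> a s \<psi> m \<beta> (V i) t \<omega>"
proof -
  interpret Vi: kG_module G \<chi> a s \<psi> "V i" by (rule V_kG_module[OF i])
  obtain \<omega> where "\<And>v. v \<in> carrier (V i) \<Longrightarrow> Vi.gop a 1 v = Vi.gop \<one>\<^bsub>G\<^esub> \<omega> v"
    using Vi.central_eigenvalue[OF simple_V[OF i]] by metis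
  then have "simple_model G \<chi> a s \<psi> m \<beta> (V i) t \<omega>"
    by (intro simple_model.intro model.intro simple_model_axioms.intro p Vi.kG_module_axioms simple_V[OF i] t)
  then show ?thesis by (rule that)
qed

lemma nilpotent_param: "ore_param G \<chi> a s \<psi> 1 0"
  by unfold_locales simp

lemma unit_param: "\<beta> \<noteq> 0 \<Longrightarrow> ore_param G \<chi> a s \<psi> s \<beta>"
  by unfold_locales simp

definition family :: "('i, 'k) label \<Rightarrow> ('g \<times> nat \<Rightarrow>\<^sub>0 'k, (('g \<times> nat \<Rightarrow>\<^sub>0 'k) \<times> 'v \<Rightarrow>\<^sub>0 int) set set) module"
  where "family l = (case l of Nilp t i \<Rightarrow> nilpotent_quotient G H t (V i)
    | Unip t j \<beta> \<Rightarrow> unit_quotient G H s t (V j) \<beta>)"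

definition labels :: "('i, 'k) label set"
  where "labels = {Nilp t i | t i. 0 < t \<and> i \<in> I} \<union> {Unip t j \<beta> | t j \<beta>. 0 < t \<and> j \<in> J \<and> \<beta> \<noteq> 0}"

fun label_model :: "('i, 'k) label \<Rightarrow> ('g \<times> nat \<Rightarrow>\<^sub>0 'k, nat \<times> nat \<Rightarrow> 'v) module"
  where "label_model (Nilp t i) = model.D G \<chi> 1 0 (V i) t"
  | "label_model (Unip t j \<beta>) = model.D G \<chi> s \<beta> (V j) t"

lemma family_iso:
  assumes "l \<in> labels"
  shows "left_module H (family l)" "module_iso H (label_model l) (family l)"
proof -
  have "left_module H (family l) \<and> module_iso H (label_model l) (family l)"
  proof (cases l)
    case (Nilp t i)
    then have "0 < t" "i \<in> I" using assms by (auto simp: labels_def)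
    then show ?thesis using kG_module.nilpotent_quotient_iso[OF V_kG_module, of i t] Nilp
      by (simp add: family_def)
  next
    case (Unip t j \<beta>)
    then have "0 < t" "j \<in> I" "\<beta> \<noteq> 0" using assms J_subset by (auto simp: labels_def)
    then show ?thesis using kG_module.unit_quotient_iso[OF V_kG_module, of j t \<beta>] Unip
      by (simp add: family_def)
  qed
  then show "left_module H (family l)" "module_iso H (label_model l) (family l)" by auto
qed

lemma label_model_props:
  assumes "l \<in> labels"
  obtains m \<beta> i t \<omega> where "simple_model G \<chi> a s \<psi> m \<beta> (V i) t \<omega>" "label_model l = model.D G \<chi> m \<beta> (V i) t"
    "l = Nilp t i \<and> m = 1 \<and> \<beta> = 0 \<and> i \<in> I \<or> l = Unip t i \<beta> \<and> m = s \<and> \<beta> \<noteq> 0 \<and> i \<in> J"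
proof (cases l)
  case (Nilp t i)
  then have *: "0 < t" "i \<in> I" using assms by (auto simp: labels_def)
  obtain \<omega> where "simple_model G \<chi> a s \<psi> 1 0 (V i) t \<omega>"
    by (rule simple_model_exists[OF *(2,1) nilpotent_param])
  then show ?thesis by (rule that) (use Nilp * in simp_all)
next
  case (Unip t j \<beta>)
  then have *: "0 < t" "j \<in> I" "\<beta> \<noteq> 0" "j \<in> J" using assms J_subset by (auto simp: labels_def)
  obtain \<omega> where "simple_model G \<chi> a s \<psi> s \<beta> (V j) t \<omega>"
    by (rule simple_model_exists[OF *(2,1) unit_param[OF *(3)]])
  then show ?thesis by (rule that) (use Unip * in simp_all)
qed

lemma family_indecomposable: assumes "l \<in> labels" shows "fin_dim_indecomposable G H (family l)"
proof -
  obtain m \<beta> i t \<omega> where M: "simple_model G \<chi> a s \<psi> m \<beta> (V i) t \<omega>" and l: "label_model l = model.D G \<chi> m \<beta> (V i) t"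
    using label_model_props[OF assms] by metis
  interpret simple_model G \<chi> a s \<psi> m \<beta> "V i" t \<omega> by (rule M)
  note Q = family_iso[OF assms, unfolded l]
  have "indecomposable_module H (family l)"
    by (rule indecomposable_module_transport[OF Q(1) module_iso_sym[OF D.M.left_module_axioms Q(2)] D_indecomposable])
  moreover obtain f where f: "linear_map H D (family l) f" "f ` carrier D = carrier (family l)"
    using Q(2) by (auto simp: module_iso_iff bij_betw_def)
  have "finite_dimensional (ore_scalar G) (family l)"
    by (rule finite_dimensional_transport[OF D.M.left_module_axioms Q(1) f _ _ _ _ _ D_finite_dimensional])
       (auto simp: ore_scalar_def HH.mon_closed HH.add_eq HH.zero_eq HH.one_eq HH.mult_mon single_add \<psi>_eq \<chi>_one)
  ultimately show ?thesis by (simp add: fin_dim_indecomposable_def)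
qed

lemma family_distinct:
  assumes l: "l \<in> labels" and l': "l' \<in> labels" and iso: "module_iso H (family l) (family l')"
  shows "l = l'"
proof -
  obtain m \<beta> i t \<omega> where M: "simple_model G \<chi> a s \<psi> m \<beta> (V i) t \<omega>" "label_model l = model.D G \<chi> m \<beta> (V i) t"
    "l = Nilp t i \<and> m = 1 \<and> \<beta> = 0 \<and> i \<in> I \<or> l = Unip t i \<beta> \<and> m = s \<and> \<beta> \<noteq> 0 \<and> i \<in> J"
    by (rule label_model_props[OF l])
  obtain m' \<beta>' i' t' \<omega>' where M': "simple_model G \<chi> a s \<psi> m' \<beta>' (V i') t' \<omega>'" "label_model l' = model.D G \<chi> m' \<beta>' (V i') t'"
    "l' = Nilp t' i' \<and> m' = 1 \<and> \<beta>' = 0 \<and> i' \<in> I \<or> l' = Unip t' i' \<beta>' \<and> m' = s \<and> \<beta>' \<noteq> 0 \<and> i' \<in> J"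
    by (rule label_model_props[OF l'])
  interpret B: simple_model G \<chi> a s \<psi> m' \<beta>' "V i'" t' \<omega>' by (rule M'(1))
  have "module_iso H (family l') (label_model l')"
    unfolding M'(2) by (rule module_iso_sym[OF B.D.M.left_module_axioms family_iso(2)[OF l', unfolded M'(2)]])
  then have iso': "module_iso H (label_model l) (label_model l')"
    using module_iso_trans[OF family_iso(2)[OF l] iso] module_iso_trans by blast
  note eq = model_iso_imp[OF M(1) M'(1) iso'[unfolded M(2) M'(2)]]
  obtain b where b: "b < m" "module_iso kG (V i) (twist b (V i'))" using eq(4) by blast
  have I: "i \<in> I" "i' \<in> I" using M(3) M'(3) J_subset by auto
  have i: "i = (\<sigma> ^^ b) i'"
    by (rule distinct_V[OF I(1) \<sigma>_funpow_closed[OF I(2)] module_iso_trans[OF b(2) twist_orbit[OF I(2)]]])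
  show ?thesis using M(3)
  proof
    assume *: "l = Nilp t i \<and> m = 1 \<and> \<beta> = 0 \<and> i \<in> I"
    then have "i = i'" using i b(1) by simp
    then show ?thesis using * M'(3) eq by auto
  next
    assume *: "l = Unip t i \<beta> \<and> m = s \<and> \<beta> \<noteq> 0 \<and> i \<in> J"
    then have "i = i'" using J_unique[OF _ _ i] M'(3) eq by auto
    then show ?thesis using * M'(3) eq by auto
  qed
qed

text \<open>
  If \<open>\<beta> \<noteq> 0\<close>, then \<open>x\<close> is injective, and a map \<open>f\<close> from \<open>V\<^sub>i\<close> can be replaced by \<open>x\<^sup>n f\<close>, which is a map
  from the twist of \<open>V\<^sub>i\<close> by \<open>\<chi>\<^sup>n\<close> and so, for suitable \<open>n\<close>, from \<open>V\<^sub>j\<close> with \<open>j \<in> J\<close>.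
\<close>

lemma family_exhausts:
  fixes M :: "('g \<times> nat \<Rightarrow>\<^sub>0 'k, 'm) module"
  assumes "fin_dim_indecomposable G H M"
  shows "\<exists>l\<in>labels. module_iso H M (family l)"
proof -
  have M: "indecomposable_module H M" and fd: "finite_dimensional (ore_scalar G) M"
    using assms by (auto simp: fin_dim_indecomposable_def)
  have LM: "left_module H M" using M by (simp add: indecomposable_module_def)
  interpret M: ore_module G \<chi> a s \<psi> M by (intro ore_module.intro ore_setting_axioms LM)
  obtain m \<beta> t where p: "ore_param G \<chi> a s \<psi> m \<beta>" and t: "0 < t"
    and nil: "\<And>v. v \<in> carrier M \<Longrightarrow> (param_module.yop G m \<beta> M ^^ t) v = \<zero>\<^bsub>M\<^esub>"
    and top: "\<exists>v\<in>carrier M. (param_module.yop G m \<beta> M ^^ (t - 1)) v \<noteq> \<zero>\<^bsub>M\<^esub>"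
    by (rule M.parameters_exist[OF M fd], rule that) (assumption, assumption, simp only:, assumption)
  interpret M: param_module G \<chi> a s \<psi> m \<beta> M by (intro param_module.intro p M.ore_module_axioms)
  obtain i f where i: "i \<in> I" and f: "linear_map kG (V i) (restriction M) f"
    and fne: "\<And>v. \<lbrakk>v \<in> carrier (V i); v \<noteq> \<zero>\<^bsub>V i\<^esub>\<rbrakk> \<Longrightarrow> (M.yop ^^ (t - 1)) (f v) \<noteq> \<zero>\<^bsub>M\<^esub>"
    by (rule M.generating_simple[OF semisimple top simple_V exhaust_V], assumption, assumption, rule that) (assumption, assumption, drule meta_spec, drule meta_mp, assumption, drule meta_mp, assumption, assumption)
  have concl: "module_iso H M (family l)"
    if l: "l \<in> labels" "label_model l = model.D G \<chi> m \<beta> (V j) t" and j: "j \<in> I"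
      and h: "linear_map kG (V j) (restriction M) h"
      and hne: "\<And>v. \<lbrakk>v \<in> carrier (V j); v \<noteq> \<zero>\<^bsub>V j\<^esub>\<rbrakk> \<Longrightarrow> (M.yop ^^ (t - 1)) (h v) \<noteq> \<zero>\<^bsub>M\<^esub>" for l j h
  proof -
    obtain \<omega> where "simple_model G \<chi> a s \<psi> m \<beta> (V j) t \<omega>" by (rule simple_model_exists[OF j t p])
    then interpret S: simple_model G \<chi> a s \<psi> m \<beta> "V j" t \<omega> .
    obtain v where v: "v \<in> carrier (V j)" "v \<noteq> \<zero>\<^bsub>V j\<^esub>" by (rule S.V_nonzero)
    have "module_iso H S.D M"
      by (rule S.splitting[OF semisimple M h nil v(1) hne[OF v]])
    from module_iso_trans[OF module_iso_sym[OF S.D.M.left_module_axioms this] family_iso(2)[OF l(1), unfolded l(2)]]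
    show ?thesis .
  qed
  have "m = 1 \<and> \<beta> = 0 \<or> m = s \<and> \<beta> \<noteq> 0" by (rule M.param)
  then show ?thesis
  proof
    assume *: "m = 1 \<and> \<beta> = 0"
    have "Nilp t i \<in> labels" using t i by (simp add: labels_def)
    moreover from this have "module_iso H M (family (Nilp t i))"
      by (rule concl[OF _ _ i f fne]) (use * in simp_all)
    ultimately show ?thesis by blast
  next
    assume *: "m = s \<and> \<beta> \<noteq> 0"
    interpret Vi: kG_module G \<chi> a s \<psi> "V i" by (rule V_kG_module[OF i])
    obtain n where n: "(\<sigma> ^^ n) i \<in> J" by (rule J_representative[OF i])
    let ?j = "(\<sigma> ^^ n) i"
    have j: "?j \<in> I" using n J_subset by auto
    have xinj: "w = \<zero>\<^bsub>M\<^esub>" if w: "w \<in> carrier M" "M.xop w = \<zero>\<^bsub>M\<^esub>" for w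
    proof -
      obtain s' where s': "s = Suc s'" using s_pos by (cases s) auto
      have "(M.xop ^^ s) w = (M.xop ^^ s') (M.xop w)" unfolding s' by (simp add: funpow_swap1)
      then have "(M.xop ^^ s) w = M.sc 0 w" using w by simp
      then have "(M.xop ^^ m) w = M.sc 0 w" using * by simp
      then have "M.sc ((0 - \<beta>) ^ t) w = \<zero>\<^bsub>M\<^esub>" using M.yop_of_eigen[OF w(1), of 0 t] nil[OF w(1)] by simp
      then show ?thesis using M.op_scalar_eq_zeroD[OF w(1)] * by simp
    qed
    have xninj: "w = \<zero>\<^bsub>M\<^esub>" if "w \<in> carrier M" "(M.xop ^^ k) w = \<zero>\<^bsub>M\<^esub>" for w k
      using that by (induction k) (auto dest!: xinj[rotated])
    obtain \<phi> where \<phi>: "linear_map kG (V ?j) (twist n (V i)) \<phi>" "bij_betw \<phi> (carrier (V ?j)) (carrier (V i))"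
      using module_iso_sym[OF Vi.left_module_twist twist_orbit[OF i, of n]] by (auto simp: module_iso_iff)
    note fD = linear_mapD[OF f, simplified]
    have xf: "linear_map kG (twist n (V i)) (restriction M) (\<lambda>v. (M.xop ^^ n) (f v))"
    proof (rule kG.linear_mapI[OF Vi.left_module_twist left_module_restriction[OF LM]])
      fix g k v assume g: "g \<in> carrier G" and "v \<in> carrier (twist n (V i))"
      then have v: "v \<in> carrier (V i)" by simp
      have fg: "f (Vi.gop g c v) = M.op g c (f v)" for c
        using fD(3)[of "mon g c" v] g v by (simp add: Vi.gop_def M.op_def kG.mon_closed ore_embed_mon)
      have "(M.xop ^^ n) (f (mon g k \<odot>\<^bsub>twist n (V i)\<^esub> v)) = M.op g (k * \<chi> g ^ n * inverse (\<chi> g) ^ n) ((M.xop ^^ n) (f v))"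
        using g v fD(1) by (simp add: Vi.twist_mon fg M.funpow_x_op)
      also have "k * \<chi> g ^ n * inverse (\<chi> g) ^ n = k"
        using \<chi>_nonzero[OF g] by (simp add: mult.assoc flip: power_mult_distrib)
      finally show "(M.xop ^^ n) (f (mon g k \<odot>\<^bsub>twist n (V i)\<^esub> v)) = mon g k \<odot>\<^bsub>restriction M\<^esub> (M.xop ^^ n) (f v)"
        unfolding M.op_restriction .
    qed (use fD in \<open>auto simp: M.funpow_x_add\<close>)
    define h where "h = (\<lambda>v. (M.xop ^^ n) (f v)) \<circ> \<phi>"
    have h: "linear_map kG (V ?j) (restriction M) h" unfolding h_def by (rule linear_map_comp[OF \<phi>(1) xf])
    have hne: "(M.yop ^^ (t - 1)) (h v) \<noteq> \<zero>\<^bsub>M\<^esub>" if v: "v \<in> carrier (V ?j)" "v \<noteq> \<zero>\<^bsub>V ?j\<^esub>" for v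
    proof
      interpret Vj: left_module kG "V ?j" by (rule V_module[OF j])
      have \<phi>v: "\<phi> v \<in> carrier (V i)" using \<phi>(2) v by (auto simp: bij_betw_def)
      have "\<phi> \<zero>\<^bsub>V ?j\<^esub> = \<zero>\<^bsub>V i\<^esub>" using linear_map_zero[OF V_module[OF j] Vi.left_module_twist \<phi>(1)] by simp
      then have "\<phi> v \<noteq> \<zero>\<^bsub>V i\<^esub>" using \<phi>(2) v Vj.M.zero_closed by (metis bij_betw_imp_inj_on inj_onD)
      then have ne: "(M.yop ^^ (t - 1)) (f (\<phi> v)) \<noteq> \<zero>\<^bsub>M\<^esub>" by (rule fne[OF \<phi>v])
      assume "(M.yop ^^ (t - 1)) (h v) = \<zero>\<^bsub>M\<^esub>"
      then have "(M.xop ^^ n) ((M.yop ^^ (t - 1)) (f (\<phi> v))) = \<zero>\<^bsub>M\<^esub>"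
        using M.funpow_y_x[OF fD(1)[OF \<phi>v], of "t - 1" n] by (simp add: h_def)
      then show False using xninj[OF M.funpow_y_closed[OF fD(1)[OF \<phi>v]]] ne by blast
    qed
    have "Unip t ?j \<beta> \<in> labels" using t n * by (simp add: labels_def)
    moreover from this have "module_iso H M (family (Unip t ?j \<beta>))"
      by (rule concl[OF _ _ j h hne]) (use * in simp_all)
    ultimately show ?thesis by blast
  qed
qed

theorem classification:
  "complete_representatives H (fin_dim_indecomposable G H)
    (fin_dim_indecomposable G H :: ('g \<times> nat \<Rightarrow>\<^sub>0 'k, 'm) module \<Rightarrow> bool) labels family"
  unfolding complete_representatives_def
  using family_indecomposable family_distinct family_exhausts by blast

end

text \<open>The supports of finitely many generators cover the supports of all linear combinations.\<close>

lemma finite_group_of_group_algebra: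
  fixes G :: "('g, 'x) monoid_scheme"
  assumes G: "group G" and fd: "finite_dimensional (group_algebra_scalar G :: 'k::field \<Rightarrow> _) (regular_module (group_algebra G))"
  shows "finite (carrier G)"
proof -
  interpret G: group G by fact
  let ?kG = "group_algebra G :: ('g \<Rightarrow>\<^sub>0 'k) ring"
  interpret kG: twisted_algebra "carrier G" "(\<otimes>\<^bsub>G\<^esub>)" "\<one>\<^bsub>G\<^esub>" "\<lambda>_ _. 1" ?kG by (rule twisted_group_algebra[OF G])
  interpret R: ring ?kG by (rule kG.ring_R)
  let ?M = "regular_module ?kG"
  have "abelian_group ?M"
  proof (rule abelian_groupI, goal_cases)
    case (6 x) then show ?case by (intro bexI[of _ "\<ominus>\<^bsub>?kG\<^esub> x"]) (auto simp: regular_module_def R.l_neg)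
  qed (auto simp: regular_module_def R.a_ac)
  then interpret M: abelian_group ?M .
  obtain B where B: "finite B" "B \<subseteq> carrier ?M"
    "\<And>v. v \<in> carrier ?M \<Longrightarrow> \<exists>c. v = (\<Oplus>\<^bsub>?M\<^esub>b\<in>B. group_algebra_scalar G (c b) \<odot>\<^bsub>?M\<^esub> b)"
    using fd unfolding finite_dimensional_def by blast
  define K where "K = (\<Union>b\<in>B. Poly_Mapping.keys b)"
  have summand: "group_algebra_scalar G c \<odot>\<^bsub>?M\<^esub> b \<in> carrier ?M \<and> Poly_Mapping.keys (group_algebra_scalar G c \<odot>\<^bsub>?M\<^esub> b) \<subseteq> K"
    if b: "b \<in> B" for b c
  proof -
    have bc: "b \<in> carrier ?kG" using b B(2) by (auto simp: regular_module_def)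
    then have keys: "Poly_Mapping.keys b \<subseteq> carrier G" by (simp add: kG.carrier_eq)
    have "Poly_Mapping.keys (mon \<one>\<^bsub>G\<^esub> c \<otimes>\<^bsub>?kG\<^esub> b) \<subseteq> Poly_Mapping.keys b"
    proof (cases "c = 0")
      case False
      then have "mon \<one>\<^bsub>G\<^esub> c \<otimes>\<^bsub>?kG\<^esub> b = (\<Sum>q\<in>Poly_Mapping.keys b. mon (\<one>\<^bsub>G\<^esub> \<otimes>\<^bsub>G\<^esub> q) (c * Poly_Mapping.lookup b q * 1))"
        by (simp add: kG.mult_eq)
      also have "Poly_Mapping.keys \<dots> \<subseteq> (\<Union>q\<in>Poly_Mapping.keys b. Poly_Mapping.keys (mon (\<one>\<^bsub>G\<^esub> \<otimes>\<^bsub>G\<^esub> q) (c * Poly_Mapping.lookup b q * 1)))"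
        by (rule keys_sum)
      also have "\<dots> \<subseteq> Poly_Mapping.keys b" using keys by (auto simp: subset_iff split: if_splits)
      finally show ?thesis .
    qed (simp add: kG.mult_zero_left)
    moreover have "mon \<one>\<^bsub>G\<^esub> c \<otimes>\<^bsub>?kG\<^esub> b \<in> carrier ?kG" using bc by (intro kG.mult_closed kG.mon_closed) auto
    ultimately show ?thesis using b by (auto simp: regular_module_def group_algebra_scalar_def K_def)
  qed
  have span: "Poly_Mapping.keys (\<Oplus>\<^bsub>?M\<^esub>b\<in>A. group_algebra_scalar G (c b) \<odot>\<^bsub>?M\<^esub> b) \<subseteq> K" if "A \<subseteq> B" for A c
    using finite_subset[OF that B(1)] that
  proof (induction A rule: finite_induct)
    case empty
    have "(\<Oplus>\<^bsub>?M\<^esub>b\<in>{}. group_algebra_scalar G (c b) \<odot>\<^bsub>?M\<^esub> b) = 0"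
      unfolding M.finsum_empty by (simp add: regular_module_def kG.zero_eq)
    then show ?case by (simp only: keys_zero empty_subsetI)
  next
    case (insert b A)
    then have "(\<Oplus>\<^bsub>?M\<^esub>b\<in>insert b A. group_algebra_scalar G (c b) \<odot>\<^bsub>?M\<^esub> b) =
        group_algebra_scalar G (c b) \<odot>\<^bsub>?M\<^esub> b \<oplus>\<^bsub>?M\<^esub> (\<Oplus>\<^bsub>?M\<^esub>b\<in>A. group_algebra_scalar G (c b) \<odot>\<^bsub>?M\<^esub> b)"
      using summand by (intro M.finsum_insert) auto
    also have "\<dots> = group_algebra_scalar G (c b) \<odot>\<^bsub>?M\<^esub> b + (\<Oplus>\<^bsub>?M\<^esub>b\<in>A. group_algebra_scalar G (c b) \<odot>\<^bsub>?M\<^esub> b)"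
      by (simp add: regular_module_def kG.add_eq)
    finally show ?case
      using keys_add[of "group_algebra_scalar G (c b) \<odot>\<^bsub>?M\<^esub> b" "\<Oplus>\<^bsub>?M\<^esub>b\<in>A. group_algebra_scalar G (c b) \<odot>\<^bsub>?M\<^esub> b"]
        summand[of b "c b"] insert by auto
  qed
  have "carrier G \<subseteq> K"
  proof
    fix g assume "g \<in> carrier G"
    then have "mon g 1 \<in> carrier ?M" by (simp add: regular_module_def kG.mon_closed)
    from B(3)[OF this] obtain c where "mon g 1 = (\<Oplus>\<^bsub>?M\<^esub>b\<in>B. group_algebra_scalar G (c b) \<odot>\<^bsub>?M\<^esub> b)" ..
    then have "Poly_Mapping.keys (mon g (1 :: 'k)) \<subseteq> K" using span[OF order_refl] by metis
    then show "g \<in> K" by simp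
  qed
  moreover have "finite K" using B(1) by (simp add: K_def)
  ultimately show ?thesis by (rule finite_subset)
qed

theorem corollary4p13:
  fixes G :: "('g, 'x) monoid_scheme"
    and a :: 'g
    and \<chi> :: "'g \<Rightarrow> 'k::alg_closed_field"
    and q :: 'k
    and s :: nat
    and I J :: "'i set"
    and V :: "'i \<Rightarrow> ('g \<Rightarrow>\<^sub>0 'k, 'v) module"
    and \<sigma> :: "'i \<Rightarrow> 'i"
    and H :: "('g \<times> nat \<Rightarrow>\<^sub>0 'k, ('g \<times> nat) \<times> ('g \<times> nat) \<Rightarrow>\<^sub>0 'k, 'k) hopf_algebra"
  assumes "group G"
    and "finite_dimensional (group_algebra_scalar G :: 'k \<Rightarrow> _)
           (regular_module (group_algebra G))"
    and "semisimple_ring (group_algebra G :: ('g \<Rightarrow>\<^sub>0 'k) ring)"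
    and "a \<in> carrier G" and "\<forall>g\<in>carrier G. a \<otimes>\<^bsub>G\<^esub> g = g \<otimes>\<^bsub>G\<^esub> a"
    and "\<chi> \<in> carrier (character_group G)"
    and "q = \<chi> a" and "q \<noteq> 1"
    and "H = hopf_ore G (inv\<^bsub>character_group G\<^esub> \<chi>) a"
    and "group.ord (units_of scalar_ring) q = s"
    and "group.ord (character_group G) \<chi> = s"
    and "complete_representatives (group_algebra G)
           (simple_module (group_algebra G))
           (simple_module (group_algebra G) :: ('g \<Rightarrow>\<^sub>0 'k, 'g \<Rightarrow>\<^sub>0 'k) module \<Rightarrow> bool)
           I V"
    and "\<sigma> permutes I"
    and "\<forall>i\<in>I. module_iso (group_algebra G)
           (tensor_module G (character_module \<chi>) (V i)) (V (\<sigma> i))"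
    and "J \<subseteq> I" and "\<forall>c\<in>I // orbit_relation I \<sigma>. \<exists>!j. j \<in> J \<inter> c"
  shows "complete_representatives H
           (fin_dim_indecomposable G H)
           (fin_dim_indecomposable G H :: ('g \<times> nat \<Rightarrow>\<^sub>0 'k, 'm) module \<Rightarrow> bool)
           ({Nilp t i | t i. 0 < t \<and> i \<in> I} \<union>
            {Unip t j \<beta> | t j \<beta>. 0 < t \<and> j \<in> J \<and> \<beta> \<noteq> 0})
           (\<lambda>l. case l of
              Nilp t i \<Rightarrow> nilpotent_quotient G H t (V i)
            | Unip t j \<beta> \<Rightarrow> unit_quotient G H s t (V j) \<beta>)"
proof -
  interpret G: group G by fact
  let ?\<psi> = "inv\<^bsub>character_group G\<^esub> \<chi>"
  have fin: "finite (carrier G)" by (rule finite_group_of_group_algebra[OF assms(1,2)])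
  have \<chi>: "\<And>g. g \<in> carrier G \<Longrightarrow> \<chi> g \<noteq> 0" "\<And>g h. \<lbrakk>g \<in> carrier G; h \<in> carrier G\<rbrakk> \<Longrightarrow> \<chi> (g \<otimes>\<^bsub>G\<^esub> h) = \<chi> g * \<chi> h"
    using assms(6) unfolding character_group_carrier[OF assms(1)] by auto
  have ord: "\<chi> a ^ n = 1 \<longleftrightarrow> s dvd n" for n
    using ord_units_of_scalar_ring[OF \<chi>(1)[OF assms(4)], of n] assms(7,10) by simp
  have "s \<noteq> 0"
  proof
    assume "s = 0"
    have pow: "\<chi> (a [^]\<^bsub>G\<^esub> n) = \<chi> a ^ n" for n :: nat
      by (induction n) (simp_all add: character_one[OF assms(1,6)] \<chi>(2) assms(4) mult.commute)
    have "\<chi> a ^ Coset.order G = 1"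
      using pow[of "Coset.order G"] G.pow_order_eq_1[OF assms(4)] character_one[OF assms(1,6)] by simp
    then have "Coset.order G = 0" using ord[of "Coset.order G"] \<open>s = 0\<close> by simp
    then show False using fin by (auto simp: Coset.order_def)
  qed
  have setting: "ore_setting G \<chi> a s ?\<psi>"
    by unfold_locales
      (use assms(4,5) fin \<chi> ord \<open>s \<noteq> 0\<close> character_inv[OF assms(1,6)] character_ord[OF assms(1,6)] assms(11) in auto)
  interpret ore_setting G \<chi> a s ?\<psi> by (rule setting)
  have simple: "simple_module kG (V i)" if "i \<in> I" for i
    using assms(12) that by (simp add: complete_representatives_def)
  have twist: "module_iso kG (twist 1 (V i)) (V (\<sigma> i))" if i: "i \<in> I" for i
  proof -
    interpret Vi: kG_module G \<chi> a s ?\<psi> "V i"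
      using simple[OF i] by (intro kG_module.intro setting) (simp add: simple_module_def)
    show ?thesis by (rule module_iso_trans[OF Vi.tensor_character_twist]) (use assms(14) i in simp)
  qed
  have "orbit_setting G \<chi> a s ?\<psi> I J V \<sigma>"
    by (intro orbit_setting.intro setting orbit_setting_axioms.intro)
       (use assms(3,12,13,15,16) simple twist in \<open>auto simp: complete_representatives_def\<close>)
  then interpret orbit_setting G \<chi> a s ?\<psi> I J V \<sigma> .
  show ?thesis
    using classification unfolding labels_def family_def[abs_def] assms(9) .
qed

end
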